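(* Let $k$ be a field, $H$ a quasi-bialgebra over $k$, $(\mathfrak A,\rho,\Phi_\rho)$ a right $H$-comodule algebra and $C$ an $H$-bimodule coalgebra, i.e. a coalgebra in the monoidal category of $H$-bimodules, with comultiplication $\underline\Delta(c)=c_{\underline1}\otimes c_{\underline2}$ and counit $\underline\varepsilon$. Write $\rho(a)=a_{\langle0\rangle}\otimes a_{\langle1\rangle}$ and $\Phi_\rho=\tilde X^1_\rho\otimes\tilde X^2_\rho\otimes\tilde X^3_\rho$. Then $(\mathfrak A,C)$ is a cowreath in ${}_H\mathcal M$ via the following structure: - $\mathfrak A$ is a left $H$-module via the counit of $H$; - $\psi:C\otimes\mathfrak A\to\mathfrak A\otimes C$, $\psi(c\otimes a)=a_{\langle0\rangle}\otimes c\cdot a_{\langle1\rangle}$; - $\delta:C\to\mathfrak A\otimes C\otimes C$, $\delta(c)=\tilde X^1_\rho\otimes c_{\underline1}\cdot\tilde X^2_\rho\otimes c_{\underline2}\cdot\tilde X^3_\rho$; - $f:C\to\mathfrak A$, $f(c)=\underline\varepsilon(c)1_{\mathfrak A}$. The category of right corepresentations of the induced $\mathfrak A$-coring $\mathfrak A\otimes C$ in ${}_H\mathcal M$ is isomorphic to the category ${}_H\mathcal M_{\mathfrak A}^C$ of quasi-Hopf $(H,\mathfrak A)$-bimodules over $C$.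
   Context: Quasi-bialgebra: an associative unital $k$-algebra $H$ with algebra maps $\Delta:H\to H\otimes H$ ($\Delta(h)=h_1\otimes h_2$), $\varepsilon:H\to k$ and an invertible $\Phi=X^1\otimes X^2\otimes X^3\in H^{\otimes3}$ (inverse $x^1\otimes x^2\otimes x^3$) with $(\mathrm{id}\otimes\Delta)\Delta(h)=\Phi\,(\Delta\otimes\mathrm{id})\Delta(h)\,\Phi^{-1}$, $(\mathrm{id}\otimes\varepsilon)\Delta=\mathrm{id}=(\varepsilon\otimes\mathrm{id})\Delta$, $(1\otimes\Phi)(\mathrm{id}\otimes\Delta\otimes\mathrm{id})(\Phi)(\Phi\otimes1)=(\mathrm{id}\otimes\mathrm{id}\otimes\Delta)(\Phi)(\Delta\otimes\mathrm{id}\otimes\mathrm{id})(\Phi)$, $(\mathrm{id}\otimes\varepsilon\otimes\mathrm{id})(\Phi)=1\otimes1$. ${}_H\mathcal M$ is monoidal with $\otimes_k$, diagonal action and associativity constraint $(u\otimes v)\otimes w\mapsto X^1u\otimes(X^2v\otimes X^3w)$; ${}_H\mathcal M_H$ is monoidal with associativity constraint $(u\otimes v)\otimes w\mapsto X^1ux^1\otimes(X^2vx^2\otimes X^3wx^3)$. Right $H$-comodule algebra: an associative unital algebra $\mathfrak A$ with an algebra map $\rho:\mathfrak A\to\mathfrak A\otimes H$ and an invertible $\Phi_\rho\in\mathfrak A\otimes H\otimes H$ with $\Phi_\rho(\rho\otimes\mathrm{id})\rho(a)=(\mathrm{id}\otimes\Delta)(\rho(a))\Phi_\rho$, $(1\otimes\Phi)(\mathrm{id}\otimes\Delta\otimes\mathrm{id})(\Phi_\rho)(\Phi_\rho\otimes1)=(\mathrm{id}\otimes\mathrm{id}\otimes\Delta)(\Phi_\rho)(\rho\otimes\mathrm{id}\otimes\mathrm{id})(\Phi_\rho)$,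 $(\mathrm{id}\otimes\varepsilon)\rho=\mathrm{id}$, $(\mathrm{id}\otimes\varepsilon\otimes\mathrm{id})(\Phi_\rho)=(\mathrm{id}\otimes\mathrm{id}\otimes\varepsilon)(\Phi_\rho)=1\otimes1$. A cowreath $(A,X)$ in a monoidal category (associativity constraints inserted where needed; identities denoted by objects): an algebra $(A,m_A,\eta_A)$, an object $X$, and morphisms $\psi:X\otimes A\to A\otimes X$, $\delta:X\to A\otimes X\otimes X$, $f:X\to A$ satisfying $\psi(X\otimes m_A)=(m_A\otimes X)(A\otimes\psi)(\psi\otimes A)$, $\psi(X\otimes\eta_A)=\eta_A\otimes X$; $(m_A\otimes X\otimes X)(A\otimes\delta)\psi=(m_A\otimes X\otimes X)(A\otimes\psi\otimes X)(A\otimes X\otimes\psi)(\delta\otimes A)$; $(m_A\otimes X^{\otimes3})(A\otimes\psi\otimes X^{\otimes2})(A\otimes X\otimes\delta)\delta=(m_A\otimes X^{\otimes3})(A\otimes\delta\otimes X)\delta$; $m_A(A\otimes f)\psi=m_A(f\otimes A)$; $(m_A\otimes X)(A\otimes f\otimes X)\delta=\eta_A\otimes X=(m_A\otimes X)(A\otimes\psi)(A\otimes X\otimes f)\delta$. The induced $A$-coring is $\mathfrak C=A\otimes X$, a coalgebra in the monoidal category of $A$-bimodules (tensor product $\otimes_A$, defined by coequalizers), with left action $m_A\otimes X$, right action $(m_A\otimes X)(A\otimes\psi)$, comultiplication $\Upsilon^{-1}(m_A\otimes X\otimes X)(A\otimes\delta)$, where $\Upsilon:\mathfrak C\otimes_A\mathfrak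 C\cong\mathfrak C\otimes X$ is the canonical isomorphism, and counit $m_A(A\otimes f)$. A right corepresentation of $\mathfrak C$ is a right $A$-module $M$ in the given monoidal category with a coassociative counital right $A$-linear morphism $M\to M\otimes_A\mathfrak C$; morphisms are $\mathfrak C$-colinear right $A$-module morphisms. Objects of ${}_H\mathcal M_{\mathfrak A}^C$: $(H,\mathfrak A)$-bimodules $M$ with a $k$-linear map $M\to M\otimes C$, $m\mapsto m_{[0]}\otimes m_{[1]}$, such that for all $h\in H$, $a\in\mathfrak A$, $m\in M$: $h\cdot m\mapsto h_1\cdot m_{[0]}\otimes h_2\cdot m_{[1]}$; $m\cdot a\mapsto m_{[0]}\cdot a_{\langle0\rangle}\otimes m_{[1]}\cdot a_{\langle1\rangle}$; $X^1\cdot m_{[0][0]}\otimes X^2\cdot m_{[0][1]}\otimes X^3\cdot m_{[1]}=m_{[0]}\cdot\tilde X^1_\rho\otimes m_{[1]\underline1}\cdot\tilde X^2_\rho\otimes m_{[1]\underline2}\cdot\tilde X^3_\rho$; $\underline\varepsilon(m_{[1]})m_{[0]}=m$. Morphisms: $(H,\mathfrak A)$-bimodule maps commuting with the coactions. *)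

theory Defs
  imports "HOL-Algebra.Module" "HOL-Algebra.AbelCoset"
begin

section \<open>Vector spaces and algebras over a field\<close>

text \<open>Vector spaces are the modules of HOL-Algebra over a field \<open>k\<close>. The record of a module also
  has the fields \<open>mult\<close> and \<open>one\<close>; they carry information only where an algebra is meant.\<close>

definition base_space :: "'k ring \<Rightarrow> ('k, 'k) module" where
  "base_space k = \<lparr>carrier = carrier k, monoid.mult = monoid.mult k, one = \<one>\<^bsub>k\<^esub>,
     zero = \<zero>\<^bsub>k\<^esub>, add = add k, smult = monoid.mult k\<rparr>"

definition lin_maps ::
    "'k ring \<Rightarrow> ('k, 'v, 'e) module_scheme \<Rightarrow> ('k, 'w, 'f) module_scheme \<Rightarrow> ('v \<Rightarrow> 'w) set" where
  "lin_maps k V W = {f \<in> carrier V \<rightarrow> carrier W.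
     (\<forall>x\<in>carrier V. \<forall>y\<in>carrier V. f (x \<oplus>\<^bsub>V\<^esub> y) = f x \<oplus>\<^bsub>W\<^esub> f y) \<and>
     (\<forall>c\<in>carrier k. \<forall>x\<in>carrier V. f (c \<odot>\<^bsub>V\<^esub> x) = c \<odot>\<^bsub>W\<^esub> f x)}"

definition bilin_maps ::
    "'k ring \<Rightarrow> ('k, 'u, 'e) module_scheme \<Rightarrow> ('k, 'v, 'f) module_scheme \<Rightarrow> ('k, 'w, 'g) module_scheme
      \<Rightarrow> ('u \<Rightarrow> 'v \<Rightarrow> 'w) set" where
  "bilin_maps k U V W = {b. (\<forall>u\<in>carrier U. b u \<in> lin_maps k V W) \<and>
     (\<forall>v\<in>carrier V. (\<lambda>u. b u v) \<in> lin_maps k U W)}"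

definition k_algebra :: "'k ring \<Rightarrow> ('k, 'a, 'e) module_scheme \<Rightarrow> bool" where
  "k_algebra k A \<longleftrightarrow> module k A \<and> ring A \<and> monoid.mult A \<in> bilin_maps k A A A"

definition alg_maps ::
    "'k ring \<Rightarrow> ('k, 'a, 'e) module_scheme \<Rightarrow> ('k, 'b, 'f) module_scheme \<Rightarrow> ('a \<Rightarrow> 'b) set" where
  "alg_maps k A B = lin_maps k A B \<inter> ring_hom A B"

definition left_action ::
    "'k ring \<Rightarrow> ('k, 'a, 'e) module_scheme \<Rightarrow> ('k, 'v, 'f) module_scheme \<Rightarrow> ('a \<Rightarrow> 'v \<Rightarrow> 'v) \<Rightarrow> bool" where
  "left_action k A V act \<longleftrightarrow> act \<in> bilin_maps k A V V \<and>
     (\<forall>v\<in>carrier V. act \<one>\<^bsub>A\<^esub> v = v) \<and>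
     (\<forall>a\<in>carrier A. \<forall>b\<in>carrier A. \<forall>v\<in>carrier V. act (a \<otimes>\<^bsub>A\<^esub> b) v = act a (act b v))"

definition right_action ::
    "'k ring \<Rightarrow> ('k, 'a, 'e) module_scheme \<Rightarrow> ('k, 'v, 'f) module_scheme \<Rightarrow> ('v \<Rightarrow> 'a \<Rightarrow> 'v) \<Rightarrow> bool" where
  "right_action k A V act \<longleftrightarrow> act \<in> bilin_maps k V A V \<and>
     (\<forall>v\<in>carrier V. act v \<one>\<^bsub>A\<^esub> = v) \<and>
     (\<forall>a\<in>carrier A. \<forall>b\<in>carrier A. \<forall>v\<in>carrier V. act v (a \<otimes>\<^bsub>A\<^esub> b) = act (act v a) b)"


section \<open>Tensor products of vector spaces\<close>

text \<open>The tensor product of \<open>V\<close> and \<open>W\<close> is given by generators and relations: a list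
  \<open>[(v\<^sub>1, w\<^sub>1), \<dots>, (v\<^sub>n, w\<^sub>n)]\<close> is the formal sum of the \<open>v\<^sub>i \<otimes> w\<^sub>i\<close>, and elements of the
  tensor product are the classes of formal sums for the congruence generated by
  bilinearity (and by commutativity of addition).\<close>

type_synonym ('v, 'w) tensor = "('v \<times> 'w) list set"

inductive tensor_eq ::
    "'k ring \<Rightarrow> ('k, 'v, 'e) module_scheme \<Rightarrow> ('k, 'w, 'f) module_scheme
      \<Rightarrow> ('v \<times> 'w) list \<Rightarrow> ('v \<times> 'w) list \<Rightarrow> bool"
  for k V W where
  refl: "set xs \<subseteq> carrier V \<times> carrier W \<Longrightarrow> tensor_eq k V W xs xs"
| sym: "tensor_eq k V W xs ys \<Longrightarrow> tensor_eq k V W ys xs"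
| trans: "tensor_eq k V W xs ys \<Longrightarrow> tensor_eq k V W ys zs \<Longrightarrow> tensor_eq k V W xs zs"
| append: "tensor_eq k V W xs ys \<Longrightarrow> tensor_eq k V W us vs \<Longrightarrow> tensor_eq k V W (xs @ us) (ys @ vs)"
| commute: "set xs \<subseteq> carrier V \<times> carrier W \<Longrightarrow> set ys \<subseteq> carrier V \<times> carrier W
    \<Longrightarrow> tensor_eq k V W (xs @ ys) (ys @ xs)"
| add_left: "v \<in> carrier V \<Longrightarrow> v' \<in> carrier V \<Longrightarrow> w \<in> carrier W
    \<Longrightarrow> tensor_eq k V W [(v \<oplus>\<^bsub>V\<^esub> v', w)] [(v, w), (v', w)]"
| add_right: "v \<in> carrier V \<Longrightarrow> w \<in> carrier W \<Longrightarrow> w' \<in> carrier W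
    \<Longrightarrow> tensor_eq k V W [(v, w \<oplus>\<^bsub>W\<^esub> w')] [(v, w), (v, w')]"
| scalar: "c \<in> carrier k \<Longrightarrow> v \<in> carrier V \<Longrightarrow> w \<in> carrier W
    \<Longrightarrow> tensor_eq k V W [(c \<odot>\<^bsub>V\<^esub> v, w)] [(v, c \<odot>\<^bsub>W\<^esub> w)]"
| zero: "w \<in> carrier W \<Longrightarrow> tensor_eq k V W [(\<zero>\<^bsub>V\<^esub>, w)] []"

definition tensor_class ::
    "'k ring \<Rightarrow> ('k, 'v, 'e) module_scheme \<Rightarrow> ('k, 'w, 'f) module_scheme \<Rightarrow> ('v \<times> 'w) list \<Rightarrow> ('v, 'w) tensor" where
  "tensor_class k V W xs = {ys. tensor_eq k V W xs ys}"

definition rep :: "'a set \<Rightarrow> 'a" where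
  "rep S = (SOME x. x \<in> S)"

text \<open>The fields \<open>mult\<close> and \<open>one\<close> are those of the tensor product of two algebras.\<close>

definition tensor ::
    "'k ring \<Rightarrow> ('k, 'v, 'e) module_scheme \<Rightarrow> ('k, 'w, 'f) module_scheme \<Rightarrow> ('k, ('v, 'w) tensor) module" where
  "tensor k V W =
    \<lparr>carrier = tensor_class k V W ` {xs. set xs \<subseteq> carrier V \<times> carrier W},
     monoid.mult = (\<lambda>s t. tensor_class k V W
       [(v \<otimes>\<^bsub>V\<^esub> v', w \<otimes>\<^bsub>W\<^esub> w'). (v, w) \<leftarrow> rep s, (v', w') \<leftarrow> rep t]),
     one = tensor_class k V W [(\<one>\<^bsub>V\<^esub>, \<one>\<^bsub>W\<^esub>)],
     zero = tensor_class k V W [],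
     add = (\<lambda>s t. tensor_class k V W (rep s @ rep t)),
     smult = (\<lambda>c t. tensor_class k V W (map (\<lambda>(v, w). (c \<odot>\<^bsub>V\<^esub> v, w)) (rep t)))\<rparr>"

definition pure ::
    "'k ring \<Rightarrow> ('k, 'v, 'e) module_scheme \<Rightarrow> ('k, 'w, 'f) module_scheme \<Rightarrow> 'v \<Rightarrow> 'w \<Rightarrow> ('v, 'w) tensor" where
  "pure k V W v w = tensor_class k V W [(v, w)]"

text \<open>The linear map out of a tensor product, with values in \<open>N\<close>, that a bilinear map \<open>b\<close> induces.\<close>

definition tensor_lift :: "('k, 'n, 'e) module_scheme \<Rightarrow> ('v \<Rightarrow> 'w \<Rightarrow> 'n) \<Rightarrow> ('v, 'w) tensor \<Rightarrow> 'n" where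
  "tensor_lift N b t = foldr (\<lambda>(v, w) s. b v w \<oplus>\<^bsub>N\<^esub> s) (rep t) \<zero>\<^bsub>N\<^esub>"

text \<open>\<open>f \<otimes> g\<close> for linear maps \<open>f\<close> and \<open>g\<close> with codomains \<open>V\<close> and \<open>W\<close>.\<close>

definition tensor_map ::
    "'k ring \<Rightarrow> ('k, 'v, 'e) module_scheme \<Rightarrow> ('k, 'w, 'f) module_scheme
      \<Rightarrow> ('v0 \<Rightarrow> 'v) \<Rightarrow> ('w0 \<Rightarrow> 'w) \<Rightarrow> ('v0, 'w0) tensor \<Rightarrow> ('v, 'w) tensor" where
  "tensor_map k V W f g = tensor_lift (tensor k V W) (\<lambda>v w. pure k V W (f v) (g w))"

text \<open>Rebracketing of vector spaces, \<open>(U \<otimes> V) \<otimes> W \<rightarrow> U \<otimes> (V \<otimes> W)\<close>, and its inverse.\<close>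

definition rebr ::
    "'k ring \<Rightarrow> ('k, 'u, 'e) module_scheme \<Rightarrow> ('k, 'v, 'f) module_scheme \<Rightarrow> ('k, 'w, 'g) module_scheme
      \<Rightarrow> (('u, 'v) tensor, 'w) tensor \<Rightarrow> ('u, ('v, 'w) tensor) tensor" where
  "rebr k U V W = tensor_lift (tensor k U (tensor k V W))
     (\<lambda>t w. tensor_lift (tensor k U (tensor k V W))
       (\<lambda>u v. pure k U (tensor k V W) u (pure k V W v w)) t)"

definition rebr_inv ::
    "'k ring \<Rightarrow> ('k, 'u, 'e) module_scheme \<Rightarrow> ('k, 'v, 'f) module_scheme \<Rightarrow> ('k, 'w, 'g) module_scheme
      \<Rightarrow> ('u, ('v, 'w) tensor) tensor \<Rightarrow> (('u, 'v) tensor, 'w) tensor" where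
  "rebr_inv k U V W = tensor_lift (tensor k (tensor k U V) W)
     (\<lambda>u t. tensor_lift (tensor k (tensor k U V) W)
       (\<lambda>v w. pure k (tensor k U V) W (pure k U V u v) w) t)"

text \<open>The unit constraints \<open>k \<otimes> V \<rightarrow> V\<close> and \<open>V \<otimes> k \<rightarrow> V\<close>, and their inverses.\<close>

definition lunit :: "('k, 'v, 'e) module_scheme \<Rightarrow> ('k, 'v) tensor \<Rightarrow> 'v" where
  "lunit V = tensor_lift V (\<lambda>c v. c \<odot>\<^bsub>V\<^esub> v)"

definition runit :: "('k, 'v, 'e) module_scheme \<Rightarrow> ('v, 'k) tensor \<Rightarrow> 'v" where
  "runit V = tensor_lift V (\<lambda>v c. c \<odot>\<^bsub>V\<^esub> v)"

definition lunit_inv :: "'k ring \<Rightarrow> ('k, 'v, 'e) module_scheme \<Rightarrow> 'v \<Rightarrow> ('k, 'v) tensor" where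
  "lunit_inv k V v = pure k (base_space k) V \<one>\<^bsub>k\<^esub> v"

definition runit_inv :: "'k ring \<Rightarrow> ('k, 'v, 'e) module_scheme \<Rightarrow> 'v \<Rightarrow> ('v, 'k) tensor" where
  "runit_inv k V v = pure k V (base_space k) v \<one>\<^bsub>k\<^esub>"

text \<open>Componentwise action on \<open>V \<otimes> W\<close>: the tensor of \<open>x \<otimes> y\<close> and \<open>v \<otimes> w\<close> is sent to
  \<open>a x v \<otimes> b y w\<close>. For right actions one passes \<open>\<lambda>x v. v \<cdot> x\<close>.\<close>

definition tensor_act ::
    "'k ring \<Rightarrow> ('k, 'v, 'e) module_scheme \<Rightarrow> ('k, 'w, 'f) module_scheme
      \<Rightarrow> ('x \<Rightarrow> 'v \<Rightarrow> 'v) \<Rightarrow> ('y \<Rightarrow> 'w \<Rightarrow> 'w) \<Rightarrow> ('x, 'y) tensor \<Rightarrow> ('v, 'w) tensor \<Rightarrow> ('v, 'w) tensor" where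
  "tensor_act k V W a b s t = tensor_lift (tensor k V W) (\<lambda>x y. tensor_map k V W (a x) (b y) t) s"


section \<open>Quasi-bialgebras\<close>

text \<open>Threefold and fourfold tensor powers are bracketed to the right throughout.\<close>

record ('k, 'h) quasi_bialg = "('k, 'h) module" +
  comult :: "'h \<Rightarrow> ('h, 'h) tensor"
  counit :: "'h \<Rightarrow> 'k"
  reass :: "('h, ('h, 'h) tensor) tensor"

definition quasi_bialgebra :: "'k ring \<Rightarrow> ('k, 'h) quasi_bialg \<Rightarrow> bool" where
  "quasi_bialgebra k H \<longleftrightarrow>
    (let H2 = tensor k H H; H3 = tensor k H H2; H4 = tensor k H H3; \<Delta> = comult H; \<epsilon> = counit H; \<Phi> = reass H
     in k_algebra k H \<and> \<Delta> \<in> alg_maps k H H2 \<and> \<epsilon> \<in> alg_maps k H (base_space k) \<and> \<Phi> \<in> Units H3 \<and>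
      (\<forall>h\<in>carrier H. tensor_map k H H2 id \<Delta> (\<Delta> h)
         = \<Phi> \<otimes>\<^bsub>H3\<^esub> rebr k H H H (tensor_map k H2 H \<Delta> id (\<Delta> h)) \<otimes>\<^bsub>H3\<^esub> inv\<^bsub>H3\<^esub> \<Phi>) \<and>
      (\<forall>h\<in>carrier H. runit H (tensor_map k H (base_space k) id \<epsilon> (\<Delta> h)) = h \<and>
         lunit H (tensor_map k (base_space k) H \<epsilon> id (\<Delta> h)) = h) \<and>
      pure k H H3 \<one>\<^bsub>H\<^esub> \<Phi>
        \<otimes>\<^bsub>H4\<^esub> tensor_map k H H3 id (rebr k H H H \<circ> tensor_map k H2 H \<Delta> id) \<Phi>
        \<otimes>\<^bsub>H4\<^esub> tensor_map k H H3 id (rebr k H H H) (rebr k H H2 H (pure k H3 H \<Phi> \<one>\<^bsub>H\<^esub>))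
      = tensor_map k H H3 id (tensor_map k H H2 id \<Delta>) \<Phi>
        \<otimes>\<^bsub>H4\<^esub> rebr k H H H2 (tensor_map k H2 H2 \<Delta> id \<Phi>) \<and>
      tensor_map k H H id (lunit H \<circ> tensor_map k (base_space k) H \<epsilon> id) \<Phi> = \<one>\<^bsub>H2\<^esub>)"


section \<open>Comodule algebras\<close>

record ('k, 'h, 'a) comod_alg = "('k, 'a) module" +
  rho :: "'a \<Rightarrow> ('a, 'h) tensor"
  reass_rho :: "('a, ('h, 'h) tensor) tensor"

definition comodule_algebra :: "'k ring \<Rightarrow> ('k, 'h) quasi_bialg \<Rightarrow> ('k, 'h, 'a) comod_alg \<Rightarrow> bool" where
  "comodule_algebra k H A \<longleftrightarrow>
    (let H2 = tensor k H H; H3 = tensor k H H2; AH = tensor k A H; AH2 = tensor k A H2; AH3 = tensor k A H3;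
         \<Delta> = comult H; \<epsilon> = counit H; \<Phi> = reass H; \<rho> = rho A; \<Phi>\<rho> = reass_rho A
     in k_algebra k A \<and> \<rho> \<in> alg_maps k A AH \<and> \<Phi>\<rho> \<in> Units AH2 \<and>
      (\<forall>a\<in>carrier A. \<Phi>\<rho> \<otimes>\<^bsub>AH2\<^esub> rebr k A H H (tensor_map k AH H \<rho> id (\<rho> a))
         = tensor_map k A H2 id \<Delta> (\<rho> a) \<otimes>\<^bsub>AH2\<^esub> \<Phi>\<rho>) \<and>
      pure k A H3 \<one>\<^bsub>A\<^esub> \<Phi>
        \<otimes>\<^bsub>AH3\<^esub> tensor_map k A H3 id (rebr k H H H \<circ> tensor_map k H2 H \<Delta> id) \<Phi>\<rho>
        \<otimes>\<^bsub>AH3\<^esub> tensor_map k A H3 id (rebr k H H H) (rebr k A H2 H (pure k AH2 H \<Phi>\<rho> \<one>\<^bsub>H\<^esub>))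
      = tensor_map k A H3 id (tensor_map k H H2 id \<Delta>) \<Phi>\<rho>
        \<otimes>\<^bsub>AH3\<^esub> rebr k A H H2 (tensor_map k AH H2 \<rho> id \<Phi>\<rho>) \<and>
      (\<forall>a\<in>carrier A. runit A (tensor_map k A (base_space k) id \<epsilon> (\<rho> a)) = a) \<and>
      tensor_map k A H id (lunit H \<circ> tensor_map k (base_space k) H \<epsilon> id) \<Phi>\<rho> = \<one>\<^bsub>AH\<^esub> \<and>
      tensor_map k A H id (runit H \<circ> tensor_map k H (base_space k) id \<epsilon>) \<Phi>\<rho> = \<one>\<^bsub>AH\<^esub>)"


section \<open>The monoidal category of left modules over a quasi-bialgebra\<close>

text \<open>Objects are records \<open>hmod\<close> satisfying \<open>hmodule\<close>, with arbitrary element type. Morphisms are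
  functions, which matter only on the carrier of their domain.\<close>

record ('k, 'h, 'm) hmod = "('k, 'm) module" +
  lact :: "'h \<Rightarrow> 'm \<Rightarrow> 'm"

definition hmodule :: "'k ring \<Rightarrow> ('k, 'h) quasi_bialg \<Rightarrow> ('k, 'h, 'm, 'e) hmod_scheme \<Rightarrow> bool" where
  "hmodule k H M \<longleftrightarrow> module k M \<and> left_action k H M (lact M)"

definition hmod_hom ::
    "'k ring \<Rightarrow> ('k, 'h) quasi_bialg \<Rightarrow> ('k, 'h, 'm, 'e) hmod_scheme \<Rightarrow> ('k, 'h, 'n, 'f) hmod_scheme
      \<Rightarrow> ('m \<Rightarrow> 'n) set" where
  "hmod_hom k H M N = {f \<in> lin_maps k M N. \<forall>h\<in>carrier H. \<forall>m\<in>carrier M. f (lact M h m) = lact N h (f m)}"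

definition htensor ::
    "'k ring \<Rightarrow> ('k, 'h) quasi_bialg \<Rightarrow> ('k, 'h, 'm, 'e) hmod_scheme \<Rightarrow> ('k, 'h, 'n, 'f) hmod_scheme
      \<Rightarrow> ('k, 'h, ('m, 'n) tensor) hmod" where
  "htensor k H M N = module.extend (tensor k M N)
     (hmod.fields (\<lambda>h. tensor_act k M N (lact M) (lact N) (comult H h)))"

definition hunit :: "'k ring \<Rightarrow> ('k, 'h) quasi_bialg \<Rightarrow> ('k, 'h, 'k) hmod" where
  "hunit k H = module.extend (base_space k) (hmod.fields (\<lambda>h c. counit H h \<otimes>\<^bsub>k\<^esub> c))"

definition hassoc ::
    "'k ring \<Rightarrow> ('k, 'h) quasi_bialg \<Rightarrow> ('k, 'h, 'u, 'e) hmod_scheme \<Rightarrow> ('k, 'h, 'v, 'f) hmod_scheme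
      \<Rightarrow> ('k, 'h, 'w, 'g) hmod_scheme \<Rightarrow> (('u, 'v) tensor, 'w) tensor \<Rightarrow> ('u, ('v, 'w) tensor) tensor" where
  "hassoc k H U V W t = tensor_act k U (tensor k V W) (lact U) (tensor_act k V W (lact V) (lact W))
     (reass H) (rebr k U V W t)"

definition hassoc_inv ::
    "'k ring \<Rightarrow> ('k, 'h) quasi_bialg \<Rightarrow> ('k, 'h, 'u, 'e) hmod_scheme \<Rightarrow> ('k, 'h, 'v, 'f) hmod_scheme
      \<Rightarrow> ('k, 'h, 'w, 'g) hmod_scheme \<Rightarrow> ('u, ('v, 'w) tensor) tensor \<Rightarrow> (('u, 'v) tensor, 'w) tensor" where
  "hassoc_inv k H U V W t = rebr_inv k U V W
     (tensor_act k U (tensor k V W) (lact U) (tensor_act k V W (lact V) (lact W))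
       (inv\<^bsub>tensor k H (tensor k H H)\<^esub> (reass H)) t)"


section \<open>Bimodule coalgebras\<close>

record ('k, 'h, 'c) hbimod = "('k, 'h, 'c) hmod" +
  ract :: "'c \<Rightarrow> 'h \<Rightarrow> 'c"

definition hbimodule :: "'k ring \<Rightarrow> ('k, 'h) quasi_bialg \<Rightarrow> ('k, 'h, 'c, 'e) hbimod_scheme \<Rightarrow> bool" where
  "hbimodule k H C \<longleftrightarrow> hmodule k H C \<and> right_action k H C (ract C) \<and>
     (\<forall>h\<in>carrier H. \<forall>c\<in>carrier C. \<forall>g\<in>carrier H. ract C (lact C h c) g = lact C h (ract C c g))"

definition hbimod_hom ::
    "'k ring \<Rightarrow> ('k, 'h) quasi_bialg \<Rightarrow> ('k, 'h, 'c, 'e) hbimod_scheme \<Rightarrow> ('k, 'h, 'd, 'f) hbimod_scheme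
      \<Rightarrow> ('c \<Rightarrow> 'd) set" where
  "hbimod_hom k H C D = {f \<in> hmod_hom k H C D.
     \<forall>c\<in>carrier C. \<forall>h\<in>carrier H. f (ract C c h) = ract D (f c) h}"

definition bitensor ::
    "'k ring \<Rightarrow> ('k, 'h) quasi_bialg \<Rightarrow> ('k, 'h, 'c, 'e) hbimod_scheme \<Rightarrow> ('k, 'h, 'd, 'f) hbimod_scheme
      \<Rightarrow> ('k, 'h, ('c, 'd) tensor) hbimod" where
  "bitensor k H C D = hmod.extend (htensor k H C D)
     (hbimod.fields (\<lambda>t h. tensor_act k C D (\<lambda>x c. ract C c x) (\<lambda>y d. ract D d y) (comult H h) t))"

definition biunit :: "'k ring \<Rightarrow> ('k, 'h) quasi_bialg \<Rightarrow> ('k, 'h, 'k) hbimod" where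
  "biunit k H = hmod.extend (hunit k H) (hbimod.fields (\<lambda>c h. c \<otimes>\<^bsub>k\<^esub> counit H h))"

definition biassoc ::
    "'k ring \<Rightarrow> ('k, 'h) quasi_bialg \<Rightarrow> ('k, 'h, 'u, 'e) hbimod_scheme \<Rightarrow> ('k, 'h, 'v, 'f) hbimod_scheme
      \<Rightarrow> ('k, 'h, 'w, 'g) hbimod_scheme \<Rightarrow> (('u, 'v) tensor, 'w) tensor \<Rightarrow> ('u, ('v, 'w) tensor) tensor" where
  "biassoc k H U V W t =
     tensor_act k U (tensor k V W) (\<lambda>x u. ract U u x)
       (tensor_act k V W (\<lambda>x v. ract V v x) (\<lambda>x w. ract W w x))
       (inv\<^bsub>tensor k H (tensor k H H)\<^esub> (reass H)) (hassoc k H U V W t)"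

record ('k, 'h, 'c) bimod_coalg = "('k, 'h, 'c) hbimod" +
  ccomult :: "'c \<Rightarrow> ('c, 'c) tensor"
  ccounit :: "'c \<Rightarrow> 'k"

definition bimodule_coalgebra :: "'k ring \<Rightarrow> ('k, 'h) quasi_bialg \<Rightarrow> ('k, 'h, 'c) bimod_coalg \<Rightarrow> bool" where
  "bimodule_coalgebra k H C \<longleftrightarrow> hbimodule k H C \<and>
     ccomult C \<in> hbimod_hom k H C (bitensor k H C C) \<and>
     ccounit C \<in> hbimod_hom k H C (biunit k H) \<and>
     (\<forall>c\<in>carrier C. biassoc k H C C C (tensor_map k (tensor k C C) C (ccomult C) id (ccomult C c))
        = tensor_map k C (tensor k C C) id (ccomult C) (ccomult C c)) \<and>
     (\<forall>c\<in>carrier C. lunit C (tensor_map k (base_space k) C (ccounit C) id (ccomult C c)) = c \<and>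
        runit C (tensor_map k C (base_space k) id (ccounit C) (ccomult C c)) = c)"


section \<open>Algebras, modules and cowreaths in the category of left modules\<close>

record ('k, 'h, 'a) halg = "('k, 'h, 'a) hmod" +
  amult :: "('a, 'a) tensor \<Rightarrow> 'a"
  aunit :: "'k \<Rightarrow> 'a"

record ('k, 'h, 'm, 'a) rmod = "('k, 'h, 'm) hmod" +
  rmult :: "('m, 'a) tensor \<Rightarrow> 'm"

text \<open>A cowreath \<open>(A, X)\<close> with \<open>\<psi> = wpsi\<close>, \<open>\<delta> = wdelta\<close> and \<open>f = wcounit\<close>. The codomain of \<open>\<delta>\<close> is
  bracketed as \<open>A \<otimes> (X \<otimes> X)\<close>.\<close>

record ('k, 'h, 'a, 'x) cowreath_data =
  walg :: "('k, 'h, 'a) halg"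
  wobj :: "('k, 'h, 'x) hmod"
  wpsi :: "('x, 'a) tensor \<Rightarrow> ('a, 'x) tensor"
  wdelta :: "'x \<Rightarrow> ('a, ('x, 'x) tensor) tensor"
  wcounit :: "'x \<Rightarrow> 'a"

text \<open>A coring over an algebra \<open>A\<close>: an \<open>A\<close>-bimodule with a comultiplication into its tensor square
  over \<open>A\<close> (whose elements are classes of tensors, see below) and a counit.\<close>

record ('k, 'h, 'a, 'd) coring_data = "('k, 'h, 'd) hmod" +
  dleft :: "('a, 'd) tensor \<Rightarrow> 'd"
  dright :: "('d, 'a) tensor \<Rightarrow> 'd"
  dcomult :: "'d \<Rightarrow> ('d, 'd) tensor set"
  dcounit :: "'d \<Rightarrow> 'a"

record ('k, 'h, 'm, 'a, 'd) corep = "('k, 'h, 'm, 'a) rmod" +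
  coact :: "'m \<Rightarrow> ('m, 'd) tensor set"

text \<open>The object underlying a coequalizer of \<open>f, g : U \<rightarrow> V\<close>: the quotient of \<open>V\<close> by the image of
  \<open>f - g\<close>, with projection \<open>coeq_proj U V f g\<close>.\<close>

definition coeq_proj ::
    "('k, 'u, 'e) module_scheme \<Rightarrow> ('k, 'v, 'f) module_scheme \<Rightarrow> ('u \<Rightarrow> 'v) \<Rightarrow> ('u \<Rightarrow> 'v) \<Rightarrow> 'v \<Rightarrow> 'v set" where
  "coeq_proj U V f g v = {f u \<ominus>\<^bsub>V\<^esub> g u | u. u \<in> carrier U} +>\<^bsub>V\<^esub> v"

definition hcoeq ::
    "('k, 'h, 'u, 'e) hmod_scheme \<Rightarrow> ('k, 'h, 'v, 'f) hmod_scheme \<Rightarrow> ('u \<Rightarrow> 'v) \<Rightarrow> ('u \<Rightarrow> 'v)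
      \<Rightarrow> ('k, 'h, 'v set) hmod" where
  "hcoeq U V f g = (let q = coeq_proj U V f g in
    \<lparr>carrier = q ` carrier V, monoid.mult = (\<lambda>P Q. q (rep P \<otimes>\<^bsub>V\<^esub> rep Q)), one = q \<one>\<^bsub>V\<^esub>,
     zero = q \<zero>\<^bsub>V\<^esub>, add = (\<lambda>P Q. q (rep P \<oplus>\<^bsub>V\<^esub> rep Q)), smult = (\<lambda>c P. q (c \<odot>\<^bsub>V\<^esub> rep P)),
     lact = (\<lambda>h P. q (lact V h (rep P)))\<rparr>)"

context
  fixes k :: "'k ring" and H :: "('k, 'h) quasi_bialg"
begin

private abbreviation hten (infixr "\<Otimes>" 75) where "U \<Otimes> V \<equiv> htensor k H U V"
private abbreviation tm where "tm V W f g \<equiv> tensor_map k V W f g"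
private abbreviation as where "as U V W \<equiv> hassoc k H U V W"
private abbreviation ai where "ai U V W \<equiv> hassoc_inv k H U V W"

definition halgebra :: "('k, 'h, 'a) halg \<Rightarrow> bool" where
  "halgebra A \<longleftrightarrow> hmodule k H A \<and>
     amult A \<in> hmod_hom k H (A \<Otimes> A) A \<and> aunit A \<in> hmod_hom k H (hunit k H) A \<and>
     (\<forall>t\<in>carrier ((A \<Otimes> A) \<Otimes> A).
        amult A (tm A A (amult A) id t) = amult A (tm A A id (amult A) (as A A A t))) \<and>
     (\<forall>t\<in>carrier (hunit k H \<Otimes> A). amult A (tm A A (aunit A) id t) = lunit A t) \<and>
     (\<forall>t\<in>carrier (A \<Otimes> hunit k H). amult A (tm A A id (aunit A) t) = runit A t)"

definition cowreath :: "('k, 'h, 'a, 'x) cowreath_data \<Rightarrow> bool" where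
  "cowreath K \<longleftrightarrow>
    (let A = walg K; X = wobj K; m = amult A; \<eta> = aunit A; \<psi> = wpsi K; \<delta> = wdelta K; f = wcounit K
     in halgebra A \<and> hmodule k H X \<and>
      \<psi> \<in> hmod_hom k H (X \<Otimes> A) (A \<Otimes> X) \<and> \<delta> \<in> hmod_hom k H X (A \<Otimes> X \<Otimes> X) \<and> f \<in> hmod_hom k H X A \<and>
      (\<forall>t\<in>carrier (X \<Otimes> A \<Otimes> A).
         \<psi> (tm X A id m t)
         = (tm A X m id \<circ> ai A A X \<circ> tm A (A \<Otimes> X) id \<psi> \<circ> as A X A \<circ> tm (A \<Otimes> X) A \<psi> id \<circ> ai X A A) t) \<and>
      (\<forall>x\<in>carrier X. \<psi> (tm X A id \<eta> (runit_inv k X x)) = tm A X \<eta> id (lunit_inv k X x)) \<and>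
      (\<forall>t\<in>carrier (X \<Otimes> A).
         (tm A (X \<Otimes> X) m id \<circ> ai A A (X \<Otimes> X) \<circ> tm A (A \<Otimes> X \<Otimes> X) id \<delta> \<circ> \<psi>) t
         = (tm A (X \<Otimes> X) m id \<circ> ai A A (X \<Otimes> X)
            \<circ> tm A (A \<Otimes> X \<Otimes> X) id (as A X X \<circ> tm (A \<Otimes> X) X \<psi> id \<circ> ai X A X)
            \<circ> tm A (X \<Otimes> A \<Otimes> X) id (tm X (A \<Otimes> X) id \<psi> \<circ> as X X A)
            \<circ> as A (X \<Otimes> X) A \<circ> tm (A \<Otimes> X \<Otimes> X) A \<delta> id) t) \<and>
      (\<forall>x\<in>carrier X.
         (tm A (X \<Otimes> X \<Otimes> X) m id \<circ> ai A A (X \<Otimes> X \<Otimes> X)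
            \<circ> tm A (A \<Otimes> X \<Otimes> X \<Otimes> X) id (as A X (X \<Otimes> X) \<circ> tm (A \<Otimes> X) (X \<Otimes> X) \<psi> id \<circ> ai X A (X \<Otimes> X))
            \<circ> tm A (X \<Otimes> A \<Otimes> X \<Otimes> X) id (tm X (A \<Otimes> X \<Otimes> X) id \<delta>) \<circ> \<delta>) x
         = (tm A (X \<Otimes> X \<Otimes> X) m id \<circ> ai A A (X \<Otimes> X \<Otimes> X)
            \<circ> tm A (A \<Otimes> X \<Otimes> X \<Otimes> X) id
                (tm A (X \<Otimes> X \<Otimes> X) id (as X X X) \<circ> as A (X \<Otimes> X) X \<circ> tm (A \<Otimes> X \<Otimes> X) X \<delta> id) \<circ> \<delta>) x) \<and>
      (\<forall>t\<in>carrier (X \<Otimes> A). m (tm A A id f (\<psi> t)) = m (tm A A f id t)) \<and>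
      (\<forall>x\<in>carrier X.
         (tm A X m id \<circ> ai A A X \<circ> tm A (A \<Otimes> X) id (tm A X f id) \<circ> \<delta>) x = tm A X \<eta> id (lunit_inv k X x)) \<and>
      (\<forall>x\<in>carrier X.
         (tm A X m id \<circ> ai A A X \<circ> tm A (A \<Otimes> X) id \<psi> \<circ> tm A (X \<Otimes> A) id (tm X A id f) \<circ> \<delta>) x
         = tm A X \<eta> id (lunit_inv k X x)))"

definition right_module :: "('k, 'h, 'a) halg \<Rightarrow> ('k, 'h, 'm, 'a, 'e) rmod_scheme \<Rightarrow> bool" where
  "right_module A M \<longleftrightarrow> hmodule k H M \<and> rmult M \<in> hmod_hom k H (M \<Otimes> A) M \<and>
     (\<forall>t\<in>carrier ((M \<Otimes> A) \<Otimes> A).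
        rmult M (tm M A (rmult M) id t) = rmult M (tm M A id (amult A) (as M A A t))) \<and>
     (\<forall>t\<in>carrier (M \<Otimes> hunit k H). rmult M (tm M A id (aunit A) t) = runit M t)"


subsection \<open>The tensor product over an algebra\<close>

text \<open>For a right \<open>A\<close>-module \<open>M\<close> with action \<open>\<mu> : M \<otimes> A \<rightarrow> M\<close> and a left \<open>A\<close>-module \<open>N\<close> with action
  \<open>\<nu> : A \<otimes> N \<rightarrow> N\<close>, \<open>M \<otimes>\<^sub>A N\<close> is the coequalizer of \<open>\<mu> \<otimes> N\<close> and \<open>M \<otimes> \<nu>\<close>, and \<open>proj_over\<close>
  is the projection \<open>M \<otimes> N \<rightarrow> M \<otimes>\<^sub>A N\<close>.\<close>

definition tensor_over ::
    "('k, 'h, 'a) halg \<Rightarrow> ('k, 'h, 'm, 'e) hmod_scheme \<Rightarrow> (('m, 'a) tensor \<Rightarrow> 'm)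
      \<Rightarrow> ('k, 'h, 'n, 'f) hmod_scheme \<Rightarrow> (('a, 'n) tensor \<Rightarrow> 'n) \<Rightarrow> ('k, 'h, ('m, 'n) tensor set) hmod" where
  "tensor_over A M \<mu> N \<nu> = hcoeq ((M \<Otimes> A) \<Otimes> N) (M \<Otimes> N) (tm M N \<mu> id) (tm M N id \<nu> \<circ> as M A N)"

definition proj_over ::
    "('k, 'h, 'a) halg \<Rightarrow> ('k, 'h, 'm, 'e) hmod_scheme \<Rightarrow> (('m, 'a) tensor \<Rightarrow> 'm)
      \<Rightarrow> ('k, 'h, 'n, 'f) hmod_scheme \<Rightarrow> (('a, 'n) tensor \<Rightarrow> 'n) \<Rightarrow> ('m, 'n) tensor \<Rightarrow> ('m, 'n) tensor set" where
  "proj_over A M \<mu> N \<nu> = coeq_proj ((M \<Otimes> A) \<Otimes> N) (M \<Otimes> N) (tm M N \<mu> id) (tm M N id \<nu> \<circ> as M A N)"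

text \<open>The maps below are induced from maps between ordinary tensor products; an element of a
  quotient is represented by an arbitrary element \<open>rep\<close> of its class. First, \<open>f \<otimes>\<^sub>A g\<close> for module
  maps \<open>f\<close> and \<open>g\<close> with codomains \<open>M\<close> and \<open>N\<close>.\<close>

definition map_over ::
    "('k, 'h, 'a) halg \<Rightarrow> ('k, 'h, 'm, 'e) hmod_scheme \<Rightarrow> (('m, 'a) tensor \<Rightarrow> 'm)
      \<Rightarrow> ('k, 'h, 'n, 'f) hmod_scheme \<Rightarrow> (('a, 'n) tensor \<Rightarrow> 'n)
      \<Rightarrow> ('m0 \<Rightarrow> 'm) \<Rightarrow> ('n0 \<Rightarrow> 'n) \<Rightarrow> ('m0, 'n0) tensor set \<Rightarrow> ('m, 'n) tensor set" where
  "map_over A M \<mu> N \<nu> f g P = proj_over A M \<mu> N \<nu> (tm M N f g (rep P))"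

text \<open>The right action \<open>(M \<otimes>\<^sub>A N) \<otimes> A \<rightarrow> M \<otimes>\<^sub>A N\<close> coming from a right action \<open>\<nu>'\<close> on a bimodule \<open>N\<close>,
  and the left action \<open>A \<otimes> (M \<otimes>\<^sub>A N) \<rightarrow> M \<otimes>\<^sub>A N\<close> coming from a left action \<open>\<mu>'\<close> on a bimodule \<open>M\<close>.\<close>

definition right_over ::
    "('k, 'h, 'a) halg \<Rightarrow> ('k, 'h, 'm, 'e) hmod_scheme \<Rightarrow> (('m, 'a) tensor \<Rightarrow> 'm)
      \<Rightarrow> ('k, 'h, 'n, 'f) hmod_scheme \<Rightarrow> (('a, 'n) tensor \<Rightarrow> 'n) \<Rightarrow> (('n, 'a) tensor \<Rightarrow> 'n)
      \<Rightarrow> (('m, 'n) tensor set, 'a) tensor \<Rightarrow> ('m, 'n) tensor set" where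
  "right_over A M \<mu> N \<nu> \<nu>' = tensor_lift (tensor_over A M \<mu> N \<nu>)
     (\<lambda>P a. proj_over A M \<mu> N \<nu> (tm M N id \<nu>' (as M N A (pure k (M \<Otimes> N) A (rep P) a))))"

definition left_over ::
    "('k, 'h, 'a) halg \<Rightarrow> ('k, 'h, 'm, 'e) hmod_scheme \<Rightarrow> (('a, 'm) tensor \<Rightarrow> 'm) \<Rightarrow> (('m, 'a) tensor \<Rightarrow> 'm)
      \<Rightarrow> ('k, 'h, 'n, 'f) hmod_scheme \<Rightarrow> (('a, 'n) tensor \<Rightarrow> 'n)
      \<Rightarrow> ('a, ('m, 'n) tensor set) tensor \<Rightarrow> ('m, 'n) tensor set" where
  "left_over A M \<mu>' \<mu> N \<nu> = tensor_lift (tensor_over A M \<mu> N \<nu>)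
     (\<lambda>a P. proj_over A M \<mu> N \<nu> (tm M N \<mu>' id (ai A M N (pure k A (M \<Otimes> N) a (rep P)))))"

text \<open>The associativity constraint \<open>(M \<otimes>\<^sub>A N) \<otimes>\<^sub>A P \<rightarrow> M \<otimes>\<^sub>A (N \<otimes>\<^sub>A P)\<close>, where \<open>\<nu>\<close>, \<open>\<nu>'\<close> are the left and
  right actions of the bimodule \<open>N\<close>.\<close>

definition assoc_over ::
    "('k, 'h, 'a) halg \<Rightarrow> ('k, 'h, 'm, 'e) hmod_scheme \<Rightarrow> (('m, 'a) tensor \<Rightarrow> 'm)
      \<Rightarrow> ('k, 'h, 'n, 'f) hmod_scheme \<Rightarrow> (('a, 'n) tensor \<Rightarrow> 'n) \<Rightarrow> (('n, 'a) tensor \<Rightarrow> 'n)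
      \<Rightarrow> ('k, 'h, 'p, 'g) hmod_scheme \<Rightarrow> (('a, 'p) tensor \<Rightarrow> 'p)
      \<Rightarrow> (('m, 'n) tensor set, 'p) tensor set \<Rightarrow> ('m, ('n, 'p) tensor set) tensor set" where
  "assoc_over A M \<mu> N \<nu> \<nu>' P \<pi> T =
     (let NP = tensor_over A N \<nu>' P \<pi>; \<nu>P = left_over A N \<nu> \<nu>' P \<pi>
      in tensor_lift (tensor_over A M \<mu> NP \<nu>P)
        (\<lambda>Q p. proj_over A M \<mu> NP \<nu>P
           (tm M NP id (proj_over A N \<nu>' P \<pi>) (as M N P (pure k (M \<Otimes> N) P (rep Q) p))))
        (rep T))"


subsection \<open>The coring induced by a cowreath, and its corepresentations\<close>

text \<open>The comultiplication is \<open>\<Upsilon>\<^sup>-\<^sup>1 (m \<otimes> X \<otimes> X) (A \<otimes> \<delta>)\<close>, where \<open>\<Upsilon>\<close> is the canonical isomorphism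
  \<open>D \<otimes>\<^sub>A D = D \<otimes>\<^sub>A (A \<otimes> X) \<rightarrow> D \<otimes> X\<close> induced by the right action of \<open>D = A \<otimes> X\<close>.\<close>

definition induced_coring ::
    "('k, 'h, 'a, 'x) cowreath_data \<Rightarrow> ('k, 'h, 'a, ('a, 'x) tensor) coring_data" where
  "induced_coring K =
    (let A = walg K; X = wobj K; m = amult A; \<psi> = wpsi K; \<delta> = wdelta K; f = wcounit K;
         D = A \<Otimes> X;
         left = tm A X m id \<circ> ai A A X;
         right = tm A X m id \<circ> ai A A X \<circ> tm A (A \<Otimes> X) id \<psi> \<circ> as A X A;
         Upsilon = (\<lambda>P. tm D X right id (ai D A X (rep P)))
     in hmod.extend D (coring_data.fields left right
          (\<lambda>d. inv_into (carrier (tensor_over A D right D left)) Upsilon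
             ((ai A X X \<circ> tm A (X \<Otimes> X) m id \<circ> ai A A (X \<Otimes> X) \<circ> tm A (A \<Otimes> X \<Otimes> X) id \<delta>) d))
          (\<lambda>d. m (tm A A id f d))))"

text \<open>The last condition is counitality modulo the isomorphism \<open>M \<otimes>\<^sub>A A \<cong> M\<close> induced by the action.\<close>

definition corepresentation ::
    "('k, 'h, 'a) halg \<Rightarrow> ('k, 'h, 'a, 'd) coring_data \<Rightarrow> ('k, 'h, 'm, 'a, 'd) corep \<Rightarrow> bool" where
  "corepresentation A D M \<longleftrightarrow>
    (let \<mu> = rmult M; \<rho> = coact M; MD = tensor_over A M \<mu> D (dleft D);
         \<mu>D = right_over A M \<mu> D (dleft D) (dright D);
         DD = tensor_over A D (dright D) D (dleft D); lDD = left_over A D (dleft D) (dright D) D (dleft D)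
     in right_module A M \<and> \<rho> \<in> hmod_hom k H M MD \<and>
      (\<forall>t\<in>carrier (M \<Otimes> A). \<rho> (\<mu> t) = \<mu>D (tm MD A \<rho> id t)) \<and>
      (\<forall>x\<in>carrier M. assoc_over A M \<mu> D (dleft D) (dright D) D (dleft D)
           (map_over A MD \<mu>D D (dleft D) \<rho> id (\<rho> x))
         = map_over A M \<mu> DD lDD id (dcomult D) (\<rho> x)) \<and>
      (\<forall>x\<in>carrier M. \<mu> (rep (map_over A M \<mu> A (amult A) id (dcounit D) (\<rho> x))) = x))"

end


section \<open>Categories and their isomorphisms\<close>

record ('o, 'm) cat =
  Obj :: "'o set"
  Arr :: "'o \<Rightarrow> 'o \<Rightarrow> 'm set"
  Idt :: "'o \<Rightarrow> 'm"
  Cmp :: "'o \<Rightarrow> 'o \<Rightarrow> 'o \<Rightarrow> 'm \<Rightarrow> 'm \<Rightarrow> 'm"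

definition category :: "('o, 'm) cat \<Rightarrow> bool" where
  "category C \<longleftrightarrow>
     (\<forall>X\<in>Obj C. Idt C X \<in> Arr C X X) \<and>
     (\<forall>X\<in>Obj C. \<forall>Y\<in>Obj C. \<forall>Z\<in>Obj C. \<forall>f\<in>Arr C X Y. \<forall>g\<in>Arr C Y Z. Cmp C X Y Z g f \<in> Arr C X Z) \<and>
     (\<forall>X\<in>Obj C. \<forall>Y\<in>Obj C. \<forall>f\<in>Arr C X Y. Cmp C X X Y f (Idt C X) = f \<and> Cmp C X Y Y (Idt C Y) f = f) \<and>
     (\<forall>W\<in>Obj C. \<forall>X\<in>Obj C. \<forall>Y\<in>Obj C. \<forall>Z\<in>Obj C. \<forall>f\<in>Arr C W X. \<forall>g\<in>Arr C X Y. \<forall>h\<in>Arr C Y Z.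
        Cmp C W X Z (Cmp C X Y Z h g) f = Cmp C W Y Z h (Cmp C W X Y g f))"

definition is_functor ::
    "('o, 'm) cat \<Rightarrow> ('p, 'n) cat \<Rightarrow> ('o \<Rightarrow> 'p) \<Rightarrow> ('o \<Rightarrow> 'o \<Rightarrow> 'm \<Rightarrow> 'n) \<Rightarrow> bool" where
  "is_functor C D F0 F1 \<longleftrightarrow>
     (\<forall>X\<in>Obj C. F0 X \<in> Obj D) \<and>
     (\<forall>X\<in>Obj C. \<forall>Y\<in>Obj C. \<forall>f\<in>Arr C X Y. F1 X Y f \<in> Arr D (F0 X) (F0 Y)) \<and>
     (\<forall>X\<in>Obj C. F1 X X (Idt C X) = Idt D (F0 X)) \<and>
     (\<forall>X\<in>Obj C. \<forall>Y\<in>Obj C. \<forall>Z\<in>Obj C. \<forall>f\<in>Arr C X Y. \<forall>g\<in>Arr C Y Z.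
        F1 X Z (Cmp C X Y Z g f) = Cmp D (F0 X) (F0 Y) (F0 Z) (F1 Y Z g) (F1 X Y f))"

definition inverse_functors ::
    "('o, 'm) cat \<Rightarrow> ('o \<Rightarrow> 'p) \<Rightarrow> ('o \<Rightarrow> 'o \<Rightarrow> 'm \<Rightarrow> 'n) \<Rightarrow> ('p \<Rightarrow> 'o) \<Rightarrow> ('p \<Rightarrow> 'p \<Rightarrow> 'n \<Rightarrow> 'm) \<Rightarrow> bool" where
  "inverse_functors C F0 F1 G0 G1 \<longleftrightarrow>
     (\<forall>X\<in>Obj C. G0 (F0 X) = X) \<and>
     (\<forall>X\<in>Obj C. \<forall>Y\<in>Obj C. \<forall>f\<in>Arr C X Y. G1 (F0 X) (F0 Y) (F1 X Y f) = f)"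

definition isomorphic_categories :: "('o, 'm) cat \<Rightarrow> ('p, 'n) cat \<Rightarrow> bool" where
  "isomorphic_categories C D \<longleftrightarrow> category C \<and> category D \<and>
     (\<exists>F0 F1 G0 G1. is_functor C D F0 F1 \<and> is_functor D C G0 G1 \<and>
        inverse_functors C F0 F1 G0 G1 \<and> inverse_functors D G0 G1 F0 F1)"

text \<open>The objects of the two categories below are the structures whose carrier is a set of elements
  of an arbitrary type \<open>'m\<close>. Functions in HOL are total; so that distinct objects and morphisms
  differ mathematically, the structure maps of objects and the morphisms are required to be
  undefined outside their domains.\<close>

definition extensional_hmod :: "'k ring \<Rightarrow> ('k, 'h) quasi_bialg \<Rightarrow> ('k, 'h, 'm, 'e) hmod_scheme \<Rightarrow> bool" where
  "extensional_hmod k H M \<longleftrightarrow>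
     monoid.mult M = undefined \<and> \<one>\<^bsub>M\<^esub> = undefined \<and>
     add M = (\<lambda>x\<in>carrier M. \<lambda>y\<in>carrier M. x \<oplus>\<^bsub>M\<^esub> y) \<and>
     smult M = (\<lambda>c\<in>carrier k. \<lambda>x\<in>carrier M. c \<odot>\<^bsub>M\<^esub> x) \<and>
     lact M = (\<lambda>h\<in>carrier H. \<lambda>x\<in>carrier M. lact M h x)"

definition corep_category ::
    "'m itself \<Rightarrow> 'k ring \<Rightarrow> ('k, 'h) quasi_bialg \<Rightarrow> ('k, 'h, 'a) halg \<Rightarrow> ('k, 'h, 'a, 'd) coring_data
      \<Rightarrow> (('k, 'h, 'm, 'a, 'd) corep, 'm \<Rightarrow> 'm) cat" where
  "corep_category T k H A D =
    \<lparr>Obj = {M. corepresentation k H A D M \<and> extensional_hmod k H M \<and>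
        rmult M \<in> extensional (carrier (htensor k H M A)) \<and> coact M \<in> extensional (carrier M)},
     Arr = (\<lambda>M N. {g \<in> hmod_hom k H M N \<inter> extensional (carrier M).
        (\<forall>t\<in>carrier (htensor k H M A). g (rmult M t) = rmult N (tensor_map k N A g id t)) \<and>
        (\<forall>x\<in>carrier M. coact N (g x) = map_over k H A N (rmult N) D (dleft D) g id (coact M x))}),
     Idt = (\<lambda>M. \<lambda>x\<in>carrier M. x),
     Cmp = (\<lambda>L M N g f. compose (carrier L) g f)\<rparr>"


section \<open>Quasi-Hopf bimodules over a bimodule coalgebra\<close>

record ('k, 'h, 'm, 'a, 'c) hopf_bimod = "('k, 'h, 'm) hmod" +
  bract :: "'m \<Rightarrow> 'a \<Rightarrow> 'm"
  bcoact :: "'m \<Rightarrow> ('m, 'c) tensor"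

definition hopf_bimodule ::
    "'k ring \<Rightarrow> ('k, 'h) quasi_bialg \<Rightarrow> ('k, 'h, 'a) comod_alg \<Rightarrow> ('k, 'h, 'c) bimod_coalg
      \<Rightarrow> ('k, 'h, 'm, 'a, 'c) hopf_bimod \<Rightarrow> bool" where
  "hopf_bimodule k H A C M \<longleftrightarrow>
    (let \<rho> = bcoact M; MC = tensor k M C; CC = tensor k C C;
         rM = (\<lambda>a m. bract M m a); rC = (\<lambda>h c. ract C c h)
     in hmodule k H M \<and> right_action k A M (bract M) \<and>
      (\<forall>h\<in>carrier H. \<forall>m\<in>carrier M. \<forall>a\<in>carrier A. bract M (lact M h m) a = lact M h (bract M m a)) \<and>
      \<rho> \<in> lin_maps k M MC \<and>
      (\<forall>h\<in>carrier H. \<forall>m\<in>carrier M. \<rho> (lact M h m) = tensor_act k M C (lact M) (lact C) (comult H h) (\<rho> m)) \<and>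
      (\<forall>m\<in>carrier M. \<forall>a\<in>carrier A. \<rho> (bract M m a) = tensor_act k M C rM rC (rho A a) (\<rho> m)) \<and>
      (\<forall>m\<in>carrier M.
         tensor_act k M CC (lact M) (tensor_act k C C (lact C) (lact C)) (reass H)
           (rebr k M C C (tensor_map k MC C \<rho> id (\<rho> m)))
         = tensor_act k M CC rM (tensor_act k C C rC rC) (reass_rho A)
           (tensor_map k M CC id (ccomult C) (\<rho> m))) \<and>
      (\<forall>m\<in>carrier M. runit M (tensor_map k M (base_space k) id (ccounit C) (\<rho> m)) = m))"

definition hopf_bimodule_category ::
    "'m itself \<Rightarrow> 'k ring \<Rightarrow> ('k, 'h) quasi_bialg \<Rightarrow> ('k, 'h, 'a) comod_alg \<Rightarrow> ('k, 'h, 'c) bimod_coalg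
      \<Rightarrow> (('k, 'h, 'm, 'a, 'c) hopf_bimod, 'm \<Rightarrow> 'm) cat" where
  "hopf_bimodule_category T k H A C =
    \<lparr>Obj = {M. hopf_bimodule k H A C M \<and> extensional_hmod k H M \<and>
        bract M = (\<lambda>m\<in>carrier M. \<lambda>a\<in>carrier A. bract M m a) \<and> bcoact M \<in> extensional (carrier M)},
     Arr = (\<lambda>M N. {g \<in> hmod_hom k H M N \<inter> extensional (carrier M).
        (\<forall>m\<in>carrier M. \<forall>a\<in>carrier A. g (bract M m a) = bract N (g m) a) \<and>
        (\<forall>m\<in>carrier M. bcoact N (g m) = tensor_map k N C g id (bcoact M m))}),
     Idt = (\<lambda>M. \<lambda>x\<in>carrier M. x),
     Cmp = (\<lambda>L M N g f. compose (carrier L) g f)\<rparr>"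


section \<open>The cowreath of a comodule algebra and a bimodule coalgebra\<close>

definition trivial_halg :: "'k ring \<Rightarrow> ('k, 'h) quasi_bialg \<Rightarrow> ('k, 'h, 'a) comod_alg \<Rightarrow> ('k, 'h, 'a) halg" where
  "trivial_halg k H A = hmod.extend
     (module.extend (module.truncate A) (hmod.fields (\<lambda>h a. counit H h \<odot>\<^bsub>A\<^esub> a)))
     (halg.fields (tensor_lift A (monoid.mult A)) (\<lambda>c. c \<odot>\<^bsub>A\<^esub> \<one>\<^bsub>A\<^esub>))"

definition comodule_cowreath ::
    "'k ring \<Rightarrow> ('k, 'h) quasi_bialg \<Rightarrow> ('k, 'h, 'a) comod_alg \<Rightarrow> ('k, 'h, 'c) bimod_coalg
      \<Rightarrow> ('k, 'h, 'a, 'c) cowreath_data" where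
  "comodule_cowreath k H A C =
    \<lparr>walg = trivial_halg k H A,
     wobj = hmod.truncate C,
     wpsi = tensor_lift (tensor k A C)
       (\<lambda>c a. tensor_lift (tensor k A C) (\<lambda>a0 a1. pure k A C a0 (ract C c a1)) (rho A a)),
     wdelta = (\<lambda>c. tensor_lift (tensor k A (tensor k C C))
       (\<lambda>x t. pure k A (tensor k C C) x
          (tensor_act k C C (\<lambda>h c. ract C c h) (\<lambda>h c. ract C c h) t (ccomult C c))) (reass_rho A)),
     wcounit = (\<lambda>c. ccounit C c \<odot>\<^bsub>A\<^esub> \<one>\<^bsub>A\<^esub>)\<rparr>"

end

theory Submission
  imports Defs
begin

text \<open>
  All axioms are identities between linear maps and are checked on pure tensors. Applying
  \<open>\<epsilon>\<close> to the pentagon shows that \<open>\<Phi>\<close> becomes trivial as soon as \<open>\<epsilon>\<close> is applied to any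
  one of its legs; since \<open>H\<close> acts on \<open>A\<close> through \<open>\<epsilon>\<close>, every associativity constraint with
  a factor \<open>A\<close> is a mere rebracketing. With \<open>\<psi>(c \<otimes> a) = (1 \<otimes> c) \<cdot> \<rho>(a)\<close> and
  \<open>\<delta>(c) = (1 \<otimes> \<Delta> c) \<cdot> \<Phi>\<^sub>\<rho>\<close>, the cowreath axioms become the axioms of \<open>\<rho>\<close>
  and \<open>\<Phi>\<^sub>\<rho>\<close> transported along right actions.

  For a right \<open>A\<close>-module \<open>M\<close> the coequalizer \<open>M \<otimes>\<^sub>A (A \<otimes> C)\<close> is split, which identifies it with
  \<open>M \<otimes> C\<close> through \<open>\<theta>(m \<otimes> (a \<otimes> c)) = m a \<otimes> c\<close>. Composition with \<open>\<theta>\<close> turns the axioms of a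
  right corepresentation into those of a quasi-Hopf bimodule, and the isomorphism of categories
  changes neither the underlying space nor the maps.
\<close>

section \<open>Linear and bilinear maps\<close>

text \<open>The elements \<rho>(a), \<Delta>(h) and the two reassociators are not pure tensors. An
  identity containing one of them is first proved with an arbitrary element in its place, where both
  sides are linear in that element and pure tensors suffice; the axiom is inserted afterwards. Maps
  on a quotient over A are defined through a representative chosen by \<open>rep\<close>. Instead of
  proving each of them well defined, one computes its value under an injective linear coordinate map
  into an ordinary tensor product and pulls module laws, linearity and equations back along it.
  These coordinates exist for all products that occur for one reason: D = A \<otimes> C is free over
  A on C, and D \<otimes>_A D is free on C \<otimes> C. So M \<otimes>_A (D \<otimes>_A D) becomes M
  \<otimes> (C \<otimes> C), where coassociativity can be compared with the axiom containing \<Phi>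
  and \<Phi>_\<rho>; there \<Phi> survives because the constraint for M, D, D has no factor A. A
  further obstacle is typing: one and the same space underlies records of several types, which
  \<open>same_module\<close> relates.\<close>

lemma lin_mapsI:
  assumes "\<And>x. x \<in> carrier V \<Longrightarrow> f x \<in> carrier W"
    and "\<And>x y. x \<in> carrier V \<Longrightarrow> y \<in> carrier V \<Longrightarrow> f (x \<oplus>\<^bsub>V\<^esub> y) = f x \<oplus>\<^bsub>W\<^esub> f y"
    and "\<And>c x. c \<in> carrier k \<Longrightarrow> x \<in> carrier V \<Longrightarrow> f (c \<odot>\<^bsub>V\<^esub> x) = c \<odot>\<^bsub>W\<^esub> f x"
  shows "f \<in> lin_maps k V W"
  using assms by (auto simp: lin_maps_def)

lemma lin_maps_closed: "f \<in> lin_maps k V W \<Longrightarrow> x \<in> carrier V \<Longrightarrow> f x \<in> carrier W"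
  by (auto simp: lin_maps_def)

lemma lin_maps_add:
  "f \<in> lin_maps k V W \<Longrightarrow> x \<in> carrier V \<Longrightarrow> y \<in> carrier V \<Longrightarrow> f (x \<oplus>\<^bsub>V\<^esub> y) = f x \<oplus>\<^bsub>W\<^esub> f y"
  by (auto simp: lin_maps_def)

lemma lin_maps_smult:
  "f \<in> lin_maps k V W \<Longrightarrow> c \<in> carrier k \<Longrightarrow> x \<in> carrier V \<Longrightarrow> f (c \<odot>\<^bsub>V\<^esub> x) = c \<odot>\<^bsub>W\<^esub> f x"
  by (auto simp: lin_maps_def)

lemma lin_maps_zero:
  assumes "f \<in> lin_maps k V W" "module k V" "module k W"
  shows "f \<zero>\<^bsub>V\<^esub> = \<zero>\<^bsub>W\<^esub>"
proof -
  interpret V: module k V by fact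
  interpret W: module k W by fact
  have c: "f \<zero>\<^bsub>V\<^esub> \<in> carrier W" using assms(1) by (rule lin_maps_closed) simp
  have "f (\<zero>\<^bsub>V\<^esub> \<oplus>\<^bsub>V\<^esub> \<zero>\<^bsub>V\<^esub>) = f \<zero>\<^bsub>V\<^esub> \<oplus>\<^bsub>W\<^esub> f \<zero>\<^bsub>V\<^esub>"
    using assms(1) by (rule lin_maps_add) simp_all
  with c show ?thesis by (simp add: W.M.add.l_cancel_one')
qed

lemma lin_maps_minus:
  assumes "f \<in> lin_maps k V W" "module k V" "module k W" "x \<in> carrier V" "y \<in> carrier V"
  shows "f (x \<ominus>\<^bsub>V\<^esub> y) = f x \<ominus>\<^bsub>W\<^esub> f y"
proof -
  interpret V: module k V by fact
  interpret W: module k W by fact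
  have c: "f x \<in> carrier W" "f y \<in> carrier W" "f (\<ominus>\<^bsub>V\<^esub> y) \<in> carrier W"
    using assms by (auto intro: lin_maps_closed)
  have "f y \<oplus>\<^bsub>W\<^esub> f (\<ominus>\<^bsub>V\<^esub> y) = f (y \<oplus>\<^bsub>V\<^esub> \<ominus>\<^bsub>V\<^esub> y)"
    using assms by (simp add: lin_maps_add)
  also have "\<dots> = \<zero>\<^bsub>W\<^esub>" using assms by (simp add: V.M.r_neg lin_maps_zero)
  finally have "f (\<ominus>\<^bsub>V\<^esub> y) = \<ominus>\<^bsub>W\<^esub> f y" using c by (metis W.M.minus_equality W.M.a_comm)
  thus ?thesis using assms by (simp add: a_minus_def lin_maps_add)
qed

lemma lin_maps_comp:
  "f \<in> lin_maps k V W \<Longrightarrow> g \<in> lin_maps k U V \<Longrightarrow> (\<lambda>x. f (g x)) \<in> lin_maps k U W"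
  by (rule lin_mapsI) (simp_all add: lin_maps_closed lin_maps_add lin_maps_smult)

lemma lin_maps_ident: "(\<lambda>x. x) \<in> lin_maps k V V" and lin_maps_id: "id \<in> lin_maps k V V"
  by (auto simp: lin_maps_def)

text \<open>Maps matter only on the carrier of their domain. The domain is a module so that sums and
  multiples of its elements are again points at which \<open>f\<close> and \<open>g\<close>
  agree.\<close>

lemma lin_maps_cong:
  "f \<in> lin_maps k V W \<Longrightarrow> module k V \<Longrightarrow> (\<And>x. x \<in> carrier V \<Longrightarrow> f x = g x) \<Longrightarrow> g \<in> lin_maps k V W"
  by (rule lin_mapsI)
    (metis lin_maps_closed lin_maps_add lin_maps_smult module.smult_closed abelian_monoid.a_closed
      abelian_group.axioms(1) module.axioms(2))+

lemma bilin_mapsI: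
  assumes "\<And>u. u \<in> carrier U \<Longrightarrow> b u \<in> lin_maps k V W"
    and "\<And>v. v \<in> carrier V \<Longrightarrow> (\<lambda>u. b u v) \<in> lin_maps k U W"
  shows "b \<in> bilin_maps k U V W"
  using assms by (auto simp: bilin_maps_def)

lemma bilin_maps_right: "b \<in> bilin_maps k U V W \<Longrightarrow> u \<in> carrier U \<Longrightarrow> b u \<in> lin_maps k V W"
  and bilin_maps_left: "b \<in> bilin_maps k U V W \<Longrightarrow> v \<in> carrier V \<Longrightarrow> (\<lambda>u. b u v) \<in> lin_maps k U W"
  by (auto simp: bilin_maps_def)

lemma bilin_maps_closed:
  "b \<in> bilin_maps k U V W \<Longrightarrow> u \<in> carrier U \<Longrightarrow> v \<in> carrier V \<Longrightarrow> b u v \<in> carrier W"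
  by (auto simp: bilin_maps_def lin_maps_def)

lemma bilin_maps_comp_left:
  "b \<in> bilin_maps k U V W \<Longrightarrow> F \<in> lin_maps k N U \<Longrightarrow> v \<in> carrier V \<Longrightarrow> (\<lambda>x. b (F x) v) \<in> lin_maps k N W"
  by (rule lin_maps_comp[OF bilin_maps_left])

lemma bilin_maps_comp_right:
  "b \<in> bilin_maps k U V W \<Longrightarrow> F \<in> lin_maps k N V \<Longrightarrow> u \<in> carrier U \<Longrightarrow> (\<lambda>x. b u (F x)) \<in> lin_maps k N W"
  by (rule lin_maps_comp[OF bilin_maps_right])

section \<open>Tensor products as modules\<close>

abbreviation formal :: "('k, 'v, 'e) module_scheme \<Rightarrow> ('k, 'w, 'f) module_scheme \<Rightarrow> ('v \<times> 'w) list \<Rightarrow> bool" where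
  "formal V W xs \<equiv> set xs \<subseteq> carrier V \<times> carrier W"

text \<open>\<open>tensor_lift\<close> before a representative is chosen: it evaluates a given list,
  so that independence of the list can be stated and proved.\<close>

definition formal_sum :: "('k, 'n, 'e) module_scheme \<Rightarrow> ('v \<Rightarrow> 'w \<Rightarrow> 'n) \<Rightarrow> ('v \<times> 'w) list \<Rightarrow> 'n" where
  "formal_sum N b xs = foldr (\<lambda>(v, w) s. b v w \<oplus>\<^bsub>N\<^esub> s) xs \<zero>\<^bsub>N\<^esub>"

lemma formal_sum_simps [simp]:
  "formal_sum N b [] = \<zero>\<^bsub>N\<^esub>"
  "formal_sum N b ((v, w) # xs) = b v w \<oplus>\<^bsub>N\<^esub> formal_sum N b xs"
  by (simp_all add: formal_sum_def)

lemma formal_sum_closed: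
  assumes "module k N" "b \<in> bilin_maps k V W N" "formal V W xs"
  shows "formal_sum N b xs \<in> carrier N"
proof -
  interpret N: module k N by fact
  show ?thesis using assms(3)
    by (induction xs) (auto simp: bilin_maps_closed[OF assms(2)])
qed

lemma formal_sum_append:
  assumes "module k N" "b \<in> bilin_maps k V W N" "formal V W xs" "formal V W ys"
  shows "formal_sum N b (xs @ ys) = formal_sum N b xs \<oplus>\<^bsub>N\<^esub> formal_sum N b ys"
proof -
  interpret N: module k N by fact
  note [simp] = bilin_maps_closed[OF assms(2)] formal_sum_closed[OF assms(1,2)] assms(4)
  show ?thesis using assms(3)
    by (induction xs) (auto simp: N.M.a_assoc)
qed

lemma tensor_eq_formal:
  assumes "module k V" "module k W"
  shows "tensor_eq k V W xs ys \<Longrightarrow> formal V W xs \<and> formal V W ys"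
proof -
  interpret V: module k V by fact
  interpret W: module k W by fact
  show "tensor_eq k V W xs ys \<Longrightarrow> formal V W xs \<and> formal V W ys"
    by (induction rule: tensor_eq.induct) auto
qed

text \<open>Every generator of \<open>tensor_eq\<close> is an instance of bilinearity of
  \<open>b\<close> or of commutativity of addition in \<open>N\<close>. This is the universal
  property of the tensor product, in the form that frees \<open>tensor_lift\<close> from the choice
  made by \<open>rep\<close>.\<close>

lemma formal_sum_cong:
  assumes "module k V" "module k W" "module k N" and b: "b \<in> bilin_maps k V W N"
  shows "tensor_eq k V W xs ys \<Longrightarrow> formal_sum N b xs = formal_sum N b ys"
proof -
  interpret N: module k N by fact
  note [simp] = bilin_maps_closed[OF b] formal_sum_closed[OF assms(3) b]
  note l = bilin_maps_left[OF b] and r = bilin_maps_right[OF b]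
  show "tensor_eq k V W xs ys \<Longrightarrow> formal_sum N b xs = formal_sum N b ys"
  proof (induction rule: tensor_eq.induct)
    case (append xs ys us vs)
    thus ?case using tensor_eq_formal[OF assms(1,2)] by (metis formal_sum_append[OF assms(3) b])
  next
    case (commute xs ys)
    thus ?case by (simp add: formal_sum_append[OF assms(3) b] N.M.a_comm)
  next
    case (add_left v v' w)
    thus ?case using lin_maps_add[OF l[of w]] by (simp)
  next
    case (add_right v w w')
    thus ?case using lin_maps_add[OF r[of v]] by (simp)
  next
    case (scalar c v w)
    thus ?case using lin_maps_smult[OF r[of v]] lin_maps_smult[OF l[of w]] by simp
  next
    case (zero w)
    thus ?case using lin_maps_zero[OF l[of w]] assms by simp
  qed auto
qed

context
  fixes k :: "'k ring" and V :: "('k, 'v, 'e) module_scheme" and W :: "('k, 'w, 'f) module_scheme"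
  assumes V: "module k V" and W: "module k W"
begin

interpretation V: module k V by (rule V)
interpretation W: module k W by (rule W)

lemma tensor_class_eq_iff:
  "formal V W xs \<Longrightarrow> tensor_class k V W xs = tensor_class k V W ys \<longleftrightarrow> tensor_eq k V W xs ys"
  unfolding tensor_class_def
  by (metis (mono_tags, lifting) tensor_eq.refl tensor_eq.sym tensor_eq.trans Collect_cong mem_Collect_eq)

lemma rep_tensor_class: "formal V W xs \<Longrightarrow> tensor_eq k V W xs (rep (tensor_class k V W xs))"
  unfolding rep_def by (rule someI2[of _ xs]) (auto simp: tensor_class_def intro: tensor_eq.refl)

lemma tensor_rep:
  assumes "t \<in> carrier (tensor k V W)"
  shows "formal V W (rep t)" "tensor_class k V W (rep t) = t"
proof -
  obtain xs where xs: "formal V W xs" "t = tensor_class k V W xs"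
    using assms by (auto simp: tensor_def)
  show "formal V W (rep t)" using rep_tensor_class[OF xs(1)] tensor_eq_formal[OF V W] xs by blast
  show "tensor_class k V W (rep t) = t"
    using rep_tensor_class[OF xs(1)] xs tensor_class_eq_iff by metis
qed

lemma tensor_cases:
  assumes "t \<in> carrier (tensor k V W)"
  obtains xs where "formal V W xs" "t = tensor_class k V W xs"
  using tensor_rep[OF assms] by metis

lemma tensor_class_closed: "formal V W xs \<Longrightarrow> tensor_class k V W xs \<in> carrier (tensor k V W)"
  by (auto simp: tensor_def)

lemma tensor_class_append:
  assumes "formal V W xs" "formal V W ys"
  shows "tensor_class k V W xs \<oplus>\<^bsub>tensor k V W\<^esub> tensor_class k V W ys = tensor_class k V W (xs @ ys)"
proof -
  have "tensor_eq k V W (xs @ ys) (rep (tensor_class k V W xs) @ rep (tensor_class k V W ys))"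
    by (intro tensor_eq.append rep_tensor_class assms)
  hence "tensor_class k V W (xs @ ys)
      = tensor_class k V W (rep (tensor_class k V W xs) @ rep (tensor_class k V W ys))"
    using assms by (intro iffD2[OF tensor_class_eq_iff]) auto
  thus ?thesis by (simp add: tensor_def)
qed

text \<open>Scalar multiplication, which acts on first components, respects the congruence. Only the
  generator \<open>scalar\<close> needs an argument: there two scalars meet on the left factor and
  have to be interchanged, by commutativity of \<open>k\<close>.\<close>

lemma tensor_eq_scale:
  assumes c: "c \<in> carrier k"
  shows "tensor_eq k V W xs ys \<Longrightarrow>
    tensor_eq k V W (map (\<lambda>(v, w). (c \<odot>\<^bsub>V\<^esub> v, w)) xs) (map (\<lambda>(v, w). (c \<odot>\<^bsub>V\<^esub> v, w)) ys)"
proof (induction rule: tensor_eq.induct)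
  case (refl xs)
  thus ?case using c by (intro tensor_eq.refl) auto
next
  case (sym xs ys)
  show ?case by (rule tensor_eq.sym) (rule sym.IH)
next
  case (trans xs ys zs)
  thus ?case using tensor_eq.trans by blast
next
  case (append xs ys us vs)
  thus ?case by (simp add: tensor_eq.append)
next
  case (commute xs ys)
  thus ?case using c unfolding map_append by (intro tensor_eq.commute) auto
next
  case (add_left v v' w)
  thus ?case using c by (simp add: V.smult_r_distr tensor_eq.add_left)
next
  case (add_right v w w')
  thus ?case using c by (simp add: tensor_eq.add_right)
next
  case (scalar d v w)
  have "c \<odot>\<^bsub>V\<^esub> (d \<odot>\<^bsub>V\<^esub> v) = d \<odot>\<^bsub>V\<^esub> (c \<odot>\<^bsub>V\<^esub> v)"
    using scalar c by (metis V.smult_assoc1 V.R.m_comm)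
  thus ?case using c scalar by (simp add: tensor_eq.scalar)
next
  case (zero w)
  thus ?case using c by (simp add: tensor_eq.zero)
qed

lemma tensor_class_scale:
  assumes "formal V W xs" "c \<in> carrier k"
  shows "c \<odot>\<^bsub>tensor k V W\<^esub> tensor_class k V W xs = tensor_class k V W (map (\<lambda>(v, w). (c \<odot>\<^bsub>V\<^esub> v, w)) xs)"
proof -
  have "formal V W (map (\<lambda>(v, w). (c \<odot>\<^bsub>V\<^esub> v, w)) xs)" using assms by auto
  note tensor_class_eq_iff[OF this, THEN iffD2,
      OF tensor_eq_scale[OF assms(2) rep_tensor_class[OF assms(1)]], symmetric]
  thus ?thesis by (simp add: tensor_def)
qed

lemma tensor_zero: "\<zero>\<^bsub>tensor k V W\<^esub> = tensor_class k V W []"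
  by (simp add: tensor_def)

lemma pure_closed: "v \<in> carrier V \<Longrightarrow> w \<in> carrier W \<Longrightarrow> pure k V W v w \<in> carrier (tensor k V W)"
  by (simp add: pure_def tensor_class_closed)

lemma tensor_class_Cons:
  "v \<in> carrier V \<Longrightarrow> w \<in> carrier W \<Longrightarrow> formal V W xs \<Longrightarrow>
    tensor_class k V W ((v, w) # xs) = pure k V W v w \<oplus>\<^bsub>tensor k V W\<^esub> tensor_class k V W xs"
  by (simp add: pure_def tensor_class_append)

lemma tensor_class_induct [consumes 1, case_names zero add]:
  assumes "t \<in> carrier (tensor k V W)" "P \<zero>\<^bsub>tensor k V W\<^esub>"
    and "\<And>v w t. v \<in> carrier V \<Longrightarrow> w \<in> carrier W \<Longrightarrow> t \<in> carrier (tensor k V W) \<Longrightarrow> P t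
      \<Longrightarrow> P (pure k V W v w \<oplus>\<^bsub>tensor k V W\<^esub> t)"
  shows "P t"
proof -
  obtain xs where xs: "formal V W xs" "t = tensor_class k V W xs" using tensor_cases[OF assms(1)] .
  have "formal V W xs \<Longrightarrow> P (tensor_class k V W xs)" for xs
  proof (induction xs)
    case Nil
    thus ?case using assms(2) by (simp add: tensor_zero)
  next
    case (Cons x xs)
    thus ?case using assms(3) by (cases x) (auto simp: tensor_class_Cons tensor_class_closed)
  qed
  thus ?thesis using xs by simp
qed

lemma pure_add_left: "v \<in> carrier V \<Longrightarrow> v' \<in> carrier V \<Longrightarrow> w \<in> carrier W \<Longrightarrow>
    pure k V W (v \<oplus>\<^bsub>V\<^esub> v') w = pure k V W v w \<oplus>\<^bsub>tensor k V W\<^esub> pure k V W v' w"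
  using tensor_class_eq_iff[of "[(v \<oplus>\<^bsub>V\<^esub> v', w)]"] tensor_eq.add_left[of v V v' w W k]
  by (simp add: pure_def tensor_class_append)

lemma pure_add_right: "v \<in> carrier V \<Longrightarrow> w \<in> carrier W \<Longrightarrow> w' \<in> carrier W \<Longrightarrow>
    pure k V W v (w \<oplus>\<^bsub>W\<^esub> w') = pure k V W v w \<oplus>\<^bsub>tensor k V W\<^esub> pure k V W v w'"
  using tensor_class_eq_iff[of "[(v, w \<oplus>\<^bsub>W\<^esub> w')]"] tensor_eq.add_right[of v V w W w' k]
  by (simp add: pure_def tensor_class_append)

lemma pure_smult_left: "c \<in> carrier k \<Longrightarrow> v \<in> carrier V \<Longrightarrow> w \<in> carrier W \<Longrightarrow>
    pure k V W (c \<odot>\<^bsub>V\<^esub> v) w = c \<odot>\<^bsub>tensor k V W\<^esub> pure k V W v w"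
  by (simp add: pure_def tensor_class_scale)

lemma pure_smult_right: "c \<in> carrier k \<Longrightarrow> v \<in> carrier V \<Longrightarrow> w \<in> carrier W \<Longrightarrow>
    pure k V W v (c \<odot>\<^bsub>W\<^esub> w) = c \<odot>\<^bsub>tensor k V W\<^esub> pure k V W v w"
  using tensor_class_eq_iff[of "[(c \<odot>\<^bsub>V\<^esub> v, w)]" "[(v, c \<odot>\<^bsub>W\<^esub> w)]"] tensor_eq.scalar[of c k v V w W]
  by (simp add: pure_smult_left[symmetric]) (simp add: pure_def)

lemma pure_zero_left: "w \<in> carrier W \<Longrightarrow> pure k V W \<zero>\<^bsub>V\<^esub> w = \<zero>\<^bsub>tensor k V W\<^esub>"
  using tensor_class_eq_iff[of "[(\<zero>\<^bsub>V\<^esub>, w)]"] tensor_eq.zero[of w W k V]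
  by (simp add: pure_def tensor_zero)

lemma tensor_abelian_monoid: "abelian_monoid (tensor k V W)"
proof (rule abelian_monoidI)
  fix x y z
  assume "x \<in> carrier (tensor k V W)" "y \<in> carrier (tensor k V W)" "z \<in> carrier (tensor k V W)"
  thus "x \<oplus>\<^bsub>tensor k V W\<^esub> y \<oplus>\<^bsub>tensor k V W\<^esub> z = x \<oplus>\<^bsub>tensor k V W\<^esub> (y \<oplus>\<^bsub>tensor k V W\<^esub> z)"
    by (elim tensor_cases) (simp add: tensor_class_append)
next
  fix x y
  assume "x \<in> carrier (tensor k V W)" "y \<in> carrier (tensor k V W)"
  thus "x \<oplus>\<^bsub>tensor k V W\<^esub> y = y \<oplus>\<^bsub>tensor k V W\<^esub> x"
    by (elim tensor_cases) (simp add: tensor_class_append tensor_class_eq_iff tensor_eq.commute)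
next
  fix x y
  assume "x \<in> carrier (tensor k V W)" "y \<in> carrier (tensor k V W)"
  thus "x \<oplus>\<^bsub>tensor k V W\<^esub> y \<in> carrier (tensor k V W)"
    by (elim tensor_cases) (simp add: tensor_class_append tensor_class_closed)
next
  fix x
  assume "x \<in> carrier (tensor k V W)"
  thus "\<zero>\<^bsub>tensor k V W\<^esub> \<oplus>\<^bsub>tensor k V W\<^esub> x = x"
    by (elim tensor_cases) (simp add: tensor_zero tensor_class_append)
qed (simp add: tensor_zero tensor_class_closed)

lemma module_tensor: "module k (tensor k V W)"
proof -
  interpret T: abelian_monoid "tensor k V W" by (rule tensor_abelian_monoid)
  have sc: "c \<odot>\<^bsub>tensor k V W\<^esub> t \<in> carrier (tensor k V W)"
    if p: "c \<in> carrier k" "t \<in> carrier (tensor k V W)" for c t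
  proof -
    obtain xs where xs: "formal V W xs" "t = tensor_class k V W xs" using tensor_cases[OF p(2)] .
    show ?thesis unfolding xs(2) tensor_class_scale[OF xs(1) p(1)]
      by (rule tensor_class_closed) (use xs p in auto)
  qed
  have sa: "c \<odot>\<^bsub>tensor k V W\<^esub> (s \<oplus>\<^bsub>tensor k V W\<^esub> t)
      = c \<odot>\<^bsub>tensor k V W\<^esub> s \<oplus>\<^bsub>tensor k V W\<^esub> c \<odot>\<^bsub>tensor k V W\<^esub> t"
    if p: "c \<in> carrier k" "s \<in> carrier (tensor k V W)" "t \<in> carrier (tensor k V W)" for c s t
  proof -
    obtain xs where xs: "formal V W xs" "s = tensor_class k V W xs" using tensor_cases[OF p(2)] .
    obtain ys where ys: "formal V W ys" "t = tensor_class k V W ys" using tensor_cases[OF p(3)] .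
    have "formal V W (map (\<lambda>(v, w). (c \<odot>\<^bsub>V\<^esub> v, w)) xs)" "formal V W (map (\<lambda>(v, w). (c \<odot>\<^bsub>V\<^esub> v, w)) ys)"
      using xs ys p by auto
    thus ?thesis using xs ys p by (simp add: tensor_class_append tensor_class_scale)
  qed
  have s0: "c \<odot>\<^bsub>tensor k V W\<^esub> \<zero>\<^bsub>tensor k V W\<^esub> = \<zero>\<^bsub>tensor k V W\<^esub>" if "c \<in> carrier k" for c
    using that by (simp add: tensor_zero tensor_class_scale)
  have sp: "c \<odot>\<^bsub>tensor k V W\<^esub> pure k V W v w = pure k V W (c \<odot>\<^bsub>V\<^esub> v) w"
    if "c \<in> carrier k" "v \<in> carrier V" "w \<in> carrier W" for c v w
    using that by (simp add: pure_smult_left)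
  have sd: "(c \<oplus>\<^bsub>k\<^esub> d) \<odot>\<^bsub>tensor k V W\<^esub> t
      = c \<odot>\<^bsub>tensor k V W\<^esub> t \<oplus>\<^bsub>tensor k V W\<^esub> d \<odot>\<^bsub>tensor k V W\<^esub> t"
    if "c \<in> carrier k" "d \<in> carrier k" "t \<in> carrier (tensor k V W)" for c d t
    using that(3)
  proof (induction rule: tensor_class_induct)
    case zero
    thus ?case using that by (simp add: s0)
  next
    case (add v w t)
    thus ?case using that
      by (simp add: sa sc sp pure_closed V.smult_l_distr pure_add_left T.a_ac)
  qed
  have one: "\<one>\<^bsub>k\<^esub> \<odot>\<^bsub>tensor k V W\<^esub> t = t" if "t \<in> carrier (tensor k V W)" for t
    using that
  proof (induction rule: tensor_class_induct)
    case zero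
    thus ?case by (simp add: s0)
  next
    case (add v w t)
    thus ?case by (simp add: sa sc sp pure_closed)
  qed
  have null: "\<zero>\<^bsub>k\<^esub> \<odot>\<^bsub>tensor k V W\<^esub> t = \<zero>\<^bsub>tensor k V W\<^esub>" if "t \<in> carrier (tensor k V W)" for t
    using that
  proof (induction rule: tensor_class_induct)
    case zero
    thus ?case by (simp add: s0)
  next
    case (add v w t)
    thus ?case by (simp add: sa sc sp pure_closed pure_zero_left)
  qed
  \<comment> \<open>The formal sums contain no negatives. They come from the scalar -1, by
    distributivity and 0 t = 0, both shown by induction on t before the tensor product is known to
    be a group.\<close>
  have neg: "(\<ominus>\<^bsub>k\<^esub> \<one>\<^bsub>k\<^esub>) \<odot>\<^bsub>tensor k V W\<^esub> t \<oplus>\<^bsub>tensor k V W\<^esub> t = \<zero>\<^bsub>tensor k V W\<^esub>"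
    if "t \<in> carrier (tensor k V W)" for t
    using sd[of "\<ominus>\<^bsub>k\<^esub> \<one>\<^bsub>k\<^esub>" "\<one>\<^bsub>k\<^esub>" t] that by (simp add: one null V.R.l_neg)
  show ?thesis
  proof (rule moduleI)
    show "cring k" by (rule V.R.cring_axioms)
    show "abelian_group (tensor k V W)"
    proof (rule abelian_groupI)
      fix t assume "t \<in> carrier (tensor k V W)"
      thus "\<exists>s\<in>carrier (tensor k V W). s \<oplus>\<^bsub>tensor k V W\<^esub> t = \<zero>\<^bsub>tensor k V W\<^esub>"
        using neg sc V.R.a_inv_closed V.R.one_closed by blast
    qed (simp_all add: T.a_ac)
  next
    fix c d t
    assume cd: "c \<in> carrier k" "d \<in> carrier k" and t: "t \<in> carrier (tensor k V W)"
    show "(c \<otimes>\<^bsub>k\<^esub> d) \<odot>\<^bsub>tensor k V W\<^esub> t = c \<odot>\<^bsub>tensor k V W\<^esub> (d \<odot>\<^bsub>tensor k V W\<^esub> t)"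
      using t
    proof (induction rule: tensor_class_induct)
      case zero
      thus ?case using cd by (simp add: s0)
    next
      case (add v w t)
      thus ?case using cd by (simp add: sa sc sp pure_closed V.smult_assoc1)
    qed
  qed (auto simp: sc sa sd one)
qed

lemma pure_bilin: "pure k V W \<in> bilin_maps k V W (tensor k V W)"
  by (auto intro!: bilin_mapsI lin_mapsI
      simp: pure_closed pure_add_left pure_add_right pure_smult_left pure_smult_right)

text \<open>The zero case of the previous induction disappears because zero is the pure tensor of
  two zeros.\<close>

lemma tensor_induct [consumes 1, case_names pure add]:
  assumes t: "t \<in> carrier (tensor k V W)"
    and pure: "\<And>v w. v \<in> carrier V \<Longrightarrow> w \<in> carrier W \<Longrightarrow> P (pure k V W v w)"
    and add: "\<And>s t. s \<in> carrier (tensor k V W) \<Longrightarrow> t \<in> carrier (tensor k V W) \<Longrightarrow> P s \<Longrightarrow> P t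
      \<Longrightarrow> P (s \<oplus>\<^bsub>tensor k V W\<^esub> t)"
  shows "P t"
  using t
proof (induction rule: tensor_class_induct)
  case zero
  thus ?case using pure[of "\<zero>\<^bsub>V\<^esub>" "\<zero>\<^bsub>W\<^esub>"] by (simp add: pure_zero_left)
next
  case (add v w t)
  thus ?case using assms by (simp add: pure_closed)
qed

lemma tensor_lift_class:
  assumes "module k N" "b \<in> bilin_maps k V W N" "formal V W xs"
  shows "tensor_lift N b (tensor_class k V W xs) = formal_sum N b xs"
  using formal_sum_cong[OF V W assms(1,2) rep_tensor_class[OF assms(3)]]
  by (simp add: tensor_lift_def formal_sum_def)

lemma tensor_lift_pure:
  assumes "b \<in> bilin_maps k V W N" "module k N" "v \<in> carrier V" "w \<in> carrier W"
  shows "tensor_lift N b (pure k V W v w) = b v w"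
proof -
  interpret N: module k N by fact
  show ?thesis using assms bilin_maps_closed[OF assms(1,3,4)] by (simp add: pure_def tensor_lift_class)
qed

lemma tensor_lift_lin:
  assumes "b \<in> bilin_maps k V W N" "module k N"
  shows "tensor_lift N b \<in> lin_maps k (tensor k V W) N"
proof -
  interpret N: module k N by fact
  note cl = formal_sum_closed[OF assms(2,1)]
  show ?thesis
  proof (rule lin_mapsI)
    fix t assume "t \<in> carrier (tensor k V W)"
    thus "tensor_lift N b t \<in> carrier N"
      by (elim tensor_cases) (simp add: tensor_lift_class[OF assms(2,1)] cl)
  next
    fix s t assume "s \<in> carrier (tensor k V W)" "t \<in> carrier (tensor k V W)"
    thus "tensor_lift N b (s \<oplus>\<^bsub>tensor k V W\<^esub> t) = tensor_lift N b s \<oplus>\<^bsub>N\<^esub> tensor_lift N b t"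
      by (elim tensor_cases) (simp add: tensor_lift_class[OF assms(2,1)] tensor_class_append
          formal_sum_append[OF assms(2,1)])
  next
    fix c t assume c: "c \<in> carrier k" and t: "t \<in> carrier (tensor k V W)"
    obtain xs where xs: "formal V W xs" "t = tensor_class k V W xs" using tensor_cases[OF t] .
    have f: "formal V W (map (\<lambda>(v, w). (c \<odot>\<^bsub>V\<^esub> v, w)) xs)" using xs c by auto
    have "formal_sum N b (map (\<lambda>(v, w). (c \<odot>\<^bsub>V\<^esub> v, w)) xs) = c \<odot>\<^bsub>N\<^esub> formal_sum N b xs"
      using xs(1)
      by (induction xs) (use c in \<open>auto simp: N.smult_r_distr cl bilin_maps_closed[OF assms(1)]
          lin_maps_smult[OF bilin_maps_left[OF assms(1)]]\<close>)
    thus "tensor_lift N b (c \<odot>\<^bsub>tensor k V W\<^esub> t) = c \<odot>\<^bsub>N\<^esub> tensor_lift N b t"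
      using xs f c by (simp add: tensor_class_scale tensor_lift_class[OF assms(2,1)])
  qed
qed

lemma tensor_ext:
  assumes "f \<in> lin_maps k (tensor k V W) N" "g \<in> lin_maps k (tensor k V W) N"
    and "\<And>v w. v \<in> carrier V \<Longrightarrow> w \<in> carrier W \<Longrightarrow> f (pure k V W v w) = g (pure k V W v w)"
    and "t \<in> carrier (tensor k V W)"
  shows "f t = g t"
  using assms(4)
  by (induction rule: tensor_induct) (simp_all add: assms(3) lin_maps_add[OF assms(1)] lin_maps_add[OF assms(2)])

text \<open>For fixed \<open>t\<close> the lift is a finite sum of terms \<open>b u v w\<close>,
  each linear in the parameter \<open>u\<close>. This is what makes iterated lifts, such as
  rebracketings and componentwise actions, linear in their outer variables.\<close>

lemma tensor_lift_param:
  assumes N: "module k N" and U: "module k U"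
    and b: "\<And>u. u \<in> carrier U \<Longrightarrow> b u \<in> bilin_maps k V W N"
    and l: "\<And>v w. v \<in> carrier V \<Longrightarrow> w \<in> carrier W \<Longrightarrow> (\<lambda>u. b u v w) \<in> lin_maps k U N"
    and t: "t \<in> carrier (tensor k V W)"
  shows "(\<lambda>u. tensor_lift N (b u) t) \<in> lin_maps k U N"
  using t
proof (induction rule: tensor_induct)
  case (pure v w)
  show ?case
    by (rule lin_maps_cong[OF l[OF pure] U]) (simp add: tensor_lift_pure[OF b N] pure)
next
  case (add s t)
  interpret N: module k N by fact
  interpret U: module k U by fact
  note a = lin_maps_add[OF tensor_lift_lin[OF b N]] lin_maps_closed[OF tensor_lift_lin[OF b N]] add(1,2)
  show ?case
    by (rule lin_mapsI) (simp_all add: a lin_maps_add[OF add(3)] lin_maps_add[OF add(4)]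
        lin_maps_smult[OF add(3)] lin_maps_smult[OF add(4)] N.M.a_ac N.smult_r_distr)
qed

end

text \<open>Closure properties, one for each structural map: linearity of a composite and membership
  in a carrier follow from the shape of the term. They settle the hypotheses of the extensionality
  lemmas.\<close>

named_theorems lin

lemma module_base_space: "cring k \<Longrightarrow> module k (base_space k)"
proof -
  assume "cring k"
  then interpret cring k .
  show ?thesis
  proof (rule moduleI)
    show "abelian_group (base_space k)"
    proof (rule abelian_groupI)
      fix x assume "x \<in> carrier (base_space k)"
      thus "\<exists>y\<in>carrier (base_space k). y \<oplus>\<^bsub>base_space k\<^esub> x = \<zero>\<^bsub>base_space k\<^esub>"
        by (auto simp: base_space_def intro: l_neg)
    qed (simp_all add: base_space_def a_ac)
  qed (simp_all add: base_space_def cring_axioms l_distr r_distr m_assoc)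
qed

lemma base_space_simps [simp]:
  "carrier (base_space k) = carrier k" "monoid.mult (base_space k) = monoid.mult k"
  "\<one>\<^bsub>base_space k\<^esub> = \<one>\<^bsub>k\<^esub>" "\<zero>\<^bsub>base_space k\<^esub> = \<zero>\<^bsub>k\<^esub>" "add (base_space k) = add k"
  "smult (base_space k) = monoid.mult k"
  by (simp_all add: base_space_def)

lemma module_cring: "module k V \<Longrightarrow> cring k"
  by (simp add: module_def)

lemma base_of_module: "module k V \<Longrightarrow> module k (base_space k)"
  by (rule module_base_space[OF module_cring])

declare module_tensor [lin]

subsection \<open>Multilinear extensionality\<close>

text \<open>Linear maps that agree on pure tensors are equal. The tensor variable is abstracted and
  quantified so that \<open>f\<close> and \<open>g\<close> may be arbitrary terms in it, read off
  from the goal.\<close>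

lemma tensor_extI:
  assumes "module k V" "module k W"
    and "(\<lambda>t. f t) \<in> lin_maps k (tensor k V W) N" "(\<lambda>t. g t) \<in> lin_maps k (tensor k V W) N"
    and "\<And>v w. v \<in> carrier V \<Longrightarrow> w \<in> carrier W \<Longrightarrow> f (pure k V W v w) = g (pure k V W v w)"
  shows "\<forall>t\<in>carrier (tensor k V W). f t = g t"
  using tensor_ext[OF assms(1,2) assms(3)[simplified] assms(4)[simplified]] assms(5) by blast

lemma tensor_extI_right:
  assumes U: "module k U" and V: "module k V" and W: "module k W"
    and f: "(\<lambda>t. f t) \<in> lin_maps k (tensor k U (tensor k V W)) N"
    and g: "(\<lambda>t. g t) \<in> lin_maps k (tensor k U (tensor k V W)) N"
    and e: "\<And>u v w. u \<in> carrier U \<Longrightarrow> v \<in> carrier V \<Longrightarrow> w \<in> carrier W \<Longrightarrow>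
      f (pure k U (tensor k V W) u (pure k V W v w)) = g (pure k U (tensor k V W) u (pure k V W v w))"
  shows "\<forall>t\<in>carrier (tensor k U (tensor k V W)). f t = g t"
proof (rule tensor_extI[OF U module_tensor[OF V W] f g])
  fix u t assume u: "u \<in> carrier U" and t: "t \<in> carrier (tensor k V W)"
  have *: "(\<lambda>t. pure k U (tensor k V W) u t) \<in> lin_maps k (tensor k V W) (tensor k U (tensor k V W))"
    by (rule bilin_maps_right[OF pure_bilin[OF U module_tensor[OF V W]] u])
  have "\<forall>t\<in>carrier (tensor k V W). f (pure k U (tensor k V W) u t) = g (pure k U (tensor k V W) u t)"
    by (rule tensor_extI[OF V W lin_maps_comp[OF f *] lin_maps_comp[OF g *]]) (rule e[OF u])
  thus "f (pure k U (tensor k V W) u t) = g (pure k U (tensor k V W) u t)" using t by blast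
qed

lemma tensor_extI_left:
  assumes U: "module k U" and V: "module k V" and W: "module k W"
    and f: "(\<lambda>t. f t) \<in> lin_maps k (tensor k (tensor k U V) W) N"
    and g: "(\<lambda>t. g t) \<in> lin_maps k (tensor k (tensor k U V) W) N"
    and e: "\<And>u v w. u \<in> carrier U \<Longrightarrow> v \<in> carrier V \<Longrightarrow> w \<in> carrier W \<Longrightarrow>
      f (pure k (tensor k U V) W (pure k U V u v) w) = g (pure k (tensor k U V) W (pure k U V u v) w)"
  shows "\<forall>t\<in>carrier (tensor k (tensor k U V) W). f t = g t"
proof (rule tensor_extI[OF module_tensor[OF U V] W f g])
  fix t w assume w: "w \<in> carrier W" and t: "t \<in> carrier (tensor k U V)"
  have *: "(\<lambda>t. pure k (tensor k U V) W t w) \<in> lin_maps k (tensor k U V) (tensor k (tensor k U V) W)"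
    by (rule bilin_maps_left[OF pure_bilin[OF module_tensor[OF U V] W] w])
  have "\<forall>t\<in>carrier (tensor k U V). f (pure k (tensor k U V) W t w) = g (pure k (tensor k U V) W t w)"
    by (rule tensor_extI[OF U V lin_maps_comp[OF f *] lin_maps_comp[OF g *]]) (rule e[OF _ _ w])
  thus "f (pure k (tensor k U V) W t w) = g (pure k (tensor k U V) W t w)" using t by blast
qed

subsection \<open>Linearity of the structural maps\<close>

lemma tensor_lift_param':
  assumes "t \<in> carrier (tensor k V W)"
    and "\<And>u. u \<in> carrier U \<Longrightarrow> b u \<in> bilin_maps k V W N"
    and "\<And>v w. v \<in> carrier V \<Longrightarrow> w \<in> carrier W \<Longrightarrow> (\<lambda>u. b u v w) \<in> lin_maps k U N"
    and "module k N" "module k U" "module k V" "module k W"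
  shows "(\<lambda>u. tensor_lift N (b u) t) \<in> lin_maps k U N"
  using assms by (intro tensor_lift_param)

lemma pure_lin_left [lin]:
  assumes "module k V" "module k W" "w \<in> carrier W" "F \<in> lin_maps k U V"
  shows "(\<lambda>x. pure k V W (F x) w) \<in> lin_maps k U (tensor k V W)"
  using bilin_maps_comp_left[OF pure_bilin[OF assms(1,2)] assms(4,3)] .

lemma pure_lin_right [lin]:
  assumes "module k V" "module k W" "v \<in> carrier V" "F \<in> lin_maps k U W"
  shows "(\<lambda>x. pure k V W v (F x)) \<in> lin_maps k U (tensor k V W)"
  using bilin_maps_comp_right[OF pure_bilin[OF assms(1,2)] assms(4,3)] .

declare lin_maps_ident [lin] lin_maps_id [lin] pure_closed [lin]

lemma tensor_map_bilin:
  assumes "module k V'" "module k W'" "f \<in> lin_maps k V V'" "g \<in> lin_maps k W W'"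
  shows "(\<lambda>v w. pure k V' W' (f v) (g w)) \<in> bilin_maps k V W (tensor k V' W')"
  by (rule bilin_mapsI pure_lin_left pure_lin_right lin_maps_closed[OF assms(3)] lin_maps_closed[OF assms(4)]
      assms | assumption)+

lemma tensor_map_lin:
  assumes "f \<in> lin_maps k V V'" "g \<in> lin_maps k W W'"
    and "module k V" "module k W" "module k V'" "module k W'"
  shows "tensor_map k V' W' f g \<in> lin_maps k (tensor k V W) (tensor k V' W')"
  unfolding tensor_map_def using assms by (intro tensor_lift_lin tensor_map_bilin module_tensor)

lemma tensor_map_pure:
  assumes "f \<in> lin_maps k V V'" "g \<in> lin_maps k W W'" "v \<in> carrier V" "w \<in> carrier W"
    and "module k V" "module k W" "module k V'" "module k W'"
  shows "tensor_map k V' W' f g (pure k V W v w) = pure k V' W' (f v) (g w)"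
  unfolding tensor_map_def using assms by (intro tensor_lift_pure tensor_map_bilin module_tensor)

lemma tensor_map_closed:
  assumes "t \<in> carrier (tensor k V W)" "f \<in> lin_maps k V V'" "g \<in> lin_maps k W W'"
    and "module k V" "module k W" "module k V'" "module k W'"
  shows "tensor_map k V' W' f g t \<in> carrier (tensor k V' W')"
  using lin_maps_closed[OF tensor_map_lin[OF assms(2-)] assms(1)] .

lemma tensor_map_comp_lin:
  assumes "F \<in> lin_maps k U (tensor k V W)" "f \<in> lin_maps k V V'" "g \<in> lin_maps k W W'"
    and "module k V" "module k W" "module k V'" "module k W'"
  shows "(\<lambda>x. tensor_map k V' W' f g (F x)) \<in> lin_maps k U (tensor k V' W')"
  by (rule lin_maps_comp[OF tensor_map_lin[OF assms(2-)] assms(1)])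

declare tensor_map_closed [lin] tensor_map_comp_lin [lin]

lemma tensor_map_comp:
  assumes "f \<in> lin_maps k V V'" "g \<in> lin_maps k W W'" "f' \<in> lin_maps k V' V''" "g' \<in> lin_maps k W' W''"
    and [lin]: "module k V" "module k W" "module k V'" "module k W'" "module k V''" "module k W''"
    and t: "t \<in> carrier (tensor k V W)"
  shows "tensor_map k V'' W'' f' g' (tensor_map k V' W' f g t)
    = tensor_map k V'' W'' (\<lambda>x. f' (f x)) (\<lambda>x. g' (g x)) t"
proof -
  have c: "(\<lambda>x. f' (f x)) \<in> lin_maps k V V''" "(\<lambda>x. g' (g x)) \<in> lin_maps k W W''"
    using assms by (auto intro: lin_maps_comp)
  have "\<forall>t\<in>carrier (tensor k V W). tensor_map k V'' W'' f' g' (tensor_map k V' W' f g t)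
    = tensor_map k V'' W'' (\<lambda>x. f' (f x)) (\<lambda>x. g' (g x)) t"
    apply (rule tensor_extI)
    apply (assumption | rule lin assms c)+
    using assms c by (simp add: tensor_map_pure lin_maps_closed)
  thus ?thesis using t by blast
qed

lemma tensor_map_ident:
  assumes [lin]: "module k V" "module k W" and t: "t \<in> carrier (tensor k V W)"
  shows "tensor_map k V W (\<lambda>x. x) (\<lambda>x. x) t = t"
proof -
  have "\<forall>t\<in>carrier (tensor k V W). tensor_map k V W (\<lambda>x. x) (\<lambda>x. x) t = t"
    apply (rule tensor_extI)
    apply (assumption | rule lin)+
    using assms by (simp add: tensor_map_pure lin_maps_ident)
  thus ?thesis using t by blast
qed

lemma tensor_map_cong:
  assumes "f \<in> lin_maps k V V'" "g \<in> lin_maps k W W'"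
    and [lin]: "module k V" "module k W" "module k V'" "module k W'"
    and t: "t \<in> carrier (tensor k V W)"
    and e: "\<And>v. v \<in> carrier V \<Longrightarrow> f v = f' v" "\<And>w. w \<in> carrier W \<Longrightarrow> g w = g' w"
  shows "tensor_map k V' W' f g t = tensor_map k V' W' f' g' t"
proof -
  have l: "f' \<in> lin_maps k V V'" "g' \<in> lin_maps k W W'"
    using lin_maps_cong assms by blast+
  have "\<forall>t\<in>carrier (tensor k V W). tensor_map k V' W' f g t = tensor_map k V' W' f' g' t"
    apply (rule tensor_extI)
    apply (assumption | rule lin assms(1,2) l)+
    using assms l by (simp add: tensor_map_pure)
  thus ?thesis using t by blast
qed

context
  fixes k :: "'k ring" and U :: "('k, 'u, 'd) module_scheme" and V :: "('k, 'v, 'e) module_scheme"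
    and W :: "('k, 'w, 'f) module_scheme"
  assumes m: "module k U" "module k V" "module k W"
begin

private lemma rebr_inner: "w \<in> carrier W \<Longrightarrow>
    (\<lambda>u v. pure k U (tensor k V W) u (pure k V W v w)) \<in> bilin_maps k U V (tensor k U (tensor k V W))"
  by (rule bilin_mapsI; (assumption | rule m lin)+)

private lemma rebr_bilin: "(\<lambda>t w. tensor_lift (tensor k U (tensor k V W))
       (\<lambda>u v. pure k U (tensor k V W) u (pure k V W v w)) t)
    \<in> bilin_maps k (tensor k U V) W (tensor k U (tensor k V W))"
  by (rule bilin_mapsI tensor_lift_param' tensor_lift_lin rebr_inner m lin | assumption)+

private lemma rebr_inv_inner: "u \<in> carrier U \<Longrightarrow>
    (\<lambda>v w. pure k (tensor k U V) W (pure k U V u v) w) \<in> bilin_maps k V W (tensor k (tensor k U V) W)"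
  by (rule bilin_mapsI; (assumption | rule m lin)+)

private lemma rebr_inv_bilin: "(\<lambda>u t. tensor_lift (tensor k (tensor k U V) W)
       (\<lambda>v w. pure k (tensor k U V) W (pure k U V u v) w) t)
    \<in> bilin_maps k U (tensor k V W) (tensor k (tensor k U V) W)"
  by (rule bilin_mapsI tensor_lift_param' tensor_lift_lin rebr_inv_inner m lin | assumption)+

lemma rebr_lin: "rebr k U V W \<in> lin_maps k (tensor k (tensor k U V) W) (tensor k U (tensor k V W))"
  unfolding rebr_def by (rule tensor_lift_lin rebr_bilin m lin)+

lemma rebr_pure:
  "u \<in> carrier U \<Longrightarrow> v \<in> carrier V \<Longrightarrow> w \<in> carrier W \<Longrightarrow>
    rebr k U V W (pure k (tensor k U V) W (pure k U V u v) w) = pure k U (tensor k V W) u (pure k V W v w)"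
  unfolding rebr_def
  by (subst tensor_lift_pure[OF _ _ rebr_bilin], (assumption | rule m lin)+)
    (rule tensor_lift_pure[OF _ _ rebr_inner], (assumption | rule m lin)+)

lemma rebr_inv_lin:
  "rebr_inv k U V W \<in> lin_maps k (tensor k U (tensor k V W)) (tensor k (tensor k U V) W)"
  unfolding rebr_inv_def by (rule tensor_lift_lin rebr_inv_bilin m lin)+

lemma rebr_inv_pure:
  "u \<in> carrier U \<Longrightarrow> v \<in> carrier V \<Longrightarrow> w \<in> carrier W \<Longrightarrow>
    rebr_inv k U V W (pure k U (tensor k V W) u (pure k V W v w)) = pure k (tensor k U V) W (pure k U V u v) w"
  unfolding rebr_inv_def
  by (subst tensor_lift_pure[OF _ _ rebr_inv_bilin], (assumption | rule m lin)+)
    (rule tensor_lift_pure[OF _ _ rebr_inv_inner], (assumption | rule m lin)+)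

lemma rebr_rebr_inv:
  assumes "t \<in> carrier (tensor k U (tensor k V W))"
  shows "rebr k U V W (rebr_inv k U V W t) = t"
proof -
  have "\<forall>t\<in>carrier (tensor k U (tensor k V W)). rebr k U V W (rebr_inv k U V W t) = t"
    by (rule tensor_extI_right; ((assumption | rule m lin lin_maps_comp[OF rebr_lin] rebr_inv_lin)+)?)
      (simp add: rebr_inv_pure rebr_pure)
  thus ?thesis using assms by blast
qed

lemma rebr_inv_rebr:
  assumes "t \<in> carrier (tensor k (tensor k U V) W)"
  shows "rebr_inv k U V W (rebr k U V W t) = t"
proof -
  have "\<forall>t\<in>carrier (tensor k (tensor k U V) W). rebr_inv k U V W (rebr k U V W t) = t"
    by (rule tensor_extI_left; ((assumption | rule m lin lin_maps_comp[OF rebr_inv_lin] rebr_lin)+)?)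
      (simp add: rebr_inv_pure rebr_pure)
  thus ?thesis using assms by blast
qed

lemma rebr_comp_lin [lin]:
  "F \<in> lin_maps k N (tensor k (tensor k U V) W) \<Longrightarrow> (\<lambda>x. rebr k U V W (F x)) \<in> lin_maps k N (tensor k U (tensor k V W))"
  by (rule m lin_maps_comp[OF rebr_lin])

lemma rebr_closed [lin]:
  "t \<in> carrier (tensor k (tensor k U V) W) \<Longrightarrow> rebr k U V W t \<in> carrier (tensor k U (tensor k V W))"
  by (rule m lin_maps_closed[OF rebr_lin])

lemma rebr_inv_comp_lin [lin]:
  "F \<in> lin_maps k N (tensor k U (tensor k V W)) \<Longrightarrow> (\<lambda>x. rebr_inv k U V W (F x)) \<in> lin_maps k N (tensor k (tensor k U V) W)"
  by (rule m lin_maps_comp[OF rebr_inv_lin])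

lemma rebr_inv_closed [lin]:
  "t \<in> carrier (tensor k U (tensor k V W)) \<Longrightarrow> rebr_inv k U V W t \<in> carrier (tensor k (tensor k U V) W)"
  by (rule m lin_maps_closed[OF rebr_inv_lin])

end

lemma smult_bilin:
  assumes "module k V"
  shows "smult V \<in> bilin_maps k (base_space k) V V"
proof -
  interpret module k V by fact
  show ?thesis
  proof (rule bilin_mapsI; rule lin_mapsI)
    fix a b v assume "a \<in> carrier (base_space k)" "b \<in> carrier k" "v \<in> carrier V"
    thus "a \<odot>\<^bsub>V\<^esub> (b \<odot>\<^bsub>V\<^esub> v) = b \<odot>\<^bsub>V\<^esub> (a \<odot>\<^bsub>V\<^esub> v)"
      by (simp add: smult_assoc1[symmetric] R.m_comm)
  qed (simp_all add: smult_r_distr smult_l_distr smult_assoc1)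
qed

lemma smult_bilin':
  assumes "module k V"
  shows "(\<lambda>v c. c \<odot>\<^bsub>V\<^esub> v) \<in> bilin_maps k V (base_space k) V"
  using smult_bilin[OF assms] by (auto simp: bilin_maps_def)

context
  fixes k :: "'k ring" and V :: "('k, 'v, 'e) module_scheme"
  assumes V: "module k V"
begin

lemma lunit_lin: "lunit V \<in> lin_maps k (tensor k (base_space k) V) V"
  unfolding lunit_def by (rule tensor_lift_lin smult_bilin base_of_module[OF V] V)+

lemma runit_lin: "runit V \<in> lin_maps k (tensor k V (base_space k)) V"
  unfolding runit_def by (rule tensor_lift_lin smult_bilin' base_of_module[OF V] V)+

lemma lunit_pure:
  "c \<in> carrier k \<Longrightarrow> v \<in> carrier V \<Longrightarrow> lunit V (pure k (base_space k) V c v) = c \<odot>\<^bsub>V\<^esub> v"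
  unfolding lunit_def
  using tensor_lift_pure[OF base_of_module[OF V] V smult_bilin[OF V] V] by simp

lemma runit_pure:
  "c \<in> carrier k \<Longrightarrow> v \<in> carrier V \<Longrightarrow> runit V (pure k V (base_space k) v c) = c \<odot>\<^bsub>V\<^esub> v"
  unfolding runit_def
  using tensor_lift_pure[OF V base_of_module[OF V] smult_bilin'[OF V] V] by simp

end

lemma lunit_comp_lin [lin]:
  "F \<in> lin_maps k U (tensor k (base_space k) V) \<Longrightarrow> module k V \<Longrightarrow> (\<lambda>x. lunit V (F x)) \<in> lin_maps k U V"
  by (rule lin_maps_comp[OF lunit_lin])

lemma runit_comp_lin [lin]:
  "F \<in> lin_maps k U (tensor k V (base_space k)) \<Longrightarrow> module k V \<Longrightarrow> (\<lambda>x. runit V (F x)) \<in> lin_maps k U V"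
  by (rule lin_maps_comp[OF runit_lin])

lemma lunit_closed [lin]:
  "t \<in> carrier (tensor k (base_space k) V) \<Longrightarrow> module k V \<Longrightarrow> lunit V t \<in> carrier V"
  by (rule lin_maps_closed[OF lunit_lin])

lemma runit_closed [lin]:
  "t \<in> carrier (tensor k V (base_space k)) \<Longrightarrow> module k V \<Longrightarrow> runit V t \<in> carrier V"
  by (rule lin_maps_closed[OF runit_lin])

subsection \<open>Componentwise actions\<close>

text \<open>\<open>tensor_act\<close> is a lift in the acting element of a map that is itself a lift
  in the element acted on. For fixed \<open>t\<close> the inner lift depends linearly on
  \<open>x\<close> and on \<open>y\<close>, by \<open>tensor_lift_param\<close>.\<close>

lemma tensor_act_inner:
  assumes a: "a \<in> bilin_maps k X V V" and b: "b \<in> bilin_maps k Y W W"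
    and m: "module k X" "module k Y" "module k V" "module k W"
    and t: "t \<in> carrier (tensor k V W)"
  shows "(\<lambda>x y. tensor_map k V W (a x) (b y) t) \<in> bilin_maps k X Y (tensor k V W)"
proof (rule bilin_mapsI)
  fix x assume x: "x \<in> carrier X"
  show "(\<lambda>y. tensor_map k V W (a x) (b y) t) \<in> lin_maps k Y (tensor k V W)"
    unfolding tensor_map_def
  proof (rule tensor_lift_param'[OF t])
    fix y assume y: "y \<in> carrier Y"
    show "(\<lambda>v w. pure k V W (a x v) (b y w)) \<in> bilin_maps k V W (tensor k V W)"
      by (intro tensor_map_bilin m bilin_maps_right[OF a] bilin_maps_right[OF b] x y)
  next
    fix v w assume "v \<in> carrier V" "w \<in> carrier W"
    thus "(\<lambda>y. pure k V W (a x v) (b y w)) \<in> lin_maps k Y (tensor k V W)"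
      by (intro pure_lin_right m bilin_maps_closed[OF a] bilin_maps_left[OF b] x)
  qed (rule m module_tensor)+
next
  fix y assume y: "y \<in> carrier Y"
  show "(\<lambda>x. tensor_map k V W (a x) (b y) t) \<in> lin_maps k X (tensor k V W)"
    unfolding tensor_map_def
  proof (rule tensor_lift_param'[OF t])
    fix x assume x: "x \<in> carrier X"
    show "(\<lambda>v w. pure k V W (a x v) (b y w)) \<in> bilin_maps k V W (tensor k V W)"
      by (intro tensor_map_bilin m bilin_maps_right[OF a] bilin_maps_right[OF b] x y)
  next
    fix v w assume "v \<in> carrier V" "w \<in> carrier W"
    thus "(\<lambda>x. pure k V W (a x v) (b y w)) \<in> lin_maps k X (tensor k V W)"
      by (intro pure_lin_left m bilin_maps_closed[OF b] bilin_maps_left[OF a] y)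
  qed (rule m module_tensor)+
qed

context
  fixes k :: "'k ring" and X :: "('k, 'x, 'd) module_scheme" and Y :: "('k, 'y, 'e) module_scheme"
    and V :: "('k, 'v, 'f) module_scheme" and W :: "('k, 'w, 'g) module_scheme"
    and a b
  assumes a: "a \<in> bilin_maps k X V V" and b: "b \<in> bilin_maps k Y W W"
    and m: "module k X" "module k Y" "module k V" "module k W"
begin

lemma tensor_act_bilin:
  "tensor_act k V W a b \<in> bilin_maps k (tensor k X Y) (tensor k V W) (tensor k V W)"
proof (rule bilin_mapsI)
  fix s assume s: "s \<in> carrier (tensor k X Y)"
  have *: "(\<lambda>t. tensor_lift (tensor k V W) (\<lambda>x y. tensor_map k V W (a x) (b y) t) s)
      \<in> lin_maps k (tensor k V W) (tensor k V W)"
    by (rule tensor_lift_param'[OF s tensor_act_inner[OF a b m]])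
      (assumption | rule m module_tensor tensor_map_lin bilin_maps_right[OF a] bilin_maps_right[OF b])+
  show "tensor_act k V W a b s \<in> lin_maps k (tensor k V W) (tensor k V W)"
    using * unfolding tensor_act_def[abs_def] .
next
  fix t assume t: "t \<in> carrier (tensor k V W)"
  show "(\<lambda>s. tensor_act k V W a b s t) \<in> lin_maps k (tensor k X Y) (tensor k V W)"
    unfolding tensor_act_def by (rule tensor_lift_lin tensor_act_inner[OF a b m t] m module_tensor)+
qed

lemma tensor_act_pure_left:
  assumes "x \<in> carrier X" "y \<in> carrier Y" and t: "t \<in> carrier (tensor k V W)"
  shows "tensor_act k V W a b (pure k X Y x y) t = tensor_map k V W (a x) (b y) t"
  unfolding tensor_act_def by (rule tensor_lift_pure[OF _ _ tensor_act_inner[OF a b m t]] m module_tensor assms)+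

lemma tensor_act_pure:
  assumes "x \<in> carrier X" "y \<in> carrier Y" "v \<in> carrier V" "w \<in> carrier W"
  shows "tensor_act k V W a b (pure k X Y x y) (pure k V W v w) = pure k V W (a x v) (b y w)"
  using tensor_map_pure[OF bilin_maps_right[OF a assms(1)] bilin_maps_right[OF b assms(2)] assms(3,4)] m
    tensor_act_pure_left[OF assms(1,2) pure_closed] assms
  by simp

end

context
  fixes k :: "'k ring" and X :: "('k, 'x, 'd) module_scheme" and Y :: "('k, 'y, 'e) module_scheme"
    and V :: "('k, 'v, 'f) module_scheme" and W :: "('k, 'w, 'g) module_scheme"
    and a :: "'x \<Rightarrow> 'v \<Rightarrow> 'v" and b :: "'y \<Rightarrow> 'w \<Rightarrow> 'w"
begin

lemma tensor_act_lin_left [lin]: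
  assumes F: "F \<in> lin_maps k N (tensor k X Y)" and t: "t \<in> carrier (tensor k V W)"
    and ab: "a \<in> bilin_maps k X V V" "b \<in> bilin_maps k Y W W"
    and m: "module k X" "module k Y" "module k V" "module k W"
  shows "(\<lambda>u. tensor_act k V W a b (F u) t) \<in> lin_maps k N (tensor k V W)"
  by (rule bilin_maps_comp_left[OF tensor_act_bilin[OF ab m] F t])

lemma tensor_act_lin_right [lin]:
  assumes F: "F \<in> lin_maps k N (tensor k V W)" and s: "s \<in> carrier (tensor k X Y)"
    and ab: "a \<in> bilin_maps k X V V" "b \<in> bilin_maps k Y W W"
    and m: "module k X" "module k Y" "module k V" "module k W"
  shows "(\<lambda>u. tensor_act k V W a b s (F u)) \<in> lin_maps k N (tensor k V W)"
  by (rule bilin_maps_comp_right[OF tensor_act_bilin[OF ab m] F s])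

lemma tensor_act_closed [lin]:
  assumes s: "s \<in> carrier (tensor k X Y)" and t: "t \<in> carrier (tensor k V W)"
    and ab: "a \<in> bilin_maps k X V V" "b \<in> bilin_maps k Y W W"
    and m: "module k X" "module k Y" "module k V" "module k W"
  shows "tensor_act k V W a b s t \<in> carrier (tensor k V W)"
  by (rule bilin_maps_closed[OF tensor_act_bilin[OF ab m] s t])

end

text \<open>A pair of maps that intertwines the actions in each factor intertwines the componentwise
  actions. Taking multiplications as actions gives multiplicativity of f \<otimes> g; taking
  \<Delta> of \<open>C\<close> as one of the maps moves a comultiplication past a right
  action.\<close>

lemma tensor_act_natural:
  assumes ab: "a \<in> bilin_maps k X V V" "b \<in> bilin_maps k Y W W"
    and ab': "a' \<in> bilin_maps k X' V' V'" "b' \<in> bilin_maps k Y' W' W'"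
    and [lin]: "module k X" "module k Y" "module k V" "module k W"
      "module k X'" "module k Y'" "module k V'" "module k W'"
    and p: "p \<in> lin_maps k X X'" "q \<in> lin_maps k Y Y'" and f: "f \<in> lin_maps k V V'" "g \<in> lin_maps k W W'"
    and e: "\<And>x v. x \<in> carrier X \<Longrightarrow> v \<in> carrier V \<Longrightarrow> f (a x v) = a' (p x) (f v)"
      "\<And>y w. y \<in> carrier Y \<Longrightarrow> w \<in> carrier W \<Longrightarrow> g (b y w) = b' (q y) (g w)"
    and s: "s \<in> carrier (tensor k X Y)" and t: "t \<in> carrier (tensor k V W)"
  shows "tensor_map k V' W' f g (tensor_act k V W a b s t)
    = tensor_act k V' W' a' b' (tensor_map k X' Y' p q s) (tensor_map k V' W' f g t)"
proof -
  note [lin] = ab ab' p f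
  note [simp] = bilin_maps_closed[OF ab(1)] bilin_maps_closed[OF ab(2)]
    lin_maps_closed[OF p(1)] lin_maps_closed[OF p(2)] lin_maps_closed[OF f(1)] lin_maps_closed[OF f(2)]
  have "\<forall>s\<in>carrier (tensor k X Y). tensor_map k V' W' f g (tensor_act k V W a b s t)
    = tensor_act k V' W' a' b' (tensor_map k X' Y' p q s) (tensor_map k V' W' f g t)"
  proof (rule tensor_extI)
    fix x y assume xy: "x \<in> carrier X" "y \<in> carrier Y"
    have "\<forall>t\<in>carrier (tensor k V W). tensor_map k V' W' f g (tensor_act k V W a b (pure k X Y x y) t)
      = tensor_act k V' W' a' b' (tensor_map k X' Y' p q (pure k X Y x y)) (tensor_map k V' W' f g t)"
    proof (rule tensor_extI)
      fix v w assume "v \<in> carrier V" "w \<in> carrier W"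
      thus "tensor_map k V' W' f g (tensor_act k V W a b (pure k X Y x y) (pure k V W v w))
        = tensor_act k V' W' a' b' (tensor_map k X' Y' p q (pure k X Y x y)) (tensor_map k V' W' f g (pure k V W v w))"
        using assms xy
        by (simp add: tensor_act_pure[OF ab] tensor_act_pure[OF ab'] tensor_map_pure[OF p] tensor_map_pure[OF f])
    qed (assumption | rule lin xy)+
    thus "tensor_map k V' W' f g (tensor_act k V W a b (pure k X Y x y) t)
      = tensor_act k V' W' a' b' (tensor_map k X' Y' p q (pure k X Y x y)) (tensor_map k V' W' f g t)"
      using t by blast
  qed (assumption | rule lin t)+
  thus ?thesis using s by blast
qed

text \<open>Naturality again, but with \<open>rebr\<close> as intertwiner, which is not a tensor
  product of maps; hence a separate check on pure tensors in both arguments.\<close>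

lemma tensor_act_rebr:
  assumes abc: "a \<in> bilin_maps k X U U" "b \<in> bilin_maps k Y V V" "c \<in> bilin_maps k Z W W"
    and m [lin]: "module k X" "module k Y" "module k Z" "module k U" "module k V" "module k W"
    and s: "s \<in> carrier (tensor k (tensor k X Y) Z)" and t: "t \<in> carrier (tensor k (tensor k U V) W)"
  shows "rebr k U V W (tensor_act k (tensor k U V) W (tensor_act k U V a b) c s t)
    = tensor_act k U (tensor k V W) a (tensor_act k V W b c) (rebr k X Y Z s) (rebr k U V W t)"
proof -
  note [lin] = abc tensor_act_bilin
  note [simp] = bilin_maps_closed[OF abc(1)] bilin_maps_closed[OF abc(2)] bilin_maps_closed[OF abc(3)]
    tensor_act_bilin abc m module_tensor pure_closed
  have "\<forall>s\<in>carrier (tensor k (tensor k X Y) Z).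
    rebr k U V W (tensor_act k (tensor k U V) W (tensor_act k U V a b) c s t)
    = tensor_act k U (tensor k V W) a (tensor_act k V W b c) (rebr k X Y Z s) (rebr k U V W t)"
  proof (rule tensor_extI_left)
    fix x y z assume xyz: "x \<in> carrier X" "y \<in> carrier Y" "z \<in> carrier Z"
    let ?s = "pure k (tensor k X Y) Z (pure k X Y x y) z"
    have "\<forall>t\<in>carrier (tensor k (tensor k U V) W).
      rebr k U V W (tensor_act k (tensor k U V) W (tensor_act k U V a b) c ?s t)
      = tensor_act k U (tensor k V W) a (tensor_act k V W b c) (rebr k X Y Z ?s) (rebr k U V W t)"
    proof (rule tensor_extI_left)
      fix u v w assume uvw: "u \<in> carrier U" "v \<in> carrier V" "w \<in> carrier W"
      let ?t = "pure k (tensor k U V) W (pure k U V u v) w"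
      show "rebr k U V W (tensor_act k (tensor k U V) W (tensor_act k U V a b) c ?s ?t)
        = tensor_act k U (tensor k V W) a (tensor_act k V W b c) (rebr k X Y Z ?s) (rebr k U V W ?t)"
        using xyz uvw
        by (simp add: rebr_pure tensor_act_pure[of _ k X] tensor_act_pure[of _ k Y]
            tensor_act_pure[of _ k "tensor k X Y"])
    qed (assumption | rule lin xyz)+
    thus "rebr k U V W (tensor_act k (tensor k U V) W (tensor_act k U V a b) c ?s t)
      = tensor_act k U (tensor k V W) a (tensor_act k V W b c) (rebr k X Y Z ?s) (rebr k U V W t)"
      using t by blast
  qed (assumption | rule lin t)+
  thus ?thesis using s by blast
qed

text \<open>For a pure acting element the first action is a tensor product of two linear maps, and
  these intertwine the second action with itself: naturality along identity maps of the acting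
  algebras.\<close>

lemma tensor_act_commute:
  assumes ab: "a \<in> bilin_maps k X V V" "b \<in> bilin_maps k Y W W"
    and ab': "a' \<in> bilin_maps k X' V V" "b' \<in> bilin_maps k Y' W W"
    and m: "module k X" "module k Y" "module k V" "module k W" "module k X'" "module k Y'"
    and e: "\<And>x x' v. x \<in> carrier X \<Longrightarrow> x' \<in> carrier X' \<Longrightarrow> v \<in> carrier V \<Longrightarrow> a x (a' x' v) = a' x' (a x v)"
      "\<And>y y' w. y \<in> carrier Y \<Longrightarrow> y' \<in> carrier Y' \<Longrightarrow> w \<in> carrier W \<Longrightarrow> b y (b' y' w) = b' y' (b y w)"
    and s: "s \<in> carrier (tensor k X Y)" and s': "s' \<in> carrier (tensor k X' Y')" and t: "t \<in> carrier (tensor k V W)"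
  shows "tensor_act k V W a b s (tensor_act k V W a' b' s' t) = tensor_act k V W a' b' s' (tensor_act k V W a b s t)"
proof -
  note [lin] = ab ab' m
  have "\<forall>s\<in>carrier (tensor k X Y). tensor_act k V W a b s (tensor_act k V W a' b' s' t)
      = tensor_act k V W a' b' s' (tensor_act k V W a b s t)"
  proof (rule tensor_extI)
    fix x y assume xy: "x \<in> carrier X" "y \<in> carrier Y"
    note l = bilin_maps_right[OF ab(1) xy(1)] bilin_maps_right[OF ab(2) xy(2)]
    have "tensor_map k V W (a x) (b y) (tensor_act k V W a' b' s' t)
        = tensor_act k V W a' b' (tensor_map k X' Y' (\<lambda>x. x) (\<lambda>x. x) s') (tensor_map k V W (a x) (b y) t)"
      by (rule tensor_act_natural[OF ab' ab']) (assumption | rule lin l s' t e xy)+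
    moreover have "tensor_map k X' Y' (\<lambda>x. x) (\<lambda>x. x) s' = s'" by (rule tensor_map_ident m s')+
    moreover have "tensor_act k V W a' b' s' t \<in> carrier (tensor k V W)"
      by (rule lin s' t)+
    ultimately show "tensor_act k V W a b (pure k X Y x y) (tensor_act k V W a' b' s' t)
        = tensor_act k V W a' b' s' (tensor_act k V W a b (pure k X Y x y) t)"
      by (simp add: tensor_act_pure_left[OF ab] m xy t)
  qed (assumption | rule lin s' t)+
  thus ?thesis using s by blast
qed

section \<open>Tensor products of algebras\<close>

lemma tensor_class_sum:
  assumes "module k V" "module k W" "formal V W xs"
  shows "tensor_class k V W xs = formal_sum (tensor k V W) (pure k V W) xs"
  using assms(3)
proof (induction xs)
  case (Cons x xs)
  thus ?case using assms by (cases x) (simp add: tensor_class_Cons)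
qed (simp add: tensor_zero[OF assms(1,2)])

lemma formal_concat:
  "formal V W xs \<Longrightarrow> formal V W ys \<Longrightarrow> (\<And>v v'. v \<in> carrier V \<Longrightarrow> v' \<in> carrier V \<Longrightarrow> v \<otimes>\<^bsub>V\<^esub> v' \<in> carrier V)
    \<Longrightarrow> (\<And>w w'. w \<in> carrier W \<Longrightarrow> w' \<in> carrier W \<Longrightarrow> w \<otimes>\<^bsub>W\<^esub> w' \<in> carrier W)
    \<Longrightarrow> formal V W [(v \<otimes>\<^bsub>V\<^esub> v', w \<otimes>\<^bsub>W\<^esub> w'). (v, w) \<leftarrow> xs, (v', w') \<leftarrow> ys]"
  by auto blast+

text \<open>Both sides are the same double sum over the chosen representatives. The product of a
  tensor product of algebras, defined by a list comprehension, thereby inherits bilinearity from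
  \<open>tensor_act\<close>.\<close>

lemma tensor_mult:
  assumes [lin]: "module k V" "module k W"
    and mult: "monoid.mult V \<in> bilin_maps k V V V" "monoid.mult W \<in> bilin_maps k W W W"
    and s: "s \<in> carrier (tensor k V W)" and t: "t \<in> carrier (tensor k V W)"
  shows "s \<otimes>\<^bsub>tensor k V W\<^esub> t = tensor_act k V W (monoid.mult V) (monoid.mult W) s t"
proof -
  let ?T = "tensor k V W"
  let ?p = "\<lambda>v w. pure k V W v w"
  note cl = bilin_maps_closed[OF mult(1)] bilin_maps_closed[OF mult(2)]
  have xs: "formal V W (rep s)" and ys: "formal V W (rep t)"
    using tensor_rep assms by blast+
  have pb: "pure k V W \<in> bilin_maps k V W ?T" by (intro pure_bilin assms)
  have f: "formal V W [(v \<otimes>\<^bsub>V\<^esub> v', w \<otimes>\<^bsub>W\<^esub> w'). (v, w) \<leftarrow> xs, (v', w') \<leftarrow> ys]"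
    if "formal V W xs" "formal V W ys" for xs ys
    by (rule formal_concat[OF that]) (rule cl; assumption)+
  have inner: "formal_sum ?T (pure k V W) (map (\<lambda>(v', w'). (v \<otimes>\<^bsub>V\<^esub> v', w \<otimes>\<^bsub>W\<^esub> w')) ys)
      = formal_sum ?T (\<lambda>v' w'. pure k V W (v \<otimes>\<^bsub>V\<^esub> v') (w \<otimes>\<^bsub>W\<^esub> w')) ys" for v w ys
    by (induction ys) auto
  have outer: "formal_sum ?T (pure k V W) [(v \<otimes>\<^bsub>V\<^esub> v', w \<otimes>\<^bsub>W\<^esub> w'). (v, w) \<leftarrow> xs, (v', w') \<leftarrow> ys]
      = formal_sum ?T (\<lambda>v w. formal_sum ?T (\<lambda>v' w'. pure k V W (v \<otimes>\<^bsub>V\<^esub> v') (w \<otimes>\<^bsub>W\<^esub> w')) ys) xs"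
    if "formal V W xs" "formal V W ys" for xs ys
    using that(1)
  proof (induction xs)
    case (Cons x xs)
    obtain v w where x: "x = (v, w)" by (cases x)
    have 1: "formal V W (map (\<lambda>(v', w'). (v \<otimes>\<^bsub>V\<^esub> v', w \<otimes>\<^bsub>W\<^esub> w')) ys)"
      using Cons x that(2) cl by auto
    have 2: "formal V W [(v \<otimes>\<^bsub>V\<^esub> v', w \<otimes>\<^bsub>W\<^esub> w'). (v, w) \<leftarrow> xs, (v', w') \<leftarrow> ys]"
      by (rule f) (use Cons that in auto)
    show ?case using Cons x formal_sum_append[OF module_tensor[OF assms(1,2)] pb 1 2]
      by (simp add: inner)
  qed simp
  have "s \<otimes>\<^bsub>?T\<^esub> t = tensor_class k V W [(v \<otimes>\<^bsub>V\<^esub> v', w \<otimes>\<^bsub>W\<^esub> w'). (v, w) \<leftarrow> rep s, (v', w') \<leftarrow> rep t]"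
    by (simp add: tensor_def)
  also have "\<dots> = tensor_act k V W (monoid.mult V) (monoid.mult W) s t"
    unfolding tensor_class_sum[OF assms(1,2) f[OF xs ys]] outer[OF xs ys]
    by (simp add: tensor_act_def tensor_map_def tensor_lift_def formal_sum_def)
  finally show ?thesis .
qed

lemma tensor_one: "\<one>\<^bsub>tensor k V W\<^esub> = pure k V W \<one>\<^bsub>V\<^esub> \<one>\<^bsub>W\<^esub>"
  by (simp add: tensor_def pure_def)

lemma k_algebraD:
  assumes "k_algebra k A"
  shows "module k A" "ring A" "monoid.mult A \<in> bilin_maps k A A A" "monoid A"
    "\<And>x y. x \<in> carrier A \<Longrightarrow> y \<in> carrier A \<Longrightarrow> x \<otimes>\<^bsub>A\<^esub> y \<in> carrier A"
    "\<one>\<^bsub>A\<^esub> \<in> carrier A"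
    "\<And>x y z. x \<in> carrier A \<Longrightarrow> y \<in> carrier A \<Longrightarrow> z \<in> carrier A \<Longrightarrow> x \<otimes>\<^bsub>A\<^esub> y \<otimes>\<^bsub>A\<^esub> z = x \<otimes>\<^bsub>A\<^esub> (y \<otimes>\<^bsub>A\<^esub> z)"
    "\<And>x. x \<in> carrier A \<Longrightarrow> x \<otimes>\<^bsub>A\<^esub> \<one>\<^bsub>A\<^esub> = x"
    "\<And>x. x \<in> carrier A \<Longrightarrow> \<one>\<^bsub>A\<^esub> \<otimes>\<^bsub>A\<^esub> x = x"
  using assms by (auto simp: k_algebra_def ring.ring_simprules ring.is_monoid monoid.m_assoc)

lemma tensor_mult_pure:
  assumes "k_algebra k V" "k_algebra k W" "v \<in> carrier V" "w \<in> carrier W" "v' \<in> carrier V" "w' \<in> carrier W"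
  shows "pure k V W v w \<otimes>\<^bsub>tensor k V W\<^esub> pure k V W v' w' = pure k V W (v \<otimes>\<^bsub>V\<^esub> v') (w \<otimes>\<^bsub>W\<^esub> w')"
  using assms by (simp add: tensor_mult tensor_act_pure[of _ k V] k_algebraD pure_closed)

lemma tensor_mult_bilin:
  assumes "k_algebra k V" "k_algebra k W"
  shows "monoid.mult (tensor k V W) \<in> bilin_maps k (tensor k V W) (tensor k V W) (tensor k V W)"
proof -
  note m = k_algebraD[OF assms(1)] k_algebraD[OF assms(2)] module_tensor
  note b = tensor_act_bilin[OF m(3,12) m(1,10) m(1,10)]
  show ?thesis
  proof (rule bilin_mapsI)
    fix s assume s: "s \<in> carrier (tensor k V W)"
    show "monoid.mult (tensor k V W) s \<in> lin_maps k (tensor k V W) (tensor k V W)"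
      by (rule lin_maps_cong[OF bilin_maps_right[OF b s]]) (use m s in \<open>simp_all add: tensor_mult\<close>)
  next
    fix s assume s: "s \<in> carrier (tensor k V W)"
    show "(\<lambda>t. t \<otimes>\<^bsub>tensor k V W\<^esub> s) \<in> lin_maps k (tensor k V W) (tensor k V W)"
      by (rule lin_maps_cong[OF bilin_maps_left[OF b s]]) (use m s in \<open>simp_all add: tensor_mult\<close>)
  qed
qed

context
  fixes k :: "'k ring" and X :: "('k, 'x, 'd) module_scheme" and Y :: "('k, 'y, 'e) module_scheme"
    and V :: "('k, 'v, 'f) module_scheme" and W :: "('k, 'w, 'g) module_scheme"
    and a b
  assumes ab: "a \<in> bilin_maps k X V V" "b \<in> bilin_maps k Y W W"
    and alg: "k_algebra k X" "k_algebra k Y" and m: "module k V" "module k W"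
begin

private lemmas lins = ab m k_algebraD(1)[OF alg(1)] k_algebraD(1)[OF alg(2)]

private lemmas simps = ab m module_tensor k_algebraD[OF alg(1)] k_algebraD[OF alg(2)] tensor_act_bilin
  tensor_mult_pure[OF alg] pure_closed bilin_maps_closed[OF ab(1)] bilin_maps_closed[OF ab(2)]
  tensor_act_pure_left[OF ab]

private lemma mult_lin:
  "s \<in> carrier (tensor k X Y) \<Longrightarrow> F \<in> lin_maps k N (tensor k X Y) \<Longrightarrow> (\<lambda>x. F x \<otimes>\<^bsub>tensor k X Y\<^esub> s) \<in> lin_maps k N (tensor k X Y)"
  "s \<in> carrier (tensor k X Y) \<Longrightarrow> F \<in> lin_maps k N (tensor k X Y) \<Longrightarrow> (\<lambda>x. s \<otimes>\<^bsub>tensor k X Y\<^esub> F x) \<in> lin_maps k N (tensor k X Y)"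
  "s \<in> carrier (tensor k X Y) \<Longrightarrow> t \<in> carrier (tensor k X Y) \<Longrightarrow> s \<otimes>\<^bsub>tensor k X Y\<^esub> t \<in> carrier (tensor k X Y)"
  using bilin_maps_comp_left[OF tensor_mult_bilin[OF alg]] bilin_maps_comp_right[OF tensor_mult_bilin[OF alg]]
    bilin_maps_closed[OF tensor_mult_bilin[OF alg]] by blast+

text \<open>For pure acting elements this is functoriality of the tensor product of linear maps;
  both sides are linear in each acting element.\<close>

lemma tensor_act_mult_left:
  assumes e: "\<And>x x' v. x \<in> carrier X \<Longrightarrow> x' \<in> carrier X \<Longrightarrow> v \<in> carrier V \<Longrightarrow> a (x \<otimes>\<^bsub>X\<^esub> x') v = a x (a x' v)"
      "\<And>y y' w. y \<in> carrier Y \<Longrightarrow> y' \<in> carrier Y \<Longrightarrow> w \<in> carrier W \<Longrightarrow> b (y \<otimes>\<^bsub>Y\<^esub> y') w = b y (b y' w)"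
    and s: "s \<in> carrier (tensor k X Y)" and s': "s' \<in> carrier (tensor k X Y)" and t: "t \<in> carrier (tensor k V W)"
  shows "tensor_act k V W a b (s \<otimes>\<^bsub>tensor k X Y\<^esub> s') t = tensor_act k V W a b s (tensor_act k V W a b s' t)"
proof -
  note [simp] = simps
  have "\<forall>s\<in>carrier (tensor k X Y).
    tensor_act k V W a b (s \<otimes>\<^bsub>tensor k X Y\<^esub> s') t = tensor_act k V W a b s (tensor_act k V W a b s' t)"
  proof (rule tensor_extI)
    fix x y assume xy: "x \<in> carrier X" "y \<in> carrier Y"
    have "\<forall>s'\<in>carrier (tensor k X Y). tensor_act k V W a b (pure k X Y x y \<otimes>\<^bsub>tensor k X Y\<^esub> s') t
      = tensor_act k V W a b (pure k X Y x y) (tensor_act k V W a b s' t)"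
    proof (rule tensor_extI)
      fix x' y' assume xy': "x' \<in> carrier X" "y' \<in> carrier Y"
      note l = bilin_maps_right[OF ab(1)] bilin_maps_right[OF ab(2)]
      have "tensor_map k V W (a (x \<otimes>\<^bsub>X\<^esub> x')) (b (y \<otimes>\<^bsub>Y\<^esub> y')) t = tensor_map k V W (\<lambda>v. a x (a x' v)) (\<lambda>w. b y (b y' w)) t"
        by (rule tensor_map_cong) (use xy xy' t e l in auto)
      also have "\<dots> = tensor_map k V W (a x) (b y) (tensor_map k V W (a x') (b y') t)"
        by (rule tensor_map_comp[symmetric]) (use xy xy' t l in auto)
      finally show "tensor_act k V W a b (pure k X Y x y \<otimes>\<^bsub>tensor k X Y\<^esub> pure k X Y x' y') t
        = tensor_act k V W a b (pure k X Y x y) (tensor_act k V W a b (pure k X Y x' y') t)"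
        using xy xy' t tensor_map_closed[OF t l] by simp
    qed (assumption | rule lins lin xy mult_lin t)+
    thus "tensor_act k V W a b (pure k X Y x y \<otimes>\<^bsub>tensor k X Y\<^esub> s') t
      = tensor_act k V W a b (pure k X Y x y) (tensor_act k V W a b s' t)" using s' by blast
  qed (assumption | rule lins lin mult_lin s' t)+
  thus ?thesis using s by blast
qed

text \<open>The version for right actions, which are written with the algebra element first: a
  product acts by its left factor first and by its right factor afterwards.\<close>

lemma tensor_act_mult_right:
  assumes e: "\<And>x x' v. x \<in> carrier X \<Longrightarrow> x' \<in> carrier X \<Longrightarrow> v \<in> carrier V \<Longrightarrow> a (x \<otimes>\<^bsub>X\<^esub> x') v = a x' (a x v)"
      "\<And>y y' w. y \<in> carrier Y \<Longrightarrow> y' \<in> carrier Y \<Longrightarrow> w \<in> carrier W \<Longrightarrow> b (y \<otimes>\<^bsub>Y\<^esub> y') w = b y' (b y w)"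
    and s: "s \<in> carrier (tensor k X Y)" and s': "s' \<in> carrier (tensor k X Y)" and t: "t \<in> carrier (tensor k V W)"
  shows "tensor_act k V W a b (s \<otimes>\<^bsub>tensor k X Y\<^esub> s') t = tensor_act k V W a b s' (tensor_act k V W a b s t)"
proof -
  note [simp] = simps
  have "\<forall>s\<in>carrier (tensor k X Y).
    tensor_act k V W a b (s \<otimes>\<^bsub>tensor k X Y\<^esub> s') t = tensor_act k V W a b s' (tensor_act k V W a b s t)"
  proof (rule tensor_extI)
    fix x y assume xy: "x \<in> carrier X" "y \<in> carrier Y"
    have "\<forall>s'\<in>carrier (tensor k X Y). tensor_act k V W a b (pure k X Y x y \<otimes>\<^bsub>tensor k X Y\<^esub> s') t
      = tensor_act k V W a b s' (tensor_act k V W a b (pure k X Y x y) t)"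
    proof (rule tensor_extI)
      fix x' y' assume xy': "x' \<in> carrier X" "y' \<in> carrier Y"
      note l = bilin_maps_right[OF ab(1)] bilin_maps_right[OF ab(2)]
      have "tensor_map k V W (a (x \<otimes>\<^bsub>X\<^esub> x')) (b (y \<otimes>\<^bsub>Y\<^esub> y')) t = tensor_map k V W (\<lambda>v. a x' (a x v)) (\<lambda>w. b y' (b y w)) t"
        by (rule tensor_map_cong) (use xy xy' t e l in auto)
      also have "\<dots> = tensor_map k V W (a x') (b y') (tensor_map k V W (a x) (b y) t)"
        by (rule tensor_map_comp[symmetric]) (use xy xy' t l in auto)
      finally show "tensor_act k V W a b (pure k X Y x y \<otimes>\<^bsub>tensor k X Y\<^esub> pure k X Y x' y') t
        = tensor_act k V W a b (pure k X Y x' y') (tensor_act k V W a b (pure k X Y x y) t)"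
        using xy xy' t tensor_map_closed[OF t l] by simp
    qed (assumption | rule lins lin xy mult_lin t)+
    thus "tensor_act k V W a b (pure k X Y x y \<otimes>\<^bsub>tensor k X Y\<^esub> s') t
      = tensor_act k V W a b s' (tensor_act k V W a b (pure k X Y x y) t)" using s' by blast
  qed (assumption | rule lins lin mult_lin s' t)+
  thus ?thesis using s by blast
qed

lemma tensor_act_one:
  assumes e: "\<And>v. v \<in> carrier V \<Longrightarrow> a \<one>\<^bsub>X\<^esub> v = v" "\<And>w. w \<in> carrier W \<Longrightarrow> b \<one>\<^bsub>Y\<^esub> w = w"
    and t: "t \<in> carrier (tensor k V W)"
  shows "tensor_act k V W a b \<one>\<^bsub>tensor k X Y\<^esub> t = t"
proof -
  note [simp] = simps
  have "tensor_map k V W (a \<one>\<^bsub>X\<^esub>) (b \<one>\<^bsub>Y\<^esub>) t = tensor_map k V W (\<lambda>v. v) (\<lambda>w. w) t"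
    by (rule tensor_map_cong) (use t e bilin_maps_right[OF ab(1)] bilin_maps_right[OF ab(2)] in auto)
  thus ?thesis using t by (simp add: tensor_one tensor_map_ident)
qed

end

text \<open>Left multiplication is a componentwise left action of the algebra on itself, so
  associativity and the left unit law are \<open>tensor_act_mult_left\<close> and
  \<open>tensor_act_one\<close>. Only the right unit law is checked on pure tensors.\<close>

lemma k_algebra_tensor [lin]:
  assumes "k_algebra k V" "k_algebra k W"
  shows "k_algebra k (tensor k V W)"
proof -
  note m = k_algebraD[OF assms(1)] k_algebraD[OF assms(2)]
  note b = tensor_mult_bilin[OF assms]
  let ?T = "tensor k V W"
  interpret T: module k ?T by (rule module_tensor[OF m(1,10)])
  note bl = bilin_maps_closed[OF b] and tm = tensor_mult[OF m(1,10) m(3,12)]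
  have one: "\<one>\<^bsub>?T\<^esub> \<in> carrier ?T" using m by (simp add: tensor_one pure_closed)
  have r1: "t \<otimes>\<^bsub>?T\<^esub> \<one>\<^bsub>?T\<^esub> = t" if t: "t \<in> carrier ?T" for t
  proof -
    have "\<forall>t\<in>carrier ?T. t \<otimes>\<^bsub>?T\<^esub> \<one>\<^bsub>?T\<^esub> = t"
      by (rule tensor_extI[OF m(1,10) bilin_maps_left[OF b one] lin_maps_ident])
        (use m assms in \<open>simp add: tensor_one tensor_mult_pure\<close>)
    thus ?thesis using t by blast
  qed
  have "ring ?T"
  proof (rule ringI)
    show "abelian_group ?T" by (rule T.M.abelian_group_axioms)
    show "monoid ?T"
    proof (rule monoidI)
      fix x y z assume xyz: "x \<in> carrier ?T" "y \<in> carrier ?T" "z \<in> carrier ?T"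
      have "tensor_act k V W (monoid.mult V) (monoid.mult W) (x \<otimes>\<^bsub>?T\<^esub> y) z
        = tensor_act k V W (monoid.mult V) (monoid.mult W) x (tensor_act k V W (monoid.mult V) (monoid.mult W) y z)"
        by (rule tensor_act_mult_left[OF m(3,12) assms m(1,10)]) (simp_all add: m xyz)
      thus "x \<otimes>\<^bsub>?T\<^esub> y \<otimes>\<^bsub>?T\<^esub> z = x \<otimes>\<^bsub>?T\<^esub> (y \<otimes>\<^bsub>?T\<^esub> z)"
        by (simp only: tm[OF bl[OF xyz(1,2)] xyz(3)] tm[OF xyz(1) bl[OF xyz(2,3)], unfolded tm[OF xyz(2,3)]] tm[OF xyz(2,3)])
    next
      fix t assume t: "t \<in> carrier ?T"
      have "tensor_act k V W (monoid.mult V) (monoid.mult W) \<one>\<^bsub>?T\<^esub> t = t"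
        by (rule tensor_act_one[OF m(3,12) assms m(1,10)]) (simp_all add: m t)
      thus "\<one>\<^bsub>?T\<^esub> \<otimes>\<^bsub>?T\<^esub> t = t" by (simp only: tm[OF one t])
    qed (simp_all only: bl one r1)
  next
    fix x y z assume xyz: "x \<in> carrier ?T" "y \<in> carrier ?T" "z \<in> carrier ?T"
    show "(x \<oplus>\<^bsub>?T\<^esub> y) \<otimes>\<^bsub>?T\<^esub> z = x \<otimes>\<^bsub>?T\<^esub> z \<oplus>\<^bsub>?T\<^esub> y \<otimes>\<^bsub>?T\<^esub> z"
      using lin_maps_add[OF bilin_maps_left[OF b xyz(3)] xyz(1,2)] .
    show "z \<otimes>\<^bsub>?T\<^esub> (x \<oplus>\<^bsub>?T\<^esub> y) = z \<otimes>\<^bsub>?T\<^esub> x \<oplus>\<^bsub>?T\<^esub> z \<otimes>\<^bsub>?T\<^esub> y"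
      using lin_maps_add[OF bilin_maps_right[OF b xyz(3)] xyz(1,2)] .
  qed
  thus ?thesis using b by (simp add: k_algebra_def T.module_axioms)
qed

section \<open>Structures with the same underlying vector space\<close>

text \<open>Extended and truncated records have different types, so an equation between them cannot
  even be written. All tensor constructions read only the base fields compared here;
  \<open>mult\<close> and \<open>one\<close> are included because \<open>tensor\<close> copies them
  into its own record.\<close>

definition same_module ::
    "('k, 'v, 'e) module_scheme \<Rightarrow> ('k, 'v, 'f) module_scheme \<Rightarrow> bool" where
  "same_module V V' \<longleftrightarrow> carrier V = carrier V' \<and> monoid.mult V = monoid.mult V' \<and> \<one>\<^bsub>V\<^esub> = \<one>\<^bsub>V'\<^esub> \<and>
     \<zero>\<^bsub>V\<^esub> = \<zero>\<^bsub>V'\<^esub> \<and> add V = add V' \<and> smult V = smult V'"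

lemma same_module_refl: "same_module V V" and same_module_sym: "same_module V V' \<Longrightarrow> same_module V' V"
  by (simp_all add: same_module_def)

lemma tensor_eq_same:
  assumes "same_module V V'" "same_module W W'"
  shows "tensor_eq k V W xs ys \<Longrightarrow> tensor_eq k V' W' xs ys"
proof (induction rule: tensor_eq.induct)
  case (refl xs)
  thus ?case using assms tensor_eq.refl[of xs V' W' k] by (simp add: same_module_def)
next
  case (sym xs ys)
  show ?case by (rule tensor_eq.sym[OF sym.IH])
next
  case (trans xs ys zs)
  show ?case by (rule tensor_eq.trans[OF trans.IH])
next
  case (append xs ys us vs)
  show ?case by (rule tensor_eq.append[OF append.IH])
next
  case (commute xs ys)
  thus ?case using assms tensor_eq.commute[of xs V' W' ys k] by (simp add: same_module_def)
next
  case (add_left v v' w)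
  thus ?case using assms tensor_eq.add_left[of v V' v' w W' k] by (simp add: same_module_def)
next
  case (add_right v w w')
  thus ?case using assms tensor_eq.add_right[of v V' w W' w' k] by (simp add: same_module_def)
next
  case (scalar c v w)
  thus ?case using assms tensor_eq.scalar[of c k v V' w W'] by (simp add: same_module_def)
next
  case (zero w)
  thus ?case using assms tensor_eq.zero[of w W' k V'] by (simp add: same_module_def)
qed

context
  fixes V :: "('k, 'v, 'e) module_scheme" and V' :: "('k, 'v, 'f) module_scheme"
    and W :: "('k, 'w, 'g) module_scheme" and W' :: "('k, 'w, 'h) module_scheme"
    and U :: "('k, 'u, 'i) module_scheme" and U' :: "('k, 'u, 'j) module_scheme"
    and k :: "'k ring"
  assumes s: "same_module U U'" "same_module V V'" "same_module W W'"
begin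

lemma tensor_class_same: "tensor_class k V W = tensor_class k V' W'"
  using tensor_eq_same[OF s(2,3)] tensor_eq_same[OF s(2,3)[THEN same_module_sym]]
  by (auto simp: fun_eq_iff tensor_class_def)

lemma tensor_same: "tensor k V W = tensor k V' W'"
  using s by (simp add: tensor_def tensor_class_same same_module_def)

lemma pure_same: "pure k V W = pure k V' W'"
  by (simp add: fun_eq_iff pure_def tensor_class_same)

lemma tensor_map_same: "tensor_map k V W = tensor_map k V' W'"
  by (simp add: fun_eq_iff tensor_map_def tensor_same pure_same)

lemma tensor_act_same: "tensor_act k V W = tensor_act k V' W'"
  by (simp add: fun_eq_iff tensor_act_def tensor_same tensor_map_same)

lemma lin_maps_same: "lin_maps k V W = lin_maps k V' W'"
  using s by (simp add: lin_maps_def same_module_def)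

lemma lunit_same: "lunit V = lunit V'" and runit_same: "runit V = runit V'"
  using s by (simp_all add: fun_eq_iff lunit_def runit_def tensor_lift_def same_module_def)

lemma tensor_lift_same: "tensor_lift V b = tensor_lift V' b"
  using s by (simp add: fun_eq_iff tensor_lift_def same_module_def)

end

lemma bilin_maps_same:
  assumes s: "same_module U U'" "same_module V V'" "same_module W W'"
  shows "bilin_maps k U V W = bilin_maps k U' V' W'"
  using lin_maps_same[OF s] lin_maps_same[OF s(2,1,3)] s by (simp add: bilin_maps_def same_module_def)

lemma rebr_same:
  assumes "same_module U U'" "same_module V V'" "same_module W W'"
  shows "rebr k U V W = rebr k U' V' W'" "rebr_inv k U V W = rebr_inv k U' V' W'"
proof -
  note r = same_module_refl
  note e = tensor_same[OF r assms(2,3)] tensor_same[OF r assms(1,2)]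
    pure_same[OF r assms(2,3)] pure_same[OF r assms(1,2)]
  have "tensor k U (tensor k V W) = tensor k U' (tensor k V' W')"
    "pure k U (tensor k V W) = pure k U' (tensor k V' W')"
    "tensor k (tensor k U V) W = tensor k (tensor k U' V') W'"
    "pure k (tensor k U V) W = pure k (tensor k U' V') W'"
    unfolding e(1,2)
    by (rule tensor_same[OF r assms(1) r], rule pure_same[OF r assms(1) r],
      rule tensor_same[OF r r assms(3)], rule pure_same[OF r r assms(3)])
  note e' = this
  show "rebr k U V W = rebr k U' V' W'"
    by (unfold rebr_def, unfold e'(1,2), unfold e(3), rule HOL.refl)
  show "rebr_inv k U V W = rebr_inv k U' V' W'"
    by (unfold rebr_inv_def, unfold e'(3,4), unfold e(4), rule HOL.refl)
qed

lemmas same_module_simps =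
  tensor_same[OF same_module_refl _ same_module_refl] tensor_same[OF same_module_refl same_module_refl]
  pure_same[OF same_module_refl _ same_module_refl] pure_same[OF same_module_refl same_module_refl]
  tensor_map_same[OF same_module_refl _ same_module_refl] tensor_map_same[OF same_module_refl same_module_refl]
  tensor_act_same[OF same_module_refl _ same_module_refl] tensor_act_same[OF same_module_refl same_module_refl]
  lin_maps_same[OF same_module_refl _ same_module_refl] lin_maps_same[OF same_module_refl same_module_refl]
  lunit_same[OF same_module_refl _ same_module_refl] runit_same[OF same_module_refl _ same_module_refl]
  tensor_lift_same[OF same_module_refl _ same_module_refl]
  bilin_maps_same[OF _ same_module_refl same_module_refl] bilin_maps_same[OF same_module_refl _ same_module_refl]
  bilin_maps_same[OF same_module_refl same_module_refl]
  rebr_same[OF _ same_module_refl same_module_refl] rebr_same[OF same_module_refl _ same_module_refl]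
  rebr_same[OF same_module_refl same_module_refl]

lemma same_module_moduleI:
  assumes "same_module V V'" "module k V" shows "module k V'"
proof -
  interpret module k V by fact
  have e: "carrier V' = carrier V" "\<zero>\<^bsub>V'\<^esub> = \<zero>\<^bsub>V\<^esub>" "add V' = add V" "smult V' = smult V"
    using assms(1) by (simp_all add: same_module_def)
  show ?thesis
  proof (rule moduleI)
    show "abelian_group V'"
    proof (rule abelian_groupI; unfold e)
      fix x assume "x \<in> carrier V"
      thus "\<exists>y\<in>carrier V. y \<oplus>\<^bsub>V\<^esub> x = \<zero>\<^bsub>V\<^esub>"
        using M.l_neg[of x] M.a_inv_closed[of x] by blast
    qed (simp_all add: M.a_ac)
  qed (unfold e, simp_all add: smult_l_distr smult_r_distr smult_assoc1 R.cring_axioms)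
qed

lemma same_module_module: "same_module V V' \<Longrightarrow> module k V = module k V'"
  by (rule iffI) (erule same_module_moduleI same_module_moduleI[OF same_module_sym], assumption)+

lemma same_module_htensor: "same_module (htensor k H M N) (tensor k M N)"
  by (simp add: same_module_def htensor_def module.extend_def hmod.fields_def)

lemma htensor_simps [simp]:
  "carrier (htensor k H M N) = carrier (tensor k M N)" "add (htensor k H M N) = add (tensor k M N)"
  "smult (htensor k H M N) = smult (tensor k M N)" "\<zero>\<^bsub>htensor k H M N\<^esub> = \<zero>\<^bsub>tensor k M N\<^esub>"
  "lact (htensor k H M N) = (\<lambda>h. tensor_act k M N (lact M) (lact N) (comult H h))"
  by (simp_all add: htensor_def module.extend_def hmod.fields_def)

lemmas htensor_same [simp] = same_module_simps[OF same_module_htensor]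
  same_module_module[OF same_module_htensor]

section \<open>Algebra maps\<close>

lemma alg_mapsI:
  assumes "f \<in> lin_maps k A B" "\<And>x y. x \<in> carrier A \<Longrightarrow> y \<in> carrier A \<Longrightarrow> f (x \<otimes>\<^bsub>A\<^esub> y) = f x \<otimes>\<^bsub>B\<^esub> f y"
    "f \<one>\<^bsub>A\<^esub> = \<one>\<^bsub>B\<^esub>"
  shows "f \<in> alg_maps k A B"
  using assms by (auto simp: alg_maps_def lin_maps_def intro!: ring_hom_memI)

lemma alg_mapsD:
  assumes "f \<in> alg_maps k A B"
  shows "f \<in> lin_maps k A B" "\<And>x y. x \<in> carrier A \<Longrightarrow> y \<in> carrier A \<Longrightarrow> f (x \<otimes>\<^bsub>A\<^esub> y) = f x \<otimes>\<^bsub>B\<^esub> f y"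
    "f \<one>\<^bsub>A\<^esub> = \<one>\<^bsub>B\<^esub>" "\<And>x. x \<in> carrier A \<Longrightarrow> f x \<in> carrier B"
  using assms by (auto simp: alg_maps_def ring_hom_mult ring_hom_one ring_hom_closed)

lemma alg_maps_ident: "(\<lambda>x. x) \<in> alg_maps k A A"
  by (rule alg_mapsI) (auto intro: lin_maps_ident)

lemma alg_maps_tensor_map:
  assumes f: "f \<in> alg_maps k V V'" and g: "g \<in> alg_maps k W W'"
    and alg: "k_algebra k V" "k_algebra k W" "k_algebra k V'" "k_algebra k W'"
  shows "tensor_map k V' W' f g \<in> alg_maps k (tensor k V W) (tensor k V' W')"
proof (rule alg_mapsI)
  note m = alg[THEN k_algebraD(1)] and mu = alg[THEN k_algebraD(3)] and fg = alg_mapsD[OF f] alg_mapsD[OF g]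
  show l: "tensor_map k V' W' f g \<in> lin_maps k (tensor k V W) (tensor k V' W')"
    by (rule tensor_map_lin[OF fg(1,5) m])
  show "tensor_map k V' W' f g \<one>\<^bsub>tensor k V W\<^esub> = \<one>\<^bsub>tensor k V' W'\<^esub>"
    by (simp add: tensor_one tensor_map_pure[OF fg(1,5) _ _ m] k_algebraD[OF alg(1)] k_algebraD[OF alg(2)] fg)
  fix x y assume xy: "x \<in> carrier (tensor k V W)" "y \<in> carrier (tensor k V W)"
  have "tensor_map k V' W' f g (tensor_act k V W (monoid.mult V) (monoid.mult W) x y)
      = tensor_act k V' W' (monoid.mult V') (monoid.mult W') (tensor_map k V' W' f g x) (tensor_map k V' W' f g y)"
    by (rule tensor_act_natural[OF mu m(1,2,1,2,3,4,3,4)]) (rule fg xy | assumption)+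
  thus "tensor_map k V' W' f g (x \<otimes>\<^bsub>tensor k V W\<^esub> y) = tensor_map k V' W' f g x \<otimes>\<^bsub>tensor k V' W'\<^esub> tensor_map k V' W' f g y"
    by (simp only: tensor_mult[OF m(1,2) mu(1,2) xy]
        tensor_mult[OF m(3,4) mu(3,4) lin_maps_closed[OF l xy(1)] lin_maps_closed[OF l xy(2)]])
qed

lemma alg_maps_pure_one:
  assumes "k_algebra k V" "k_algebra k W"
  shows "(\<lambda>w. pure k V W \<one>\<^bsub>V\<^esub> w) \<in> alg_maps k W (tensor k V W)"
  by (rule alg_mapsI)
    (simp_all add: assms tensor_mult_pure tensor_one k_algebraD[OF assms(1)] k_algebraD[OF assms(2)]
      pure_lin_right lin_maps_ident)

text \<open>f(y) = f(x) f(y) = f(xy) = f(1) for the inverse y of x. It carries every statement that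
  \<Phi> becomes trivial over to the inverse of \<Phi>.\<close>

lemma alg_maps_inverse:
  assumes f: "f \<in> alg_maps k A B" and alg: "k_algebra k A" "k_algebra k B"
    and x: "x \<in> Units A" and "f x = \<one>\<^bsub>B\<^esub>"
  shows "f (inv\<^bsub>A\<^esub> x) = \<one>\<^bsub>B\<^esub>"
proof -
  interpret A: monoid A using alg by (simp add: k_algebraD)
  have c: "x \<in> carrier A" "inv\<^bsub>A\<^esub> x \<in> carrier A" using x by auto
  have "f (inv\<^bsub>A\<^esub> x) = \<one>\<^bsub>B\<^esub> \<otimes>\<^bsub>B\<^esub> f (inv\<^bsub>A\<^esub> x)"
    using alg_mapsD(4)[OF f c(2)] by (simp add: k_algebraD[OF alg(2)])
  also have "\<dots> = f (x \<otimes>\<^bsub>A\<^esub> inv\<^bsub>A\<^esub> x)" using assms(5) by (simp add: alg_mapsD(2)[OF f c])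
  also have "\<dots> = \<one>\<^bsub>B\<^esub>" using x by (simp add: alg_mapsD(3)[OF f])
  finally show ?thesis .
qed

section \<open>Quasi-bialgebras and their modules\<close>

locale quasi_bialgebra_over =
  fixes k :: "'k ring" and H :: "('k, 'h) quasi_bialg"
  assumes cring_k: "cring k" and quasi_bialg: "quasi_bialgebra k H"
begin

abbreviation "H2 \<equiv> tensor k H H"
abbreviation "H3 \<equiv> tensor k H H2"
abbreviation "H4 \<equiv> tensor k H H3"

lemma H_axioms:
  shows alg_H [simp, lin]: "k_algebra k H"
    and comult_alg: "comult H \<in> alg_maps k H H2"
    and counit_alg: "counit H \<in> alg_maps k H (base_space k)"
    and reass_Units: "reass H \<in> Units H3"
    and comult_counit: "\<And>h. h \<in> carrier H \<Longrightarrow> runit H (tensor_map k H (base_space k) id (counit H) (comult H h)) = h"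
      "\<And>h. h \<in> carrier H \<Longrightarrow> lunit H (tensor_map k (base_space k) H (counit H) id (comult H h)) = h"
    and pentagon: "pure k H H3 \<one>\<^bsub>H\<^esub> (reass H)
        \<otimes>\<^bsub>H4\<^esub> tensor_map k H H3 id (rebr k H H H \<circ> tensor_map k H2 H (comult H) id) (reass H)
        \<otimes>\<^bsub>H4\<^esub> tensor_map k H H3 id (rebr k H H H) (rebr k H H2 H (pure k H3 H (reass H) \<one>\<^bsub>H\<^esub>))
      = tensor_map k H H3 id (tensor_map k H H2 id (comult H)) (reass H)
        \<otimes>\<^bsub>H4\<^esub> rebr k H H H2 (tensor_map k H2 H2 (comult H) id (reass H))"
    and reass_counit: "tensor_map k H H id (lunit H \<circ> tensor_map k (base_space k) H (counit H) id) (reass H) = \<one>\<^bsub>H2\<^esub>"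
  using quasi_bialg unfolding quasi_bialgebra_def Let_def by blast+

lemma mod_base [simp, lin]: "module k (base_space k)" by (rule module_base_space[OF cring_k])

lemmas H_simps [simp] = k_algebraD[OF alg_H]
lemmas mod_H [lin] = H_simps(1)
lemmas H_alg [simp, lin] = k_algebra_tensor[OF alg_H alg_H]
  k_algebra_tensor[OF alg_H k_algebra_tensor[OF alg_H alg_H]]
  k_algebra_tensor[OF alg_H k_algebra_tensor[OF alg_H k_algebra_tensor[OF alg_H alg_H]]]

lemmas counit_simps [simp] = alg_mapsD(4)[OF counit_alg, simplified] alg_mapsD(3)[OF counit_alg, simplified]
  alg_mapsD(2)[OF counit_alg, simplified]
lemmas comult_closed [simp, lin] = alg_mapsD(4)[OF comult_alg]

lemma comult_lin [lin]: "comult H \<in> lin_maps k H H2" and counit_lin [lin]: "counit H \<in> lin_maps k H (base_space k)"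
  by (rule alg_mapsD[OF comult_alg] alg_mapsD[OF counit_alg])+

lemma reass_closed [simp, lin]: "reass H \<in> carrier H3" "inv\<^bsub>H3\<^esub> (reass H) \<in> carrier H3"
  using reass_Units k_algebraD(4)[of k H3] by (auto simp: monoid.Units_inv_closed monoid.Units_closed)

lemma cring_simps [simp]:
  "a \<in> carrier k \<Longrightarrow> b \<in> carrier k \<Longrightarrow> a \<otimes>\<^bsub>k\<^esub> b \<in> carrier k" "\<one>\<^bsub>k\<^esub> \<in> carrier k"
  "a \<in> carrier k \<Longrightarrow> \<one>\<^bsub>k\<^esub> \<otimes>\<^bsub>k\<^esub> a = a" "a \<in> carrier k \<Longrightarrow> a \<otimes>\<^bsub>k\<^esub> \<one>\<^bsub>k\<^esub> = a"
proof -
  interpret cring k by (rule cring_k)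
  show "a \<in> carrier k \<Longrightarrow> b \<in> carrier k \<Longrightarrow> a \<otimes>\<^bsub>k\<^esub> b \<in> carrier k" "\<one>\<^bsub>k\<^esub> \<in> carrier k"
    "a \<in> carrier k \<Longrightarrow> \<one>\<^bsub>k\<^esub> \<otimes>\<^bsub>k\<^esub> a = a" "a \<in> carrier k \<Longrightarrow> a \<otimes>\<^bsub>k\<^esub> \<one>\<^bsub>k\<^esub> = a"
    by simp_all
qed

text \<open>The algebra endomorphism that replaces a leg by a multiple of 1 instead of deleting it.
  Applying the counit to a leg then keeps the number of legs, and the pentagon can be transformed
  inside one algebra.\<close>

definition counit_unit :: "'h \<Rightarrow> 'h" where "counit_unit h = counit H h \<odot>\<^bsub>H\<^esub> \<one>\<^bsub>H\<^esub>"

lemma counit_unit_alg: "counit_unit \<in> alg_maps k H H"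
proof (rule alg_mapsI)
  interpret module k H by simp
  show "counit_unit \<in> lin_maps k H H"
    unfolding counit_unit_def[abs_def]
    using bilin_maps_comp_left[OF smult_bilin[OF mod_H] counit_lin, of "\<one>\<^bsub>H\<^esub>"] by simp
  show "counit_unit \<one>\<^bsub>H\<^esub> = \<one>\<^bsub>H\<^esub>" by (simp add: counit_unit_def)
  fix x y assume "x \<in> carrier H" "y \<in> carrier H"
  thus "counit_unit (x \<otimes>\<^bsub>H\<^esub> y) = counit_unit x \<otimes>\<^bsub>H\<^esub> counit_unit y"
    by (simp add: counit_unit_def lin_maps_smult[OF bilin_maps_left[OF H_simps(3)]] smult_assoc1)
qed

lemmas counit_unit_lin [lin] = alg_mapsD(1)[OF counit_unit_alg]
lemmas counit_unit_closed [simp, lin] = alg_mapsD(4)[OF counit_unit_alg]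

abbreviation "slot1 \<equiv> tensor_map k H H2 counit_unit (\<lambda>x. x)"
abbreviation "slot2 \<equiv> tensor_map k H H2 (\<lambda>x. x) (tensor_map k H H counit_unit (\<lambda>x. x))"
abbreviation "slot3 \<equiv> tensor_map k H H2 (\<lambda>x. x) (tensor_map k H H (\<lambda>x. x) counit_unit)"

lemma slot_alg: "slot1 \<in> alg_maps k H3 H3" "slot2 \<in> alg_maps k H3 H3" "slot3 \<in> alg_maps k H3 H3"
  by (intro alg_maps_tensor_map alg_maps_ident counit_unit_alg; simp)+

end

section \<open>Triviality of the reassociator after applying the counit to a leg\<close>

context quasi_bialgebra_over
begin

lemmas lin_simps [simp] = pure_closed tensor_map_pure rebr_pure rebr_inv_pure module_tensor lin_maps_ident lin_maps_id
  comult_lin counit_lin counit_unit_lin rebr_lin rebr_inv_lin tensor_map_lin lunit_lin runit_lin lunit_pure runit_pure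
  alg_maps_ident counit_unit_alg module.smult_closed[OF H_simps(1)] tensor_mult_pure rebr_closed rebr_inv_closed

lemma pure_one_lin [simp, lin]: "module k W \<Longrightarrow> (\<lambda>w. pure k H W \<one>\<^bsub>H\<^esub> w) \<in> lin_maps k W (tensor k H W)"
  by (rule pure_lin_right) simp_all

lemma rebr_counit:
  assumes W [simp, lin]: "module k W" and [simp, lin]: "w \<in> carrier W" and d: "d \<in> carrier H2"
  shows "tensor_map k H (tensor k H W) (\<lambda>x. x) (tensor_map k H W counit_unit (\<lambda>x. x)) (rebr k H H W (pure k H2 W d w))
      = pure k H (tensor k H W) (runit H (tensor_map k H (base_space k) id (counit H) d)) (pure k H W \<one>\<^bsub>H\<^esub> w)"
    and "tensor_map k H (tensor k H W) counit_unit (\<lambda>x. x) (rebr k H H W (pure k H2 W d w))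
      = pure k H (tensor k H W) \<one>\<^bsub>H\<^esub> (pure k H W (lunit H (tensor_map k (base_space k) H (counit H) id d)) w)"
proof -
  have "\<forall>d\<in>carrier H2. tensor_map k H (tensor k H W) (\<lambda>x. x) (tensor_map k H W counit_unit (\<lambda>x. x)) (rebr k H H W (pure k H2 W d w))
      = pure k H (tensor k H W) (runit H (tensor_map k H (base_space k) id (counit H) d)) (pure k H W \<one>\<^bsub>H\<^esub> w)"
  proof (rule tensor_extI)
    fix x y assume "x \<in> carrier H" "y \<in> carrier H"
    thus "tensor_map k H (tensor k H W) (\<lambda>x. x) (tensor_map k H W counit_unit (\<lambda>x. x)) (rebr k H H W (pure k H2 W (pure k H H x y) w))
      = pure k H (tensor k H W) (runit H (tensor_map k H (base_space k) id (counit H) (pure k H H x y))) (pure k H W \<one>\<^bsub>H\<^esub> w)"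
      by (simp add: counit_unit_def pure_smult_left pure_smult_right)
  qed (assumption | rule lin tensor_map_lin | simp)+
  thus "tensor_map k H (tensor k H W) (\<lambda>x. x) (tensor_map k H W counit_unit (\<lambda>x. x)) (rebr k H H W (pure k H2 W d w))
      = pure k H (tensor k H W) (runit H (tensor_map k H (base_space k) id (counit H) d)) (pure k H W \<one>\<^bsub>H\<^esub> w)"
    using d by blast
  have "\<forall>d\<in>carrier H2. tensor_map k H (tensor k H W) counit_unit (\<lambda>x. x) (rebr k H H W (pure k H2 W d w))
      = pure k H (tensor k H W) \<one>\<^bsub>H\<^esub> (pure k H W (lunit H (tensor_map k (base_space k) H (counit H) id d)) w)"
  proof (rule tensor_extI)
    fix x y assume "x \<in> carrier H" "y \<in> carrier H"
    thus "tensor_map k H (tensor k H W) counit_unit (\<lambda>x. x) (rebr k H H W (pure k H2 W (pure k H H x y) w))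
      = pure k H (tensor k H W) \<one>\<^bsub>H\<^esub> (pure k H W (lunit H (tensor_map k (base_space k) H (counit H) id (pure k H H x y))) w)"
      by (simp add: counit_unit_def pure_smult_left pure_smult_right)
  qed (assumption | rule lin tensor_map_lin | simp)+
  thus "tensor_map k H (tensor k H W) counit_unit (\<lambda>x. x) (rebr k H H W (pure k H2 W d w))
      = pure k H (tensor k H W) \<one>\<^bsub>H\<^esub> (pure k H W (lunit H (tensor_map k (base_space k) H (counit H) id d)) w)"
    using d by blast
qed

text \<open>The two counit axioms for \<Delta>, with 1 reinserted at the killed leg and a passive
  factor \<open>w\<close> on the right, in the shape in which \<Delta> occurs in the
  pentagon.\<close>

lemma rebr_comult_counit:
  assumes "module k W" "w \<in> carrier W" "h \<in> carrier H"
  shows "tensor_map k H (tensor k H W) (\<lambda>x. x) (tensor_map k H W counit_unit (\<lambda>x. x)) (rebr k H H W (pure k H2 W (comult H h) w))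
      = pure k H (tensor k H W) h (pure k H W \<one>\<^bsub>H\<^esub> w)"
    and "tensor_map k H (tensor k H W) counit_unit (\<lambda>x. x) (rebr k H H W (pure k H2 W (comult H h) w))
      = pure k H (tensor k H W) \<one>\<^bsub>H\<^esub> (pure k H W h w)"
  using assms by (simp_all add: rebr_counit comult_counit)

lemma comult_counit_left:
  assumes "h \<in> carrier H"
  shows "tensor_map k H H counit_unit (\<lambda>x. x) (comult H h) = pure k H H \<one>\<^bsub>H\<^esub> h"
proof -
  have "\<forall>d\<in>carrier H2. tensor_map k H H counit_unit (\<lambda>x. x) d
      = pure k H H \<one>\<^bsub>H\<^esub> (lunit H (tensor_map k (base_space k) H (counit H) id d))"
  proof (rule tensor_extI)
    fix x y assume "x \<in> carrier H" "y \<in> carrier H"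
    thus "tensor_map k H H counit_unit (\<lambda>x. x) (pure k H H x y)
      = pure k H H \<one>\<^bsub>H\<^esub> (lunit H (tensor_map k (base_space k) H (counit H) id (pure k H H x y)))"
      by (simp add: counit_unit_def pure_smult_left pure_smult_right)
  qed (assumption | rule lin | simp)+
  thus ?thesis using assms comult_counit by simp
qed

text \<open>The normalization axiom deletes the middle leg of \<Phi>; the map \<open>?i\<close> puts
  1 back in its place.\<close>

lemma slot2_reass: "slot2 (reass H) = \<one>\<^bsub>H3\<^esub>"
proof -
  let ?c = "lunit H \<circ> tensor_map k (base_space k) H (counit H) id"
  let ?i = "tensor_map k H H2 (\<lambda>x. x) (\<lambda>z. pure k H H \<one>\<^bsub>H\<^esub> z)"
  have c [simp, lin]: "?c \<in> lin_maps k H2 H" unfolding comp_def by (rule lin | simp)+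
  have "\<forall>s\<in>carrier H3. slot2 s = ?i (tensor_map k H H id ?c s)"
  proof (rule tensor_extI_right)
    fix x y z assume "x \<in> carrier H" "y \<in> carrier H" "z \<in> carrier H"
    thus "slot2 (pure k H H2 x (pure k H H y z)) = ?i (tensor_map k H H id ?c (pure k H H2 x (pure k H H y z)))"
      by (simp add: counit_unit_def) (simp add: pure_smult_left pure_smult_right)
  qed (assumption | rule lin tensor_map_lin | simp)+
  hence "slot2 (reass H) = ?i \<one>\<^bsub>H2\<^esub>" using reass_counit by simp
  also have "\<dots> = \<one>\<^bsub>H3\<^esub>" by (simp add: tensor_one)
  finally show ?thesis .
qed

text \<open>This map and the next two are factors of the pentagon, made functions of a variable
  tensor: extensionality can then be applied with a pure tensor in place of \<Phi>.\<close>

definition "inner_comult = rebr k H H H \<circ> tensor_map k H2 H (comult H) id"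

lemma inner_comult_lin [simp, lin]: "inner_comult \<in> lin_maps k H2 H3"
  unfolding inner_comult_def comp_def by (rule lin | simp)+

lemma inner_comult_pure [simp]:
  "x \<in> carrier H \<Longrightarrow> y \<in> carrier H \<Longrightarrow> inner_comult (pure k H H x y) = rebr k H H H (pure k H2 H (comult H x) y)"
  by (simp add: inner_comult_def)

definition "times_one s = tensor_map k H H3 id (rebr k H H H) (rebr k H H2 H (pure k H3 H s \<one>\<^bsub>H\<^esub>))"

lemma times_one_lin [simp]: "times_one \<in> lin_maps k H3 H4"
  unfolding times_one_def[abs_def] by (rule lin | simp)+

lemmas times_one_comp_lin [lin] = lin_maps_comp[OF times_one_lin]

lemma times_one_pure [simp]:
  "x \<in> carrier H \<Longrightarrow> y \<in> carrier H \<Longrightarrow> z \<in> carrier H \<Longrightarrow>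
    times_one (pure k H H2 x (pure k H H y z)) = pure k H H3 x (pure k H H2 y (pure k H H z \<one>\<^bsub>H\<^esub>))"
  by (simp add: times_one_def)

definition "comult_first s = rebr k H H H2 (tensor_map k H2 H2 (comult H) id s)"

lemma comult_first_lin [simp]: "comult_first \<in> lin_maps k H3 H4"
  unfolding comult_first_def[abs_def] by (rule lin | simp)+

lemmas comult_first_comp_lin [lin] = lin_maps_comp[OF comult_first_lin]

lemma comult_first_pure [simp]:
  "x \<in> carrier H \<Longrightarrow> t \<in> carrier H2 \<Longrightarrow> comult_first (pure k H H2 x t) = rebr k H H H2 (pure k H2 H2 (comult H x) t)"
  by (simp add: comult_first_def)

lemma H_ops_one: "times_one \<one>\<^bsub>H3\<^esub> = \<one>\<^bsub>H4\<^esub>" "comult_first \<one>\<^bsub>H3\<^esub> = \<one>\<^bsub>H4\<^esub>"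
    "tensor_map k H H3 id (tensor_map k H H2 id (comult H)) \<one>\<^bsub>H3\<^esub> = \<one>\<^bsub>H4\<^esub>"
  using alg_mapsD(3)[OF comult_alg] by (simp_all add: tensor_one)

text \<open>Apply the counit to the second leg of the pentagon. The factor \<Phi> \<otimes> 1 and
  the factor in which \<Delta> hits the last leg become 1 by normalization. The two factors in which
  \<Delta> produces the second leg both become X^1 \<otimes> 1 \<otimes> X^2 \<otimes> X^3, which is
  invertible as the image of \<Phi> under the algebra map \<open>?j\<close> and cancels on the
  right. What is left says that 1 \<otimes> \<open>slot1\<close>(\<Phi>) is the unit.\<close>

lemma slot1_reass: "slot1 (reass H) = \<one>\<^bsub>H3\<^esub>"
proof -
  let ?E = "tensor_map k H H3 (\<lambda>x. x) slot1"
  let ?j = "tensor_map k H H3 (\<lambda>x. x) (\<lambda>t. pure k H H2 \<one>\<^bsub>H\<^esub> t)"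
  let ?N = "tensor_map k H H3 id (tensor_map k H H2 id (comult H))"
  have E: "?E \<in> alg_maps k H4 H4" by (intro alg_maps_tensor_map slot_alg alg_maps_ident; simp)
  have j: "?j \<in> alg_maps k H3 H4" by (intro alg_maps_tensor_map alg_maps_pure_one alg_maps_ident; simp)
  have 1: "\<forall>s\<in>carrier H3. ?E (tensor_map k H H3 id inner_comult s) = ?j s"
    by (rule tensor_extI_right; (assumption | rule lin tensor_map_lin | simp add: rebr_comult_counit)+)
  have 2: "\<forall>s\<in>carrier H3. ?E (times_one s) = times_one (slot2 s)"
    by (rule tensor_extI_right; (assumption | rule lin tensor_map_lin | simp)+)
  have 3: "\<forall>s\<in>carrier H3. ?E (?N s) = ?N (slot2 s)"
    by (rule tensor_extI_right; (assumption | rule lin tensor_map_lin | simp)+)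
  have 4: "\<forall>s\<in>carrier H3. ?E (comult_first s) = ?j s"
    by (rule tensor_extI; (assumption | rule lin tensor_map_lin | simp add: rebr_comult_counit)+)
  have c: "tensor_map k H H3 id inner_comult (reass H) \<in> carrier H4" "times_one (reass H) \<in> carrier H4"
    "?N (reass H) \<in> carrier H4" "comult_first (reass H) \<in> carrier H4" "pure k H H3 \<one>\<^bsub>H\<^esub> (reass H) \<in> carrier H4"
    using lin_maps_closed[OF times_one_lin] lin_maps_closed[OF comult_first_lin]
    by (simp_all add: tensor_map_closed[OF reass_closed(1) lin_maps_id])
  have "?E (pure k H H3 \<one>\<^bsub>H\<^esub> (reass H) \<otimes>\<^bsub>H4\<^esub> tensor_map k H H3 id inner_comult (reass H) \<otimes>\<^bsub>H4\<^esub> times_one (reass H))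
      = ?E (?N (reass H) \<otimes>\<^bsub>H4\<^esub> comult_first (reass H))"
    using pentagon by (simp only: inner_comult_def times_one_def comult_first_def)
  hence "pure k H H3 \<one>\<^bsub>H\<^esub> (slot1 (reass H)) \<otimes>\<^bsub>H4\<^esub> ?j (reass H) \<otimes>\<^bsub>H4\<^esub> \<one>\<^bsub>H4\<^esub> = \<one>\<^bsub>H4\<^esub> \<otimes>\<^bsub>H4\<^esub> ?j (reass H)"
    using c 1 2 3 4 k_algebraD(5)[OF H_alg(3)]
    by (simp add: alg_mapsD(2)[OF E] slot2_reass H_ops_one del: tensor_mult_pure)
  moreover have cl: "pure k H H3 \<one>\<^bsub>H\<^esub> (slot1 (reass H)) \<in> carrier H4" "?j (reass H) \<in> carrier H4" "?j (inv\<^bsub>H3\<^esub> reass H) \<in> carrier H4"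
    using alg_mapsD(4)[OF j] alg_mapsD(4)[OF slot_alg(1)] by simp_all
  ultimately have "pure k H H3 \<one>\<^bsub>H\<^esub> (slot1 (reass H)) \<otimes>\<^bsub>H4\<^esub> ?j (reass H) = ?j (reass H)"
    by (simp add: k_algebraD[OF H_alg(3)])
  hence "pure k H H3 \<one>\<^bsub>H\<^esub> (slot1 (reass H)) \<otimes>\<^bsub>H4\<^esub> (?j (reass H) \<otimes>\<^bsub>H4\<^esub> ?j (inv\<^bsub>H3\<^esub> reass H)) = ?j (reass H) \<otimes>\<^bsub>H4\<^esub> ?j (inv\<^bsub>H3\<^esub> reass H)"
    using cl by (simp add: k_algebraD(7)[OF H_alg(3), symmetric])
  moreover have "?j (reass H) \<otimes>\<^bsub>H4\<^esub> ?j (inv\<^bsub>H3\<^esub> reass H) = \<one>\<^bsub>H4\<^esub>"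
    using alg_mapsD(2,3)[OF j] reass_Units k_algebraD(4)[OF H_alg(2)] by (metis monoid.Units_r_inv reass_closed)
  ultimately have "pure k H H3 \<one>\<^bsub>H\<^esub> (slot1 (reass H)) = \<one>\<^bsub>H4\<^esub>"
    using cl by (simp add: k_algebraD[OF H_alg(3)])
  hence "pure k H H3 \<one>\<^bsub>H\<^esub> (slot1 (reass H)) = pure k H H3 \<one>\<^bsub>H\<^esub> \<one>\<^bsub>H3\<^esub>"
    by (simp only: tensor_one)
  \<comment> \<open>The counit on the first leg strips the leading factor 1, since \<epsilon>(1) =
    1.\<close>
  hence "lunit H3 (tensor_map k (base_space k) H3 (counit H) id (pure k H H3 \<one>\<^bsub>H\<^esub> (slot1 (reass H))))
      = lunit H3 (tensor_map k (base_space k) H3 (counit H) id (pure k H H3 \<one>\<^bsub>H\<^esub> \<one>\<^bsub>H3\<^esub>))" by simp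
  thus ?thesis
    using alg_mapsD(4)[OF slot_alg(1)] by (simp add: k_algebraD[OF H_alg(2)] module.smult_one)
qed

text \<open>The mirror image, with the counit on the third leg of the pentagon. Now 1 \<otimes>
  \<Phi> and the factor in which \<Delta> hits the first leg become 1, and X^1 \<otimes> X^2
  \<otimes> 1 \<otimes> X^3 cancels on the left, leaving that \<open>slot3\<close>(\<Phi>) \<otimes>
  1 is the unit.\<close>

lemma slot3_reass: "slot3 (reass H) = \<one>\<^bsub>H3\<^esub>"
proof -
  let ?E = "tensor_map k H H3 (\<lambda>x. x) slot2"
  let ?j = "tensor_map k H H3 (\<lambda>x. x) (tensor_map k H H2 (\<lambda>x. x) (\<lambda>t. pure k H H \<one>\<^bsub>H\<^esub> t))"
  let ?N = "tensor_map k H H3 id (tensor_map k H H2 id (comult H))"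
  let ?r = "\<lambda>t. runit H (tensor_map k H (base_space k) (\<lambda>x. x) (counit H) t)"
  let ?T = "tensor_map k H H2 (\<lambda>x. x) (tensor_map k H H (\<lambda>x. x) ?r)"
  have r [simp, lin]: "?r \<in> lin_maps k H2 H" by (rule lin | simp)+
  have E: "?E \<in> alg_maps k H4 H4" by (intro alg_maps_tensor_map slot_alg alg_maps_ident; simp)
  have j: "?j \<in> alg_maps k H3 H4"
    by (rule alg_maps_tensor_map alg_maps_pure_one alg_maps_ident k_algebra_tensor alg_H)+
  have 1: "\<forall>s\<in>carrier H3. ?E (tensor_map k H H3 id inner_comult s) = ?j s"
    by (rule tensor_extI_right; (assumption | rule lin tensor_map_lin | simp add: rebr_comult_counit)+)
  have 2: "\<forall>s\<in>carrier H3. ?E (times_one s) = times_one (slot3 s)"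
    by (rule tensor_extI_right; (assumption | rule lin tensor_map_lin | simp)+)
  have 3: "\<forall>s\<in>carrier H3. ?E (?N s) = ?j s"
    by (rule tensor_extI_right; (assumption | rule lin tensor_map_lin | simp add: comult_counit_left)+)
  have 4: "\<forall>s\<in>carrier H3. ?E (comult_first s) = comult_first (slot2 s)"
  proof (rule tensor_extI_right)
    fix x y z assume xyz: "x \<in> carrier H" "y \<in> carrier H" "z \<in> carrier H"
    have "\<forall>d\<in>carrier H2. ?E (rebr k H H H2 (pure k H2 H2 d (pure k H H y z)))
        = rebr k H H H2 (pure k H2 H2 d (pure k H H (counit_unit y) z))"
      by (rule tensor_extI; (assumption | rule lin tensor_map_lin xyz | simp add: xyz)+)
    thus "?E (comult_first (pure k H H2 x (pure k H H y z))) = comult_first (slot2 (pure k H H2 x (pure k H H y z)))"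
      using xyz by simp
  qed (assumption | rule lin tensor_map_lin | simp)+
  have c: "tensor_map k H H3 id inner_comult (reass H) \<in> carrier H4" "times_one (reass H) \<in> carrier H4"
    "?N (reass H) \<in> carrier H4" "comult_first (reass H) \<in> carrier H4" "pure k H H3 \<one>\<^bsub>H\<^esub> (reass H) \<in> carrier H4"
    using lin_maps_closed[OF times_one_lin] lin_maps_closed[OF comult_first_lin]
    by (simp_all add: tensor_map_closed[OF reass_closed(1) lin_maps_id])
  have "?E (pure k H H3 \<one>\<^bsub>H\<^esub> (reass H) \<otimes>\<^bsub>H4\<^esub> tensor_map k H H3 id inner_comult (reass H) \<otimes>\<^bsub>H4\<^esub> times_one (reass H))
      = ?E (?N (reass H) \<otimes>\<^bsub>H4\<^esub> comult_first (reass H))"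
    using pentagon by (simp only: inner_comult_def times_one_def comult_first_def)
  hence "\<one>\<^bsub>H4\<^esub> \<otimes>\<^bsub>H4\<^esub> ?j (reass H) \<otimes>\<^bsub>H4\<^esub> times_one (slot3 (reass H)) = ?j (reass H) \<otimes>\<^bsub>H4\<^esub> \<one>\<^bsub>H4\<^esub>"
    using c 1 2 3 4 k_algebraD(5)[OF H_alg(3)]
    by (simp add: alg_mapsD(2)[OF E] slot2_reass H_ops_one tensor_one[of k H H3, symmetric] del: tensor_mult_pure)
  moreover have cl: "times_one (slot3 (reass H)) \<in> carrier H4" "?j (reass H) \<in> carrier H4" "?j (inv\<^bsub>H3\<^esub> reass H) \<in> carrier H4"
    using alg_mapsD(4)[OF j] alg_mapsD(4)[OF slot_alg(3)] lin_maps_closed[OF times_one_lin] by simp_all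
  ultimately have "?j (reass H) \<otimes>\<^bsub>H4\<^esub> times_one (slot3 (reass H)) = ?j (reass H)"
    by (simp add: k_algebraD[OF H_alg(3)])
  hence "(?j (inv\<^bsub>H3\<^esub> reass H) \<otimes>\<^bsub>H4\<^esub> ?j (reass H)) \<otimes>\<^bsub>H4\<^esub> times_one (slot3 (reass H)) = ?j (inv\<^bsub>H3\<^esub> reass H) \<otimes>\<^bsub>H4\<^esub> ?j (reass H)"
    using cl by (simp add: k_algebraD(7)[OF H_alg(3)])
  moreover have "?j (inv\<^bsub>H3\<^esub> reass H) \<otimes>\<^bsub>H4\<^esub> ?j (reass H) = \<one>\<^bsub>H4\<^esub>"
    using alg_mapsD(2,3)[OF j] reass_Units k_algebraD(4)[OF H_alg(2)] by (metis monoid.Units_l_inv reass_closed)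
  ultimately have "times_one (slot3 (reass H)) = \<one>\<^bsub>H4\<^esub>"
    using cl by (simp add: k_algebraD[OF H_alg(3)])
  \<comment> \<open>\<open>?T\<close> applies the counit to the fourth leg, which makes it a left
    inverse of \<open>times_one\<close>.\<close>
  hence "?T (times_one (slot3 (reass H))) = ?T \<one>\<^bsub>H4\<^esub>" by simp
  moreover have "?T \<one>\<^bsub>H4\<^esub> = \<one>\<^bsub>H3\<^esub>" by (simp add: tensor_one module.smult_one)
  moreover have "\<forall>s\<in>carrier H3. ?T (times_one s) = s"
    by (rule tensor_extI_right; (assumption | rule lin tensor_map_lin | simp add: module.smult_one)+)
  ultimately show ?thesis using alg_mapsD(4)[OF slot_alg(3)] by simp
qed

subsection \<open>Left modules\<close>

lemma hmoduleD:
  assumes "hmodule k H M"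
  shows "module k M" "lact M \<in> bilin_maps k H M M" "\<And>m. m \<in> carrier M \<Longrightarrow> lact M \<one>\<^bsub>H\<^esub> m = m"
    "\<And>h h' m. h \<in> carrier H \<Longrightarrow> h' \<in> carrier H \<Longrightarrow> m \<in> carrier M \<Longrightarrow> lact M (h \<otimes>\<^bsub>H\<^esub> h') m = lact M h (lact M h' m)"
    "\<And>h m. h \<in> carrier H \<Longrightarrow> m \<in> carrier M \<Longrightarrow> lact M h m \<in> carrier M"
  using assms by (auto simp: hmodule_def left_action_def intro: bilin_maps_closed)

lemma hmodule_htensor:
  assumes M: "hmodule k H M" and N: "hmodule k H N"
  shows "hmodule k H (htensor k H M N)"
proof -
  note m = hmoduleD(1)[OF M] hmoduleD(1)[OF N] and b = hmoduleD(2)[OF M] hmoduleD(2)[OF N]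
  note tb = tensor_act_bilin[OF b mod_H mod_H m]
  have "(\<lambda>h. tensor_act k M N (lact M) (lact N) (comult H h)) \<in> bilin_maps k H (tensor k M N) (tensor k M N)"
    by (rule bilin_mapsI) (simp_all add: bilin_maps_right[OF tb] bilin_maps_comp_left[OF tb comult_lin])
  moreover have "tensor_act k M N (lact M) (lact N) \<one>\<^bsub>H2\<^esub> t = t" if "t \<in> carrier (tensor k M N)" for t
    by (rule tensor_act_one[OF b alg_H alg_H m]) (simp_all add: hmoduleD[OF M] hmoduleD[OF N] that)
  moreover have "tensor_act k M N (lact M) (lact N) (s \<otimes>\<^bsub>H2\<^esub> s') t
      = tensor_act k M N (lact M) (lact N) s (tensor_act k M N (lact M) (lact N) s' t)"
    if "t \<in> carrier (tensor k M N)" "s \<in> carrier H2" "s' \<in> carrier H2" for s s' t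
    by (rule tensor_act_mult_left[OF b alg_H alg_H m]) (simp_all add: hmoduleD[OF M] hmoduleD[OF N] that)
  ultimately show ?thesis using m
    by (simp add: hmodule_def left_action_def alg_mapsD(2,3)[OF comult_alg])
qed

definition trivial_module :: "('k, 'h, 'v, 'e) hmod_scheme \<Rightarrow> bool" where
  "trivial_module V \<longleftrightarrow> (\<forall>h\<in>carrier H. \<forall>v\<in>carrier V. lact V h v = counit H h \<odot>\<^bsub>V\<^esub> v)"

text \<open>The element \<epsilon>(h)1 acts as the scalar \<epsilon>(h), and on a trivial module so
  does h. Hence \<open>counit_unit\<close> may be inserted at any leg that acts on a trivial
  factor.\<close>

lemma lact_counit_unit:
  assumes V: "hmodule k H V" "trivial_module V" and hv: "h \<in> carrier H" "v \<in> carrier V"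
  shows "lact V (counit_unit h) v = lact V h v"
proof -
  have "counit H h \<in> carrier k" using hv by simp
  thus ?thesis
    using lin_maps_smult[OF bilin_maps_left[OF hmoduleD(2)[OF V(1)] hv(2)], of "counit H h" "\<one>\<^bsub>H\<^esub>"]
      V(2) hv hmoduleD(3)[OF V(1) hv(2)] by (simp add: counit_unit_def trivial_module_def)
qed

context
  fixes U :: "('k, 'h, 'u, 'd) hmod_scheme" and V :: "('k, 'h, 'v, 'e) hmod_scheme"
    and W :: "('k, 'h, 'w, 'f) hmod_scheme"
  assumes UVW: "hmodule k H U" "hmodule k H V" "hmodule k H W"
begin

lemmas UVW_module = UVW[THEN hmoduleD(1)] and UVW_bilin = UVW[THEN hmoduleD(2)]
  and UVW_one = UVW[THEN hmoduleD(3)]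

definition "act3 = tensor_act k U (tensor k V W) (lact U) (tensor_act k V W (lact V) (lact W))"

lemma act_VW_bilin: "tensor_act k V W (lact V) (lact W) \<in> bilin_maps k H2 (tensor k V W) (tensor k V W)"
  by (rule tensor_act_bilin UVW_bilin mod_H UVW_module)+

lemma act3_bilin: "act3 \<in> bilin_maps k H3 (tensor k U (tensor k V W)) (tensor k U (tensor k V W))"
  unfolding act3_def
  by (rule tensor_act_bilin act_VW_bilin UVW_bilin mod_H UVW_module module_tensor)+

lemma act3_pure:
  assumes "x \<in> carrier H" "y \<in> carrier H" "z \<in> carrier H" "u \<in> carrier U" "v \<in> carrier V" "w \<in> carrier W"
  shows "act3 (pure k H H2 x (pure k H H y z)) (pure k U (tensor k V W) u (pure k V W v w))
    = pure k U (tensor k V W) (lact U x u) (pure k V W (lact V y v) (lact W z w))"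
  using assms unfolding act3_def
  by (simp add: tensor_act_pure[OF UVW_bilin(1) act_VW_bilin] tensor_act_pure[OF UVW_bilin(2,3)] UVW_module)

lemma act3_one: "t \<in> carrier (tensor k U (tensor k V W)) \<Longrightarrow> act3 \<one>\<^bsub>H3\<^esub> t = t"
  unfolding act3_def
  by (rule tensor_act_one[OF UVW_bilin(1) act_VW_bilin])
    (simp_all add: UVW_module UVW_one tensor_act_one[OF UVW_bilin(2,3)])

lemma act3_ext:
  assumes p: "p \<in> lin_maps k H3 H3" and s: "s \<in> carrier H3" and t: "t \<in> carrier (tensor k U (tensor k V W))"
    and e: "\<And>x y z u v w. x \<in> carrier H \<Longrightarrow> y \<in> carrier H \<Longrightarrow> z \<in> carrier H \<Longrightarrow>
      u \<in> carrier U \<Longrightarrow> v \<in> carrier V \<Longrightarrow> w \<in> carrier W \<Longrightarrow>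
      act3 (p (pure k H H2 x (pure k H H y z))) (pure k U (tensor k V W) u (pure k V W v w))
      = act3 (pure k H H2 x (pure k H H y z)) (pure k U (tensor k V W) u (pure k V W v w))"
  shows "act3 (p s) t = act3 s t"
proof -
  have "\<forall>s\<in>carrier H3. act3 (p s) t = act3 s t"
  proof (rule tensor_extI_right)
    fix x y z assume xyz: "x \<in> carrier H" "y \<in> carrier H" "z \<in> carrier H"
    let ?s = "pure k H H2 x (pure k H H y z)"
    have c: "?s \<in> carrier H3" "p ?s \<in> carrier H3" using xyz lin_maps_closed[OF p] by simp_all
    have "\<forall>t\<in>carrier (tensor k U (tensor k V W)). act3 (p ?s) t = act3 ?s t"
      by (rule tensor_extI_right[OF UVW_module]) (rule bilin_maps_right[OF act3_bilin] c e xyz | assumption)+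
    thus "act3 (p ?s) t = act3 ?s t" using t by blast
  qed (rule bilin_maps_comp_left[OF act3_bilin] bilin_maps_left[OF act3_bilin] p t mod_H)+
  thus ?thesis using s by blast
qed

text \<open>Choose the slot of the trivial factor. The corresponding algebra map does not change how
  an element acts, and it sends \<Phi> and its inverse to 1.\<close>

lemma act3_trivial:
  assumes triv: "trivial_module U \<or> trivial_module V \<or> trivial_module W"
    and t: "t \<in> carrier (tensor k U (tensor k V W))"
  shows "act3 (reass H) t = t" "act3 (inv\<^bsub>H3\<^esub> reass H) t = t"
proof -
  have 1: "p \<in> alg_maps k H3 H3 \<Longrightarrow> p (reass H) = \<one>\<^bsub>H3\<^esub> \<Longrightarrow>
      (\<And>x y z u v w. x \<in> carrier H \<Longrightarrow> y \<in> carrier H \<Longrightarrow> z \<in> carrier H \<Longrightarrow>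
      u \<in> carrier U \<Longrightarrow> v \<in> carrier V \<Longrightarrow> w \<in> carrier W \<Longrightarrow>
      act3 (p (pure k H H2 x (pure k H H y z))) (pure k U (tensor k V W) u (pure k V W v w))
      = act3 (pure k H H2 x (pure k H H y z)) (pure k U (tensor k V W) u (pure k V W v w)))
      \<Longrightarrow> act3 (reass H) t = t \<and> act3 (inv\<^bsub>H3\<^esub> reass H) t = t" for p
    using act3_ext[of p, OF alg_mapsD(1) reass_closed(1) t] act3_ext[of p, OF alg_mapsD(1) reass_closed(2) t]
      alg_maps_inverse[OF _ H_alg(2) H_alg(2) reass_Units, of p] act3_one[OF t] by simp
  have "act3 (reass H) t = t \<and> act3 (inv\<^bsub>H3\<^esub> reass H) t = t"
    using triv
  proof (elim disjE)
    assume "trivial_module U"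
    thus ?thesis by (intro 1[OF slot_alg(1) slot1_reass]) (simp add: act3_pure lact_counit_unit[OF UVW(1)])
  next
    assume "trivial_module V"
    thus ?thesis by (intro 1[OF slot_alg(2) slot2_reass]) (simp add: act3_pure lact_counit_unit[OF UVW(2)])
  next
    assume "trivial_module W"
    thus ?thesis by (intro 1[OF slot_alg(3) slot3_reass]) (simp add: act3_pure lact_counit_unit[OF UVW(3)])
  qed
  thus "act3 (reass H) t = t" "act3 (inv\<^bsub>H3\<^esub> reass H) t = t" by auto
qed

lemma hassoc_trivial:
  assumes triv: "trivial_module U \<or> trivial_module V \<or> trivial_module W"
  shows "t \<in> carrier (tensor k (tensor k U V) W) \<Longrightarrow> hassoc k H U V W t = rebr k U V W t"
    and "s \<in> carrier (tensor k U (tensor k V W)) \<Longrightarrow> hassoc_inv k H U V W s = rebr_inv k U V W s"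
  using act3_trivial[OF triv] rebr_closed[OF UVW_module] unfolding hassoc_def hassoc_inv_def act3_def by simp_all

end

end

lemma tensor_lift_cong:
  assumes "module k V" "module k W" "t \<in> carrier (tensor k V W)"
    and e: "\<And>v w. v \<in> carrier V \<Longrightarrow> w \<in> carrier W \<Longrightarrow> b v w = b' v w"
  shows "tensor_lift N b t = tensor_lift N b' t"
proof -
  have "formal V W xs \<Longrightarrow> foldr (\<lambda>(v, w) s. b v w \<oplus>\<^bsub>N\<^esub> s) xs z = foldr (\<lambda>(v, w) s. b' v w \<oplus>\<^bsub>N\<^esub> s) xs z" for xs z
    by (induction xs) (auto simp: e)
  thus ?thesis using tensor_rep(1)[OF assms(1-3)] by (simp add: tensor_lift_def)
qed

lemma bilin_maps_cong:
  assumes "b \<in> bilin_maps k U V W" "module k U" "module k V"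
    and "\<And>u v. u \<in> carrier U \<Longrightarrow> v \<in> carrier V \<Longrightarrow> b u v = b' u v"
  shows "b' \<in> bilin_maps k U V W"
  by (rule bilin_mapsI; rule lin_maps_cong[OF bilin_maps_right[OF assms(1)]] lin_maps_cong[OF bilin_maps_left[OF assms(1)]])
    (use assms in auto)

section \<open>The cowreath of a comodule algebra\<close>

locale comodule_setup = quasi_bialgebra_over k H for k :: "'k ring" and H :: "('k, 'h) quasi_bialg" +
  fixes A :: "('k, 'h, 'a) comod_alg" and C :: "('k, 'h, 'c) bimod_coalg"
  assumes comod_alg: "comodule_algebra k H A" and bimod_coalg: "bimodule_coalgebra k H C"
begin

abbreviation "AH \<equiv> tensor k A H"
abbreviation "AH2 \<equiv> tensor k A H2"
abbreviation "AH3 \<equiv> tensor k A H3"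
abbreviation "C2 \<equiv> tensor k C C"
abbreviation "C3 \<equiv> tensor k C C2"
abbreviation "AC \<equiv> tensor k A C"
abbreviation "AC2 \<equiv> tensor k A C2"
abbreviation "AC3 \<equiv> tensor k A C3"

lemma A_axioms:
  shows alg_A [simp, lin]: "k_algebra k A"
    and rho_alg: "rho A \<in> alg_maps k A AH"
    and reass_rho_Units: "reass_rho A \<in> Units AH2"
    and rho_coassoc: "\<And>a. a \<in> carrier A \<Longrightarrow> reass_rho A \<otimes>\<^bsub>AH2\<^esub> rebr k A H H (tensor_map k AH H (rho A) id (rho A a))
         = tensor_map k A H2 id (comult H) (rho A a) \<otimes>\<^bsub>AH2\<^esub> reass_rho A"
    and rho_pentagon: "pure k A H3 \<one>\<^bsub>A\<^esub> (reass H)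
        \<otimes>\<^bsub>AH3\<^esub> tensor_map k A H3 id (rebr k H H H \<circ> tensor_map k H2 H (comult H) id) (reass_rho A)
        \<otimes>\<^bsub>AH3\<^esub> tensor_map k A H3 id (rebr k H H H) (rebr k A H2 H (pure k AH2 H (reass_rho A) \<one>\<^bsub>H\<^esub>))
      = tensor_map k A H3 id (tensor_map k H H2 id (comult H)) (reass_rho A)
        \<otimes>\<^bsub>AH3\<^esub> rebr k A H H2 (tensor_map k AH H2 (rho A) id (reass_rho A))"
    and rho_counit: "\<And>a. a \<in> carrier A \<Longrightarrow> runit A (tensor_map k A (base_space k) id (counit H) (rho A a)) = a"
    and reass_rho_counit: "tensor_map k A H id (lunit H \<circ> tensor_map k (base_space k) H (counit H) id) (reass_rho A) = \<one>\<^bsub>AH\<^esub>"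
      "tensor_map k A H id (runit H \<circ> tensor_map k H (base_space k) id (counit H)) (reass_rho A) = \<one>\<^bsub>AH\<^esub>"
  using comod_alg unfolding comodule_algebra_def Let_def by blast+

lemmas A_simps [simp] = k_algebraD[OF alg_A]
lemmas mod_A [lin] = A_simps(1)
lemmas AH_alg [simp, lin] = k_algebra_tensor[OF alg_A alg_H] k_algebra_tensor[OF alg_A H_alg(1)] k_algebra_tensor[OF alg_A H_alg(2)]
lemmas rho_closed [simp, lin] = alg_mapsD(4)[OF rho_alg]
lemmas rho_lin [simp, lin] = alg_mapsD(1)[OF rho_alg]

lemma reass_rho_closed [simp, lin]: "reass_rho A \<in> carrier AH2"
  using reass_rho_Units k_algebraD(4)[of k AH2] by (auto simp: monoid.Units_closed)

text \<open>Right actions are written with the acting element first, as \<open>tensor_act\<close>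
  expects it. So \<open>RA1 s d\<close> is d s for the right A \<otimes> H-module A \<otimes> C, and
  similarly for \<open>RA2\<close> and \<open>RA3\<close>.\<close>

abbreviation "RA \<equiv> (\<lambda>b a. a \<otimes>\<^bsub>A\<^esub> b)"
abbreviation "RC \<equiv> (\<lambda>h c. ract C c h)"
abbreviation "RC2 \<equiv> tensor_act k C C RC RC"
abbreviation "RC3 \<equiv> tensor_act k C C2 RC RC2"
abbreviation "RA1 \<equiv> tensor_act k A C RA RC"
abbreviation "RA2 \<equiv> tensor_act k A C2 RA RC2"
abbreviation "RA3 \<equiv> tensor_act k A C3 RA RC3"
abbreviation "LC2 \<equiv> tensor_act k C C (lact C) (lact C)"
abbreviation "LC3 \<equiv> tensor_act k C C2 (lact C) LC2"

lemma hmodule_C [simp]: "hmodule k H C"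
  using bimod_coalg by (simp add: bimodule_coalgebra_def hbimodule_def)

lemmas C_simps [simp] = hmoduleD[OF hmodule_C]
lemmas mod_C [lin] = C_simps(1)

lemma RC_facts: "right_action k H C (ract C)"
  "\<And>h c g. h \<in> carrier H \<Longrightarrow> c \<in> carrier C \<Longrightarrow> g \<in> carrier H \<Longrightarrow> ract C (lact C h c) g = lact C h (ract C c g)"
  using bimod_coalg by (auto simp: bimodule_coalgebra_def hbimodule_def)

lemma RC_simps [simp]:
  shows "RC \<in> bilin_maps k H C C" "\<And>c. c \<in> carrier C \<Longrightarrow> ract C c \<one>\<^bsub>H\<^esub> = c"
    "\<And>c h. c \<in> carrier C \<Longrightarrow> h \<in> carrier H \<Longrightarrow> ract C c h \<in> carrier C"
    "\<And>c. c \<in> carrier C \<Longrightarrow> ract C c \<in> lin_maps k H C"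
  using RC_facts(1) by (auto simp: right_action_def bilin_maps_def lin_maps_closed)

lemma RC_mult: "c \<in> carrier C \<Longrightarrow> h \<in> carrier H \<Longrightarrow> g \<in> carrier H \<Longrightarrow> ract C c (h \<otimes>\<^bsub>H\<^esub> g) = ract C (ract C c h) g"
  using RC_facts(1) by (auto simp: right_action_def)

lemma RA_bilin [simp]: "RA \<in> bilin_maps k A A A"
  using A_simps(3) by (auto simp: bilin_maps_def)

lemma R_bilin [simp]:
  "RC2 \<in> bilin_maps k H2 C2 C2" "RC3 \<in> bilin_maps k H3 C3 C3" "RA1 \<in> bilin_maps k AH AC AC"
  "RA2 \<in> bilin_maps k AH2 AC2 AC2" "RA3 \<in> bilin_maps k AH3 AC3 AC3"
  "LC2 \<in> bilin_maps k H2 C2 C2" "LC3 \<in> bilin_maps k H3 C3 C3"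
  by (intro tensor_act_bilin; simp)+

lemmas R_lin [lin] = RA_bilin RC_simps(1) R_bilin C_simps(2)

lemma R_closed [simp, lin]:
  "\<And>s t. s \<in> carrier H2 \<Longrightarrow> t \<in> carrier C2 \<Longrightarrow> RC2 s t \<in> carrier C2"
  "\<And>s t. s \<in> carrier H3 \<Longrightarrow> t \<in> carrier C3 \<Longrightarrow> RC3 s t \<in> carrier C3"
  "\<And>s t. s \<in> carrier AH \<Longrightarrow> t \<in> carrier AC \<Longrightarrow> RA1 s t \<in> carrier AC"
  "\<And>s t. s \<in> carrier AH2 \<Longrightarrow> t \<in> carrier AC2 \<Longrightarrow> RA2 s t \<in> carrier AC2"
  "\<And>s t. s \<in> carrier AH3 \<Longrightarrow> t \<in> carrier AC3 \<Longrightarrow> RA3 s t \<in> carrier AC3"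
  "\<And>s t. s \<in> carrier H2 \<Longrightarrow> t \<in> carrier C2 \<Longrightarrow> LC2 s t \<in> carrier C2"
  "\<And>s t. s \<in> carrier H3 \<Longrightarrow> t \<in> carrier C3 \<Longrightarrow> LC3 s t \<in> carrier C3"
  by (rule R_bilin[THEN bilin_maps_closed]; assumption)+

lemma R_mult:
  "\<And>s s' t. s \<in> carrier H2 \<Longrightarrow> s' \<in> carrier H2 \<Longrightarrow> t \<in> carrier C2 \<Longrightarrow> RC2 (s \<otimes>\<^bsub>H2\<^esub> s') t = RC2 s' (RC2 s t)"
  "\<And>s s' t. s \<in> carrier H3 \<Longrightarrow> s' \<in> carrier H3 \<Longrightarrow> t \<in> carrier C3 \<Longrightarrow> RC3 (s \<otimes>\<^bsub>H3\<^esub> s') t = RC3 s' (RC3 s t)"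
  "\<And>s s' t. s \<in> carrier AH \<Longrightarrow> s' \<in> carrier AH \<Longrightarrow> t \<in> carrier AC \<Longrightarrow> RA1 (s \<otimes>\<^bsub>AH\<^esub> s') t = RA1 s' (RA1 s t)"
  "\<And>s s' t. s \<in> carrier AH2 \<Longrightarrow> s' \<in> carrier AH2 \<Longrightarrow> t \<in> carrier AC2 \<Longrightarrow> RA2 (s \<otimes>\<^bsub>AH2\<^esub> s') t = RA2 s' (RA2 s t)"
  "\<And>s s' t. s \<in> carrier AH3 \<Longrightarrow> s' \<in> carrier AH3 \<Longrightarrow> t \<in> carrier AC3 \<Longrightarrow> RA3 (s \<otimes>\<^bsub>AH3\<^esub> s') t = RA3 s' (RA3 s t)"
proof -
  show 1: "\<And>s s' t. s \<in> carrier H2 \<Longrightarrow> s' \<in> carrier H2 \<Longrightarrow> t \<in> carrier C2 \<Longrightarrow> RC2 (s \<otimes>\<^bsub>H2\<^esub> s') t = RC2 s' (RC2 s t)"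
    by (rule tensor_act_mult_right[OF RC_simps(1) RC_simps(1)]) (simp_all add: RC_mult)
  show 2: "\<And>s s' t. s \<in> carrier H3 \<Longrightarrow> s' \<in> carrier H3 \<Longrightarrow> t \<in> carrier C3 \<Longrightarrow> RC3 (s \<otimes>\<^bsub>H3\<^esub> s') t = RC3 s' (RC3 s t)"
    by (rule tensor_act_mult_right[OF RC_simps(1) R_bilin(1)]) (simp_all add: RC_mult 1)
  show "\<And>s s' t. s \<in> carrier AH \<Longrightarrow> s' \<in> carrier AH \<Longrightarrow> t \<in> carrier AC \<Longrightarrow> RA1 (s \<otimes>\<^bsub>AH\<^esub> s') t = RA1 s' (RA1 s t)"
    by (rule tensor_act_mult_right[OF RA_bilin RC_simps(1)]) (simp_all add: RC_mult)
  show "\<And>s s' t. s \<in> carrier AH2 \<Longrightarrow> s' \<in> carrier AH2 \<Longrightarrow> t \<in> carrier AC2 \<Longrightarrow> RA2 (s \<otimes>\<^bsub>AH2\<^esub> s') t = RA2 s' (RA2 s t)"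
    by (rule tensor_act_mult_right[OF RA_bilin R_bilin(1)]) (simp_all add: 1)
  show "\<And>s s' t. s \<in> carrier AH3 \<Longrightarrow> s' \<in> carrier AH3 \<Longrightarrow> t \<in> carrier AC3 \<Longrightarrow> RA3 (s \<otimes>\<^bsub>AH3\<^esub> s') t = RA3 s' (RA3 s t)"
    by (rule tensor_act_mult_right[OF RA_bilin R_bilin(2)]) (simp_all add: 2)
qed

lemma RC_one:
  "t \<in> carrier C2 \<Longrightarrow> RC2 \<one>\<^bsub>H2\<^esub> t = t" "s \<in> carrier C3 \<Longrightarrow> RC3 \<one>\<^bsub>H3\<^esub> s = s"
proof -
  show 1: "RC2 \<one>\<^bsub>H2\<^esub> t = t" if "t \<in> carrier C2" for t
    by (rule tensor_act_one[OF RC_simps(1) RC_simps(1)]) (simp_all add: that)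
  show "s \<in> carrier C3 \<Longrightarrow> RC3 \<one>\<^bsub>H3\<^esub> s = s"
    by (rule tensor_act_one[OF RC_simps(1) R_bilin(1)]) (simp_all add: 1)
qed

lemma LR_commute:
  "\<And>s s' t. s \<in> carrier H2 \<Longrightarrow> s' \<in> carrier H2 \<Longrightarrow> t \<in> carrier C2 \<Longrightarrow> LC2 s (RC2 s' t) = RC2 s' (LC2 s t)"
  "\<And>s s' t. s \<in> carrier H3 \<Longrightarrow> s' \<in> carrier H3 \<Longrightarrow> t \<in> carrier C3 \<Longrightarrow> LC3 s (RC3 s' t) = RC3 s' (LC3 s t)"
proof -
  show 1: "\<And>s s' t. s \<in> carrier H2 \<Longrightarrow> s' \<in> carrier H2 \<Longrightarrow> t \<in> carrier C2 \<Longrightarrow> LC2 s (RC2 s' t) = RC2 s' (LC2 s t)"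
    by (rule tensor_act_commute[OF C_simps(2) C_simps(2) RC_simps(1) RC_simps(1)]) (simp_all add: RC_facts)
  show "\<And>s s' t. s \<in> carrier H3 \<Longrightarrow> s' \<in> carrier H3 \<Longrightarrow> t \<in> carrier C3 \<Longrightarrow> LC3 s (RC3 s' t) = RC3 s' (LC3 s t)"
    by (rule tensor_act_commute[OF C_simps(2) R_bilin(6) RC_simps(1) R_bilin(1)]) (simp_all add: RC_facts 1)
qed

lemma C_axioms:
  shows ccomult_lin [simp, lin]: "ccomult C \<in> lin_maps k C C2"
    and ccounit_lin [simp, lin]: "ccounit C \<in> lin_maps k C (base_space k)"
    and ccomult_lact: "\<And>h c. h \<in> carrier H \<Longrightarrow> c \<in> carrier C \<Longrightarrow> ccomult C (lact C h c) = LC2 (comult H h) (ccomult C c)"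
    and ccomult_ract: "\<And>h c. h \<in> carrier H \<Longrightarrow> c \<in> carrier C \<Longrightarrow> ccomult C (ract C c h) = RC2 (comult H h) (ccomult C c)"
    and ccounit_lact: "\<And>h c. h \<in> carrier H \<Longrightarrow> c \<in> carrier C \<Longrightarrow> ccounit C (lact C h c) = counit H h \<otimes>\<^bsub>k\<^esub> ccounit C c"
    and ccounit_ract: "\<And>h c. h \<in> carrier H \<Longrightarrow> c \<in> carrier C \<Longrightarrow> ccounit C (ract C c h) = ccounit C c \<otimes>\<^bsub>k\<^esub> counit H h"
    and ccoassoc: "\<And>c. c \<in> carrier C \<Longrightarrow> RC3 (inv\<^bsub>H3\<^esub> reass H) (LC3 (reass H) (rebr k C C C (tensor_map k C2 C (ccomult C) id (ccomult C c))))
        = tensor_map k C C2 id (ccomult C) (ccomult C c)"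
    and ccounit_ccomult: "\<And>c. c \<in> carrier C \<Longrightarrow> lunit C (tensor_map k (base_space k) C (ccounit C) id (ccomult C c)) = c"
         "\<And>c. c \<in> carrier C \<Longrightarrow> runit C (tensor_map k C (base_space k) id (ccounit C) (ccomult C c)) = c"
proof -
  have b: "ccomult C \<in> hbimod_hom k H C (bitensor k H C C)" "ccounit C \<in> hbimod_hom k H C (biunit k H)"
    "\<forall>c\<in>carrier C. biassoc k H C C C (tensor_map k (tensor k C C) C (ccomult C) id (ccomult C c))
        = tensor_map k C (tensor k C C) id (ccomult C) (ccomult C c)"
     "\<forall>c\<in>carrier C. lunit C (tensor_map k (base_space k) C (ccounit C) id (ccomult C c)) = c \<and>
        runit C (tensor_map k C (base_space k) id (ccounit C) (ccomult C c)) = c"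
    using bimod_coalg unfolding bimodule_coalgebra_def by blast+
  have s: "same_module (bitensor k H C C) C2" "same_module (biunit k H) (base_space k)"
    by (simp_all add: same_module_def bitensor_def biunit_def hunit_def htensor_def module.extend_def
        hmod.extend_def hmod.fields_def hbimod.fields_def)
  have l: "lact (bitensor k H C C) h = LC2 (comult H h)" "ract (bitensor k H C C) t h = RC2 (comult H h) t"
    "lact (biunit k H) h x = counit H h \<otimes>\<^bsub>k\<^esub> x" "ract (biunit k H) x h = x \<otimes>\<^bsub>k\<^esub> counit H h" for h t x
    by (simp_all add: bitensor_def biunit_def hunit_def htensor_def module.extend_def
        hmod.extend_def hmod.fields_def hbimod.fields_def)
  note e = lin_maps_same[OF same_module_refl same_module_refl s(1)] lin_maps_same[OF same_module_refl same_module_refl s(2)]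
  show "ccomult C \<in> lin_maps k C C2" "ccounit C \<in> lin_maps k C (base_space k)"
    using b(1,2) unfolding hbimod_hom_def hmod_hom_def e by blast+
  show "\<And>h c. h \<in> carrier H \<Longrightarrow> c \<in> carrier C \<Longrightarrow> ccomult C (lact C h c) = LC2 (comult H h) (ccomult C c)"
    "\<And>h c. h \<in> carrier H \<Longrightarrow> c \<in> carrier C \<Longrightarrow> ccomult C (ract C c h) = RC2 (comult H h) (ccomult C c)"
    "\<And>h c. h \<in> carrier H \<Longrightarrow> c \<in> carrier C \<Longrightarrow> ccounit C (lact C h c) = counit H h \<otimes>\<^bsub>k\<^esub> ccounit C c"
    "\<And>h c. h \<in> carrier H \<Longrightarrow> c \<in> carrier C \<Longrightarrow> ccounit C (ract C c h) = ccounit C c \<otimes>\<^bsub>k\<^esub> counit H h"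
    using b(1,2) unfolding hbimod_hom_def hmod_hom_def by (simp_all add: l)
  show "\<And>c. c \<in> carrier C \<Longrightarrow> RC3 (inv\<^bsub>H3\<^esub> reass H) (LC3 (reass H) (rebr k C C C (tensor_map k C2 C (ccomult C) id (ccomult C c))))
        = tensor_map k C C2 id (ccomult C) (ccomult C c)"
    using b(3) by (simp add: biassoc_def hassoc_def)
  show "\<And>c. c \<in> carrier C \<Longrightarrow> lunit C (tensor_map k (base_space k) C (ccounit C) id (ccomult C c)) = c"
         "\<And>c. c \<in> carrier C \<Longrightarrow> runit C (tensor_map k C (base_space k) id (ccounit C) (ccomult C c)) = c"
    using b(4) by auto
qed

lemmas C_comult_closed [simp, lin] = lin_maps_closed[OF ccomult_lin]
lemmas C_counit_closed [simp] = lin_maps_closed[OF ccounit_lin, simplified]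
lemmas smult_closed_A [simp] = module.smult_closed[OF A_simps(1)] module.smult_closed[OF C_simps(1)]

text \<open>Acting with \<Phi> from the right undoes the inverse of \<Phi> in the coassociativity
  axiom of C. The right action of \<Phi> obtained here is the one that the factor 1 \<otimes> \<Phi>
  of the comodule pentagon produces.\<close>

lemma C_coassoc:
  assumes c: "c \<in> carrier C"
  shows "LC3 (reass H) (rebr k C C C (tensor_map k C2 C (ccomult C) id (ccomult C c)))
    = RC3 (reass H) (tensor_map k C C2 id (ccomult C) (ccomult C c))"
proof -
  let ?z = "LC3 (reass H) (rebr k C C C (tensor_map k C2 C (ccomult C) id (ccomult C c)))"
  have z: "?z \<in> carrier C3"
    using c by (intro R_closed rebr_closed tensor_map_closed[of _ k C C]) simp_all
  have "RC3 (reass H) (RC3 (inv\<^bsub>H3\<^esub> reass H) w) = w" if w: "w \<in> carrier C3" for w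
  proof -
    have "RC3 (reass H) (RC3 (inv\<^bsub>H3\<^esub> reass H) w) = RC3 (inv\<^bsub>H3\<^esub> reass H \<otimes>\<^bsub>H3\<^esub> reass H) w"
      by (simp add: R_mult w)
    also have "inv\<^bsub>H3\<^esub> reass H \<otimes>\<^bsub>H3\<^esub> reass H = \<one>\<^bsub>H3\<^esub>"
      using reass_Units k_algebraD(4)[OF H_alg(2)] by (rule monoid.Units_l_inv[rotated])
    finally show ?thesis by (simp add: RC_one w)
  qed
  from this[OF z] show ?thesis unfolding ccoassoc[OF c] by (rule HOL.sym)
qed

end

section \<open>Diagonal actions with a trivial factor\<close>

context quasi_bialgebra_over
begin

text \<open>On a trivial first factor x \<otimes> y acts as 1 \<otimes> \<epsilon>(x)y, so
  \<Delta>(h) acts as 1 \<otimes> h by the counit axiom; symmetrically for a trivial second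
  factor.\<close>

lemma lact_trivial:
  assumes U: "hmodule k H U" and V: "hmodule k H V" and h: "h \<in> carrier H" and t: "t \<in> carrier (tensor k U V)"
  shows "trivial_module U \<Longrightarrow> tensor_act k U V (lact U) (lact V) (comult H h) t = tensor_map k U V id (lact V h) t"
    and "trivial_module V \<Longrightarrow> tensor_act k U V (lact U) (lact V) (comult H h) t = tensor_map k U V (lact U h) id t"
proof -
  note m [simp, lin] = hmoduleD(1)[OF U] hmoduleD(1)[OF V] and b [simp, lin] = hmoduleD(2)[OF U] hmoduleD(2)[OF V]
  note [simp] = hmoduleD(3,5)[OF U] hmoduleD(3,5)[OF V] tensor_act_pure bilin_maps_right[OF b(1)] bilin_maps_right[OF b(2)]
    module.smult_one[OF m(1)] module.smult_one[OF m(2)] module.smult_closed[OF m(1)] module.smult_closed[OF m(2)]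
  note sm = lin_maps_smult[OF bilin_maps_left[OF b(1)]] lin_maps_smult[OF bilin_maps_left[OF b(2)]]
  let ?a = "tensor_act k U V (lact U) (lact V)"
  let ?l = "\<lambda>s. lunit H (tensor_map k (base_space k) H (counit H) id s)"
  let ?r = "\<lambda>s. runit H (tensor_map k H (base_space k) id (counit H) s)"
  {
    assume tr: "trivial_module U"
    have "\<forall>s\<in>carrier H2. ?a s t = ?a (pure k H H \<one>\<^bsub>H\<^esub> (?l s)) t"
    proof (rule tensor_extI)
      fix x y assume xy: "x \<in> carrier H" "y \<in> carrier H"
      have l [simp]: "?l (pure k H H x y) = counit H x \<odot>\<^bsub>H\<^esub> y" using xy by simp
      have "\<forall>t\<in>carrier (tensor k U V). ?a (pure k H H x y) t = ?a (pure k H H \<one>\<^bsub>H\<^esub> (?l (pure k H H x y))) t"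
        unfolding l
        by (rule tensor_extI)
          (assumption | rule lin xy | (simp add: xy tr[unfolded trivial_module_def] sm, (simp add: xy pure_smult_left pure_smult_right)?))+
      thus "?a (pure k H H x y) t = ?a (pure k H H \<one>\<^bsub>H\<^esub> (?l (pure k H H x y))) t" using t by blast
    qed (assumption | rule lin t | simp)+
    hence "?a (comult H h) t = ?a (pure k H H \<one>\<^bsub>H\<^esub> h) t" using h by (simp add: comult_counit)
    also have "\<dots> = tensor_map k U V (lact U \<one>\<^bsub>H\<^esub>) (lact V h) t"
      by (rule tensor_act_pure_left) (simp_all add: h t)
    also have "\<dots> = tensor_map k U V id (lact V h) t"
      by (rule tensor_map_cong[OF bilin_maps_right[OF b(1)] bilin_maps_right[OF b(2)] m m t])
        (simp_all add: h hmoduleD(3)[OF U] hmoduleD(3)[OF V])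
    finally show "?a (comult H h) t = tensor_map k U V id (lact V h) t" .
  }
  {
    assume tr: "trivial_module V"
    have "\<forall>s\<in>carrier H2. ?a s t = ?a (pure k H H (?r s) \<one>\<^bsub>H\<^esub>) t"
    proof (rule tensor_extI)
      fix x y assume xy: "x \<in> carrier H" "y \<in> carrier H"
      have l [simp]: "?r (pure k H H x y) = counit H y \<odot>\<^bsub>H\<^esub> x" using xy by simp
      have "\<forall>t\<in>carrier (tensor k U V). ?a (pure k H H x y) t = ?a (pure k H H (?r (pure k H H x y)) \<one>\<^bsub>H\<^esub>) t"
        unfolding l
        by (rule tensor_extI)
          (assumption | rule lin xy | (simp add: xy tr[unfolded trivial_module_def] sm, (simp add: xy pure_smult_left pure_smult_right)?))+
      thus "?a (pure k H H x y) t = ?a (pure k H H (?r (pure k H H x y)) \<one>\<^bsub>H\<^esub>) t" using t by blast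
    qed (assumption | rule lin t | simp)+
    hence "?a (comult H h) t = ?a (pure k H H h \<one>\<^bsub>H\<^esub>) t" using h by (simp add: comult_counit)
    also have "\<dots> = tensor_map k U V (lact U h) (lact V \<one>\<^bsub>H\<^esub>) t"
      by (rule tensor_act_pure_left) (simp_all add: h t)
    also have "\<dots> = tensor_map k U V (lact U h) id t"
      by (rule tensor_map_cong[OF bilin_maps_right[OF b(1)] bilin_maps_right[OF b(2)] m m t])
        (simp_all add: h hmoduleD(3)[OF U] hmoduleD(3)[OF V])
    finally show "?a (comult H h) t = tensor_map k U V (lact U h) id t" .
  }
qed

end

section \<open>The structure maps of the cowreath as right actions\<close>

context comodule_setup
begin

lemmas act_pure [simp] = tensor_act_pure

abbreviation "psi \<equiv> wpsi (comodule_cowreath k H A C)"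
abbreviation "del \<equiv> wdelta (comodule_cowreath k H A C)"
abbreviation "cou \<equiv> wcounit (comodule_cowreath k H A C)"
abbreviation "mA \<equiv> tensor_lift A (monoid.mult A)"

lemma psi_inner:
  assumes "c \<in> carrier C" "r \<in> carrier AH"
  shows "tensor_lift AC (\<lambda>a0 a1. pure k A C a0 (ract C c a1)) r = RA1 r (pure k A C \<one>\<^bsub>A\<^esub> c)"
proof -
  have "\<forall>r\<in>carrier AH. tensor_map k A C (\<lambda>x. x) (ract C c) r = RA1 r (pure k A C \<one>\<^bsub>A\<^esub> c)"
    by (rule tensor_extI) (assumption | rule lin | simp add: assms)+
  thus ?thesis using assms by (simp add: tensor_map_def)
qed

lemma psi_bilin: "(\<lambda>c a. RA1 (rho A a) (pure k A C \<one>\<^bsub>A\<^esub> c)) \<in> bilin_maps k C A AC"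
  by (rule bilin_mapsI) (assumption | rule lin | simp)+

lemma psi_facts:
  shows psi_lin [simp, lin]: "psi \<in> lin_maps k (tensor k C A) AC"
    and psi_pure [simp]: "c \<in> carrier C \<Longrightarrow> a \<in> carrier A \<Longrightarrow> psi (pure k C A c a) = RA1 (rho A a) (pure k A C \<one>\<^bsub>A\<^esub> c)"
proof -
  have b: "(\<lambda>c a. tensor_lift AC (\<lambda>a0 a1. pure k A C a0 (ract C c a1)) (rho A a)) \<in> bilin_maps k C A AC"
    by (rule bilin_maps_cong[OF psi_bilin]) (simp_all add: psi_inner)
  show "psi \<in> lin_maps k (tensor k C A) AC"
    unfolding comodule_cowreath_def cowreath_data.select_convs by (rule tensor_lift_lin b | simp)+
  show "c \<in> carrier C \<Longrightarrow> a \<in> carrier A \<Longrightarrow> psi (pure k C A c a) = RA1 (rho A a) (pure k A C \<one>\<^bsub>A\<^esub> c)"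
    unfolding comodule_cowreath_def cowreath_data.select_convs
    by (subst tensor_lift_pure[OF _ _ b]) (simp_all add: psi_inner)
qed

lemmas psi_comp_lin [lin] = lin_maps_comp[OF psi_lin]
lemmas psi_closed [simp, lin] = lin_maps_closed[OF psi_lin]

lemma del_eq:
  assumes c: "c \<in> carrier C"
  shows "del c = RA2 (reass_rho A) (pure k A C2 \<one>\<^bsub>A\<^esub> (ccomult C c))"
proof -
  have l [simp, lin]: "(\<lambda>t. RC2 t (ccomult C c)) \<in> lin_maps k H2 C2"
    by (rule lin | simp add: c)+
  have "\<forall>s\<in>carrier AH2. tensor_map k A C2 (\<lambda>x. x) (\<lambda>t. RC2 t (ccomult C c)) s = RA2 s (pure k A C2 \<one>\<^bsub>A\<^esub> (ccomult C c))"
    by (rule tensor_extI) (assumption | rule lin | simp add: c)+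
  thus ?thesis by (simp add: tensor_map_def comodule_cowreath_def)
qed

lemma del_closed [simp, lin]: "c \<in> carrier C \<Longrightarrow> del c \<in> carrier AC2"
  by (simp add: del_eq)

lemma del_lin [simp, lin]: "del \<in> lin_maps k C AC2"
proof (rule lin_maps_cong[where f = "\<lambda>c. RA2 (reass_rho A) (pure k A C2 \<one>\<^bsub>A\<^esub> (ccomult C c))"])
  show "(\<lambda>c. RA2 (reass_rho A) (pure k A C2 \<one>\<^bsub>A\<^esub> (ccomult C c))) \<in> lin_maps k C AC2"
    by (rule lin | simp)+
qed (simp_all add: del_eq)

lemma cou_eq: "cou c = ccounit C c \<odot>\<^bsub>A\<^esub> \<one>\<^bsub>A\<^esub>"
  by (simp add: comodule_cowreath_def)

lemma cou_lin [simp, lin]: "cou \<in> lin_maps k C A"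
  unfolding cou_eq[abs_def]
  using bilin_maps_comp_left[OF smult_bilin[OF mod_A] ccounit_lin, of "\<one>\<^bsub>A\<^esub>"] by simp

lemma mA_facts:
  shows mA_lin [simp, lin]: "mA \<in> lin_maps k (tensor k A A) A"
    and mA_pure [simp]: "a \<in> carrier A \<Longrightarrow> b \<in> carrier A \<Longrightarrow> mA (pure k A A a b) = a \<otimes>\<^bsub>A\<^esub> b"
  by (rule tensor_lift_lin tensor_lift_pure A_simps | assumption)+

lemmas mA_comp_lin [lin] = lin_maps_comp[OF mA_lin]

text \<open>The left A-action on the free module A \<otimes> Y, as it occurs after every use of
  \<psi> or \<delta>.\<close>

definition "lmul Y t = tensor_map k A Y mA id (rebr_inv k A A Y t)"

lemma lmul_lin [simp, lin]:
  "module k Y \<Longrightarrow> lmul Y \<in> lin_maps k (tensor k A (tensor k A Y)) (tensor k A Y)"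
  unfolding lmul_def[abs_def] by (rule lin | simp)+

lemma lmul_comp_lin [lin]:
  "F \<in> lin_maps k N (tensor k A (tensor k A Y)) \<Longrightarrow> module k Y \<Longrightarrow> (\<lambda>x. lmul Y (F x)) \<in> lin_maps k N (tensor k A Y)"
  by (rule lin_maps_comp[OF lmul_lin])

lemma lmul_closed [simp, lin]:
  "t \<in> carrier (tensor k A (tensor k A Y)) \<Longrightarrow> module k Y \<Longrightarrow> lmul Y t \<in> carrier (tensor k A Y)"
  by (rule lin_maps_closed[OF lmul_lin])

lemma lmul_pure [simp]:
  "module k Y \<Longrightarrow> a \<in> carrier A \<Longrightarrow> b \<in> carrier A \<Longrightarrow> y \<in> carrier Y \<Longrightarrow>
    lmul Y (pure k A (tensor k A Y) a (pure k A Y b y)) = pure k A Y (a \<otimes>\<^bsub>A\<^esub> b) y"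
  by (simp add: lmul_def)

text \<open>Left and right multiplication in A commute: x times (1 \<otimes> y) s is (x \<otimes> y)
  s. This extends the formulas for \<psi> and \<delta>, which start from 1 \<otimes> c and 1
  \<otimes> \<Delta>(c), to an arbitrary coefficient.\<close>

lemma lmul_act:
  assumes r: "r \<in> bilin_maps k Z Y Y" and m [simp, lin]: "module k Z" "module k Y"
    and x: "x \<in> carrier A" and s: "s \<in> carrier (tensor k A Z)" and y: "y \<in> carrier Y"
  shows "lmul Y (pure k A (tensor k A Y) x (tensor_act k A Y RA r s (pure k A Y \<one>\<^bsub>A\<^esub> y)))
    = tensor_act k A Y RA r s (pure k A Y x y)"
proof -
  note [simp, lin] = r and [simp] = bilin_maps_closed[OF r]
  have "\<forall>s\<in>carrier (tensor k A Z). lmul Y (pure k A (tensor k A Y) x (tensor_act k A Y RA r s (pure k A Y \<one>\<^bsub>A\<^esub> y)))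
    = tensor_act k A Y RA r s (pure k A Y x y)"
    by (rule tensor_extI) (assumption | rule lin x y | simp add: x y)+
  thus ?thesis using s by blast
qed

text \<open>The morphism \<psi> \<otimes> W between right-bracketed products.\<close>

definition "psi_left W t = rebr k A C W (tensor_map k AC W psi id (rebr_inv k C A W t))"

lemma psi_left_lin [simp, lin]:
  "module k W \<Longrightarrow> psi_left W \<in> lin_maps k (tensor k C (tensor k A W)) (tensor k A (tensor k C W))"
  unfolding psi_left_def[abs_def] by (rule lin | simp)+

lemma psi_left_comp_lin [lin]:
  "F \<in> lin_maps k N (tensor k C (tensor k A W)) \<Longrightarrow> module k W \<Longrightarrow>
    (\<lambda>x. psi_left W (F x)) \<in> lin_maps k N (tensor k A (tensor k C W))"
  by (rule lin_maps_comp[OF psi_left_lin])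

lemma psi_left_pure [simp]:
  "module k W \<Longrightarrow> c \<in> carrier C \<Longrightarrow> a \<in> carrier A \<Longrightarrow> w \<in> carrier W \<Longrightarrow>
    psi_left W (pure k C (tensor k A W) c (pure k A W a w))
    = rebr k A C W (pure k AC W (RA1 (rho A a) (pure k A C \<one>\<^bsub>A\<^esub> c)) w)"
  by (simp add: psi_left_def)

text \<open>Moving \<open>c\<close> past \<open>a\<^sub>0 \<otimes> w z\<close> with \<open>\<psi>\<close> replaces \<open>r = a\<^sub>0 \<otimes> z\<close> by \<open>(\<rho> \<otimes> id) r\<close>.\<close>

lemma psi_left_act:
  assumes r: "b \<in> bilin_maps k Z W W" and m [simp, lin]: "module k Z" "module k W"
    and x: "x \<in> carrier A" and c: "c \<in> carrier C" and w: "w \<in> carrier W" and s: "s \<in> carrier (tensor k A Z)"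
  shows "lmul (tensor k C W) (pure k A (tensor k A (tensor k C W)) x
      (psi_left W (pure k C (tensor k A W) c (tensor_act k A W RA b s (pure k A W \<one>\<^bsub>A\<^esub> w)))))
    = tensor_act k A (tensor k C W) RA (tensor_act k C W RC b) (rebr k A H Z (tensor_map k AH Z (rho A) id s))
        (pure k A (tensor k C W) x (pure k C W c w))"
proof -
  note [simp, lin] = r and [simp] = bilin_maps_closed[OF r]
  have b2 [simp, lin]: "tensor_act k C W RC b \<in> bilin_maps k (tensor k H Z) (tensor k C W) (tensor k C W)"
    by (rule tensor_act_bilin) simp_all
  have "\<forall>s\<in>carrier (tensor k A Z). lmul (tensor k C W) (pure k A (tensor k A (tensor k C W)) x
      (psi_left W (pure k C (tensor k A W) c (tensor_act k A W RA b s (pure k A W \<one>\<^bsub>A\<^esub> w)))))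
    = tensor_act k A (tensor k C W) RA (tensor_act k C W RC b) (rebr k A H Z (tensor_map k AH Z (rho A) id s))
        (pure k A (tensor k C W) x (pure k C W c w))"
  proof (rule tensor_extI)
    fix a z assume az: "a \<in> carrier A" "z \<in> carrier Z"
    \<comment> \<open>\<open>q\<close> stands for \<rho>(a), which is not a pure tensor.\<close>
    have "\<forall>q\<in>carrier AH. lmul (tensor k C W) (pure k A (tensor k A (tensor k C W)) x
      (rebr k A C W (pure k AC W (RA1 q (pure k A C \<one>\<^bsub>A\<^esub> c)) (b z w))))
      = tensor_act k A (tensor k C W) RA (tensor_act k C W RC b) (rebr k A H Z (pure k AH Z q z))
        (pure k A (tensor k C W) x (pure k C W c w))"
      by (rule tensor_extI) (assumption | rule lin x c w az | simp add: x c w az)+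
    thus "lmul (tensor k C W) (pure k A (tensor k A (tensor k C W)) x
      (psi_left W (pure k C (tensor k A W) c (tensor_act k A W RA b (pure k A Z a z) (pure k A W \<one>\<^bsub>A\<^esub> w)))))
    = tensor_act k A (tensor k C W) RA (tensor_act k C W RC b) (rebr k A H Z (tensor_map k AH Z (rho A) id (pure k A Z a z)))
        (pure k A (tensor k C W) x (pure k C W c w))"
      using az x c w by simp
  qed (assumption | rule lin x c w | simp add: x c w)+
  thus ?thesis using s by blast
qed

end

lemma smult_left_commute:
  assumes "module k V" "c \<in> carrier k" "d \<in> carrier k" "v \<in> carrier V"
  shows "c \<odot>\<^bsub>V\<^esub> (d \<odot>\<^bsub>V\<^esub> v) = d \<odot>\<^bsub>V\<^esub> (c \<odot>\<^bsub>V\<^esub> v)"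
proof -
  interpret module k V by fact
  show ?thesis using assms by (simp add: smult_assoc1[symmetric] R.m_comm)
qed

section \<open>The cowreath identities on underlying spaces\<close>

context comodule_setup
begin

lemmas smult_commutes = smult_left_commute[OF A_simps(1)] smult_left_commute[OF C_simps(1)]
  smult_left_commute[OF module_tensor[OF A_simps(1) C_simps(1)]]

lemmas lmul_acts = lmul_act[OF RC_simps(1)] lmul_act[OF R_bilin(1)] lmul_act[OF R_bilin(2)]
lemmas psi_left_acts = psi_left_act[OF RC_simps(1)] psi_left_act[OF R_bilin(1)]

text \<open>The right A-action of the induced coring, (m \<otimes> C)(A \<otimes> \<psi>) with plain
  rebracketing.\<close>

definition "dr t = lmul C (tensor_map k A AC id psi (rebr k A C A t))"

lemma dr_lin [simp, lin]: "dr \<in> lin_maps k (tensor k AC A) AC"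
  unfolding dr_def[abs_def] by (rule lin | simp)+

lemmas dr_comp_lin [lin] = lin_maps_comp[OF dr_lin]

text \<open>The right A-action on A \<otimes> C is the restriction along \<rho> of its right A
  \<otimes> H-action.\<close>

lemma dr_pure [simp]:
  assumes d: "d \<in> carrier AC" and a: "a \<in> carrier A"
  shows "dr (pure k AC A d a) = RA1 (rho A a) d"
proof -
  have "\<forall>d\<in>carrier AC. dr (pure k AC A d a) = RA1 (rho A a) d"
    by (rule tensor_extI) (assumption | rule lin a | simp add: a dr_def lmul_acts)+
  thus ?thesis using d by blast
qed

text \<open>Multiplicativity of \<rho>: acting on 1 \<otimes> c by \<rho>(ab) is acting by \<rho>(a)
  and then by \<rho>(b), and the second action is \<open>dr\<close>.\<close>

lemma psi_mult:
  assumes t: "t \<in> carrier (tensor k C (tensor k A A))"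
  shows "psi (tensor_map k C A id mA t) = dr (tensor_map k AC A psi id (rebr_inv k C A A t))"
proof -
  have "\<forall>t\<in>carrier (tensor k C (tensor k A A)). psi (tensor_map k C A id mA t) = dr (tensor_map k AC A psi id (rebr_inv k C A A t))"
    by (rule tensor_extI_right) (assumption | rule lin | simp add: alg_mapsD(2)[OF rho_alg] R_mult)+
  thus ?thesis using t by blast
qed

lemma rho_one [simp]: "rho A \<one>\<^bsub>A\<^esub> = pure k A H \<one>\<^bsub>A\<^esub> \<one>\<^bsub>H\<^esub>"
  using alg_mapsD(3)[OF rho_alg] by (simp add: tensor_one)

definition "psi_right t = tensor_map k C AC id psi (rebr k C C A t)"

lemma psi_right_lin [simp, lin]: "psi_right \<in> lin_maps k (tensor k C2 A) (tensor k C AC)"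
  unfolding psi_right_def[abs_def] by (rule lin | simp)+

lemma psi_right_pure [simp]:
  "c \<in> carrier C \<Longrightarrow> c' \<in> carrier C \<Longrightarrow> a \<in> carrier A \<Longrightarrow>
    psi_right (pure k C2 A (pure k C C c c') a) = pure k C AC c (psi (pure k C A c' a))"
  by (simp add: psi_right_def del: psi_pure)

text \<open>The element a passes the last factor C first, where its H-part stays behind; its A-part
  then passes the first factor C, which applies \<rho> once more. Together this is the action of
  (\<rho> \<otimes> id)\<rho>(a).\<close>

lemma psi_past_two:
  assumes y: "y \<in> carrier AC2" and a: "a \<in> carrier A"
  shows "lmul C2 (tensor_map k A AC2 id (psi_left C) (tensor_map k A (tensor k C AC) id psi_right (rebr k A C2 A (pure k AC2 A y a))))
    = RA2 (rebr k A H H (tensor_map k AH H (rho A) id (rho A a))) y"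
proof -
  have c: "rebr k A H H (tensor_map k AH H (rho A) id (rho A a)) \<in> carrier AH2"
    by (rule lin a | simp)+
  have "\<forall>y\<in>carrier AC2. lmul C2 (tensor_map k A AC2 id (psi_left C) (tensor_map k A (tensor k C AC) id psi_right (rebr k A C2 A (pure k AC2 A y a))))
    = RA2 (rebr k A H H (tensor_map k AH H (rho A) id (rho A a))) y"
    by (rule tensor_extI_right) (assumption | rule lin a c | simp add: a psi_left_acts del: psi_left_pure)+
  thus ?thesis using y by blast
qed

text \<open>The comultiplication of the induced coring in the coordinates A \<otimes> C \<otimes> C
  of D \<otimes>_A D: apply \<Delta> of C and act by \<Phi>_\<rho> from the right.\<close>

lemma id_del:
  assumes d: "d \<in> carrier AC"
  shows "lmul C2 (tensor_map k A AC2 id del d) = RA2 (reass_rho A) (tensor_map k A C2 id (ccomult C) d)"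
proof -
  have "\<forall>d\<in>carrier AC. lmul C2 (tensor_map k A AC2 id del d) = RA2 (reass_rho A) (tensor_map k A C2 id (ccomult C) d)"
    by (rule tensor_extI) (assumption | rule lin | simp add: del_eq lmul_acts)+
  thus ?thesis using d by blast
qed

lemma comult_RA1:
  assumes s: "s \<in> carrier AH" and d: "d \<in> carrier AC"
  shows "tensor_map k A C2 id (ccomult C) (RA1 s d)
    = RA2 (tensor_map k A H2 id (comult H) s) (tensor_map k A C2 id (ccomult C) d)"
  by (rule tensor_act_natural[OF RA_bilin RC_simps(1) RA_bilin R_bilin(1)]) (simp_all add: s d ccomult_ract)

text \<open>With u = 1 \<otimes> \<Delta>(c), the left side is u acted on by (id \<otimes>
  \<Delta>)\<rho>(a) and then \<Phi>_\<rho>, the right side u acted on by \<Phi>_\<rho> and then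
  (\<rho> \<otimes> id)\<rho>(a). These products agree by quasi-coassociativity of \<rho>.\<close>

lemma del_psi:
  assumes t: "t \<in> carrier (tensor k C A)"
  shows "lmul C2 (tensor_map k A AC2 id del (psi t))
    = lmul C2 (tensor_map k A AC2 id (psi_left C) (tensor_map k A (tensor k C AC) id psi_right
        (rebr k A C2 A (tensor_map k AC2 A del id t))))"
proof -
  have "\<forall>t\<in>carrier (tensor k C A). lmul C2 (tensor_map k A AC2 id del (psi t))
    = lmul C2 (tensor_map k A AC2 id (psi_left C) (tensor_map k A (tensor k C AC) id psi_right
        (rebr k A C2 A (tensor_map k AC2 A del id t))))"
  proof (rule tensor_extI)
    fix c a assume ca: "c \<in> carrier C" "a \<in> carrier A"
    let ?d = "tensor_map k A H2 id (comult H) (rho A a)" and ?r = "rebr k A H H (tensor_map k AH H (rho A) id (rho A a))"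
    let ?u = "pure k A C2 \<one>\<^bsub>A\<^esub> (ccomult C c)"
    have cl: "?d \<in> carrier AH2" "?r \<in> carrier AH2" by (rule lin ca | simp)+
    have "lmul C2 (tensor_map k A AC2 id del (psi (pure k C A c a))) = RA2 (reass_rho A) (RA2 ?d ?u)"
      using ca by (simp add: id_del comult_RA1)
    also have "\<dots> = RA2 ?r (RA2 (reass_rho A) ?u)"
      using ca cl rho_coassoc[OF ca(2)] R_mult(4)[of ?d "reass_rho A" ?u] R_mult(4)[of "reass_rho A" ?r ?u] by simp
    finally show "lmul C2 (tensor_map k A AC2 id del (psi (pure k C A c a)))
      = lmul C2 (tensor_map k A AC2 id (psi_left C) (tensor_map k A (tensor k C AC) id psi_right
        (rebr k A C2 A (tensor_map k AC2 A del id (pure k C A c a)))))"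
      using ca by (simp add: psi_past_two del_eq)
  qed (assumption | rule lin | simp)+
  thus ?thesis using t by blast
qed

text \<open>The associativity constraint on C \<otimes> C \<otimes> C in left modules: only the left
  action of \<Phi> enters. It is the one constraint in the cowreath axioms that is not a plain
  rebracketing.\<close>

definition "assC t = LC3 (reass H) (rebr k C C C t)"

lemma assC_lin [simp, lin]: "assC \<in> lin_maps k (tensor k C2 C) C3"
  unfolding assC_def[abs_def] by (rule lin | simp)+

lemmas assC_comp_lin [lin] = lin_maps_comp[OF assC_lin]
lemmas assC_closed [simp, lin] = lin_maps_closed[OF assC_lin]

text \<open>The left action of \<Phi> commutes with all right actions, so the constraint intertwines
  them up to rebracketing.\<close>

lemma assC_act:
  assumes p: "p \<in> carrier (tensor k H2 H)" and t: "t \<in> carrier (tensor k C2 C)"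
  shows "assC (tensor_act k C2 C RC2 RC p t) = RC3 (rebr k H H H p) (assC t)"
proof -
  have "rebr k C C C (tensor_act k C2 C RC2 RC p t) = RC3 (rebr k H H H p) (rebr k C C C t)"
    by (rule tensor_act_rebr[OF RC_simps(1) RC_simps(1) RC_simps(1)]) (simp_all add: p t)
  thus ?thesis using p t by (simp add: assC_def LR_commute)
qed

definition "del_left t = tensor_map k A C3 id assC (rebr k A C2 C (tensor_map k AC2 C del id t))"

lemma del_left_lin [simp, lin]: "del_left \<in> lin_maps k C2 AC3"
  unfolding del_left_def[abs_def] by (rule lin | simp)+

definition "rtimes_one s = tensor_map k A H3 id (rebr k H H H) (rebr k A H2 H (pure k AH2 H s \<one>\<^bsub>H\<^esub>))"

lemma rtimes_one_lin [simp, lin]: "rtimes_one \<in> lin_maps k AH2 AH3"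
  unfolding rtimes_one_def[abs_def] by (rule lin | simp)+

lemmas rtimes_one_closed [simp, lin] = lin_maps_closed[OF rtimes_one_lin]

lemma rtimes_one_pure [simp]:
  "a \<in> carrier A \<Longrightarrow> u \<in> carrier H2 \<Longrightarrow> rtimes_one (pure k A H2 a u) = pure k A H3 a (rebr k H H H (pure k H2 H u \<one>\<^bsub>H\<^esub>))"
  by (simp add: rtimes_one_def)

definition "comultC t = assC (tensor_map k C2 C (ccomult C) id t)"

lemma comultC_lin [simp, lin]: "comultC \<in> lin_maps k C2 C3"
  unfolding comultC_def[abs_def] by (rule lin | simp)+

lemma comultC_act:
  assumes s: "s \<in> carrier H2" and t: "t \<in> carrier C2"
  shows "comultC (RC2 s t) = RC3 (inner_comult s) (comultC t)"
proof -
  have "tensor_map k C2 C (ccomult C) id (RC2 s t)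
      = tensor_act k C2 C RC2 RC (tensor_map k H2 H (comult H) id s) (tensor_map k C2 C (ccomult C) id t)"
    by (rule tensor_act_natural[OF RC_simps(1) RC_simps(1) R_bilin(1) RC_simps(1)]) (simp_all add: s t ccomult_ract)
  moreover have "tensor_map k H2 H (comult H) id s \<in> carrier (tensor k H2 H)"
    "tensor_map k C2 C (ccomult C) id t \<in> carrier (tensor k C2 C)"
    by (rule lin s t | simp)+
  ultimately show ?thesis by (simp add: comultC_def assC_act inner_comult_def)
qed

text \<open>The second \<delta> is applied to the first C of a pair, so its \<Phi>_\<rho> acts on A
  and on the two legs that replace this C, and by 1 on the last leg.\<close>

lemma del_left_lmul:
  assumes y: "y \<in> carrier AC2"
  shows "lmul C3 (tensor_map k A AC3 id del_left y) = RA3 (rtimes_one (reass_rho A)) (tensor_map k A C3 id comultC y)"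
proof -
  have 1: "\<forall>s\<in>carrier AH2. lmul C3 (pure k A AC3 x (tensor_map k A C3 id assC (rebr k A C2 C
        (pure k AC2 C (RA2 s (pure k A C2 \<one>\<^bsub>A\<^esub> d)) c'))))
      = RA3 (rtimes_one s) (pure k A C3 x (assC (pure k C2 C d c')))"
    if x: "x \<in> carrier A" "d \<in> carrier C2" "c' \<in> carrier C" for x d c'
  proof (rule tensor_extI)
    fix a u assume au: "a \<in> carrier A" "u \<in> carrier H2"
    have "assC (pure k C2 C (RC2 u d) c') = RC3 (rebr k H H H (pure k H2 H u \<one>\<^bsub>H\<^esub>)) (assC (pure k C2 C d c'))"
      using assC_act[of "pure k H2 H u \<one>\<^bsub>H\<^esub>" "pure k C2 C d c'"] x au by simp
    thus "lmul C3 (pure k A AC3 x (tensor_map k A C3 id assC (rebr k A C2 C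
        (pure k AC2 C (RA2 (pure k A H2 a u) (pure k A C2 \<one>\<^bsub>A\<^esub> d)) c'))))
      = RA3 (rtimes_one (pure k A H2 a u)) (pure k A C3 x (assC (pure k C2 C d c')))"
      using x au by simp
  qed (assumption | rule lin x | simp add: x)+
  have "\<forall>y\<in>carrier AC2. lmul C3 (tensor_map k A AC3 id del_left y)
      = RA3 (rtimes_one (reass_rho A)) (tensor_map k A C3 id comultC y)"
  proof (rule tensor_extI_right)
    fix x c c' assume x: "x \<in> carrier A" "c \<in> carrier C" "c' \<in> carrier C"
    thus "lmul C3 (tensor_map k A AC3 id del_left (pure k A C2 x (pure k C C c c')))
      = RA3 (rtimes_one (reass_rho A)) (tensor_map k A C3 id comultC (pure k A C2 x (pure k C C c c')))"
      using 1[of x "ccomult C c" c'] by (simp add: del_left_def comultC_def del_eq)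
  qed (assumption | rule lin | simp)+
  thus ?thesis using y by blast
qed

lemma comult_RA2:
  assumes s: "s \<in> carrier AH2" and t: "t \<in> carrier AC2"
  shows "tensor_map k A C3 id (tensor_map k C C2 id (ccomult C)) (RA2 s t)
      = RA3 (tensor_map k A H3 id (tensor_map k H H2 id (comult H)) s) (tensor_map k A C3 id (tensor_map k C C2 id (ccomult C)) t)"
    and "tensor_map k A C3 id comultC (RA2 s t)
      = RA3 (tensor_map k A H3 id inner_comult s) (tensor_map k A C3 id comultC t)"
proof -
  have 1: "tensor_map k C C2 id (ccomult C) (RC2 p q) = RC3 (tensor_map k H H2 id (comult H) p) (tensor_map k C C2 id (ccomult C) q)"
    if "p \<in> carrier H2" "q \<in> carrier C2" for p q
    by (rule tensor_act_natural[OF RC_simps(1) RC_simps(1) RC_simps(1) R_bilin(1)]) (simp_all add: that ccomult_ract)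
  show "tensor_map k A C3 id (tensor_map k C C2 id (ccomult C)) (RA2 s t)
      = RA3 (tensor_map k A H3 id (tensor_map k H H2 id (comult H)) s) (tensor_map k A C3 id (tensor_map k C C2 id (ccomult C)) t)"
    by (rule tensor_act_natural[OF RA_bilin R_bilin(1) RA_bilin R_bilin(2)]) (simp_all add: s t 1)
  show "tensor_map k A C3 id comultC (RA2 s t)
      = RA3 (tensor_map k A H3 id inner_comult s) (tensor_map k A C3 id comultC t)"
    by (rule tensor_act_natural[OF RA_bilin R_bilin(1) RA_bilin R_bilin(2)]) (simp_all add: s t comultC_act)
qed

lemma id_psi_del:
  assumes y: "y \<in> carrier AC2"
  shows "lmul C3 (tensor_map k A AC3 id (psi_left C2) (tensor_map k A (tensor k C AC2) id (tensor_map k C AC2 id del) y))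
    = RA3 (rebr k A H H2 (tensor_map k AH H2 (rho A) id (reass_rho A))) (tensor_map k A C3 id (tensor_map k C C2 id (ccomult C)) y)"
proof -
  have c: "rebr k A H H2 (tensor_map k AH H2 (rho A) id (reass_rho A)) \<in> carrier AH3" by (rule lin | simp)+
  have "\<forall>y\<in>carrier AC2. lmul C3 (tensor_map k A AC3 id (psi_left C2) (tensor_map k A (tensor k C AC2) id (tensor_map k C AC2 id del) y))
    = RA3 (rebr k A H H2 (tensor_map k AH H2 (rho A) id (reass_rho A))) (tensor_map k A C3 id (tensor_map k C C2 id (ccomult C)) y)"
    by (rule tensor_extI_right) (assumption | rule lin tensor_map_lin c | simp add: psi_left_acts del_eq del: psi_left_pure)+
  thus ?thesis using y by blast
qed

text \<open>Both sides are values of right actions on v = 1 \<otimes> (id \<otimes>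
  \<Delta>)\<Delta>(c). The left side acts by (id \<otimes> id \<otimes> \<Delta>)(\<Phi>_\<rho>)
  and then (\<rho> \<otimes> id \<otimes> id)(\<Phi>_\<rho>); the pentagon of \<Phi>_\<rho> rewrites
  this product with first factor 1 \<otimes> \<Phi>, which exchanges the bracketing of the iterated
  comultiplication.\<close>

lemma del_coassoc:
  assumes c: "c \<in> carrier C"
  shows "lmul C3 (tensor_map k A AC3 id (psi_left C2) (tensor_map k A (tensor k C AC2) id (tensor_map k C AC2 id del) (del c)))
    = lmul C3 (tensor_map k A AC3 id del_left (del c))"
proof -
  let ?w = "tensor_map k C C2 id (ccomult C) (ccomult C c)" and ?u = "pure k A C2 \<one>\<^bsub>A\<^esub> (ccomult C c)"
  let ?N = "tensor_map k A H3 id (tensor_map k H H2 id (comult H)) (reass_rho A)"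
  let ?Q = "rebr k A H H2 (tensor_map k AH H2 (rho A) id (reass_rho A))"
  let ?M = "tensor_map k A H3 id inner_comult (reass_rho A)" and ?P = "pure k A H3 \<one>\<^bsub>A\<^esub> (reass H)"
  let ?R = "rtimes_one (reass_rho A)" and ?v = "pure k A C3 \<one>\<^bsub>A\<^esub> (tensor_map k C C2 id (ccomult C) (ccomult C c))"
  have cl: "?N \<in> carrier AH3" "?Q \<in> carrier AH3" "?M \<in> carrier AH3" "?P \<in> carrier AH3" "?w \<in> carrier C3"
    by (rule lin tensor_map_lin c | simp)+
  have v: "?v \<in> carrier AC3" using cl by simp
  have "lmul C3 (tensor_map k A AC3 id (psi_left C2) (tensor_map k A (tensor k C AC2) id (tensor_map k C AC2 id del) (del c)))
      = RA3 ?Q (RA3 ?N ?v)"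
    using c by (simp add: id_psi_del) (simp add: del_eq comult_RA2)
  also have "\<dots> = RA3 (?N \<otimes>\<^bsub>AH3\<^esub> ?Q) ?v" using cl v by (simp add: R_mult)
  also have "?N \<otimes>\<^bsub>AH3\<^esub> ?Q = ?P \<otimes>\<^bsub>AH3\<^esub> ?M \<otimes>\<^bsub>AH3\<^esub> ?R"
    using rho_pentagon by (simp only: inner_comult_def rtimes_one_def)
  also have "RA3 (?P \<otimes>\<^bsub>AH3\<^esub> ?M \<otimes>\<^bsub>AH3\<^esub> ?R) ?v = RA3 ?R (RA3 ?M (RA3 ?P ?v))"
    using cl v k_algebraD(5)[OF AH_alg(3)] by (simp add: R_mult del: act_pure)
  \<comment> \<open>Here coassociativity of C is used: the right action of \<Phi> turns into the
    left action of \<Phi> hidden in \<open>assC\<close>, now on the other iterated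
    comultiplication.\<close>
  also have "RA3 ?P ?v = pure k A C3 \<one>\<^bsub>A\<^esub> (comultC (ccomult C c))"
    using c cl by (simp add: comultC_def assC_def C_coassoc)
  also have "RA3 ?R (RA3 ?M (pure k A C3 \<one>\<^bsub>A\<^esub> (comultC (ccomult C c)))) = lmul C3 (tensor_map k A AC3 id del_left (del c))"
    using c by (simp add: del_left_lmul) (simp add: del_eq comult_RA2)
  finally show ?thesis .
qed

text \<open>The counit of C is right H-linear, so f after \<psi> sees \<rho>(a) only through (id
  \<otimes> \<epsilon>)\<rho>(a) = a.\<close>

lemma cou_psi:
  assumes t: "t \<in> carrier (tensor k C A)"
  shows "mA (tensor_map k A A id cou (psi t)) = mA (tensor_map k A A cou id t)"
proof -
  interpret A: module k A by simp
  note sm = lin_maps_smult[OF bilin_maps_left[OF A_simps(3)]] lin_maps_smult[OF bilin_maps_right[OF A_simps(3)]]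
  have "\<forall>t\<in>carrier (tensor k C A). mA (tensor_map k A A id cou (psi t)) = mA (tensor_map k A A cou id t)"
  proof (rule tensor_extI)
    fix c a assume ca: "c \<in> carrier C" "a \<in> carrier A"
    have "\<forall>r\<in>carrier AH. mA (tensor_map k A A id cou (RA1 r (pure k A C \<one>\<^bsub>A\<^esub> c)))
        = ccounit C c \<odot>\<^bsub>A\<^esub> runit A (tensor_map k A (base_space k) id (counit H) r)"
      by (rule tensor_extI) (assumption | rule lin bilin_maps_comp_right[OF smult_bilin[OF mod_A]] |
          simp add: ca cou_eq ccounit_ract sm A.smult_assoc1)+
    thus "mA (tensor_map k A A id cou (psi (pure k C A c a))) = mA (tensor_map k A A cou id (pure k C A c a))"
      using ca by (simp add: rho_counit cou_eq sm)
  qed (assumption | rule lin | simp)+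
  thus ?thesis using t by blast
qed

lemma RA1_one: "c \<in> carrier C \<Longrightarrow> RA1 \<one>\<^bsub>AH\<^esub> (pure k A C \<one>\<^bsub>A\<^esub> c) = pure k A C \<one>\<^bsub>A\<^esub> c"
  by (simp add: tensor_one)

text \<open>By right H-linearity, the counit of C on the first C-leg of (1 \<otimes> d) s applies
  \<epsilon> to the middle leg of s. For d = \<Delta>(c) and s = \<Phi>_\<rho> the counit axiom of C
  and the normalization of \<Phi>_\<rho> finish.\<close>

lemma cou_del_left:
  assumes c: "c \<in> carrier C"
  shows "lmul C (tensor_map k A AC id (tensor_map k A C cou id) (del c)) = pure k A C \<one>\<^bsub>A\<^esub> c"
proof -
  interpret A: module k A by simp
  note sm = lin_maps_smult[OF bilin_maps_left[OF A_simps(3)]] lin_maps_smult[OF bilin_maps_right[OF A_simps(3)]]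
    lin_maps_smult[OF RC_simps(4)] lin_maps_smult[OF bilin_maps_right[OF RC_simps(1)]]
  let ?h = "lunit H \<circ> tensor_map k (base_space k) H (counit H) id"
  let ?c = "\<lambda>t. lunit C (tensor_map k (base_space k) C (ccounit C) id t)"
  have h [simp, lin]: "?h \<in> lin_maps k H2 H" unfolding comp_def by (rule lin | simp)+
  have "\<forall>s\<in>carrier AH2. lmul C (tensor_map k A AC id (tensor_map k A C cou id) (RA2 s (pure k A C2 \<one>\<^bsub>A\<^esub> d)))
      = RA1 (tensor_map k A H id ?h s) (pure k A C \<one>\<^bsub>A\<^esub> (?c d))" if d: "d \<in> carrier C2" for d
  proof (rule tensor_extI_right)
    fix a g h assume agh: "a \<in> carrier A" "g \<in> carrier H" "h \<in> carrier H"
    have "\<forall>d\<in>carrier C2. lmul C (tensor_map k A AC id (tensor_map k A C cou id) (RA2 (pure k A H2 a (pure k H H g h)) (pure k A C2 \<one>\<^bsub>A\<^esub> d)))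
      = RA1 (tensor_map k A H id ?h (pure k A H2 a (pure k H H g h))) (pure k A C \<one>\<^bsub>A\<^esub> (?c d))"
      by (rule tensor_extI) (assumption | rule lin tensor_map_lin agh |
        (simp add: agh cou_eq ccounit_ract sm A.smult_assoc1 module.smult_assoc1[OF C_simps(1)],
         (simp add: agh pure_smult_left pure_smult_right sm smult_commutes module.smult_assoc1[OF module_tensor] A.smult_assoc1 module.smult_assoc1[OF C_simps(1)])?))+
    thus "lmul C (tensor_map k A AC id (tensor_map k A C cou id) (RA2 (pure k A H2 a (pure k H H g h)) (pure k A C2 \<one>\<^bsub>A\<^esub> d)))
      = RA1 (tensor_map k A H id ?h (pure k A H2 a (pure k H H g h))) (pure k A C \<one>\<^bsub>A\<^esub> (?c d))" using d by blast
  qed (assumption | rule lin tensor_map_lin d | simp add: d)+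
  thus ?thesis using c by (simp add: del_eq ccounit_ccomult reass_rho_counit RA1_one)
qed

text \<open>The same with the second C-leg and the last leg of \<Phi>_\<rho>. The extra \<psi> only
  moves multiples of the unit of A.\<close>

lemma cou_del_right:
  assumes c: "c \<in> carrier C"
  shows "lmul C (tensor_map k A AC id psi (tensor_map k A (tensor k C A) id (tensor_map k C A id cou) (del c))) = pure k A C \<one>\<^bsub>A\<^esub> c"
proof -
  interpret A: module k A by simp
  note sm = lin_maps_smult[OF bilin_maps_left[OF A_simps(3)]] lin_maps_smult[OF bilin_maps_right[OF A_simps(3)]]
    lin_maps_smult[OF RC_simps(4)] lin_maps_smult[OF bilin_maps_right[OF RC_simps(1)]]
  let ?h = "runit H \<circ> tensor_map k H (base_space k) id (counit H)"
  let ?c = "\<lambda>t. runit C (tensor_map k C (base_space k) id (ccounit C) t)"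
  have h [simp, lin]: "?h \<in> lin_maps k H2 H" unfolding comp_def by (rule lin | simp)+
  \<comment> \<open>The values of f are scalar multiples of 1, and \<psi>(x \<otimes> 1) = 1
    \<otimes> x because \<rho> is unital.\<close>
  have p: "psi (pure k C A x (e \<odot>\<^bsub>A\<^esub> \<one>\<^bsub>A\<^esub>)) = pure k A C \<one>\<^bsub>A\<^esub> (e \<odot>\<^bsub>C\<^esub> x)"
    if "x \<in> carrier C" "e \<in> carrier k" for x e
  proof -
    have "psi (pure k C A x (e \<odot>\<^bsub>A\<^esub> \<one>\<^bsub>A\<^esub>)) = psi (e \<odot>\<^bsub>tensor k C A\<^esub> pure k C A x \<one>\<^bsub>A\<^esub>)"
      using that by (simp add: pure_smult_right)
    also have "\<dots> = e \<odot>\<^bsub>AC\<^esub> pure k A C \<one>\<^bsub>A\<^esub> x"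
      using that by (simp add: lin_maps_smult[OF psi_lin])
    finally show ?thesis using that by (simp add: pure_smult_right)
  qed
  have "\<forall>s\<in>carrier AH2. lmul C (tensor_map k A AC id psi (tensor_map k A (tensor k C A) id (tensor_map k C A id cou) (RA2 s (pure k A C2 \<one>\<^bsub>A\<^esub> d))))
      = RA1 (tensor_map k A H id ?h s) (pure k A C \<one>\<^bsub>A\<^esub> (?c d))" if d: "d \<in> carrier C2" for d
  proof (rule tensor_extI_right)
    fix a g h assume agh: "a \<in> carrier A" "g \<in> carrier H" "h \<in> carrier H"
    have "\<forall>d\<in>carrier C2. lmul C (tensor_map k A AC id psi (tensor_map k A (tensor k C A) id (tensor_map k C A id cou) (RA2 (pure k A H2 a (pure k H H g h)) (pure k A C2 \<one>\<^bsub>A\<^esub> d))))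
      = RA1 (tensor_map k A H id ?h (pure k A H2 a (pure k H H g h))) (pure k A C \<one>\<^bsub>A\<^esub> (?c d))"
      by (rule tensor_extI) (assumption | rule lin tensor_map_lin agh |
        (simp add: agh cou_eq ccounit_ract p sm module.smult_assoc1[OF C_simps(1)] del: psi_pure,
         (simp add: agh pure_smult_left pure_smult_right sm smult_commutes module.smult_assoc1[OF C_simps(1)])?))+
    thus "lmul C (tensor_map k A AC id psi (tensor_map k A (tensor k C A) id (tensor_map k C A id cou) (RA2 (pure k A H2 a (pure k H H g h)) (pure k A C2 \<one>\<^bsub>A\<^esub> d))))
      = RA1 (tensor_map k A H id ?h (pure k A H2 a (pure k H H g h))) (pure k A C \<one>\<^bsub>A\<^esub> (?c d))" using d by blast
  qed (assumption | rule lin tensor_map_lin d | simp add: d)+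
  thus ?thesis using c by (simp add: del_eq ccounit_ccomult reass_rho_counit RA1_one)
qed

text \<open>H-linearity of \<psi>, since H acts on C \<otimes> A and on A \<otimes> C through C
  alone. It holds because the left and right H-actions on C commute.\<close>

lemma psi_lact:
  assumes h: "h \<in> carrier H" and t: "t \<in> carrier (tensor k C A)"
  shows "psi (tensor_map k C A (lact C h) id t) = tensor_map k A C id (lact C h) (psi t)"
proof -
  note l [simp, lin] = bilin_maps_right[OF C_simps(2) h]
  have "\<forall>t\<in>carrier (tensor k C A). psi (tensor_map k C A (lact C h) id t) = tensor_map k A C id (lact C h) (psi t)"
  proof (rule tensor_extI)
    fix c a assume ca: "c \<in> carrier C" "a \<in> carrier A"
    have "\<forall>r\<in>carrier AH. RA1 r (pure k A C \<one>\<^bsub>A\<^esub> (lact C h c)) = tensor_map k A C id (lact C h) (RA1 r (pure k A C \<one>\<^bsub>A\<^esub> c))"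
      by (rule tensor_extI) (assumption | rule lin | simp add: ca h RC_facts)+
    thus "psi (tensor_map k C A (lact C h) id (pure k C A c a)) = tensor_map k A C id (lact C h) (psi (pure k C A c a))"
      using ca h by simp
  qed (assumption | rule lin | simp)+
  thus ?thesis using t by blast
qed

lemma del_lact:
  assumes h: "h \<in> carrier H" and c: "c \<in> carrier C"
  shows "del (lact C h c) = tensor_map k A C2 id (LC2 (comult H h)) (del c)"
proof -
  note l [simp, lin] = bilin_maps_right[OF R_bilin(6) comult_closed[OF h]]
  have "\<forall>s\<in>carrier AH2. RA2 s (pure k A C2 \<one>\<^bsub>A\<^esub> (LC2 (comult H h) (ccomult C c)))
      = tensor_map k A C2 id (LC2 (comult H h)) (RA2 s (pure k A C2 \<one>\<^bsub>A\<^esub> (ccomult C c)))"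
    by (rule tensor_extI) (assumption | rule lin h c | simp add: c h LR_commute)+
  thus ?thesis using c h by (simp add: del_eq ccomult_lact)
qed

end

section \<open>The cowreath in the category of left H-modules\<close>

context comodule_setup
begin

abbreviation "TA \<equiv> trivial_halg k H A"
abbreviation "TX \<equiv> hmod.truncate C"

lemma same_TA: "same_module TA A"
  by (simp add: same_module_def trivial_halg_def hmod.extend_def module.extend_def module.truncate_def
      hmod.fields_def halg.fields_def)

lemma same_TX: "same_module TX C"
  by (simp add: same_module_def hmod.truncate_def)

lemmas T_same [simp] = same_module_simps[OF same_TA] same_module_module[OF same_TA]
  same_module_simps[OF same_TX] same_module_module[OF same_TX]

lemma T_simps [simp]:
  "carrier TA = carrier A" "add TA = add A" "smult TA = smult A" "\<zero>\<^bsub>TA\<^esub> = \<zero>\<^bsub>A\<^esub>"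
  "lact TA = (\<lambda>h a. counit H h \<odot>\<^bsub>A\<^esub> a)" "amult TA = mA" "aunit TA = (\<lambda>c. c \<odot>\<^bsub>A\<^esub> \<one>\<^bsub>A\<^esub>)"
  "carrier TX = carrier C" "add TX = add C" "smult TX = smult C" "lact TX = lact C"
  by (simp_all add: trivial_halg_def hmod.extend_def module.extend_def module.truncate_def
      hmod.fields_def halg.fields_def hmod.truncate_def)

lemma TA_trivial [simp]: "trivial_module TA"
  by (simp add: trivial_module_def)

lemma hmodule_TX [simp]: "hmodule k H TX"
  using hmodule_C by (simp add: hmodule_def left_action_def)

lemma hmodule_TA [simp]: "hmodule k H TA"
proof -
  interpret A: module k A by simp
  have "(\<lambda>h a. counit H h \<odot>\<^bsub>A\<^esub> a) \<in> bilin_maps k H A A"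
    using bilin_maps_right[OF smult_bilin[OF mod_A]] bilin_maps_comp_left[OF smult_bilin[OF mod_A] counit_lin]
    by (intro bilin_mapsI) simp_all
  thus ?thesis by (simp add: hmodule_def left_action_def A.smult_assoc1)
qed

lemmas hmodule_htensors [simp] = hmodule_htensor

text \<open>With these rules and those for the inverse, all constraints in the cowreath axioms
  become rebracketings, except the one for three copies of C.\<close>

lemma hassoc_T [simp]:
  "hmodule k H V \<Longrightarrow> hmodule k H W \<Longrightarrow> t \<in> carrier (tensor k (tensor k A V) W) \<Longrightarrow> hassoc k H TA V W t = rebr k A V W t"
  "hmodule k H U \<Longrightarrow> hmodule k H V \<Longrightarrow> t' \<in> carrier (tensor k (tensor k U V) A) \<Longrightarrow> hassoc k H U V TA t' = rebr k U V A t'"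
  "hmodule k H U \<Longrightarrow> hmodule k H W \<Longrightarrow> t'' \<in> carrier (tensor k (tensor k U A) W) \<Longrightarrow> hassoc k H U TA W t'' = rebr k U A W t''"
  using hassoc_trivial(1)[of TA V W t] hassoc_trivial(1)[of U V TA t'] hassoc_trivial(1)[of U TA W t''] by simp_all

lemma hassoc_inv_T [simp]:
  "hmodule k H V \<Longrightarrow> hmodule k H W \<Longrightarrow> t \<in> carrier (tensor k A (tensor k V W)) \<Longrightarrow> hassoc_inv k H TA V W t = rebr_inv k A V W t"
  "hmodule k H U \<Longrightarrow> hmodule k H W \<Longrightarrow> t'' \<in> carrier (tensor k U (tensor k A W)) \<Longrightarrow> hassoc_inv k H U TA W t'' = rebr_inv k U A W t''"
  using hassoc_trivial(2)[of TA V W t] hassoc_trivial(2)[of U TA W t''] by simp_all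

lemma hassoc_X: "hassoc k H TX TX TX t = assC t"
  by (simp add: hassoc_def assC_def)

lemma halgebra_TA: "halgebra k H TA"
proof -
  interpret A: module k A by simp
  note sm = lin_maps_smult[OF bilin_maps_left[OF A_simps(3)]] lin_maps_smult[OF bilin_maps_right[OF A_simps(3)]]
  have "lin_maps k (htensor k H TA TA) TA = lin_maps k (tensor k A A) A" by simp
  have l: "mA (tensor_act k A A (\<lambda>h a. counit H h \<odot>\<^bsub>A\<^esub> a) (\<lambda>h a. counit H h \<odot>\<^bsub>A\<^esub> a) (comult H h) t) = counit H h \<odot>\<^bsub>A\<^esub> mA t"
    if ht: "h \<in> carrier H" "t \<in> carrier (tensor k A A)" for h t
  proof -
    have s [simp, lin]: "(\<lambda>a. counit H h \<odot>\<^bsub>A\<^esub> a) \<in> lin_maps k A A"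
      using bilin_maps_right[OF smult_bilin[OF mod_A]] ht by simp
    have s' [simp, lin]: "F \<in> lin_maps k N A \<Longrightarrow> (\<lambda>x. counit H h \<odot>\<^bsub>A\<^esub> F x) \<in> lin_maps k N A" for F N
      using lin_maps_comp[OF s] .
    have "tensor_act k A A (\<lambda>h a. counit H h \<odot>\<^bsub>A\<^esub> a) (\<lambda>h a. counit H h \<odot>\<^bsub>A\<^esub> a) (comult H h) t
        = tensor_map k A A id (\<lambda>a. counit H h \<odot>\<^bsub>A\<^esub> a) t"
      using lact_trivial(1)[of TA TA h t] ht by simp
    moreover have "\<forall>t\<in>carrier (tensor k A A). mA (tensor_map k A A id (\<lambda>a. counit H h \<odot>\<^bsub>A\<^esub> a) t) = counit H h \<odot>\<^bsub>A\<^esub> mA t"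
      by (rule tensor_extI) (assumption | rule lin | simp add: ht sm)+
    ultimately show ?thesis using ht by simp
  qed
  have u [simp, lin]: "(\<lambda>c. c \<odot>\<^bsub>A\<^esub> \<one>\<^bsub>A\<^esub>) \<in> lin_maps k (base_space k) A"
    using bilin_maps_left[OF smult_bilin[OF mod_A]] by simp
  have hu: "same_module (hunit k H) (base_space k)" "lact (hunit k H) h c = counit H h \<otimes>\<^bsub>k\<^esub> c" for h c
    by (simp_all add: same_module_def hunit_def module.extend_def hmod.fields_def)
  note [simp] = same_module_simps[OF hu(1)] hu(2)
  have [simp]: "carrier (hunit k H) = carrier k" using hu(1) by (simp add: same_module_def)
  have as: "mA (tensor_map k A A mA id t) = mA (tensor_map k A A id mA (rebr k A A A t))"
    if "t \<in> carrier (tensor k (tensor k A A) A)" for t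
  proof -
    have "\<forall>t\<in>carrier (tensor k (tensor k A A) A). mA (tensor_map k A A mA id t) = mA (tensor_map k A A id mA (rebr k A A A t))"
      by (rule tensor_extI_left) (assumption | rule lin | simp)+
    thus ?thesis using that by blast
  qed
  have ul: "mA (tensor_map k A A (\<lambda>c. c \<odot>\<^bsub>A\<^esub> \<one>\<^bsub>A\<^esub>) id t) = lunit A t" if "t \<in> carrier (tensor k (base_space k) A)" for t
  proof -
    have "\<forall>t\<in>carrier (tensor k (base_space k) A). mA (tensor_map k A A (\<lambda>c. c \<odot>\<^bsub>A\<^esub> \<one>\<^bsub>A\<^esub>) id t) = lunit A t"
      by (rule tensor_extI) (assumption | rule lin | simp add: sm)+
    thus ?thesis using that by blast
  qed
  have ur: "mA (tensor_map k A A id (\<lambda>c. c \<odot>\<^bsub>A\<^esub> \<one>\<^bsub>A\<^esub>) t) = runit A t" if "t \<in> carrier (tensor k A (base_space k))" for t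
  proof -
    have "\<forall>t\<in>carrier (tensor k A (base_space k)). mA (tensor_map k A A id (\<lambda>c. c \<odot>\<^bsub>A\<^esub> \<one>\<^bsub>A\<^esub>) t) = runit A t"
      by (rule tensor_extI) (assumption | rule lin | simp add: sm)+
    thus ?thesis using that by blast
  qed
  show ?thesis unfolding halgebra_def
    by (simp add: hmod_hom_def l as ul ur A.smult_assoc1)
qed

lemma map_closed [simp]:
  "module k W \<Longrightarrow> t1 \<in> carrier (tensor k (tensor k C A) W) \<Longrightarrow> tensor_map k AC W psi id t1 \<in> carrier (tensor k AC W)"
  "module k V \<Longrightarrow> t2 \<in> carrier (tensor k V (tensor k C A)) \<Longrightarrow> tensor_map k V AC id psi t2 \<in> carrier (tensor k V AC)"
  "module k W \<Longrightarrow> t3 \<in> carrier (tensor k C W) \<Longrightarrow> tensor_map k AC2 W del id t3 \<in> carrier (tensor k AC2 W)"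
  "module k V \<Longrightarrow> t4 \<in> carrier (tensor k V C) \<Longrightarrow> tensor_map k V AC2 id del t4 \<in> carrier (tensor k V AC2)"
  "module k W \<Longrightarrow> t5 \<in> carrier (tensor k V (tensor k C (tensor k A W))) \<Longrightarrow> module k V \<Longrightarrow>
    tensor_map k V (tensor k A (tensor k C W)) id (psi_left W) t5 \<in> carrier (tensor k V (tensor k A (tensor k C W)))"
  "module k V \<Longrightarrow> t6 \<in> carrier (tensor k V (tensor k C2 A)) \<Longrightarrow> tensor_map k V (tensor k C AC) id psi_right t6 \<in> carrier (tensor k V (tensor k C AC))"
  "module k V \<Longrightarrow> t7 \<in> carrier (tensor k V C2) \<Longrightarrow> tensor_map k V (tensor k C AC2) id (tensor_map k C AC2 id del) t7 \<in> carrier (tensor k V (tensor k C AC2))"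
  "module k V \<Longrightarrow> t8 \<in> carrier (tensor k V C2) \<Longrightarrow> tensor_map k V AC3 id del_left t8 \<in> carrier (tensor k V AC3)"
  "module k V \<Longrightarrow> t9 \<in> carrier (tensor k V C2) \<Longrightarrow> tensor_map k V AC id (tensor_map k A C cou id) t9 \<in> carrier (tensor k V AC)"
  "module k V \<Longrightarrow> t10 \<in> carrier (tensor k V C2) \<Longrightarrow> tensor_map k V (tensor k C A) id (tensor_map k C A id cou) t10 \<in> carrier (tensor k V (tensor k C A))"
  by (simp_all add: tensor_map_closed[OF _ psi_lin lin_maps_id] tensor_map_closed[OF _ lin_maps_id psi_lin]
      tensor_map_closed[OF _ del_lin lin_maps_id] tensor_map_closed[OF _ lin_maps_id del_lin]
      tensor_map_closed[OF _ lin_maps_id psi_left_lin] tensor_map_closed[OF _ lin_maps_id psi_right_lin]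
      tensor_map_closed[OF _ lin_maps_id tensor_map_lin[OF lin_maps_id del_lin]]
      tensor_map_closed[OF _ lin_maps_id del_left_lin]
      tensor_map_closed[OF _ lin_maps_id tensor_map_lin[OF cou_lin lin_maps_id]]
      tensor_map_closed[OF _ lin_maps_id tensor_map_lin[OF lin_maps_id cou_lin]])

text \<open>The two inner maps agree only on the carrier, so the exchange has to take place under
  \<open>tensor_map\<close>, where nothing else is seen.\<close>

lemma psi_left_hassoc:
  assumes "hmodule k H W" "module k V" "t \<in> carrier (tensor k V (tensor k C (tensor k A W)))"
  shows "tensor_map k V (tensor k A (tensor k C W)) id
      (\<lambda>x. hassoc k H TA TX W (tensor_map k AC W psi id (hassoc_inv k H TX TA W x))) t
    = tensor_map k V (tensor k A (tensor k C W)) id (psi_left W) t"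
  by (rule tensor_map_cong[symmetric, where V = V and W = "tensor k C (tensor k A W)"])
    (use assms hmoduleD(1)[OF assms(1)] in \<open>simp_all add: psi_left_def\<close>)

lemma psi_left_T [simp]: "psi_left TX = psi_left C" "psi_left (htensor k H TX TX) = psi_left C2"
  by (simp_all add: fun_eq_iff psi_left_def)

lemmas psi_left_hassocs = psi_left_hassoc[of TX, simplified] psi_left_hassoc[of "htensor k H TX TX", simplified]

lemma psi_right_hassoc:
  assumes "module k V" "t \<in> carrier (tensor k V (tensor k C2 A))"
  shows "tensor_map k V (tensor k C AC) id (\<lambda>x. tensor_map k C AC id psi (hassoc k H TX TX TA x)) t
    = tensor_map k V (tensor k C AC) id psi_right t"
  by (rule tensor_map_cong[symmetric, where V = V and W = "tensor k C2 A"])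
    (use assms in \<open>simp_all add: psi_right_def\<close>)

lemma del_left_hassoc:
  assumes "module k V" "t \<in> carrier (tensor k V C2)"
  shows "tensor_map k V AC3 id (\<lambda>x. tensor_map k A C3 id (hassoc k H TX TX TX)
      (hassoc k H TA (htensor k H TX TX) TX (tensor_map k AC2 C del id x))) t
    = tensor_map k V AC3 id del_left t"
proof -
  have e: "hassoc k H TX TX TX = assC" by (rule ext) (rule hassoc_X)
  show ?thesis unfolding e
    by (rule tensor_map_cong[symmetric, where V = V and W = C2])
      (use assms in \<open>simp_all add: del_left_def\<close>)
qed

lemma lunit_runit_inv [simp]:
  "lunit_inv k TX x = pure k (base_space k) C \<one>\<^bsub>k\<^esub> x" "runit_inv k TX x = pure k C (base_space k) x \<one>\<^bsub>k\<^esub>"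
  by (simp_all add: lunit_inv_def runit_inv_def)

lemma unit_lin [simp]: "(\<lambda>c. c \<odot>\<^bsub>A\<^esub> \<one>\<^bsub>A\<^esub>) \<in> lin_maps k (base_space k) A"
  using bilin_maps_left[OF smult_bilin[OF mod_A]] by simp

lemma walg_simps [simp]: "walg (comodule_cowreath k H A C) = TA" "wobj (comodule_cowreath k H A C) = TX"
  by (simp_all add: comodule_cowreath_def)

lemma base_one [simp]: "\<one>\<^bsub>k\<^esub> \<odot>\<^bsub>A\<^esub> \<one>\<^bsub>A\<^esub> = \<one>\<^bsub>A\<^esub>"
  by (simp add: module.smult_one)

lemma cowreath_comodule: "cowreath k H (comodule_cowreath k H A C)"
proof -
  interpret A: module k A by simp
  \<comment> \<open>With A trivial, the diagonal action on each source and target collapses to the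
    factors coming from C.\<close>
  have hom: "psi \<in> hmod_hom k H (htensor k H TX TA) (htensor k H TA TX)"
    "del \<in> hmod_hom k H TX (htensor k H TA (htensor k H TX TX))" "cou \<in> hmod_hom k H TX TA"
    using lact_trivial(2)[of TX TA] lact_trivial(1)[of TA TX] lact_trivial(1)[of TA "htensor k H TX TX"]
    by (simp_all add: hmod_hom_def psi_lact del_lact cou_eq ccounit_lact A.smult_assoc1)
  have dr: "tensor_map k A C mA id (rebr_inv k A A C (tensor_map k A AC id psi (rebr k A C A t))) = dr t" for t
    by (simp add: dr_def lmul_def)
  have lm: "tensor_map k A Y mA id (rebr_inv k A A Y t) = lmul Y t" for t and Y :: "('k, 'y, 'e) module_scheme"
    by (simp add: lmul_def)
  note [simp] = module.smult_one
  note ml = psi_mult del_psi del_coassoc cou_psi cou_del_left cou_del_right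
  show ?thesis
    using [[goals_limit = 1]]
    unfolding cowreath_def Let_def comp_def walg_simps
    apply (intro conjI ballI)
               apply (rule halgebra_TA)
              apply (rule hmodule_TX)
             apply (rule hom)
            apply (rule hom)
           apply (rule hom)
          apply (simp add: psi_mult dr_def lmul_def)
         apply (simp)
        apply (simp add: psi_left_hassocs psi_right_hassoc del_psi lmul_def[symmetric])
       apply (simp add: psi_left_hassocs del_left_hassoc del_coassoc lmul_def[symmetric])
      apply (simp add: cou_psi)
     apply (simp add: cou_del_left lmul_def[symmetric])
    apply (simp add: cou_del_right lmul_def[symmetric])
    done
qed

end

section \<open>Split coequalizers\<close>

text \<open>Any element of the coset of v has the form (f u - g u) + v, so a linear map that
  coequalizes f and g takes the value T v on it. All maps defined through \<open>rep\<close> are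
  evaluated with this.\<close>

lemma coeq_proj_rep:
  assumes m: "module k U" "module k V" and f: "f \<in> lin_maps k U V" and g: "g \<in> lin_maps k U V"
    and v: "v \<in> carrier V"
  shows "rep (coeq_proj U V f g v) \<in> carrier V"
    and "module k W \<Longrightarrow> T \<in> lin_maps k V W \<Longrightarrow> (\<And>u. u \<in> carrier U \<Longrightarrow> T (f u) = T (g u))
      \<Longrightarrow> T (rep (coeq_proj U V f g v)) = T v"
proof -
  interpret U: module k U by fact
  interpret V: module k V by fact
  let ?q = "coeq_proj U V f g v"
  note cl = lin_maps_closed[OF f] lin_maps_closed[OF g]
  \<comment> \<open>The parameter 0 exhibits v itself, so \<open>rep\<close> chooses from a nonempty
    set.\<close>
  have "f \<zero>\<^bsub>U\<^esub> \<ominus>\<^bsub>V\<^esub> g \<zero>\<^bsub>U\<^esub> = \<zero>\<^bsub>V\<^esub>"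
    using lin_maps_zero[OF f m] lin_maps_zero[OF g m] by (simp add: a_minus_def V.M.r_neg)
  hence "v \<in> ?q"
    unfolding coeq_proj_def a_r_coset_def' using v U.M.zero_closed by (force intro!: exI[of _ "\<zero>\<^bsub>U\<^esub>"])
  hence "rep ?q \<in> ?q" unfolding rep_def by (rule someI)
  then obtain u where u: "u \<in> carrier U" "rep ?q = (f u \<ominus>\<^bsub>V\<^esub> g u) \<oplus>\<^bsub>V\<^esub> v"
    unfolding coeq_proj_def a_r_coset_def' by blast
  show "rep ?q \<in> carrier V" using u v cl by simp
  assume W: "module k W" and T: "T \<in> lin_maps k V W" and e: "\<And>u. u \<in> carrier U \<Longrightarrow> T (f u) = T (g u)"
  interpret W: module k W by fact
  have "T (rep ?q) = (T (f u) \<ominus>\<^bsub>W\<^esub> T (g u)) \<oplus>\<^bsub>W\<^esub> T v"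
    using u v cl by (simp add: lin_maps_add[OF T] lin_maps_minus[OF T m(2) W])
  also have "\<dots> = T v"
    using u v cl lin_maps_closed[OF T] by (simp add: e a_minus_def W.M.r_neg)
  finally show "T (rep ?q) = T v" .
qed

text \<open>The two cosets are reparametrizations of each other, by x + u in one direction and x - u
  in the other.\<close>

lemma coeq_proj_eq:
  assumes m: "module k U" "module k V" and f: "f \<in> lin_maps k U V" and g: "g \<in> lin_maps k U V"
    and u: "u \<in> carrier U"
  shows "coeq_proj U V f g (f u) = coeq_proj U V f g (g u)"
proof -
  interpret U: module k U by fact
  interpret V: module k V by fact
  note cl = lin_maps_closed[OF f] lin_maps_closed[OF g]
  have 1: "(f x \<ominus>\<^bsub>V\<^esub> g x) \<oplus>\<^bsub>V\<^esub> f u = (f (x \<oplus>\<^bsub>U\<^esub> u) \<ominus>\<^bsub>V\<^esub> g (x \<oplus>\<^bsub>U\<^esub> u)) \<oplus>\<^bsub>V\<^esub> g u" if x: "x \<in> carrier U" for x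
  proof -
    have "(f (x \<oplus>\<^bsub>U\<^esub> u) \<ominus>\<^bsub>V\<^esub> g (x \<oplus>\<^bsub>U\<^esub> u)) \<oplus>\<^bsub>V\<^esub> g u = f x \<oplus>\<^bsub>V\<^esub> f u \<oplus>\<^bsub>V\<^esub> (\<ominus>\<^bsub>V\<^esub> g x \<oplus>\<^bsub>V\<^esub> (\<ominus>\<^bsub>V\<^esub> g u \<oplus>\<^bsub>V\<^esub> g u))"
      using x u cl by (simp add: lin_maps_add[OF f] lin_maps_add[OF g] a_minus_def V.M.minus_add V.M.a_assoc)
    also have "\<dots> = f x \<oplus>\<^bsub>V\<^esub> f u \<oplus>\<^bsub>V\<^esub> \<ominus>\<^bsub>V\<^esub> g x" using x u cl by (simp add: V.M.l_neg)
    also have "\<dots> = (f x \<ominus>\<^bsub>V\<^esub> g x) \<oplus>\<^bsub>V\<^esub> f u" using x u cl by (simp add: a_minus_def V.M.a_ac)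
    finally show ?thesis by (rule HOL.sym)
  qed
  have 2: "(f x \<ominus>\<^bsub>V\<^esub> g x) \<oplus>\<^bsub>V\<^esub> g u = (f (x \<ominus>\<^bsub>U\<^esub> u) \<ominus>\<^bsub>V\<^esub> g (x \<ominus>\<^bsub>U\<^esub> u)) \<oplus>\<^bsub>V\<^esub> f u" if x: "x \<in> carrier U" for x
    using 1[of "x \<ominus>\<^bsub>U\<^esub> u"] x u by (simp add: a_minus_def U.M.a_assoc U.M.l_neg)
  have s: "coeq_proj U V f g v = {(f x \<ominus>\<^bsub>V\<^esub> g x) \<oplus>\<^bsub>V\<^esub> v | x. x \<in> carrier U}" for v
    unfolding coeq_proj_def a_r_coset_def' by blast
  show ?thesis
    unfolding s
  proof (intro equalityI subsetI)
    fix y assume "y \<in> {(f x \<ominus>\<^bsub>V\<^esub> g x) \<oplus>\<^bsub>V\<^esub> f u | x. x \<in> carrier U}"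
    then obtain x where x: "x \<in> carrier U" "y = (f x \<ominus>\<^bsub>V\<^esub> g x) \<oplus>\<^bsub>V\<^esub> f u" by blast
    show "y \<in> {(f x \<ominus>\<^bsub>V\<^esub> g x) \<oplus>\<^bsub>V\<^esub> g u | x. x \<in> carrier U}"
      using x(2)[unfolded 1[OF x(1)]] U.M.a_closed[OF x(1) u] by blast
  next
    fix y assume "y \<in> {(f x \<ominus>\<^bsub>V\<^esub> g x) \<oplus>\<^bsub>V\<^esub> g u | x. x \<in> carrier U}"
    then obtain x where x: "x \<in> carrier U" "y = (f x \<ominus>\<^bsub>V\<^esub> g x) \<oplus>\<^bsub>V\<^esub> g u" by blast
    show "y \<in> {(f x \<ominus>\<^bsub>V\<^esub> g x) \<oplus>\<^bsub>V\<^esub> f u | x. x \<in> carrier U}"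
      using x(2)[unfolded 2[OF x(1)]] U.M.minus_closed[OF x(1) u] by blast
  qed
qed

text \<open>The operations of \<open>hcoeq\<close> are computed on chosen representatives and
  satisfy no laws on sight. A bijection onto a module that respects them pulls all laws back at
  once.\<close>

lemma module_transfer:
  assumes W: "module k W" and inj: "inj_on \<theta> (carrier Q)" and im: "\<theta> ` carrier Q = carrier W"
    and cl: "\<And>x y. x \<in> carrier Q \<Longrightarrow> y \<in> carrier Q \<Longrightarrow> x \<oplus>\<^bsub>Q\<^esub> y \<in> carrier Q" "\<zero>\<^bsub>Q\<^esub> \<in> carrier Q"
      "\<And>c x. c \<in> carrier k \<Longrightarrow> x \<in> carrier Q \<Longrightarrow> c \<odot>\<^bsub>Q\<^esub> x \<in> carrier Q"
    and ops: "\<And>x y. x \<in> carrier Q \<Longrightarrow> y \<in> carrier Q \<Longrightarrow> \<theta> (x \<oplus>\<^bsub>Q\<^esub> y) = \<theta> x \<oplus>\<^bsub>W\<^esub> \<theta> y" "\<theta> \<zero>\<^bsub>Q\<^esub> = \<zero>\<^bsub>W\<^esub>"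
      "\<And>c x. c \<in> carrier k \<Longrightarrow> x \<in> carrier Q \<Longrightarrow> \<theta> (c \<odot>\<^bsub>Q\<^esub> x) = c \<odot>\<^bsub>W\<^esub> \<theta> x"
  shows "module k Q"
proof -
  interpret W: module k W by fact
  have t: "\<And>x. x \<in> carrier Q \<Longrightarrow> \<theta> x \<in> carrier W" using im by auto
  note e = inj_onD[OF inj]
  note [simp] = t cl ops
  show ?thesis
  proof (rule moduleI)
    show "cring k" by (rule W.R.cring_axioms)
    show "abelian_group Q"
    proof (rule abelian_groupI)
      fix x assume x: "x \<in> carrier Q"
      obtain y where y: "y \<in> carrier Q" "\<theta> y = \<ominus>\<^bsub>W\<^esub> \<theta> x" using im t[OF x] by (metis W.M.a_inv_closed imageE)
      show "\<exists>y\<in>carrier Q. y \<oplus>\<^bsub>Q\<^esub> x = \<zero>\<^bsub>Q\<^esub>"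
        by (rule bexI[of _ y], rule e) (simp_all add: x y W.M.l_neg)
    next
      fix x y z assume "x \<in> carrier Q" "y \<in> carrier Q" "z \<in> carrier Q"
      thus "x \<oplus>\<^bsub>Q\<^esub> y \<oplus>\<^bsub>Q\<^esub> z = x \<oplus>\<^bsub>Q\<^esub> (y \<oplus>\<^bsub>Q\<^esub> z)" by (intro e) (simp_all add: W.M.a_assoc)
    next
      fix x y assume "x \<in> carrier Q" "y \<in> carrier Q"
      thus "x \<oplus>\<^bsub>Q\<^esub> y = y \<oplus>\<^bsub>Q\<^esub> x" by (intro e) (simp_all add: W.M.a_comm)
    next
      fix x assume "x \<in> carrier Q"
      thus "\<zero>\<^bsub>Q\<^esub> \<oplus>\<^bsub>Q\<^esub> x = x" by (intro e) simp_all
    qed simp_all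
  next
    fix a b x assume "a \<in> carrier k" "b \<in> carrier k" "x \<in> carrier Q"
    thus "(a \<oplus>\<^bsub>k\<^esub> b) \<odot>\<^bsub>Q\<^esub> x = a \<odot>\<^bsub>Q\<^esub> x \<oplus>\<^bsub>Q\<^esub> b \<odot>\<^bsub>Q\<^esub> x" "(a \<otimes>\<^bsub>k\<^esub> b) \<odot>\<^bsub>Q\<^esub> x = a \<odot>\<^bsub>Q\<^esub> (b \<odot>\<^bsub>Q\<^esub> x)"
      by (auto intro!: e simp: W.smult_l_distr W.smult_assoc1)
  next
    fix a x y assume "a \<in> carrier k" "x \<in> carrier Q" "y \<in> carrier Q"
    thus "a \<odot>\<^bsub>Q\<^esub> (x \<oplus>\<^bsub>Q\<^esub> y) = a \<odot>\<^bsub>Q\<^esub> x \<oplus>\<^bsub>Q\<^esub> a \<odot>\<^bsub>Q\<^esub> y"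
      by (intro e) (simp_all add: W.smult_r_distr)
  next
    fix x assume "x \<in> carrier Q"
    thus "\<one>\<^bsub>k\<^esub> \<odot>\<^bsub>Q\<^esub> x = x" by (intro e) simp_all
  qed simp_all
qed

text \<open>A split fork with splittings \<open>S\<close> and \<open>R\<close>. The equations make
  every class equal to the class of a value of \<open>S\<close>, so \<open>T\<close> identifies the
  quotient with \<open>W\<close> by explicit formulas, without a description of the image of f -
  g.\<close>

locale split_coeq =
  fixes k :: "'k ring" and U :: "('k, 'h, 'u, 'e) hmod_scheme" and V :: "('k, 'h, 'v, 'f) hmod_scheme"
    and W :: "('k, 'w, 'g) module_scheme" and f g T S R
  assumes mods: "module k U" "module k V" "module k W"
    and lins: "f \<in> lin_maps k U V" "g \<in> lin_maps k U V" "T \<in> lin_maps k V W"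
    and S_closed: "\<And>w. w \<in> carrier W \<Longrightarrow> S w \<in> carrier V"
    and R_closed: "\<And>v. v \<in> carrier V \<Longrightarrow> R v \<in> carrier U"
    and T_eq: "\<And>u. u \<in> carrier U \<Longrightarrow> T (f u) = T (g u)"
    and TS: "\<And>w. w \<in> carrier W \<Longrightarrow> T (S w) = w"
    and ST: "\<And>v. v \<in> carrier V \<Longrightarrow> S (T v) = f (R v)"
    and gR: "\<And>v. v \<in> carrier V \<Longrightarrow> g (R v) = v"
begin

abbreviation "q \<equiv> coeq_proj U V f g"
abbreviation "Q \<equiv> hcoeq U V f g"

definition "\<theta> P = T (rep P)"

lemma Q_simps:
  "carrier Q = q ` carrier V" "\<zero>\<^bsub>Q\<^esub> = q \<zero>\<^bsub>V\<^esub>" "x \<oplus>\<^bsub>Q\<^esub> y = q (rep x \<oplus>\<^bsub>V\<^esub> rep y)"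
  "c \<odot>\<^bsub>Q\<^esub> x = q (c \<odot>\<^bsub>V\<^esub> rep x)" "lact Q h x = q (lact V h (rep x))"
  by (simp_all add: hcoeq_def Let_def)

lemma q_closed: "v \<in> carrier V \<Longrightarrow> q v \<in> carrier Q"
  by (simp add: Q_simps)

lemma rep_closed: "P \<in> carrier Q \<Longrightarrow> rep P \<in> carrier V"
  using coeq_proj_rep(1)[OF mods(1,2) lins(1,2)] by (auto simp: Q_simps)

lemma \<theta>_q: "v \<in> carrier V \<Longrightarrow> \<theta> (q v) = T v"
  using coeq_proj_rep(2)[OF mods(1,2) lins(1,2) _ mods(3) lins(3) T_eq] by (simp add: \<theta>_def)

lemma \<theta>_closed: "P \<in> carrier Q \<Longrightarrow> \<theta> P \<in> carrier W"
  using lin_maps_closed[OF lins(3) rep_closed] by (simp add: \<theta>_def)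

text \<open>v = g (R v) and S (T v) = f (R v) have the same class, so the class of v is determined
  by T v.\<close>

lemma \<theta>_inj: "inj_on \<theta> (carrier Q)"
proof (rule inj_onI)
  have *: "q (S (T v)) = q v" if "v \<in> carrier V" for v
    using coeq_proj_eq[OF mods(1,2) lins(1,2) R_closed[OF that]] by (simp add: ST gR that)
  fix x y assume xy: "x \<in> carrier Q" "y \<in> carrier Q" "\<theta> x = \<theta> y"
  then obtain v w where vw: "v \<in> carrier V" "w \<in> carrier V" "x = q v" "y = q w" by (auto simp: Q_simps)
  with xy have "T v = T w" by (simp add: \<theta>_q)
  thus "x = y" using vw * by metis
qed

lemma \<theta>_image: "\<theta> ` carrier Q = carrier W"
proof
  show "\<theta> ` carrier Q \<subseteq> carrier W" using \<theta>_closed by auto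
  show "carrier W \<subseteq> \<theta> ` carrier Q"
  proof
    fix w assume "w \<in> carrier W"
    thus "w \<in> \<theta> ` carrier Q" using \<theta>_q[OF S_closed] TS q_closed[OF S_closed] by (metis imageI)
  qed
qed

lemma Q_closed:
  "x \<in> carrier Q \<Longrightarrow> y \<in> carrier Q \<Longrightarrow> x \<oplus>\<^bsub>Q\<^esub> y \<in> carrier Q" "\<zero>\<^bsub>Q\<^esub> \<in> carrier Q"
  "c \<in> carrier k \<Longrightarrow> x \<in> carrier Q \<Longrightarrow> c \<odot>\<^bsub>Q\<^esub> x \<in> carrier Q"
proof -
  interpret V: module k V by (rule mods)
  show "x \<in> carrier Q \<Longrightarrow> y \<in> carrier Q \<Longrightarrow> x \<oplus>\<^bsub>Q\<^esub> y \<in> carrier Q"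
    using q_closed rep_closed by (simp add: Q_simps(3))
  show "\<zero>\<^bsub>Q\<^esub> \<in> carrier Q" using q_closed by (simp add: Q_simps(2))
  show "c \<in> carrier k \<Longrightarrow> x \<in> carrier Q \<Longrightarrow> c \<odot>\<^bsub>Q\<^esub> x \<in> carrier Q"
    using q_closed rep_closed by (simp add: Q_simps(4))
qed

lemma \<theta>_ops:
  "x \<in> carrier Q \<Longrightarrow> y \<in> carrier Q \<Longrightarrow> \<theta> (x \<oplus>\<^bsub>Q\<^esub> y) = \<theta> x \<oplus>\<^bsub>W\<^esub> \<theta> y" "\<theta> \<zero>\<^bsub>Q\<^esub> = \<zero>\<^bsub>W\<^esub>"
  "c \<in> carrier k \<Longrightarrow> x \<in> carrier Q \<Longrightarrow> \<theta> (c \<odot>\<^bsub>Q\<^esub> x) = c \<odot>\<^bsub>W\<^esub> \<theta> x"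
proof -
  interpret V: module k V by (rule mods)
  show "x \<in> carrier Q \<Longrightarrow> y \<in> carrier Q \<Longrightarrow> \<theta> (x \<oplus>\<^bsub>Q\<^esub> y) = \<theta> x \<oplus>\<^bsub>W\<^esub> \<theta> y"
    using rep_closed by (simp add: Q_simps(3) \<theta>_q) (simp add: \<theta>_def lin_maps_add[OF lins(3)])
  show "\<theta> \<zero>\<^bsub>Q\<^esub> = \<zero>\<^bsub>W\<^esub>" by (simp add: Q_simps(2) \<theta>_q lin_maps_zero[OF lins(3) mods(2,3)])
  show "c \<in> carrier k \<Longrightarrow> x \<in> carrier Q \<Longrightarrow> \<theta> (c \<odot>\<^bsub>Q\<^esub> x) = c \<odot>\<^bsub>W\<^esub> \<theta> x"
    using rep_closed by (simp add: Q_simps(4) \<theta>_q) (simp add: \<theta>_def lin_maps_smult[OF lins(3)])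
qed

lemma module_Q: "module k Q"
  by (rule module_transfer[OF mods(3) \<theta>_inj \<theta>_image]) (simp_all only: Q_closed \<theta>_ops)

lemma \<theta>_lin: "\<theta> \<in> lin_maps k Q W"
  by (rule lin_mapsI) (simp_all only: \<theta>_closed \<theta>_ops)

lemma \<theta>_eqI: "x \<in> carrier Q \<Longrightarrow> y \<in> carrier Q \<Longrightarrow> \<theta> x = \<theta> y \<Longrightarrow> x = y"
  using inj_onD[OF \<theta>_inj] by blast

text \<open>Linearity into the quotient is tested after the injective linear map
  \<open>\<theta>\<close>; this avoids every argument about representatives.\<close>

lemma lin_to_Q:
  assumes "module k N" "\<And>x. x \<in> carrier N \<Longrightarrow> F x \<in> carrier Q" "(\<lambda>x. \<theta> (F x)) \<in> lin_maps k N W"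
  shows "F \<in> lin_maps k N Q"
proof -
  interpret N: module k N by fact
  show ?thesis
    by (rule lin_mapsI; (rule \<theta>_eqI)?)
      (simp_all only: assms(2) Q_closed \<theta>_ops N.M.a_closed N.smult_closed lin_maps_add[OF assms(3)] lin_maps_smult[OF assms(3)])
qed

lemma q_lin: "q \<in> lin_maps k V Q"
  by (rule lin_to_Q[OF mods(2) q_closed lin_maps_cong[OF lins(3) mods(2)]]) (simp_all add: \<theta>_q)

lemma lact_closed:
  "(\<And>v. v \<in> carrier V \<Longrightarrow> lact V h v \<in> carrier V) \<Longrightarrow> P \<in> carrier Q \<Longrightarrow> lact Q h P \<in> carrier Q"
  using q_closed rep_closed by (simp add: Q_simps(5))

lemma \<theta>_lact:
  "(\<And>v. v \<in> carrier V \<Longrightarrow> lact V h v \<in> carrier V \<and> T (lact V h v) = l (T v)) \<Longrightarrow> P \<in> carrier Q \<Longrightarrow> \<theta> (lact Q h P) = l (\<theta> P)"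
  using rep_closed by (simp add: Q_simps(5) \<theta>_q) (simp add: \<theta>_def)

end

lemma hmodule_transfer:
  assumes "quasi_bialgebra_over k H" and W: "hmodule k H W" and Q: "module k Q"
    and inj: "inj_on \<theta> (carrier Q)" and \<theta>: "\<theta> \<in> lin_maps k Q W"
    and cl: "\<And>h x. h \<in> carrier H \<Longrightarrow> x \<in> carrier Q \<Longrightarrow> lact Q h x \<in> carrier Q"
    and l: "\<And>h x. h \<in> carrier H \<Longrightarrow> x \<in> carrier Q \<Longrightarrow> \<theta> (lact Q h x) = lact W h (\<theta> x)"
  shows "hmodule k H Q"
proof -
  interpret quasi_bialgebra_over k H by fact
  interpret Q: module k Q by fact
  interpret H: module k H by simp
  note w = hmoduleD[OF W] and e = inj_onD[OF inj]
  note [simp] = cl l lin_maps_closed[OF \<theta>] lin_maps_add[OF \<theta>] lin_maps_smult[OF \<theta>]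
    lin_maps_add[OF bilin_maps_left[OF w(2)]] lin_maps_smult[OF bilin_maps_left[OF w(2)]]
    lin_maps_add[OF bilin_maps_right[OF w(2)]] lin_maps_smult[OF bilin_maps_right[OF w(2)]]
  have "lact Q \<in> bilin_maps k H Q Q"
    by (rule bilin_mapsI; rule lin_mapsI; (rule e)?) simp_all
  moreover have "lact Q \<one>\<^bsub>H\<^esub> x = x" if "x \<in> carrier Q" for x
    by (rule e) (simp_all add: that w)
  moreover have "lact Q (g \<otimes>\<^bsub>H\<^esub> h) x = lact Q g (lact Q h x)" if "x \<in> carrier Q" "g \<in> carrier H" "h \<in> carrier H" for g h x
    by (rule e) (simp_all add: that w)
  ultimately show ?thesis using Q by (simp add: hmodule_def left_action_def)
qed

section \<open>The tensor product over the comodule algebra\<close>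

text \<open>A right A-module in left H-modules, written elementwise. Since A is trivial,
  associativity involves no \<Phi> and H-linearity of the action involves only the H-action on
  \<open>M\<close>.\<close>

locale right_module_setup = comodule_setup k H A C
  for k :: "'k ring" and H :: "('k, 'h) quasi_bialg" and A :: "('k, 'h, 'a) comod_alg" and C :: "('k, 'h, 'c) bimod_coalg" +
  fixes M :: "('k, 'h, 'm, 'e) hmod_scheme" and \<mu> :: "('m, 'a) tensor \<Rightarrow> 'm"
  assumes hmodule_M [simp]: "hmodule k H M" and \<mu>_lin [simp]: "\<mu> \<in> lin_maps k (tensor k M A) M"
    and \<mu>_mult: "\<And>m a b. m \<in> carrier M \<Longrightarrow> a \<in> carrier A \<Longrightarrow> b \<in> carrier A \<Longrightarrow>
      \<mu> (pure k M A m (a \<otimes>\<^bsub>A\<^esub> b)) = \<mu> (pure k M A (\<mu> (pure k M A m a)) b)"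
    and \<mu>_one: "\<And>m. m \<in> carrier M \<Longrightarrow> \<mu> (pure k M A m \<one>\<^bsub>A\<^esub>) = m"
    and \<mu>_lact: "\<And>h m a. h \<in> carrier H \<Longrightarrow> m \<in> carrier M \<Longrightarrow> a \<in> carrier A \<Longrightarrow>
      \<mu> (pure k M A (lact M h m) a) = lact M h (\<mu> (pure k M A m a))"
begin

lemmas M_simps [simp] = hmoduleD[OF hmodule_M]
lemmas mod_M [lin] = M_simps(1)
lemmas \<mu>_lins [lin] = \<mu>_lin lin_maps_comp[OF \<mu>_lin]
lemmas \<mu>_closed [simp, lin] = lin_maps_closed[OF \<mu>_lin]

abbreviation "rM \<equiv> (\<lambda>a m. \<mu> (pure k M A m a))"
abbreviation "RM1 \<equiv> tensor_act k M C rM RC"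
abbreviation "RM2 \<equiv> tensor_act k M C2 rM RC2"

lemma rM_bilin [simp]: "rM \<in> bilin_maps k A M M"
  by (rule bilin_mapsI; (assumption | rule lin | simp)+)

lemma RM_bilin [simp]:
  "RM1 \<in> bilin_maps k AH (tensor k M C) (tensor k M C)" "RM2 \<in> bilin_maps k AH2 (tensor k M C2) (tensor k M C2)"
  by (intro tensor_act_bilin; simp)+

lemmas RM_lin [lin] = rM_bilin RM_bilin M_simps(2)

lemma RM1_mult:
  "s \<in> carrier AH \<Longrightarrow> s' \<in> carrier AH \<Longrightarrow> t \<in> carrier (tensor k M C) \<Longrightarrow> RM1 (s \<otimes>\<^bsub>AH\<^esub> s') t = RM1 s' (RM1 s t)"
  by (rule tensor_act_mult_right[OF rM_bilin RC_simps(1)]) (simp_all add: RC_mult \<mu>_mult)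

lemma RM1_one: "t \<in> carrier (tensor k M C) \<Longrightarrow> RM1 \<one>\<^bsub>AH\<^esub> t = t"
  by (rule tensor_act_one[OF rM_bilin RC_simps(1)]) (simp_all add: \<mu>_one)

text \<open>Lets the coefficient of A \<otimes> Y act on M; for Y = C this is the map \<theta> on
  representatives.\<close>

definition "mu_out Y t = tensor_map k M Y \<mu> id (rebr_inv k M A Y t)"

lemma mu_out_lin [simp, lin]:
  "module k Y \<Longrightarrow> mu_out Y \<in> lin_maps k (tensor k M (tensor k A Y)) (tensor k M Y)"
  unfolding mu_out_def[abs_def] by (rule lin | simp)+

lemma mu_out_comp_lin [lin]:
  "F \<in> lin_maps k N (tensor k M (tensor k A Y)) \<Longrightarrow> module k Y \<Longrightarrow> (\<lambda>x. mu_out Y (F x)) \<in> lin_maps k N (tensor k M Y)"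
  by (rule lin_maps_comp[OF mu_out_lin])

lemma mu_out_closed [simp, lin]:
  "t \<in> carrier (tensor k M (tensor k A Y)) \<Longrightarrow> module k Y \<Longrightarrow> mu_out Y t \<in> carrier (tensor k M Y)"
  by (rule lin_maps_closed[OF mu_out_lin])

lemma mu_out_pure [simp]:
  "module k Y \<Longrightarrow> m \<in> carrier M \<Longrightarrow> a \<in> carrier A \<Longrightarrow> y \<in> carrier Y \<Longrightarrow>
    mu_out Y (pure k M (tensor k A Y) m (pure k A Y a y)) = pure k M Y (\<mu> (pure k M A m a)) y"
  by (simp add: mu_out_def)

end

text \<open>\<open>N\<close> is a free left A-module on \<open>Y\<close> through the isomorphism
  \<open>\<phi>\<close> with inverse \<open>\<chi>\<close>, so that M \<otimes>_A N should be M
  \<otimes> Y. The cases are N = D with Y = C and N = D \<otimes>_A D with Y = C \<otimes> C; in the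
  first, \<open>M\<close> may again be D or M \<otimes>_A D.\<close>

locale over_split = right_module_setup k H A C M \<mu>
  for k :: "'k ring" and H :: "('k, 'h) quasi_bialg" and A :: "('k, 'h, 'a) comod_alg" and C :: "('k, 'h, 'c) bimod_coalg"
    and M :: "('k, 'h, 'm, 'e) hmod_scheme" and \<mu> :: "('m, 'a) tensor \<Rightarrow> 'm" +
  fixes N :: "('k, 'h, 'n, 'f) hmod_scheme" and \<nu> :: "('a, 'n) tensor \<Rightarrow> 'n"
    and Y :: "('k, 'h, 'y, 'g) hmod_scheme" and \<phi> \<chi>
  assumes hmodule_N [simp]: "hmodule k H N" and hmodule_Y [simp]: "hmodule k H Y"
    and \<nu>_lin [simp]: "\<nu> \<in> lin_maps k (tensor k A N) N"
    and \<phi>_lin [simp]: "\<phi> \<in> lin_maps k N (tensor k A Y)" and \<chi>_lin [simp]: "\<chi> \<in> lin_maps k (tensor k A Y) N"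
    and \<phi>\<chi>: "\<And>t. t \<in> carrier (tensor k A Y) \<Longrightarrow> \<phi> (\<chi> t) = t" and \<chi>\<phi>: "\<And>n. n \<in> carrier N \<Longrightarrow> \<chi> (\<phi> n) = n"
    and \<phi>_\<nu>: "\<And>a n. a \<in> carrier A \<Longrightarrow> n \<in> carrier N \<Longrightarrow>
      \<phi> (\<nu> (pure k A N a n)) = lmul Y (pure k A (tensor k A Y) a (\<phi> n))"
    and \<phi>_lact: "\<And>h n. h \<in> carrier H \<Longrightarrow> n \<in> carrier N \<Longrightarrow> \<phi> (lact N h n) = tensor_map k A Y id (lact Y h) (\<phi> n)"
begin

lemmas N_simps [simp] = hmoduleD[OF hmodule_N] hmoduleD[OF hmodule_Y]
lemmas mod_N [lin] = N_simps(1) N_simps(6)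
lemmas \<nu>_lins [lin] = \<nu>_lin lin_maps_comp[OF \<nu>_lin] \<phi>_lin lin_maps_comp[OF \<phi>_lin] \<chi>_lin lin_maps_comp[OF \<chi>_lin]
lemmas \<nu>_closed [simp, lin] = lin_maps_closed[OF \<nu>_lin] lin_maps_closed[OF \<phi>_lin] lin_maps_closed[OF \<chi>_lin]

text \<open>The splitting data. \<open>S\<close> inserts the unit of A into the free module;
  \<open>R\<close> writes n as \<open>\<chi>\<close> of a sum of a \<otimes> y and splits it into
  the coefficient a and the basis part \<open>sec y\<close>. The action on M of the coefficient
  gives S T, its action on \<open>sec y\<close> gives back n.\<close>

definition "T t = mu_out Y (tensor_map k M (tensor k A Y) id \<phi> t)"
definition "sec y = \<chi> (pure k A Y \<one>\<^bsub>A\<^esub> y)"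
definition "S = tensor_map k M N id sec"
definition "R t = tensor_map k (tensor k M A) N id sec (rebr_inv k M A Y (tensor_map k M (tensor k A Y) id \<phi> t))"

lemma T_lin [simp, lin]: "T \<in> lin_maps k (tensor k M N) (tensor k M Y)"
  unfolding T_def[abs_def] by (rule lin | simp)+

lemma sec_lin [simp, lin]: "sec \<in> lin_maps k Y N"
  unfolding sec_def[abs_def] by (rule lin | simp)+

lemma S_lin [simp, lin]: "S \<in> lin_maps k (tensor k M Y) (tensor k M N)"
  unfolding S_def by (rule tensor_map_lin) simp_all

lemma R_lin': "R \<in> lin_maps k (tensor k M N) (tensor k (tensor k M A) N)"
  unfolding R_def[abs_def] by (rule lin | simp)+

lemmas TSR_comp_lin [lin] = lin_maps_comp[OF T_lin] lin_maps_comp[OF S_lin] lin_maps_comp[OF R_lin']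
lemmas TSR_closed [simp, lin] = lin_maps_closed[OF T_lin] lin_maps_closed[OF S_lin] lin_maps_closed[OF sec_lin]

lemma T_pure [simp]: "m \<in> carrier M \<Longrightarrow> n \<in> carrier N \<Longrightarrow> T (pure k M N m n) = mu_out Y (pure k M (tensor k A Y) m (\<phi> n))"
  by (simp add: T_def)

abbreviation "MN \<equiv> tensor_over k H TA M \<mu> N \<nu>"
abbreviation "prMN \<equiv> proj_over k H TA M \<mu> N \<nu>"

abbreviation "ff \<equiv> tensor_map k M N \<mu> id"
abbreviation "gg \<equiv> tensor_map k M N id \<nu> \<circ> hassoc k H M TA N"

lemma split: "split_coeq k (htensor k H (htensor k H M TA) N) (htensor k H M N) (tensor k M Y) ff gg T S R"
proof (rule split_coeq.intro)
  show "gg \<in> lin_maps k (htensor k H (htensor k H M TA) N) (htensor k H M N)"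
  proof (rule lin_maps_cong[where f = "\<lambda>t. tensor_map k M N id \<nu> (rebr k M A N t)"])
    show "(\<lambda>t. tensor_map k M N id \<nu> (rebr k M A N t)) \<in> lin_maps k (htensor k H (htensor k H M TA) N) (htensor k H M N)"
      by simp (rule lin | simp)+
  qed simp_all
  have "\<forall>t\<in>carrier (tensor k (tensor k M A) N). T (ff t) = T (tensor_map k M N id \<nu> (rebr k M A N t))"
  proof (rule tensor_extI_left)
    fix m a n assume man: "m \<in> carrier M" "a \<in> carrier A" "n \<in> carrier N"
    \<comment> \<open>\<open>z\<close> replaces \<phi>(n), so that a pure coefficient and basis
      element suffice; what remains is associativity of the action on M.\<close>
    have "\<forall>z\<in>carrier (tensor k A Y). mu_out Y (pure k M (tensor k A Y) (\<mu> (pure k M A m a)) z)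
        = mu_out Y (pure k M (tensor k A Y) m (lmul Y (pure k A (tensor k A Y) a z)))"
      by (rule tensor_extI) (assumption | rule lin man | simp add: man \<mu>_mult)+
    thus "T (ff (pure k (tensor k M A) N (pure k M A m a) n)) = T (tensor_map k M N id \<nu> (rebr k M A N (pure k (tensor k M A) N (pure k M A m a) n)))"
      using man by (simp add: \<phi>_\<nu>)
  qed (assumption | rule lin | simp)+
  thus "T (ff u) = T (gg u)" if "u \<in> carrier (htensor k H (htensor k H M TA) N)" for u using that by simp
  have "\<forall>w\<in>carrier (tensor k M Y). T (S w) = w"
    by (rule tensor_extI) (assumption | rule lin | simp add: S_def sec_def \<phi>\<chi> \<mu>_one)+
  thus "T (S w) = w" if "w \<in> carrier (tensor k M Y)" for w using that by blast
  have "\<forall>t\<in>carrier (tensor k M N). S (T t) = ff (R t)"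
  proof (rule tensor_extI)
    fix m n assume mn: "m \<in> carrier M" "n \<in> carrier N"
    have "\<forall>z\<in>carrier (tensor k A Y). S (mu_out Y (pure k M (tensor k A Y) m z))
        = ff (tensor_map k (tensor k M A) N id sec (rebr_inv k M A Y (pure k M (tensor k A Y) m z)))"
      by (rule tensor_extI) (assumption | rule lin mn | simp add: mn S_def)+
    thus "S (T (pure k M N m n)) = ff (R (pure k M N m n))" using mn by (simp add: R_def)
  qed (assumption | rule lin | simp)+
  thus "S (T v) = ff (R v)" if "v \<in> carrier (htensor k H M N)" for v using that by simp
  \<comment> \<open>By A-linearity \<phi> sends the left side to b(1 \<otimes> y) = b \<otimes> y,
    and \<open>\<chi>\<close> inverts \<phi>.\<close>
  have \<nu>sec: "\<nu> (pure k A N b (sec y)) = \<chi> (pure k A Y b y)" if "b \<in> carrier A" "y \<in> carrier Y" for b y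
  proof -
    have "\<phi> (\<nu> (pure k A N b (sec y))) = pure k A Y b y" using that by (simp add: \<phi>_\<nu> sec_def \<phi>\<chi>)
    thus ?thesis using that \<chi>\<phi>[of "\<nu> (pure k A N b (sec y))"] by simp
  qed
  have "\<forall>t\<in>carrier (tensor k M N). tensor_map k M N id \<nu> (rebr k M A N (R t)) = t"
  proof (rule tensor_extI)
    fix m n assume mn: "m \<in> carrier M" "n \<in> carrier N"
    have "\<forall>z\<in>carrier (tensor k A Y). tensor_map k M N id \<nu> (rebr k M A N
        (tensor_map k (tensor k M A) N id sec (rebr_inv k M A Y (pure k M (tensor k A Y) m z)))) = pure k M N m (\<chi> z)"
      by (rule tensor_extI) (assumption | rule lin mn | simp add: mn \<nu>sec)+
    thus "tensor_map k M N id \<nu> (rebr k M A N (R (pure k M N m n))) = pure k M N m n"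
      using mn by (simp add: R_def \<chi>\<phi>)
  qed (assumption | rule lin | simp)+
  thus "gg (R v) = v" if "v \<in> carrier (htensor k H M N)" for v
    using that lin_maps_closed[OF R_lin'] by simp
qed (simp_all add: tensor_map_lin lin_maps_closed[OF R_lin'])

sublocale sc: split_coeq k "htensor k H (htensor k H M TA) N" "htensor k H M N" "tensor k M Y" ff gg T S R
  by (rule split)

lemma MN_eq: "MN = sc.Q" "prMN = sc.q"
  by (simp_all add: tensor_over_def proj_over_def fun_eq_iff)

lemmas MN_simps [simp] = sc.module_Q[folded MN_eq]
lemmas MN_lin [simp, lin] = sc.\<theta>_lin[folded MN_eq] sc.q_lin[folded MN_eq, simplified htensor_same]
lemmas MN_closed [simp, lin] = lin_maps_closed[OF MN_lin(1)] lin_maps_closed[OF MN_lin(2)]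
lemmas rep_MN [simp, lin] = sc.rep_closed[folded MN_eq, simplified htensor_simps]
lemmas \<theta>_pr [simp] = sc.\<theta>_q[folded MN_eq, simplified htensor_simps]
lemmas \<theta>_eqI = sc.\<theta>_eqI[folded MN_eq]
lemmas \<theta>_image = sc.\<theta>_image[folded MN_eq]
lemmas \<theta>_inj = sc.\<theta>_inj[folded MN_eq]
lemmas lin_to_MN = sc.lin_to_Q[folded MN_eq]

text \<open>H acts on A \<otimes> Y through Y alone and commutes with the A-action on M, so letting
  coefficients act on M is H-linear. Stated for all of H \<otimes> H in place of
  \<Delta>(h).\<close>

lemma T_lact:
  assumes s: "s \<in> carrier H2" and t: "t \<in> carrier (tensor k M N)"
  shows "T (tensor_act k M N (lact M) (lact N) s t) = tensor_act k M Y (lact M) (lact Y) s (T t)"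
proof -
  note [lin] = N_simps(2,7)
  have "\<forall>s\<in>carrier H2. T (tensor_act k M N (lact M) (lact N) s t) = tensor_act k M Y (lact M) (lact Y) s (T t)"
  proof (rule tensor_extI)
    fix x y assume xy: "x \<in> carrier H" "y \<in> carrier H"
    note l [simp, lin] = bilin_maps_right[OF N_simps(7) xy(2)]
    have "\<forall>t\<in>carrier (tensor k M N). T (tensor_act k M N (lact M) (lact N) (pure k H H x y) t)
        = tensor_act k M Y (lact M) (lact Y) (pure k H H x y) (T t)"
    proof (rule tensor_extI)
      fix m n assume mn: "m \<in> carrier M" "n \<in> carrier N"
      have "\<forall>z\<in>carrier (tensor k A Y). mu_out Y (pure k M (tensor k A Y) (lact M x m) (tensor_map k A Y id (lact Y y) z))
          = tensor_act k M Y (lact M) (lact Y) (pure k H H x y) (mu_out Y (pure k M (tensor k A Y) m z))"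
        by (rule tensor_extI) (assumption | rule lin mn xy | simp add: mn xy \<mu>_lact)+
      thus "T (tensor_act k M N (lact M) (lact N) (pure k H H x y) (pure k M N m n))
        = tensor_act k M Y (lact M) (lact Y) (pure k H H x y) (T (pure k M N m n))"
        using mn xy by (simp add: \<phi>_lact)
    qed (assumption | rule lin xy | simp add: xy)+
    thus "T (tensor_act k M N (lact M) (lact N) (pure k H H x y) t)
        = tensor_act k M Y (lact M) (lact Y) (pure k H H x y) (T t)" using t by blast
  qed (assumption | rule lin t | simp)+
  thus ?thesis using s by blast
qed

lemma lact_MN:
  assumes h: "h \<in> carrier H" and P: "P \<in> carrier MN"
  shows "lact MN h P \<in> carrier MN"
    and "sc.\<theta> (lact MN h P) = tensor_act k M Y (lact M) (lact Y) (comult H h) (sc.\<theta> P)"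
proof -
  note b = tensor_act_bilin[OF M_simps(2) N_simps(2) mod_H mod_H mod_M mod_N(1)]
  show "lact MN h P \<in> carrier MN"
    unfolding MN_eq by (rule sc.lact_closed)
      (use P h bilin_maps_closed[OF b] in \<open>simp_all add: MN_eq\<close>)
  show "sc.\<theta> (lact MN h P) = tensor_act k M Y (lact M) (lact Y) (comult H h) (sc.\<theta> P)"
    unfolding MN_eq by (rule sc.\<theta>_lact)
      (use P h bilin_maps_closed[OF b] T_lact in \<open>simp_all add: MN_eq\<close>)
qed

lemma hmodule_MN: "hmodule k H MN"
  by (rule hmodule_transfer[OF quasi_bialgebra_over_axioms hmodule_htensor[OF hmodule_M hmodule_Y] MN_simps \<theta>_inj])
    (simp_all add: lact_MN)

end

lemma lin_maps_inv_into:
  assumes \<theta>: "\<theta> \<in> lin_maps k Q W" and inj: "inj_on \<theta> (carrier Q)" and im: "\<theta> ` carrier Q = carrier W"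
    and Q: "module k Q"
  shows "inv_into (carrier Q) \<theta> \<in> lin_maps k W Q"
proof -
  interpret Q: module k Q by fact
  let ?i = "inv_into (carrier Q) \<theta>"
  have c: "\<And>w. w \<in> carrier W \<Longrightarrow> ?i w \<in> carrier Q" "\<And>w. w \<in> carrier W \<Longrightarrow> \<theta> (?i w) = w"
    using im by (auto intro: inv_into_into f_inv_into_f)
  have b: "\<And>x. x \<in> carrier Q \<Longrightarrow> ?i (\<theta> x) = x" using inj by simp
  show ?thesis
  proof (rule lin_mapsI)
    fix x y assume xy: "x \<in> carrier W" "y \<in> carrier W"
    have "?i (\<theta> (?i x \<oplus>\<^bsub>Q\<^esub> ?i y)) = ?i x \<oplus>\<^bsub>Q\<^esub> ?i y" by (rule b) (simp add: c xy)
    thus "?i (x \<oplus>\<^bsub>W\<^esub> y) = ?i x \<oplus>\<^bsub>Q\<^esub> ?i y" using c xy by (simp add: lin_maps_add[OF \<theta>])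
  next
    fix r x assume rx: "r \<in> carrier k" "x \<in> carrier W"
    have "?i (\<theta> (r \<odot>\<^bsub>Q\<^esub> ?i x)) = r \<odot>\<^bsub>Q\<^esub> ?i x" by (rule b) (simp add: c rx)
    thus "?i (r \<odot>\<^bsub>W\<^esub> x) = r \<odot>\<^bsub>Q\<^esub> ?i x" using c rx by (simp add: lin_maps_smult[OF \<theta>])
  qed (rule c)
qed

lemma tensor_map_param:
  assumes b: "b \<in> bilin_maps k Z W' W" and f: "f \<in> lin_maps k V' V" and F: "F \<in> lin_maps k N Z"
    and t: "t \<in> carrier (tensor k V' W')"
    and m: "module k Z" "module k V" "module k W" "module k V'" "module k W'" "module k N"
  shows "(\<lambda>s. tensor_map k V W f (b (F s)) t) \<in> lin_maps k N (tensor k V W)"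
  unfolding tensor_map_def
proof (rule tensor_lift_param'[OF t])
  fix u assume "u \<in> carrier N"
  thus "(\<lambda>v w. pure k V W (f v) (b (F u) w)) \<in> bilin_maps k V' W' (tensor k V W)"
    by (intro tensor_map_bilin m f bilin_maps_right[OF b] lin_maps_closed[OF F])
next
  fix v w assume "v \<in> carrier V'" "w \<in> carrier W'"
  thus "(\<lambda>u. pure k V W (f v) (b (F u) w)) \<in> lin_maps k N (tensor k V W)"
    by (intro pure_lin_right m lin_maps_closed[OF f] bilin_maps_comp_left[OF b F])
qed (rule m module_tensor)+

lemma htensor_cong:
  assumes "same_module M M'" "lact M = lact M'" "same_module N N'" "lact N = lact N'"
  shows "htensor k H M N = htensor k H M' N'"
  unfolding htensor_def tensor_same[OF same_module_refl assms(1,3)] tensor_act_same[OF same_module_refl assms(1,3)] assms(2,4)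
  by (rule HOL.refl)

text \<open>Needed where the same tensor product over A is formed from two records: the coring D and
  its underlying object A \<otimes> C, or a corepresentation and the bimodule made from it.\<close>

lemma tensor_over_cong:
  assumes s: "same_module M M'" "same_module N N'" and l: "lact M = lact M'" "lact N = lact N'"
  shows "tensor_over k H A M \<mu> N \<nu> = tensor_over k H A M' \<mu> N' \<nu>"
proof -
  note h1 = htensor_cong[OF s(1) l(1) same_module_refl HOL.refl] and h2 = htensor_cong[OF s(1) l(1) s(2) l(2)]
  have h3: "htensor k H (htensor k H M A) N = htensor k H (htensor k H M' A) N'"
    unfolding h1 by (rule htensor_cong[OF same_module_refl HOL.refl s(2) l(2)])
  have t: "tensor_map k M N = tensor_map k M' N'" by (rule tensor_map_same[OF same_module_refl s])
  have r: "rebr k M A N = rebr k M' A N'" by (rule rebr_same[OF s(1) same_module_refl s(2)])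
  have a: "hassoc k H M A N = hassoc k H M' A N'"
    unfolding hassoc_def[abs_def] r l tensor_same[OF same_module_refl same_module_refl s(2)]
      tensor_act_same[OF same_module_refl same_module_refl s(2)]
    by (simp add: tensor_act_same[OF same_module_refl s(1) same_module_refl])
  show ?thesis unfolding tensor_over_def h2 h3 t a by (rule HOL.refl)
qed

section \<open>The induced coring as an A-bimodule\<close>

context comodule_setup
begin

abbreviation "D \<equiv> induced_coring k H (comodule_cowreath k H A C)"

lemma same_D: "same_module D AC" and lact_D: "lact D = lact (htensor k H TA TX)"
proof -
  have "same_module D (htensor k H TA TX)"
    by (simp add: same_module_def induced_coring_def Let_def hmod.extend_def coring_data.fields_def)
  with same_module_htensor[of k H TA TX] show "same_module D AC"
    by (simp add: same_module_def)
qed (simp add: induced_coring_def Let_def hmod.extend_def coring_data.fields_def)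

lemmas D_same [simp] = same_module_simps[OF same_D] same_module_module[OF same_D]

lemma D_simps [simp]: "carrier D = carrier AC" "add D = add AC" "smult D = smult AC" "\<zero>\<^bsub>D\<^esub> = \<zero>\<^bsub>AC\<^esub>"
  using same_D by (simp_all add: same_module_def)

lemma hmodule_D [simp]: "hmodule k H D"
  using hmodule_htensor[OF hmodule_TA hmodule_TX] lact_D by (simp add: hmodule_def left_action_def)

lemma lact_D_eq [simp]: "h \<in> carrier H \<Longrightarrow> d \<in> carrier AC \<Longrightarrow> lact D h d = tensor_map k A C id (lact C h) d"
  using lact_trivial(1)[of TA TX h d] by (simp add: lact_D)

lemma lact_D_closed [simp]: "h \<in> carrier H \<Longrightarrow> d \<in> carrier AC \<Longrightarrow> tensor_map k A C id (lact C h) d \<in> carrier AC"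
  using hmoduleD(5)[OF hmodule_D, of h d] by simp

lemma lact_D_bilin [simp, lin]: "lact D \<in> bilin_maps k H AC AC"
  using hmoduleD(2)[OF hmodule_D] by simp

lemma lact_C_lin [simp, lin]: "h \<in> carrier H \<Longrightarrow> lact C h \<in> lin_maps k C C"
  by (rule bilin_maps_right[OF C_simps(2)])

lemma dleft_eq [simp]: "t \<in> carrier (tensor k A AC) \<Longrightarrow> dleft D t = lmul C t"
  by (simp add: induced_coring_def Let_def hmod.extend_def coring_data.fields_def lmul_def)

lemma dright_eq [simp]: "t \<in> carrier (tensor k AC A) \<Longrightarrow> dright D t = dr t"
  by (simp add: induced_coring_def Let_def hmod.extend_def coring_data.fields_def dr_def lmul_def)

lemma dcounit_eq [simp]: "dcounit D d = mA (tensor_map k A A id cou d)"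
  by (simp add: induced_coring_def Let_def hmod.extend_def coring_data.fields_def)

lemma dleft_lin [simp, lin]: "dleft D \<in> lin_maps k (tensor k A AC) AC" and dright_lin [simp, lin]: "dright D \<in> lin_maps k (tensor k AC A) AC"
  by (rule lin_maps_cong[OF lmul_lin] lin_maps_cong[OF dr_lin]; simp)+

lemma RA1_id: "d \<in> carrier AC \<Longrightarrow> RA1 (pure k A H \<one>\<^bsub>A\<^esub> \<one>\<^bsub>H\<^esub>) d = d"
  unfolding tensor_one[symmetric] by (rule tensor_act_one[OF RA_bilin RC_simps(1)]) simp_all

text \<open>D is itself an admissible right module, by multiplicativity and unitality of \<rho>, so
  D \<otimes>_A D is an instance of the general M \<otimes>_A D.\<close>

lemma right_module_D: "right_module_setup k H A C D (dright D)"
proof (rule right_module_setup.intro[OF comodule_setup_axioms right_module_setup_axioms.intro])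
  fix h d a assume hda: "h \<in> carrier H" "d \<in> carrier D" "a \<in> carrier A"
  have d: "d \<in> carrier AC" using hda by simp
  have "\<forall>s\<in>carrier AH. RA1 s (tensor_map k A C id (lact C h) d) = tensor_map k A C id (lact C h) (RA1 s d)"
  proof (rule tensor_extI)
    fix a g assume ag: "a \<in> carrier A" "g \<in> carrier H"
    have "\<forall>d\<in>carrier AC. RA1 (pure k A H a g) (tensor_map k A C id (lact C h) d) = tensor_map k A C id (lact C h) (RA1 (pure k A H a g) d)"
      by (rule tensor_extI) (assumption | rule lin hda ag | simp add: hda ag RC_facts)+
    thus "RA1 (pure k A H a g) (tensor_map k A C id (lact C h) d) = tensor_map k A C id (lact C h) (RA1 (pure k A H a g) d)"
      using d by blast
  qed (assumption | rule lin hda d | simp add: hda d)+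
  thus "dright D (pure k D A (lact D h d) a) = lact D h (dright D (pure k D A d a))"
    using hda d by simp
qed (simp_all add: alg_mapsD(2)[OF rho_alg] R_mult RA1_id)

end

section \<open>Coordinates on M \<otimes>_A D\<close>

context right_module_setup
begin

abbreviation "MD \<equiv> tensor_over k H TA M \<mu> D (dleft D)"
abbreviation "prMD \<equiv> proj_over k H TA M \<mu> D (dleft D)"
definition "thetaMD P = mu_out C (rep P)"

lemma over_split_MD: "over_split k H A C M \<mu> D (dleft D) C id id"
  by (rule over_split.intro[OF right_module_setup_axioms over_split_axioms.intro])
    (simp_all add: lin_maps_id)

lemma MD_facts:
  shows mod_MD [simp, lin]: "module k MD"
    and thetaMD_lin [simp, lin]: "thetaMD \<in> lin_maps k MD (tensor k M C)"
    and prMD_lin [simp, lin]: "prMD \<in> lin_maps k (tensor k M AC) MD"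
    and rep_MD [simp, lin]: "P \<in> carrier MD \<Longrightarrow> rep P \<in> carrier (tensor k M AC)"
    and thetaMD_pr [simp]: "v \<in> carrier (tensor k M AC) \<Longrightarrow> thetaMD (prMD v) = mu_out C v"
    and thetaMD_eqI: "P \<in> carrier MD \<Longrightarrow> P' \<in> carrier MD \<Longrightarrow> thetaMD P = thetaMD P' \<Longrightarrow> P = P'"
    and thetaMD_image: "thetaMD ` carrier MD = carrier (tensor k M C)"
    and lin_to_MD: "module k N \<Longrightarrow> (\<And>x. x \<in> carrier N \<Longrightarrow> F x \<in> carrier MD) \<Longrightarrow> (\<lambda>x. thetaMD (F x)) \<in> lin_maps k N (tensor k M C) \<Longrightarrow> F \<in> lin_maps k N MD"
    and lact_MD_closed [simp]: "h \<in> carrier H \<Longrightarrow> P \<in> carrier MD \<Longrightarrow> lact MD h P \<in> carrier MD"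
    and thetaMD_lact: "h \<in> carrier H \<Longrightarrow> P \<in> carrier MD \<Longrightarrow> thetaMD (lact MD h P) = tensor_act k M C (lact M) (lact C) (comult H h) (thetaMD P)"
    and hmodule_MD [simp]: "hmodule k H MD"
proof -
  interpret X: over_split k H A C M \<mu> D "dleft D" C id id by (rule over_split_MD)
  have T: "X.T v = mu_out C v" if "v \<in> carrier (tensor k M AC)" for v
    using tensor_map_cong[OF lin_maps_id lin_maps_id mod_M module_tensor[OF mod_A mod_C] mod_M module_tensor[OF mod_A mod_C] that,
      of "\<lambda>x. x" "\<lambda>x. x"] tensor_map_ident[OF mod_M module_tensor[OF mod_A mod_C] that]
    by (simp add: X.T_def)
  show rep: "\<And>P. P \<in> carrier MD \<Longrightarrow> rep P \<in> carrier (tensor k M AC)"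
    using X.rep_MN by simp
  have \<theta>: "X.sc.\<theta> P = thetaMD P" if "P \<in> carrier MD" for P
    using T[OF rep[OF that]] by (simp add: thetaMD_def X.sc.\<theta>_def)
  show m: "module k MD" by (rule X.MN_simps)
  show "thetaMD \<in> lin_maps k MD (tensor k M C)"
    by (rule lin_maps_cong[OF X.MN_lin(1) m \<theta>])
  show pr: "prMD \<in> lin_maps k (tensor k M AC) MD"
    using X.MN_lin(2) by simp
  show "\<And>v. v \<in> carrier (tensor k M AC) \<Longrightarrow> thetaMD (prMD v) = mu_out C v"
    using X.\<theta>_pr T \<theta> lin_maps_closed[OF pr] by simp
  show "\<And>P P'. P \<in> carrier MD \<Longrightarrow> P' \<in> carrier MD \<Longrightarrow> thetaMD P = thetaMD P' \<Longrightarrow> P = P'"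
    using X.\<theta>_eqI \<theta> by simp
  show "thetaMD ` carrier MD = carrier (tensor k M C)"
    unfolding X.\<theta>_image[symmetric] by (rule image_cong[OF HOL.refl \<theta>[symmetric]])
  show "module k N \<Longrightarrow> (\<And>x. x \<in> carrier N \<Longrightarrow> F x \<in> carrier MD) \<Longrightarrow> (\<lambda>x. thetaMD (F x)) \<in> lin_maps k N (tensor k M C) \<Longrightarrow> F \<in> lin_maps k N MD"
    using X.lin_to_MN[of N F, OF _ _ lin_maps_cong[where f = "\<lambda>x. thetaMD (F x)"]] \<theta> by simp
  show "\<And>h P. h \<in> carrier H \<Longrightarrow> P \<in> carrier MD \<Longrightarrow> lact MD h P \<in> carrier MD"
    by (rule X.lact_MN)
  thus "\<And>h P. h \<in> carrier H \<Longrightarrow> P \<in> carrier MD \<Longrightarrow> thetaMD (lact MD h P) = tensor_act k M C (lact M) (lact C) (comult H h) (thetaMD P)"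
    using X.lact_MN(2) \<theta> by simp
  show "hmodule k H MD" by (rule X.hmodule_MN)
qed

end

section \<open>Coordinates on D \<otimes>_A D and the comultiplication\<close>

context comodule_setup
begin

abbreviation "DD \<equiv> tensor_over k H TA D (dright D) D (dleft D)"
abbreviation "prDD \<equiv> proj_over k H TA D (dright D) D (dleft D)"

text \<open>On representatives \<open>dr_out\<close> is \<Upsilon>, from D \<otimes>_A D to D
  \<otimes> C. Rebracketing its target to A \<otimes> (C \<otimes> C) yields \<open>phiDD\<close>,
  which exhibits D \<otimes>_A D as a free left A-module on C \<otimes> C.\<close>

definition "dr_out t = tensor_map k AC C dr id (rebr_inv k AC A C t)"
definition "phiDD P = rebr k A C C (dr_out (rep P))"

lemma dr_out_lin [simp, lin]: "dr_out \<in> lin_maps k (tensor k AC AC) (tensor k AC C)"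
  unfolding dr_out_def[abs_def] by (rule lin | simp)+

lemmas dr_out_comp_lin [lin] = lin_maps_comp[OF dr_out_lin]
lemmas dr_out_closed [simp, lin] = lin_maps_closed[OF dr_out_lin]

lemma dr_out_pure [simp]:
  "d \<in> carrier AC \<Longrightarrow> a \<in> carrier A \<Longrightarrow> c \<in> carrier C \<Longrightarrow>
    dr_out (pure k AC AC d (pure k A C a c)) = pure k AC C (RA1 (rho A a) d) c"
  by (simp add: dr_out_def)

lemma rebr_lact_D:
  assumes s: "s \<in> carrier H2" and d: "d \<in> carrier (tensor k AC C)"
  shows "rebr k A C C (tensor_act k AC C (lact D) (lact C) s d) = tensor_map k A C2 id (LC2 s) (rebr k A C C d)"
proof -
  have "\<forall>s\<in>carrier H2. rebr k A C C (tensor_act k AC C (lact D) (lact C) s d) = tensor_map k A C2 id (LC2 s) (rebr k A C C d)"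
  proof (rule tensor_extI)
    fix x y assume xy: "x \<in> carrier H" "y \<in> carrier H"
    have l [simp, lin]: "LC2 (pure k H H x y) \<in> lin_maps k C2 C2"
      by (rule bilin_maps_right[OF R_bilin(6)]) (simp add: xy)
    have "\<forall>d\<in>carrier (tensor k AC C). rebr k A C C (tensor_act k AC C (lact D) (lact C) (pure k H H x y) d)
        = tensor_map k A C2 id (LC2 (pure k H H x y)) (rebr k A C C d)"
      by (rule tensor_extI_left) (assumption | rule lin xy | simp add: xy)+
    thus "rebr k A C C (tensor_act k AC C (lact D) (lact C) (pure k H H x y) d)
        = tensor_map k A C2 id (LC2 (pure k H H x y)) (rebr k A C C d)" using d by blast
  qed (assumption | rule lin d tensor_map_param[where V' = A and W' = C2] | simp add: d)+
  thus ?thesis using s by blast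
qed

lemma DD_facts:
  shows mod_DD [simp, lin]: "module k DD"
    and phiDD_lin [simp, lin]: "phiDD \<in> lin_maps k DD AC2"
    and prDD_lin [simp, lin]: "prDD \<in> lin_maps k (tensor k AC AC) DD"
    and rep_DD [simp, lin]: "P \<in> carrier DD \<Longrightarrow> rep P \<in> carrier (tensor k AC AC)"
    and phiDD_pr [simp]: "v \<in> carrier (tensor k AC AC) \<Longrightarrow> phiDD (prDD v) = rebr k A C C (dr_out v)"
    and phiDD_inj: "inj_on phiDD (carrier DD)"
    and phiDD_image: "phiDD ` carrier DD = carrier AC2"
    and lin_to_DD: "module k N \<Longrightarrow> (\<And>x. x \<in> carrier N \<Longrightarrow> F x \<in> carrier DD) \<Longrightarrow> (\<lambda>x. phiDD (F x)) \<in> lin_maps k N AC2 \<Longrightarrow> F \<in> lin_maps k N DD"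
    and lact_DD_closed [simp]: "h \<in> carrier H \<Longrightarrow> P \<in> carrier DD \<Longrightarrow> lact DD h P \<in> carrier DD"
    and phiDD_lact: "h \<in> carrier H \<Longrightarrow> P \<in> carrier DD \<Longrightarrow> phiDD (lact DD h P) = tensor_map k A C2 id (LC2 (comult H h)) (phiDD P)"
    and hmodule_DD [simp]: "hmodule k H DD"
    and dcomult_facts: "d \<in> carrier AC \<Longrightarrow> dcomult D d \<in> carrier DD \<and> phiDD (dcomult D d) = lmul C2 (tensor_map k A AC2 id del d)"
proof -
  interpret X: right_module_setup k H A C D "dright D" by (rule right_module_D)
  have m: "X.mu_out C v = dr_out v" if v: "v \<in> carrier (tensor k AC AC)" for v
    unfolding X.mu_out_def dr_out_def D_same
    by (rule tensor_map_cong[of _ k "tensor k AC A" _ _ C]) (simp_all add: v)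
  have r: "rep P \<in> carrier (tensor k AC AC)" if "P \<in> carrier DD" for P
    using X.rep_MD[OF that] by simp
  have \<theta>: "X.thetaMD P = dr_out (rep P)" if "P \<in> carrier DD" for P
    by (simp add: X.thetaMD_def m r that)
  have \<phi>: "phiDD P = rebr k A C C (X.thetaMD P)" if "P \<in> carrier DD" for P
    by (simp add: \<theta> phiDD_def that)
  have \<theta>c: "X.thetaMD P \<in> carrier (tensor k AC C)" if "P \<in> carrier DD" for P
    by (simp add: \<theta> r that)
  have \<phi>': "rebr_inv k A C C (phiDD P) = X.thetaMD P" if "P \<in> carrier DD" for P
    unfolding \<phi>[OF that] by (rule rebr_inv_rebr) (simp_all add: \<theta>c that)
  have tl: "X.thetaMD \<in> lin_maps k DD (tensor k AC C)" using X.thetaMD_lin by simp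
  show mD: "module k DD" by (rule X.mod_MD)
  show "phiDD \<in> lin_maps k DD AC2"
    by (rule lin_maps_cong[OF lin_maps_comp[OF rebr_lin tl] mD \<phi>[symmetric]]) simp_all
  show pr: "prDD \<in> lin_maps k (tensor k AC AC) DD" using X.prMD_lin by simp
  show "\<And>P. P \<in> carrier DD \<Longrightarrow> rep P \<in> carrier (tensor k AC AC)" by (rule r)
  show "phiDD (prDD v) = rebr k A C C (dr_out v)" if "v \<in> carrier (tensor k AC AC)" for v
    using that lin_maps_closed[OF pr that] X.thetaMD_pr[of v] by (simp add: \<phi> m)
  show "inj_on phiDD (carrier DD)"
    by (rule inj_onI, rule X.thetaMD_eqI) (simp_all add: \<phi>'[symmetric])
  have im: "X.thetaMD ` carrier DD = carrier (tensor k AC C)" using X.thetaMD_image by simp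
  show "phiDD ` carrier DD = carrier AC2"
  proof (intro equalityI subsetI)
    fix y assume "y \<in> phiDD ` carrier DD"
    thus "y \<in> carrier AC2" using \<phi> \<theta>c by auto
  next
    fix y assume y: "y \<in> carrier AC2"
    hence "rebr_inv k A C C y \<in> X.thetaMD ` carrier DD" unfolding im by simp
    then obtain P where P: "P \<in> carrier DD" "X.thetaMD P = rebr_inv k A C C y" by auto
    hence "phiDD P = y" using y by (simp add: \<phi> rebr_rebr_inv)
    thus "y \<in> phiDD ` carrier DD" using P by blast
  qed
  show "F \<in> lin_maps k N DD"
    if N: "module k N" and c: "\<And>x. x \<in> carrier N \<Longrightarrow> F x \<in> carrier DD" and l: "(\<lambda>x. phiDD (F x)) \<in> lin_maps k N AC2"
  proof -
    have "(\<lambda>x. rebr_inv k A C C (phiDD (F x))) \<in> lin_maps k N (tensor k AC C)"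
      by (rule lin_maps_comp[OF rebr_inv_lin l]) simp_all
    hence "(\<lambda>x. X.thetaMD (F x)) \<in> lin_maps k N (tensor k AC C)"
      by (rule lin_maps_cong[OF _ N]) (simp add: \<phi>' c)
    thus ?thesis using X.lin_to_MD[of N F, OF N c] by simp
  qed
  show lc: "\<And>h P. h \<in> carrier H \<Longrightarrow> P \<in> carrier DD \<Longrightarrow> lact DD h P \<in> carrier DD" by (rule X.lact_MD_closed)
  show "phiDD (lact DD h P) = tensor_map k A C2 id (LC2 (comult H h)) (phiDD P)" if "h \<in> carrier H" "P \<in> carrier DD" for h P
    using that X.thetaMD_lact[OF that] rebr_lact_D[of "comult H h" "X.thetaMD P"] by (simp add: \<phi> lc \<theta>c)
  show "hmodule k H DD" by (rule X.hmodule_MD)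
  show "dcomult D d \<in> carrier DD \<and> phiDD (dcomult D d) = lmul C2 (tensor_map k A AC2 id del d)" if d: "d \<in> carrier AC"
  proof -
    let ?D0 = "htensor k H TA TX"
    let ?U = "\<lambda>P. tensor_map k ?D0 TX (dright D) id (hassoc_inv k H ?D0 TA TX (rep P))"
    let ?y = "rebr_inv k A C C (lmul C2 (tensor_map k A AC2 id del d))"
    have lr: "dleft D = tensor_map k TA TX mA id \<circ> hassoc_inv k H TA TA TX"
      "dright D = tensor_map k TA TX mA id \<circ> hassoc_inv k H TA TA TX \<circ> tensor_map k TA (htensor k H TA TX) id psi \<circ> hassoc k H TA TX TA"
      by (simp_all add: induced_coring_def Let_def hmod.extend_def coring_data.fields_def)
    have s: "same_module ?D0 D" using same_module_htensor[of k H TA TX] same_D by (simp add: same_module_def)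
    \<comment> \<open>The definition of the coring forms D \<otimes>_A D from the bare object A
      \<otimes> C, before the coring record exists.\<close>
    have T: "tensor_over k H TA ?D0 (dright D) ?D0 (dleft D) = DD"
      by (rule tensor_over_cong[OF s s lact_D[symmetric] lact_D[symmetric]])
    have "dcomult D d = inv_into (carrier (tensor_over k H TA ?D0 (dright D) ?D0 (dleft D))) ?U
        ((hassoc_inv k H TA TX TX \<circ> tensor_map k TA (htensor k H TX TX) mA id \<circ> hassoc_inv k H TA TA (htensor k H TX TX)
          \<circ> tensor_map k TA (htensor k H TA (htensor k H TX TX)) id del) d)"
      unfolding lr by (simp only: induced_coring_def Let_def hmod.extend_def coring_data.fields_def coring_data.select_convs walg_simps T_simps comp_assoc)
    also have "(hassoc_inv k H TA TX TX \<circ> tensor_map k TA (htensor k H TX TX) mA id \<circ> hassoc_inv k H TA TA (htensor k H TX TX)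
          \<circ> tensor_map k TA (htensor k H TA (htensor k H TX TX)) id del) d = ?y"
      using d by (simp add: lmul_def[symmetric])
    finally have dc: "dcomult D d = inv_into (carrier DD) ?U ?y" unfolding T .
    \<comment> \<open>\<Upsilon> is the coordinate map of D \<otimes>_A D, hence a bijection, and
      \<open>inv_into\<close> is a true inverse: the comultiplication is characterized by its
      coordinates.\<close>
    have U: "?U P = X.thetaMD P" if "P \<in> carrier DD" for P
      using r[OF that] tensor_map_cong[of dr k "tensor k AC A" AC id C C "rebr_inv k AC A C (rep P)" "dright D" id]
      by (simp add: \<theta> that dr_out_def)
    have y: "?y \<in> ?U ` carrier DD"
    proof -
      have "?y \<in> X.thetaMD ` carrier DD" unfolding im using d by simp
      thus ?thesis using U by auto
    qed
    have 1: "dcomult D d \<in> carrier DD" unfolding dc by (rule inv_into_into[OF y])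
    have "X.thetaMD (dcomult D d) = ?y" using U[OF 1] f_inv_into_f[OF y] unfolding dc by simp
    thus ?thesis using 1 d by (simp add: \<phi> rebr_rebr_inv)
  qed
qed

lemmas phiDD_closed [simp, lin] = lin_maps_closed[OF phiDD_lin]
lemmas DD_comp_lin [lin] = lin_maps_comp[OF phiDD_lin] lin_maps_comp[OF prDD_lin]
lemmas prDD_closed [simp, lin] = lin_maps_closed[OF prDD_lin]

lemma dcomult_lin [simp, lin]: "dcomult D \<in> lin_maps k AC DD"
proof (rule lin_to_DD)
  show "(\<lambda>x. phiDD (dcomult D x)) \<in> lin_maps k AC AC2"
    by (rule lin_maps_cong[where f = "\<lambda>d. lmul C2 (tensor_map k A AC2 id del d)"])
      ((rule lin | simp add: dcomult_facts)+)
qed (simp_all add: dcomult_facts)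

abbreviation "lDD \<equiv> left_over k H TA D (dleft D) (dright D) D (dleft D)"

text \<open>Left multiplication on the A-factor commutes with the right action by \<rho>, so the
  coordinates of D \<otimes>_A D are left A-linear; here at the level of representatives.\<close>

lemma phiDD_left:
  assumes a: "a \<in> carrier A" and t: "t \<in> carrier (tensor k AC AC)"
  shows "rebr k A C C (dr_out (tensor_map k AC AC (dleft D) id (rebr_inv k A AC AC (pure k A (tensor k AC AC) a t))))
    = lmul C2 (pure k A AC2 a (rebr k A C C (dr_out t)))"
proof -
  have "\<forall>t\<in>carrier (tensor k AC AC). rebr k A C C (dr_out (tensor_map k AC AC (dleft D) id (rebr_inv k A AC AC (pure k A (tensor k AC AC) a t))))
    = lmul C2 (pure k A AC2 a (rebr k A C C (dr_out t)))"
  proof (rule tensor_extI_left)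
    fix b c d assume bcd: "b \<in> carrier A" "c \<in> carrier C" "d \<in> carrier AC"
    have "\<forall>d\<in>carrier AC. rebr k A C C (dr_out (pure k AC AC (pure k A C (a \<otimes>\<^bsub>A\<^esub> b) c) d))
        = lmul C2 (pure k A AC2 a (rebr k A C C (dr_out (pure k AC AC (pure k A C b c) d))))"
    proof (rule tensor_extI)
      fix b' c' assume bc': "b' \<in> carrier A" "c' \<in> carrier C"
      have "\<forall>r\<in>carrier AH. rebr k A C C (pure k AC C (RA1 r (pure k A C (a \<otimes>\<^bsub>A\<^esub> b) c)) c')
          = lmul C2 (pure k A AC2 a (rebr k A C C (pure k AC C (RA1 r (pure k A C b c)) c')))"
        by (rule tensor_extI) (assumption | rule lin a bcd bc' | simp add: a bcd bc')+
      thus "rebr k A C C (dr_out (pure k AC AC (pure k A C (a \<otimes>\<^bsub>A\<^esub> b) c) (pure k A C b' c')))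
        = lmul C2 (pure k A AC2 a (rebr k A C C (dr_out (pure k AC AC (pure k A C b c) (pure k A C b' c')))))"
        using a bcd bc' by simp
    qed (assumption | rule lin a bcd | simp add: a bcd)+
    thus "rebr k A C C (dr_out (tensor_map k AC AC (dleft D) id (rebr_inv k A AC AC (pure k A (tensor k AC AC) a (pure k AC AC (pure k A C b c) d)))))
      = lmul C2 (pure k A AC2 a (rebr k A C C (dr_out (pure k AC AC (pure k A C b c) d))))"
      using a bcd by simp
  qed (assumption | rule lin a | simp add: a)+
  thus ?thesis using t by blast
qed

text \<open>The left action chooses a representative of each class, which hides its bilinearity. In
  the coordinates \<open>phiDD\<close> it is \<open>lmul\<close>, and linearity comes back because
  \<open>phiDD\<close> is injective and linear.\<close>

lemma lDD_facts:
  shows lDD_lin [simp, lin]: "lDD \<in> lin_maps k (tensor k A DD) DD"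
    and lDD_phi: "a \<in> carrier A \<Longrightarrow> P \<in> carrier DD \<Longrightarrow> phiDD (lDD (pure k A DD a P)) = lmul C2 (pure k A AC2 a (phiDD P))"
proof -
  let ?b = "\<lambda>a P. prDD (tensor_map k AC AC (dleft D) id (hassoc_inv k H TA D D (pure k A (tensor k AC AC) a (rep P))))"
  have c: "tensor_map k AC AC (dleft D) id (rebr_inv k A AC AC (pure k A (tensor k AC AC) a (rep P))) \<in> carrier (tensor k AC AC)"
    if "a \<in> carrier A" "P \<in> carrier DD" for a P by (rule lin that | simp)+
  have b: "?b a P \<in> carrier DD \<and> phiDD (?b a P) = lmul C2 (pure k A AC2 a (phiDD P))" if "a \<in> carrier A" "P \<in> carrier DD" for a P
    using that c[OF that] phiDD_left[OF that(1) rep_DD[OF that(2)]] by (simp add: phiDD_def[of P])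
  have bil: "?b \<in> bilin_maps k A DD DD"
  proof (rule bilin_mapsI; rule lin_to_DD)
    fix a assume a: "a \<in> carrier A"
    show "(\<lambda>P. phiDD (?b a P)) \<in> lin_maps k DD AC2"
      by (rule lin_maps_cong[OF _ mod_DD conjunct2[OF b[OF a], symmetric]]) ((rule lin a | simp add: a)+)
  next
    fix P assume P: "P \<in> carrier DD"
    show "(\<lambda>a. phiDD (?b a P)) \<in> lin_maps k A AC2"
      by (rule lin_maps_cong[OF _ mod_A conjunct2[OF b[OF _ P], symmetric]]) ((rule lin P | simp add: P)+)
  qed (use b in blast | simp)+
  have l: "lDD = tensor_lift DD ?b" by (simp add: left_over_def)
  show "lDD \<in> lin_maps k (tensor k A DD) DD" unfolding l by (rule tensor_lift_lin bil mod_A mod_DD)+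
  show "phiDD (lDD (pure k A DD a P)) = lmul C2 (pure k A AC2 a (phiDD P))" if "a \<in> carrier A" "P \<in> carrier DD"
    unfolding l by (subst tensor_lift_pure[OF mod_A mod_DD bil]) (use that b in simp_all)
qed

end

context comodule_setup
begin

lemma lmul_htensor [simp]: "lmul (htensor k H C C) = lmul C2"
  by (simp add: fun_eq_iff lmul_def)

end

section \<open>Coordinates on threefold tensor products over A\<close>

context right_module_setup
begin

abbreviation "MC \<equiv> tensor k M C"
abbreviation "MDD \<equiv> tensor_over k H TA M \<mu> DD lDD"
abbreviation "prMDD \<equiv> proj_over k H TA M \<mu> DD lDD"
definition "thetaMDD P = mu_out C2 (tensor_map k M AC2 id phiDD (rep P))"

lemma mu_out_htensor [simp]: "mu_out (htensor k H C C) = mu_out C2"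
  by (simp add: fun_eq_iff mu_out_def)

text \<open>The freeness of D \<otimes>_A D on C \<otimes> C, used a second time: M \<otimes>_A (D
  \<otimes>_A D) gets the coordinates M \<otimes> (C \<otimes> C), in which coassociativity will be
  compared.\<close>

lemma over_split_MDD: "over_split k H A C M \<mu> DD lDD (htensor k H C C) phiDD (inv_into (carrier DD) phiDD)"
  by (rule over_split.intro[OF right_module_setup_axioms over_split_axioms.intro])
    (simp_all add: lDD_phi phiDD_lact lin_maps_inv_into[OF phiDD_lin phiDD_inj phiDD_image]
      f_inv_into_f[where A = "carrier DD"] phiDD_image phiDD_inj)

lemma MDD_facts:
  shows mod_MDD [simp, lin]: "module k MDD"
    and thetaMDD_lin [simp, lin]: "thetaMDD \<in> lin_maps k MDD (tensor k M C2)"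
    and prMDD_lin [simp, lin]: "prMDD \<in> lin_maps k (tensor k M DD) MDD"
    and thetaMDD_pr [simp]: "v \<in> carrier (tensor k M DD) \<Longrightarrow> thetaMDD (prMDD v) = mu_out C2 (tensor_map k M AC2 id phiDD v)"
    and thetaMDD_eqI: "P \<in> carrier MDD \<Longrightarrow> P' \<in> carrier MDD \<Longrightarrow> thetaMDD P = thetaMDD P' \<Longrightarrow> P = P'"
    and lin_to_MDD: "module k N \<Longrightarrow> (\<And>x. x \<in> carrier N \<Longrightarrow> F x \<in> carrier MDD) \<Longrightarrow> (\<lambda>x. thetaMDD (F x)) \<in> lin_maps k N (tensor k M C2) \<Longrightarrow> F \<in> lin_maps k N MDD"
proof -
  interpret X: over_split k H A C M \<mu> DD lDD "htensor k H C C" phiDD "inv_into (carrier DD) phiDD" by (rule over_split_MDD)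
  have T: "X.T v = mu_out C2 (tensor_map k M AC2 id phiDD v)" for v
    by (simp add: X.T_def)
  have \<theta>: "X.sc.\<theta> = thetaMDD"
    by (simp add: fun_eq_iff thetaMDD_def X.sc.\<theta>_def T)
  show "module k MDD" by (rule X.MN_simps)
  show "thetaMDD \<in> lin_maps k MDD (tensor k M C2)" using X.MN_lin(1) by (simp add: \<theta>)
  show "prMDD \<in> lin_maps k (tensor k M DD) MDD" using X.MN_lin(2) by simp
  show "\<And>v. v \<in> carrier (tensor k M DD) \<Longrightarrow> thetaMDD (prMDD v) = mu_out C2 (tensor_map k M AC2 id phiDD v)"
    using X.\<theta>_pr by (simp add: \<theta> T)
  show "\<And>P P'. P \<in> carrier MDD \<Longrightarrow> P' \<in> carrier MDD \<Longrightarrow> thetaMDD P = thetaMDD P' \<Longrightarrow> P = P'"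
    using X.\<theta>_eqI by (simp add: \<theta>)
  show "module k N \<Longrightarrow> (\<And>x. x \<in> carrier N \<Longrightarrow> F x \<in> carrier MDD) \<Longrightarrow> (\<lambda>x. thetaMDD (F x)) \<in> lin_maps k N (tensor k M C2) \<Longrightarrow> F \<in> lin_maps k N MDD"
    using X.lin_to_MN[of N F] by (simp add: \<theta>)
qed

lemmas M_pr_closed [simp, lin] = lin_maps_closed[OF prMD_lin] lin_maps_closed[OF thetaMD_lin]
  lin_maps_closed[OF prMDD_lin] lin_maps_closed[OF thetaMDD_lin]
lemmas M_pr_comp_lin [lin] = lin_maps_comp[OF prMDD_lin] lin_maps_comp[OF thetaMDD_lin]

abbreviation "muD \<equiv> right_over k H TA M \<mu> D (dleft D) (dright D)"

text \<open>In the coordinates M \<otimes> C the right A-action on M \<otimes>_A D is the action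
  through \<rho>. Associativity of the action on M moves the A-leg of \<rho>(a) across the
  coefficient.\<close>

lemma mu_out_dr:
  assumes t: "t \<in> carrier (tensor k M AC)" and a: "a \<in> carrier A"
  shows "mu_out C (tensor_map k M AC id (dright D) (rebr k M AC A (pure k (tensor k M AC) A t a))) = RM1 (rho A a) (mu_out C t)"
proof -
  have "\<forall>t\<in>carrier (tensor k M AC). mu_out C (tensor_map k M AC id (dright D) (rebr k M AC A (pure k (tensor k M AC) A t a))) = RM1 (rho A a) (mu_out C t)"
  proof (rule tensor_extI_right)
    fix m b c assume mbc: "m \<in> carrier M" "b \<in> carrier A" "c \<in> carrier C"
    have "\<forall>r\<in>carrier AH. mu_out C (pure k M AC m (RA1 r (pure k A C b c))) = RM1 r (pure k M C (\<mu> (pure k M A m b)) c)"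
      by (rule tensor_extI) (assumption | rule lin mbc | simp add: mbc \<mu>_mult)+
    thus "mu_out C (tensor_map k M AC id (dright D) (rebr k M AC A (pure k (tensor k M AC) A (pure k M AC m (pure k A C b c)) a)))
        = RM1 (rho A a) (mu_out C (pure k M AC m (pure k A C b c)))"
      using mbc a by simp
  qed (assumption | rule lin a | simp add: a)+
  thus ?thesis using t by blast
qed

lemma muD_facts:
  shows muD_lin [simp, lin]: "muD \<in> lin_maps k (tensor k MD A) MD"
    and thetaMD_muD: "P \<in> carrier MD \<Longrightarrow> a \<in> carrier A \<Longrightarrow> thetaMD (muD (pure k MD A P a)) = RM1 (rho A a) (thetaMD P)"
proof -
  let ?b = "\<lambda>P a. prMD (tensor_map k M AC id (dright D) (hassoc k H M D TA (pure k (tensor k M AC) A (rep P) a)))"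
  have c: "tensor_map k M AC id (dright D) (rebr k M AC A (pure k (tensor k M AC) A (rep P) a)) \<in> carrier (tensor k M AC)"
    if "P \<in> carrier MD" "a \<in> carrier A" for a P by (rule lin that | simp)+
  have b: "?b P a \<in> carrier MD \<and> thetaMD (?b P a) = RM1 (rho A a) (thetaMD P)" if "P \<in> carrier MD" "a \<in> carrier A" for a P
    using that c[OF that] mu_out_dr[OF rep_MD[OF that(1)] that(2)] by (simp add: thetaMD_def[of P])
  have bil: "?b \<in> bilin_maps k MD A MD"
  proof (rule bilin_mapsI; rule lin_to_MD)
    fix a assume a: "a \<in> carrier A"
    show "(\<lambda>P. thetaMD (?b P a)) \<in> lin_maps k MD MC"
      by (rule lin_maps_cong[OF _ mod_MD conjunct2[OF b[OF _ a], symmetric]]) ((rule lin a | simp add: a)+)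
  next
    fix P assume P: "P \<in> carrier MD"
    show "(\<lambda>a. thetaMD (?b P a)) \<in> lin_maps k A MC"
      by (rule lin_maps_cong[OF _ mod_A conjunct2[OF b[OF P], symmetric]]) ((rule lin P | simp add: P)+)
  qed (use b in blast | simp)+
  have l: "muD = tensor_lift MD ?b" by (simp add: right_over_def)
  show "muD \<in> lin_maps k (tensor k MD A) MD" unfolding l by (rule tensor_lift_lin bil mod_A mod_MD)+
  show "thetaMD (muD (pure k MD A P a)) = RM1 (rho A a) (thetaMD P)" if "P \<in> carrier MD" "a \<in> carrier A"
    unfolding l by (subst tensor_lift_pure[OF mod_MD mod_A bil]) (use that b in simp_all)
qed

lemmas muD_closed [simp, lin] = lin_maps_closed[OF muD_lin]

text \<open>M \<otimes>_A D has to be a right A-module in its own right for (M \<otimes>_A D)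
  \<otimes>_A D, the target of \<rho> \<otimes>_A D, to make sense and to have coordinates.\<close>

lemma right_module_MD: "right_module_setup k H A C MD muD"
proof (rule right_module_setup.intro[OF comodule_setup_axioms right_module_setup_axioms.intro])
  show "hmodule k H MD" "muD \<in> lin_maps k (tensor k MD A) MD" by simp_all
  fix P assume P: "P \<in> carrier MD"
  show "muD (pure k MD A P \<one>\<^bsub>A\<^esub>) = P"
    by (rule thetaMD_eqI) (use P RM1_one[of "thetaMD P"] in \<open>simp_all add: thetaMD_muD tensor_one\<close>)
  fix a assume a: "a \<in> carrier A"
  show "muD (pure k MD A P (a \<otimes>\<^bsub>A\<^esub> b)) = muD (pure k MD A (muD (pure k MD A P a)) b)" if b: "b \<in> carrier A" for b
    by (rule thetaMD_eqI) (use P a b in \<open>simp_all add: thetaMD_muD alg_mapsD(2)[OF rho_alg] RM1_mult\<close>)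
  show "muD (pure k MD A (lact MD h P) a) = lact MD h (muD (pure k MD A P a))" if h: "h \<in> carrier H" for h
  proof (rule thetaMD_eqI)
    have "tensor_act k M C (lact M) (lact C) (comult H h) (RM1 (rho A a) (thetaMD P))
        = RM1 (rho A a) (tensor_act k M C (lact M) (lact C) (comult H h) (thetaMD P))"
      by (rule tensor_act_commute[OF M_simps(2) C_simps(2) rM_bilin RC_simps(1)])
        (simp_all add: P a h \<mu>_lact RC_facts)
    thus "thetaMD (muD (pure k MD A (lact MD h P) a)) = thetaMD (lact MD h (muD (pure k MD A P a)))"
      using P a h by (simp add: thetaMD_muD thetaMD_lact)
  qed (use P a h in simp_all)
qed

abbreviation "LD2 \<equiv> tensor_act k AC AC (lact D) (lact D)"
abbreviation "LMD \<equiv> tensor_act k M (tensor k AC AC) (lact M) LD2"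
abbreviation "LMC \<equiv> tensor_act k M C2 (lact M) LC2"

lemma LM_bilin [simp, lin]:
  "LD2 \<in> bilin_maps k H2 (tensor k AC AC) (tensor k AC AC)"
  "LMD \<in> bilin_maps k H3 (tensor k M (tensor k AC AC)) (tensor k M (tensor k AC AC))"
  "LMC \<in> bilin_maps k H3 (tensor k M C2) (tensor k M C2)"
  by (intro tensor_act_bilin; simp)+

text \<open>The constraint for M, D, D keeps its \<Phi>, here the arbitrary \<open>s\<close>. Its
  legs reach D only through C, and its action commutes with the right actions that compute the
  coordinates, so in M \<otimes> (C \<otimes> C) it acts from outside.\<close>

lemma assoc_inner:
  assumes v: "v \<in> carrier (tensor k M AC)" and ac: "a \<in> carrier A" "c \<in> carrier C" and s: "s \<in> carrier H3"
  shows "mu_out C2 (tensor_map k M AC2 id (\<lambda>d. rebr k A C C (dr_out d)) (LMD s (rebr k M AC AC (pure k (tensor k M AC) AC v (pure k A C a c)))))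
    = LMC s (rebr k M C C (pure k MC C (RM1 (rho A a) (mu_out C v)) c))"
proof -
  have tau [simp, lin]: "(\<lambda>d. rebr k A C C (dr_out d)) \<in> lin_maps k (tensor k AC AC) AC2"
    by (rule lin | simp)+
  have "\<forall>s\<in>carrier H3. mu_out C2 (tensor_map k M AC2 id (\<lambda>d. rebr k A C C (dr_out d)) (LMD s (rebr k M AC AC (pure k (tensor k M AC) AC v (pure k A C a c)))))
    = LMC s (rebr k M C C (pure k MC C (RM1 (rho A a) (mu_out C v)) c))"
  proof (rule tensor_extI_right)
    fix x y z assume xyz: "x \<in> carrier H" "y \<in> carrier H" "z \<in> carrier H"
    let ?s = "pure k H H2 x (pure k H H y z)"
    have "\<forall>v\<in>carrier (tensor k M AC). mu_out C2 (tensor_map k M AC2 id (\<lambda>d. rebr k A C C (dr_out d)) (LMD ?s (rebr k M AC AC (pure k (tensor k M AC) AC v (pure k A C a c)))))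
      = LMC ?s (rebr k M C C (pure k MC C (RM1 (rho A a) (mu_out C v)) c))"
    proof (rule tensor_extI_right)
      fix m b c' assume mbc: "m \<in> carrier M" "b \<in> carrier A" "c' \<in> carrier C"
      have "\<forall>r\<in>carrier AH. mu_out C2 (pure k M AC2 (lact M x m) (rebr k A C C (pure k AC C (RA1 r (pure k A C b (lact C y c'))) (lact C z c))))
          = LMC ?s (rebr k M C C (pure k MC C (RM1 r (pure k M C (\<mu> (pure k M A m b)) c')) c))"
        by (rule tensor_extI) (assumption | rule lin mbc xyz ac | simp add: mbc xyz ac \<mu>_mult \<mu>_lact RC_facts)+
      thus "mu_out C2 (tensor_map k M AC2 id (\<lambda>d. rebr k A C C (dr_out d)) (LMD ?s (rebr k M AC AC (pure k (tensor k M AC) AC (pure k M AC m (pure k A C b c')) (pure k A C a c)))))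
        = LMC ?s (rebr k M C C (pure k MC C (RM1 (rho A a) (mu_out C (pure k M AC m (pure k A C b c')))) c))"
        using mbc xyz ac by simp
    qed (assumption | rule lin ac xyz | simp add: ac xyz)+
    thus "mu_out C2 (tensor_map k M AC2 id (\<lambda>d. rebr k A C C (dr_out d)) (LMD ?s (rebr k M AC AC (pure k (tensor k M AC) AC v (pure k A C a c)))))
      = LMC ?s (rebr k M C C (pure k MC C (RM1 (rho A a) (mu_out C v)) c))" using v by blast
  qed (assumption | rule lin ac v | simp add: ac v)+
  thus ?thesis using s by blast
qed

end

section \<open>Comultiplication and counit in coordinates\<close>

context right_module_setup
begin

text \<open>The part of the definition of a quasi-Hopf bimodule that concerns the coaction, the
  module structure being fixed. It is the common ground on which both kinds of objects are
  compared.\<close>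

definition hopf_coaction :: "('m \<Rightarrow> ('m, 'c) tensor) \<Rightarrow> bool" where
  "hopf_coaction \<sigma> \<longleftrightarrow> \<sigma> \<in> lin_maps k M MC \<and>
    (\<forall>h\<in>carrier H. \<forall>m\<in>carrier M. \<sigma> (lact M h m) = tensor_act k M C (lact M) (lact C) (comult H h) (\<sigma> m)) \<and>
    (\<forall>m\<in>carrier M. \<forall>a\<in>carrier A. \<sigma> (\<mu> (pure k M A m a)) = RM1 (rho A a) (\<sigma> m)) \<and>
    (\<forall>m\<in>carrier M. LMC (reass H) (rebr k M C C (tensor_map k MC C \<sigma> id (\<sigma> m)))
      = RM2 (reass_rho A) (tensor_map k M C2 id (ccomult C) (\<sigma> m))) \<and>
    (\<forall>m\<in>carrier M. runit M (tensor_map k M (base_space k) id (ccounit C) (\<sigma> m)) = m)"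

text \<open>The map M \<otimes>_A \<Delta>_D in coordinates: the comultiplication of D is \<Delta>
  of C followed by \<Phi>_\<rho>, and the A-leg of \<Phi>_\<rho> ends up acting on M.\<close>

lemma mu_out_comult:
  assumes t: "t \<in> carrier (tensor k M AC)"
  shows "mu_out C2 (tensor_map k M AC2 id (\<lambda>d. phiDD (dcomult D d)) t) = RM2 (reass_rho A) (tensor_map k M C2 id (ccomult C) (mu_out C t))"
proof -
  have l: "(\<lambda>d. phiDD (dcomult D d)) \<in> lin_maps k AC AC2" by (rule lin | simp)+
  have "\<forall>t\<in>carrier (tensor k M AC). mu_out C2 (tensor_map k M AC2 id (\<lambda>d. phiDD (dcomult D d)) t) = RM2 (reass_rho A) (tensor_map k M C2 id (ccomult C) (mu_out C t))"
  proof (rule tensor_extI_right)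
    fix m a c assume mac: "m \<in> carrier M" "a \<in> carrier A" "c \<in> carrier C"
    have d: "phiDD (dcomult D (pure k A C a c)) = RA2 (reass_rho A) (pure k A C2 a (ccomult C c))"
      using mac dcomult_facts[of "pure k A C a c"] id_del[of "pure k A C a c"] by simp
    have "\<forall>s\<in>carrier AH2. mu_out C2 (pure k M AC2 m (RA2 s (pure k A C2 a (ccomult C c))))
        = RM2 s (pure k M C2 (\<mu> (pure k M A m a)) (ccomult C c))"
      by (rule tensor_extI) (assumption | rule lin mac | simp add: mac \<mu>_mult)+
    thus "mu_out C2 (tensor_map k M AC2 id (\<lambda>d. phiDD (dcomult D d)) (pure k M AC m (pure k A C a c)))
        = RM2 (reass_rho A) (tensor_map k M C2 id (ccomult C) (mu_out C (pure k M AC m (pure k A C a c))))"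
      using mac l by (simp add: d)
  qed (assumption | rule lin l | simp)+
  thus ?thesis using t by blast
qed

text \<open>The counit of D sends a \<otimes> c to the multiple of a by the counit of c, so acting
  with it on m is applying the counit of C to m a \<otimes> c.\<close>

lemma mu_dcounit:
  assumes t: "t \<in> carrier (tensor k M AC)"
  shows "\<mu> (tensor_map k M A id (dcounit D) t) = runit M (tensor_map k M (base_space k) id (ccounit C) (mu_out C t))"
proof -
  interpret A: module k A by simp
  have l [simp, lin]: "dcounit D \<in> lin_maps k AC A"
    unfolding dcounit_eq[abs_def] by (rule lin | simp)+
  note sm = lin_maps_smult[OF bilin_maps_right[OF A_simps(3)]]
  have s: "\<mu> (pure k M A m (e \<odot>\<^bsub>A\<^esub> a)) = e \<odot>\<^bsub>M\<^esub> \<mu> (pure k M A m a)" if "m \<in> carrier M" "a \<in> carrier A" "e \<in> carrier k" for m a e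
    using that by (simp add: pure_smult_right lin_maps_smult[OF \<mu>_lin])
  have "\<forall>t\<in>carrier (tensor k M AC). \<mu> (tensor_map k M A id (dcounit D) t) = runit M (tensor_map k M (base_space k) id (ccounit C) (mu_out C t))"
    by (rule tensor_extI_right) (assumption | rule lin | simp add: cou_eq sm s)+
  thus ?thesis using t by blast
qed

end

text \<open>Of the candidate coaction only its codomain is fixed; linearity is one of the axioms
  under comparison.\<close>

locale corep_setup = right_module_setup k H A C M \<mu>
  for k :: "'k ring" and H :: "('k, 'h) quasi_bialg" and A :: "('k, 'h, 'a) comod_alg" and C :: "('k, 'h, 'c) bimod_coalg"
    and M :: "('k, 'h, 'm, 'e) hmod_scheme" and \<mu> :: "('m, 'a) tensor \<Rightarrow> 'm" +
  fixes \<rho> :: "'m \<Rightarrow> ('m, ('a, 'c) tensor) tensor set"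
  assumes \<rho>_closed [simp, lin]: "m \<in> carrier M \<Longrightarrow> \<rho> m \<in> carrier MD"
begin

definition "sigma m = thetaMD (\<rho> m)"

lemma hom_iff: "\<rho> \<in> hmod_hom k H M MD \<longleftrightarrow> sigma \<in> lin_maps k M MC \<and>
    (\<forall>h\<in>carrier H. \<forall>m\<in>carrier M. sigma (lact M h m) = tensor_act k M C (lact M) (lact C) (comult H h) (sigma m))"
proof
  assume r: "\<rho> \<in> hmod_hom k H M MD"
  hence l: "\<rho> \<in> lin_maps k M MD" by (simp add: hmod_hom_def)
  show "sigma \<in> lin_maps k M MC \<and>
    (\<forall>h\<in>carrier H. \<forall>m\<in>carrier M. sigma (lact M h m) = tensor_act k M C (lact M) (lact C) (comult H h) (sigma m))"
    using lin_maps_comp[OF thetaMD_lin l] r by (simp add: sigma_def[abs_def] hmod_hom_def thetaMD_lact)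
next
  assume s: "sigma \<in> lin_maps k M MC \<and>
    (\<forall>h\<in>carrier H. \<forall>m\<in>carrier M. sigma (lact M h m) = tensor_act k M C (lact M) (lact C) (comult H h) (sigma m))"
  hence "\<rho> \<in> lin_maps k M MD" by (intro lin_to_MD) (simp_all add: sigma_def[abs_def])
  moreover have "\<rho> (lact M h m) = lact MD h (\<rho> m)" if "h \<in> carrier H" "m \<in> carrier M" for h m
    by (rule thetaMD_eqI) (use s that in \<open>simp_all add: thetaMD_lact sigma_def[abs_def]\<close>)
  ultimately show "\<rho> \<in> hmod_hom k H M MD" by (simp add: hmod_hom_def)
qed

context
  assumes \<rho>_lin: "\<rho> \<in> lin_maps k M MD"
begin

lemma sigma_lin: "sigma \<in> lin_maps k M MC"
  unfolding sigma_def[abs_def] by (rule lin_maps_comp[OF thetaMD_lin \<rho>_lin])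

text \<open>Apply the injective coordinates to both sides: the right action on M \<otimes>_A D turns
  into the action through \<rho>. Pure tensors suffice by linearity of the coaction.\<close>

lemma colinear_iff:
  "(\<forall>t\<in>carrier (tensor k M A). \<rho> (\<mu> t) = muD (tensor_map k MD A \<rho> id t))
    \<longleftrightarrow> (\<forall>m\<in>carrier M. \<forall>a\<in>carrier A. sigma (\<mu> (pure k M A m a)) = RM1 (rho A a) (sigma m))" (is "?l \<longleftrightarrow> ?r")
proof
  assume l: ?l
  show ?r
  proof (intro ballI)
    fix m a assume ma: "m \<in> carrier M" "a \<in> carrier A"
    have "\<rho> (\<mu> (pure k M A m a)) = muD (pure k MD A (\<rho> m) a)"
      using l ma \<rho>_lin by simp
    thus "sigma (\<mu> (pure k M A m a)) = RM1 (rho A a) (sigma m)" using ma by (simp add: sigma_def thetaMD_muD)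
  qed
next
  assume r: ?r
  show ?l
  proof (rule tensor_extI)
    fix m a assume ma: "m \<in> carrier M" "a \<in> carrier A"
    show "\<rho> (\<mu> (pure k M A m a)) = muD (tensor_map k MD A \<rho> id (pure k M A m a))"
      by (rule thetaMD_eqI) (use ma r \<rho>_lin in \<open>simp_all add: thetaMD_muD sigma_def[symmetric]\<close>)
  qed (assumption | rule lin \<rho>_lin lin_maps_comp[OF \<rho>_lin] lin_maps_comp[OF muD_lin] | simp)+
qed

text \<open>The action coequalizes the two maps that define M \<otimes>_A A, by associativity. Its
  value on an arbitrary representative is therefore its value on the tensor from which the class was
  formed.\<close>

lemma counit_eq:
  assumes x: "x \<in> carrier M"
  shows "\<mu> (rep (map_over k H TA M \<mu> TA (amult TA) id (dcounit D) (\<rho> x))) = runit M (tensor_map k M (base_space k) id (ccounit C) (sigma x))"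
proof -
  have l [simp, lin]: "dcounit D \<in> lin_maps k AC A"
    unfolding dcounit_eq[abs_def] by (rule lin | simp)+
  let ?f = "tensor_map k M A \<mu> id" and ?g = "tensor_map k M A id mA \<circ> hassoc k H M TA TA"
  let ?U = "htensor k H (htensor k H M TA) TA" and ?V = "htensor k H M TA"
  have m: "module k ?U" "module k ?V" by simp_all
  have f: "?f \<in> lin_maps k ?U ?V" by simp
  have g: "?g \<in> lin_maps k ?U ?V"
  proof (rule lin_maps_cong[OF _ m(1)])
    show "(\<lambda>t. tensor_map k M A id mA (rebr k M A A t)) \<in> lin_maps k ?U ?V"
      by simp (rule lin | simp)+
  qed simp
  let ?v = "tensor_map k M A id (dcounit D) (rep (\<rho> x))"
  have v: "?v \<in> carrier ?V" using tensor_map_closed[OF rep_MD[OF \<rho>_closed[OF x]] lin_maps_id l] by simp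
  have "\<forall>u\<in>carrier (tensor k (tensor k M A) A). \<mu> (?f u) = \<mu> (tensor_map k M A id mA (rebr k M A A u))"
    by (rule tensor_extI_left) (assumption | rule lin | simp add: \<mu>_mult)+
  hence e: "\<mu> (?f u) = \<mu> (?g u)" if "u \<in> carrier ?U" for u using that by simp
  have "map_over k H TA M \<mu> TA (amult TA) id (dcounit D) (\<rho> x) = coeq_proj ?U ?V ?f ?g ?v"
    by (simp add: map_over_def proj_over_def)
  hence "\<mu> (rep (map_over k H TA M \<mu> TA (amult TA) id (dcounit D) (\<rho> x))) = \<mu> (rep (coeq_proj ?U ?V ?f ?g ?v))" by simp
  also have "\<dots> = \<mu> ?v"
    by (rule coeq_proj_rep(2)[OF m f g v mod_M _ e]) simp_all
  also have "\<dots> = runit M (tensor_map k M (base_space k) id (ccounit C) (mu_out C (rep (\<rho> x))))"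
    by (rule mu_dcounit) (simp add: x)
  finally show ?thesis by (simp add: sigma_def thetaMD_def)
qed

text \<open>Both sides lie in M \<otimes>_A (D \<otimes>_A D), where \<open>thetaMDD\<close> is
  injective. It sends the left side to \<Phi> acting on (\<sigma> \<otimes> id)\<sigma>(x), and the
  right side to (id \<otimes> \<Delta>)\<sigma>(x) acted on by \<Phi>_\<rho>.\<close>

lemma coassoc_iff:
  assumes co: "\<forall>m\<in>carrier M. \<forall>a\<in>carrier A. sigma (\<mu> (pure k M A m a)) = RM1 (rho A a) (sigma m)" and x: "x \<in> carrier M"
  shows "assoc_over k H TA M \<mu> D (dleft D) (dright D) D (dleft D) (map_over k H TA MD muD D (dleft D) \<rho> id (\<rho> x))
      = map_over k H TA M \<mu> DD lDD id (dcomult D) (\<rho> x)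
    \<longleftrightarrow> LMC (reass H) (rebr k M C C (tensor_map k MC C sigma id (sigma x)))
      = RM2 (reass_rho A) (tensor_map k M C2 id (ccomult C) (sigma x))"
proof -
  interpret Z: right_module_setup k H A C MD muD by (rule right_module_MD)
  note [simp, lin] = \<rho>_lin sigma_lin
  note [lin] = lin_maps_comp[OF \<rho>_lin] lin_maps_comp[OF sigma_lin]
  let ?t = "rep (\<rho> x)"
  have t [simp, lin]: "?t \<in> carrier (tensor k M AC)" using x by simp
  let ?R = "map_over k H TA M \<mu> DD lDD id (dcomult D) (\<rho> x)"
  have R: "?R = prMDD (tensor_map k M DD id (dcomult D) ?t)" by (simp add: map_over_def)
  have Rc: "tensor_map k M DD id (dcomult D) ?t \<in> carrier (tensor k M DD)"
    by (rule tensor_map_closed[OF t lin_maps_id dcomult_lin]) simp_all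
  have "thetaMDD ?R = mu_out C2 (tensor_map k M AC2 id (\<lambda>d. phiDD (dcomult D d)) ?t)"
    using tensor_map_comp[OF lin_maps_id dcomult_lin lin_maps_id phiDD_lin mod_M module_tensor[OF mod_A mod_C] mod_M mod_DD mod_M module_tensor[OF mod_A module_tensor[OF mod_C mod_C]] t]
    unfolding R thetaMDD_pr[OF Rc] by (simp add: id_def)
  hence thR: "thetaMDD ?R = RM2 (reass_rho A) (tensor_map k M C2 id (ccomult C) (sigma x))"
    by (simp add: mu_out_comult sigma_def thetaMD_def)
  have Rcl: "?R \<in> carrier MDD" unfolding R using Rc by simp

  \<comment> \<open>The associativity constraint in coordinates, as a manifestly linear function on
    (M \<otimes>_A D) \<otimes> D. Comparison with it shows that \<open>?b\<close>, which picks a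
    representative of Q, is bilinear.\<close>
  let ?Lam = "\<lambda>u. LMC (reass H) (rebr k M C C (tensor_map k MC C thetaMD id (Z.mu_out C u)))"
  have Lam [simp, lin]: "?Lam \<in> lin_maps k (tensor k MD AC) (tensor k M C2)"
    by (rule lin | simp)+
  let ?b = "\<lambda>Q p. prMDD (tensor_map k M DD id prDD (hassoc k H M D D (pure k (tensor k M AC) AC (rep Q) p)))"
  have tau: "tensor_map k M AC2 id phiDD (tensor_map k M DD id prDD w) = tensor_map k M AC2 id (\<lambda>d. rebr k A C C (dr_out d)) w"
    if w: "w \<in> carrier (tensor k M (tensor k AC AC))" for w
  proof -
    have "tensor_map k M AC2 id phiDD (tensor_map k M DD id prDD w) = tensor_map k M AC2 (\<lambda>x. id (id x)) (\<lambda>d. phiDD (prDD d)) w"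
      by (rule tensor_map_comp[OF lin_maps_id prDD_lin]) (simp_all add: w)
    also have "\<dots> = tensor_map k M AC2 id (\<lambda>d. rebr k A C C (dr_out d)) w"
      by (rule tensor_map_cong[of _ k M _ _ "tensor k AC AC"]) ((rule lin | simp add: w)+)
    finally show ?thesis .
  qed
  have hw: "hassoc k H M D D (pure k (tensor k M AC) AC v p) = LMD (reass H) (rebr k M AC AC (pure k (tensor k M AC) AC v p))" for v p
    by (simp add: hassoc_def)
  have wc: "LMD (reass H) (rebr k M AC AC (pure k (tensor k M AC) AC v p)) \<in> carrier (tensor k M (tensor k AC AC))"
    if "v \<in> carrier (tensor k M AC)" "p \<in> carrier AC" for v p by (rule lin that | simp)+
  have bc: "tensor_map k M DD id prDD (hassoc k H M D D (pure k (tensor k M AC) AC v p)) \<in> carrier (tensor k M DD)"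
    if "v \<in> carrier (tensor k M AC)" "p \<in> carrier AC" for v p
    unfolding hw by (rule tensor_map_closed[OF wc[OF that] lin_maps_id prDD_lin]) simp_all
  have b: "?b Q p \<in> carrier MDD \<and> thetaMDD (?b Q p) = ?Lam (pure k MD AC Q p)" if Q: "Q \<in> carrier MD" and p: "p \<in> carrier AC" for Q p
  proof
    show "?b Q p \<in> carrier MDD" using bc[OF rep_MD[OF Q] p] by simp
    have tl [simp, lin]: "(\<lambda>d. rebr k A C C (dr_out d)) \<in> lin_maps k (tensor k AC AC) AC2" by (rule lin | simp)+
    have "\<forall>p\<in>carrier AC. mu_out C2 (tensor_map k M AC2 id (\<lambda>d. rebr k A C C (dr_out d)) (LMD (reass H) (rebr k M AC AC (pure k (tensor k M AC) AC (rep Q) p))))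
        = ?Lam (pure k MD AC Q p)"
    proof (rule tensor_extI)
      fix a c assume ac: "a \<in> carrier A" "c \<in> carrier C"
      show "mu_out C2 (tensor_map k M AC2 id (\<lambda>d. rebr k A C C (dr_out d)) (LMD (reass H) (rebr k M AC AC (pure k (tensor k M AC) AC (rep Q) (pure k A C a c)))))
        = ?Lam (pure k MD AC Q (pure k A C a c))"
        using assoc_inner[OF rep_MD[OF Q] ac reass_closed(1)] Q ac by (simp add: thetaMD_muD thetaMD_def[of Q, symmetric])
    qed (assumption | rule lin lin_maps_comp[OF Lam] Q rep_MD[OF Q] | simp add: Q)+
    thus "thetaMDD (?b Q p) = ?Lam (pure k MD AC Q p)"
      using p bc[OF rep_MD[OF Q] p] wc[OF rep_MD[OF Q] p] tau by (simp add: hw)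
  qed
  have bil: "?b \<in> bilin_maps k MD AC MDD"
  proof (rule bilin_mapsI; rule lin_to_MDD)
    fix Q assume Q: "Q \<in> carrier MD"
    show "(\<lambda>p. thetaMDD (?b Q p)) \<in> lin_maps k AC (tensor k M C2)"
      by (rule lin_maps_cong[OF _ _ conjunct2[OF b[OF Q], symmetric]]) ((rule lin_maps_comp[OF Lam] lin Q | simp)+)
  next
    fix p assume p: "p \<in> carrier AC"
    show "(\<lambda>Q. thetaMDD (?b Q p)) \<in> lin_maps k MD (tensor k M C2)"
      by (rule lin_maps_cong[OF _ _ conjunct2[OF b[OF _ p], symmetric]]) ((rule lin_maps_comp[OF Lam] lin p | simp)+)
  qed (use b in blast | simp)+
  have lb: "tensor_lift MDD ?b u \<in> carrier MDD \<and> thetaMDD (tensor_lift MDD ?b u) = ?Lam u" if u: "u \<in> carrier (tensor k MD AC)" for u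
  proof
    have l: "tensor_lift MDD ?b \<in> lin_maps k (tensor k MD AC) MDD"
      by (rule tensor_lift_lin bil lin)+
    show "tensor_lift MDD ?b u \<in> carrier MDD" by (rule lin_maps_closed[OF l u])
    have "\<forall>u\<in>carrier (tensor k MD AC). thetaMDD (tensor_lift MDD ?b u) = ?Lam u"
    proof (rule tensor_extI)
      fix Q p assume Qp: "Q \<in> carrier MD" "p \<in> carrier AC"
      show "thetaMDD (tensor_lift MDD ?b (pure k MD AC Q p)) = ?Lam (pure k MD AC Q p)"
        using conjunct2[OF b[OF Qp]] tensor_lift_pure[OF _ _ bil _ Qp] by simp
    qed (rule lin_maps_comp[OF thetaMDD_lin l] Lam lin)+
    thus "thetaMDD (tensor_lift MDD ?b u) = ?Lam u" using u by blast
  qed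
  let ?P = "map_over k H TA MD muD D (dleft D) \<rho> id (\<rho> x)"
  let ?w = "tensor_map k MD AC \<rho> id ?t"
  have w: "?w \<in> carrier (tensor k MD AC)" by (rule tensor_map_closed[OF t \<rho>_lin lin_maps_id]) simp_all
  have P: "?P = Z.prMD ?w" by (simp add: map_over_def)
  have Pc: "?P \<in> carrier Z.MD" unfolding P using w by simp
  let ?L = "assoc_over k H TA M \<mu> D (dleft D) (dright D) D (dleft D) ?P"
  have L: "?L = tensor_lift MDD ?b (rep ?P)"
    by (simp add: assoc_over_def Let_def)
  have Lcl: "?L \<in> carrier MDD" unfolding L using lb[OF Z.rep_MD[OF Pc]] by blast
  have "thetaMDD ?L = ?Lam (rep ?P)" unfolding L using lb[OF Z.rep_MD[OF Pc]] by blast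
  \<comment> \<open>The class was formed from \<open>?w\<close>; the coordinates of (M \<otimes>_A
    D) \<otimes>_A D do not depend on the representative that is then picked from it.\<close>
  also have "Z.mu_out C (rep ?P) = Z.mu_out C ?w"
    unfolding Z.thetaMD_def[symmetric] unfolding P by (rule Z.thetaMD_pr[OF w])
  also have "tensor_map k MC C thetaMD id (Z.mu_out C ?w) = tensor_map k MC C sigma id (mu_out C ?t)"
  proof -
    \<comment> \<open>On m \<otimes> (a \<otimes> c), the coordinates of \<rho>(m)a are \<sigma>(m)
      acted on by \<rho>(a), that is \<sigma>(m a). This is where compatibility of the coaction with
      the A-action enters.\<close>
    have "\<forall>t\<in>carrier (tensor k M AC). tensor_map k MC C thetaMD id (Z.mu_out C (tensor_map k MD AC \<rho> id t)) = tensor_map k MC C sigma id (mu_out C t)"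
      by (rule tensor_extI_right) (assumption | rule lin | simp add: thetaMD_muD co sigma_def[symmetric])+
    thus ?thesis using t by blast
  qed
  finally have "thetaMDD ?L = LMC (reass H) (rebr k M C C (tensor_map k MC C sigma id (sigma x)))"
    unfolding sigma_def[of x] thetaMD_def .
  with thR show ?thesis using thetaMDD_eqI[OF Lcl Rcl] by metis
qed

end

text \<open>The axioms cannot be matched independently: the last three translate only for a linear
  coaction, and coassociativity only if moreover the coaction is compatible with the A-action. Hence
  the case distinctions.\<close>

lemma corep_iff:
  "\<rho> \<in> hmod_hom k H M MD \<and>
    (\<forall>t\<in>carrier (htensor k H M TA). \<rho> (\<mu> t) = muD (tensor_map k MD TA \<rho> id t)) \<and>
    (\<forall>x\<in>carrier M. assoc_over k H TA M \<mu> D (dleft D) (dright D) D (dleft D) (map_over k H TA MD muD D (dleft D) \<rho> id (\<rho> x))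
      = map_over k H TA M \<mu> DD lDD id (dcomult D) (\<rho> x)) \<and>
    (\<forall>x\<in>carrier M. \<mu> (rep (map_over k H TA M \<mu> TA (amult TA) id (dcounit D) (\<rho> x))) = x)
  \<longleftrightarrow> hopf_coaction sigma"
proof -
  let ?P1 = "\<rho> \<in> hmod_hom k H M MD"
  let ?P2 = "\<forall>t\<in>carrier (htensor k H M TA). \<rho> (\<mu> t) = muD (tensor_map k MD TA \<rho> id t)"
  let ?P3 = "\<forall>x\<in>carrier M. assoc_over k H TA M \<mu> D (dleft D) (dright D) D (dleft D) (map_over k H TA MD muD D (dleft D) \<rho> id (\<rho> x))
      = map_over k H TA M \<mu> DD lDD id (dcomult D) (\<rho> x)"
  let ?P4 = "\<forall>x\<in>carrier M. \<mu> (rep (map_over k H TA M \<mu> TA (amult TA) id (dcounit D) (\<rho> x))) = x"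
  let ?S3 = "\<forall>m\<in>carrier M. \<forall>a\<in>carrier A. sigma (\<mu> (pure k M A m a)) = RM1 (rho A a) (sigma m)"
  let ?S4 = "\<forall>m\<in>carrier M. LMC (reass H) (rebr k M C C (tensor_map k MC C sigma id (sigma m)))
      = RM2 (reass_rho A) (tensor_map k M C2 id (ccomult C) (sigma m))"
  let ?S5 = "\<forall>m\<in>carrier M. runit M (tensor_map k M (base_space k) id (ccounit C) (sigma m)) = m"
  have l: "\<rho> \<in> lin_maps k M MD" if ?P1 using that by (simp add: hmod_hom_def)
  have 2: "?P2 \<longleftrightarrow> ?S3" if ?P1
    unfolding htensor_simps T_same using colinear_iff[OF l[OF that]] .
  have 3: "?P3 \<longleftrightarrow> ?S4" if ?P1 ?S3
    by (rule ball_cong[OF HOL.refl coassoc_iff[OF l[OF that(1)] that(2)]])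
  have 4: "?P4 \<longleftrightarrow> ?S5" if ?P1
    by (rule ball_cong[OF HOL.refl]) (simp only: counit_eq[OF l[OF that]])
  show ?thesis
  proof (cases ?P1)
    case True
    show ?thesis
    proof (cases ?S3)
      case S3: True
      show ?thesis unfolding hopf_coaction_def 2[OF True] 3[OF True S3] 4[OF True] using hom_iff True S3 by argo
    next
      case False
      thus ?thesis unfolding hopf_coaction_def 2[OF True] by argo
    qed
  next
    case False
    thus ?thesis unfolding hopf_coaction_def using hom_iff by argo
  qed
qed

end

section \<open>The isomorphism of categories\<close>

text \<open>For functors that are the identity on morphisms. One category then inherits the category
  axioms from the other, so that they are verified only for quasi-Hopf bimodules.\<close>

lemma isomorphic_categoriesI:
  assumes D: "category D"
    and F0: "\<And>X. X \<in> Obj C \<Longrightarrow> F0 X \<in> Obj D" and G0: "\<And>Y. Y \<in> Obj D \<Longrightarrow> G0 Y \<in> Obj C"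
    and GF: "\<And>X. X \<in> Obj C \<Longrightarrow> G0 (F0 X) = X" and FG: "\<And>Y. Y \<in> Obj D \<Longrightarrow> F0 (G0 Y) = Y"
    and Arr: "\<And>X Y. X \<in> Obj C \<Longrightarrow> Y \<in> Obj C \<Longrightarrow> Arr C X Y = Arr D (F0 X) (F0 Y)"
    and Idt: "\<And>X. X \<in> Obj C \<Longrightarrow> Idt C X = Idt D (F0 X)"
    and Cmp: "\<And>X Y Z g f. X \<in> Obj C \<Longrightarrow> Y \<in> Obj C \<Longrightarrow> Z \<in> Obj C \<Longrightarrow> Cmp C X Y Z g f = Cmp D (F0 X) (F0 Y) (F0 Z) g f"
  shows "isomorphic_categories C D"
proof -
  note d = D[unfolded category_def]
  have C: "category C"
    unfolding category_def
  proof (intro conjI ballI)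
    fix X assume "X \<in> Obj C"
    thus "Idt C X \<in> Arr C X X" using d F0 by (simp add: Arr Idt)
  next
    fix X Y Z f g assume "X \<in> Obj C" "Y \<in> Obj C" "Z \<in> Obj C" "f \<in> Arr C X Y" "g \<in> Arr C Y Z"
    thus "Cmp C X Y Z g f \<in> Arr C X Z" using d F0 by (simp add: Arr Cmp)
  next
    fix X Y f assume "X \<in> Obj C" "Y \<in> Obj C" "f \<in> Arr C X Y"
    thus "Cmp C X X Y f (Idt C X) = f" "Cmp C X Y Y (Idt C Y) f = f" using d F0 by (simp_all add: Arr Cmp Idt)
  next
    fix W X Y Z f g h
    assume "W \<in> Obj C" "X \<in> Obj C" "Y \<in> Obj C" "Z \<in> Obj C" "f \<in> Arr C W X" "g \<in> Arr C X Y" "h \<in> Arr C Y Z"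
    thus "Cmp C W X Z (Cmp C X Y Z h g) f = Cmp C W Y Z h (Cmp C W X Y g f)"
      using conjunct2[OF conjunct2[OF conjunct2[OF d]]] F0 by (simp add: Arr Cmp)
  qed
  have "is_functor C D F0 (\<lambda>X Y f. f)"
    using F0 by (simp add: is_functor_def Arr Idt Cmp)
  moreover have "is_functor D C G0 (\<lambda>X Y f. f)"
    using G0 by (simp add: is_functor_def Arr Idt Cmp FG)
  moreover have "inverse_functors C F0 (\<lambda>X Y f. f) G0 (\<lambda>X Y f. f)" "inverse_functors D G0 (\<lambda>X Y f. f) F0 (\<lambda>X Y f. f)"
    by (simp_all add: inverse_functors_def GF FG)
  ultimately show ?thesis unfolding isomorphic_categories_def using C D by blast
qed

lemma tensor_act_cong:
  assumes ab: "a \<in> bilin_maps k X V V" "b \<in> bilin_maps k Y W W"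
    and m: "module k X" "module k Y" "module k V" "module k W"
    and e: "\<And>x v. x \<in> carrier X \<Longrightarrow> v \<in> carrier V \<Longrightarrow> a x v = a' x v" "\<And>y w. y \<in> carrier Y \<Longrightarrow> w \<in> carrier W \<Longrightarrow> b y w = b' y w"
    and s: "s \<in> carrier (tensor k X Y)" and t: "t \<in> carrier (tensor k V W)"
  shows "tensor_act k V W a b s t = tensor_act k V W a' b' s t"
  unfolding tensor_act_def
  by (rule tensor_lift_cong[OF m(1,2) s], rule tensor_map_cong[OF bilin_maps_right[OF ab(1)] bilin_maps_right[OF ab(2)] m(3,4,3,4) t])
    (simp_all add: e)

context right_module_setup
begin

text \<open>The coaction stored in a bimodule is restricted to the carrier, while the one computed
  from a corepresentation is not; the axioms do not see the difference.\<close>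

lemma hopf_coaction_cong:
  assumes e: "\<And>m. m \<in> carrier M \<Longrightarrow> \<sigma> m = \<sigma>' m"
  shows "hopf_coaction \<sigma> \<longleftrightarrow> hopf_coaction \<sigma>'"
proof -
  have l: "\<sigma> \<in> lin_maps k M MC \<longleftrightarrow> \<sigma>' \<in> lin_maps k M MC"
    using lin_maps_cong[of \<sigma> k M MC \<sigma>'] lin_maps_cong[of \<sigma>' k M MC \<sigma>] e by auto
  have t: "tensor_map k MC C \<sigma> id (\<sigma> m) = tensor_map k MC C \<sigma>' id (\<sigma>' m)" if "\<sigma>' \<in> lin_maps k M MC" "m \<in> carrier M" for m
    unfolding e[OF that(2)]
    by (rule tensor_map_cong[symmetric, OF that(1) lin_maps_id]) (use that lin_maps_closed[OF that(1)] e in simp_all)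
  show ?thesis
    unfolding hopf_coaction_def l using e t by (intro conj_cong ball_cong HOL.refl) simp_all
qed

text \<open>The module axioms hold by the locale. The curried action agrees with
  \<open>\<mu>\<close> only on the carriers, so the componentwise actions in the coaction axioms are
  exchanged by \<open>tensor_act_cong\<close>.\<close>

lemma hopf_bimodule_iff:
  fixes N :: "('k, 'h, 'm, 'a, 'c) hopf_bimod"
  assumes s: "same_module N M" and lact: "lact N = lact M"
    and br: "\<And>m a. m \<in> carrier M \<Longrightarrow> a \<in> carrier A \<Longrightarrow> bract N m a = \<mu> (pure k M A m a)"
  shows "hopf_bimodule k H A C N \<longleftrightarrow> hopf_coaction (bcoact N)"
proof -
  note [simp] = same_module_simps[OF s] same_module_module[OF s] lact
  have cN [simp]: "carrier N = carrier M" using s by (simp add: same_module_def)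
  have h: "hmodule k H N" using hmodule_M by (simp add: hmodule_def left_action_def)
  have b: "bract N \<in> bilin_maps k M A M"
  proof (rule bilin_maps_cong)
    show "(\<lambda>m a. \<mu> (pure k M A m a)) \<in> bilin_maps k M A M"
      by (rule bilin_mapsI; (assumption | rule lin | simp)+)
  qed (simp_all add: br)
  have r: "right_action k A N (bract N)"
    using b by (simp add: right_action_def br \<mu>_one \<mu>_mult)
  have c: "\<forall>h\<in>carrier H. \<forall>m\<in>carrier N. \<forall>a\<in>carrier A. bract N (lact N h m) a = lact N h (bract N m a)"
    by (simp add: br \<mu>_lact)
  have t1: "tensor_act k M C (\<lambda>a m. bract N m a) RC s t = RM1 s t" if "s \<in> carrier AH" "t \<in> carrier MC" for s t
    by (rule tensor_act_cong[symmetric, OF rM_bilin RC_simps(1)]) (simp_all add: br that)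
  have t2: "tensor_act k M C2 (\<lambda>a m. bract N m a) RC2 s t = RM2 s t" if "s \<in> carrier AH2" "t \<in> carrier (tensor k M C2)" for s t
    by (rule tensor_act_cong[symmetric, OF rM_bilin R_bilin(1)]) (simp_all add: br that)
  have cl: "\<sigma> m \<in> carrier MC" "tensor_map k M C2 id (ccomult C) (\<sigma> m) \<in> carrier (tensor k M C2)"
    if "\<sigma> \<in> lin_maps k M MC" "m \<in> carrier M" for \<sigma> m
    using lin_maps_closed[OF that] tensor_map_closed[OF lin_maps_closed[OF that] lin_maps_id ccomult_lin] by simp_all
  show ?thesis
    unfolding hopf_bimodule_def hopf_coaction_def Let_def using h r c
    by (simp add: br t1 t2 cl cong: conj_cong)
qed

end

context comodule_setup
begin

text \<open>The coordinate map \<theta> as a function of \<open>M\<close> and \<open>\<mu>\<close>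
  outside their locale, to be used for records of different types over one space.\<close>

definition "theta M \<mu> P = tensor_map k M C \<mu> id (rebr_inv k M A C (rep P))"

lemma theta_eq: "right_module_setup k H A C M \<mu> \<Longrightarrow> right_module_setup.thetaMD k A C M \<mu> = theta M \<mu>"
  by (simp add: fun_eq_iff right_module_setup.thetaMD_def right_module_setup.mu_out_def theta_def)

lemma theta_same: "same_module M M' \<Longrightarrow> theta M \<mu> = theta M' \<mu>"
  unfolding theta_def[abs_def]
  by (simp only: tensor_map_same[OF same_module_refl _ same_module_refl, of M M'] rebr_same[of M M', OF _ same_module_refl same_module_refl])

lemma right_module_setup_same:
  assumes s: "same_module M M'" and l: "lact M = lact M'" and r: "right_module_setup k H A C M \<mu>"
  shows "right_module_setup k H A C M' \<mu>"
proof -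
  interpret right_module_setup k H A C M \<mu> by fact
  note [simp] = same_module_simps[OF same_module_sym[OF s]] same_module_module[OF same_module_sym[OF s]] l[symmetric]
  have [simp]: "carrier M' = carrier M" using s by (simp add: same_module_def)
  have "hmodule k H M'" using hmodule_M by (simp add: hmodule_def left_action_def)
  thus ?thesis
    by (intro right_module_setup.intro[OF comodule_setup_axioms right_module_setup_axioms.intro])
      (simp_all add: \<mu>_mult \<mu>_one \<mu>_lact)
qed

text \<open>As A is trivial, its constraint is a rebracketing and H acts on M \<otimes> A through M.
  One direction evaluates the axioms at pure tensors, with 1 of the ground field for the unit law;
  the other is extensionality.\<close>

lemma right_module_iff:
  fixes M :: "('k, 'h, 'm, 'a, 'e) rmod_scheme"
  shows "right_module k H TA M \<longleftrightarrow> right_module_setup k H A C M (rmult M)"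
proof -
  have hu: "same_module (hunit k H) (base_space k)"
    by (simp add: same_module_def hunit_def module.extend_def hmod.fields_def)
  note [simp] = same_module_simps[OF hu]
  have [simp]: "carrier (hunit k H) = carrier k" using hu by (simp add: same_module_def)
  have ul [simp, lin]: "(\<lambda>c. c \<odot>\<^bsub>A\<^esub> \<one>\<^bsub>A\<^esub>) \<in> lin_maps k (base_space k) A" by simp
  show ?thesis
  proof
    assume R: "right_module k H TA M"
    have h: "hmodule k H M" and l: "rmult M \<in> lin_maps k (tensor k M A) M"
      using R by (simp_all add: right_module_def hmod_hom_def)
    note hs = hmoduleD[OF h]
    note [simp] = hs(1,2,3,5)
    show "right_module_setup k H A C M (rmult M)"
    proof (intro right_module_setup.intro[OF comodule_setup_axioms right_module_setup_axioms.intro])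
      fix m a b assume m: "m \<in> carrier M" and a: "a \<in> carrier A" and b: "b \<in> carrier A"
      have mc: "rmult M (pure k M A m a) \<in> carrier M" using lin_maps_closed[OF l] m a by simp
      show "rmult M (pure k M A m (a \<otimes>\<^bsub>A\<^esub> b)) = rmult M (pure k M A (rmult M (pure k M A m a)) b)"
        using R h l m a b unfolding right_module_def
        by (auto dest!: bspec[where x = "pure k (tensor k M A) A (pure k M A m a) b"])
    next
      fix m assume m: "m \<in> carrier M"
      have u: "\<forall>t\<in>carrier (tensor k M (base_space k)). rmult M (tensor_map k M A id (\<lambda>c. c \<odot>\<^bsub>A\<^esub> \<one>\<^bsub>A\<^esub>) t) = runit M t"
        using R by (simp add: right_module_def)
      show "rmult M (pure k M A m \<one>\<^bsub>A\<^esub>) = m"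
        using bspec[OF u, of "pure k M (base_space k) m \<one>\<^bsub>k\<^esub>"] m by (simp add: module.smult_one[OF hs(1)])
    next
      fix x m a assume xma: "x \<in> carrier H" "m \<in> carrier M" "a \<in> carrier A"
      have "rmult M (tensor_act k M A (lact M) (lact TA) (comult H x) (pure k M A m a)) = lact M x (rmult M (pure k M A m a))"
        using R xma by (simp add: right_module_def hmod_hom_def)
      also have "tensor_act k M A (lact M) (lact TA) (comult H x) (pure k M A m a) = pure k M A (lact M x m) a"
        using lact_trivial(2)[of M TA x "pure k M A m a"] xma h bilin_maps_right[OF hs(2) xma(1)] by simp
      finally show "rmult M (pure k M A (lact M x m) a) = lact M x (rmult M (pure k M A m a))" .
    qed (simp_all add: h l)
  next
    assume "right_module_setup k H A C M (rmult M)"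
    then interpret right_module_setup k H A C M "rmult M" .
    have 1: "\<forall>t\<in>carrier (tensor k (tensor k M A) A). rmult M (tensor_map k M A (rmult M) id t) = rmult M (tensor_map k M A id mA (rebr k M A A t))"
      by (rule tensor_extI_left) (assumption | rule lin | simp add: \<mu>_mult)+
    have 2: "\<forall>t\<in>carrier (tensor k M (base_space k)). rmult M (tensor_map k M A id (\<lambda>c. c \<odot>\<^bsub>A\<^esub> \<one>\<^bsub>A\<^esub>) t) = runit M t"
    proof (rule tensor_extI)
      fix m c assume "m \<in> carrier M" "c \<in> carrier (base_space k)"
      hence mc: "m \<in> carrier M" "c \<in> carrier k" by simp_all
      have "rmult M (pure k M A m (c \<odot>\<^bsub>A\<^esub> \<one>\<^bsub>A\<^esub>)) = c \<odot>\<^bsub>M\<^esub> m"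
        using mc by (simp add: pure_smult_right lin_maps_smult[OF \<mu>_lin] \<mu>_one)
      thus "rmult M (tensor_map k M A id (\<lambda>c. c \<odot>\<^bsub>A\<^esub> \<one>\<^bsub>A\<^esub>) (pure k M (base_space k) m c)) = runit M (pure k M (base_space k) m c)"
        using mc by simp
    qed (assumption | rule lin | simp)+
    have 3: "rmult M (tensor_act k M A (lact M) (\<lambda>h a. counit H h \<odot>\<^bsub>A\<^esub> a) (comult H h) t) = lact M h (rmult M t)"
      if h: "h \<in> carrier H" and t: "t \<in> carrier (tensor k M A)" for h t
    proof -
      note ll [simp, lin] = bilin_maps_right[OF M_simps(2) h] lin_maps_comp[OF bilin_maps_right[OF M_simps(2) h]]
      have "\<forall>t\<in>carrier (tensor k M A). rmult M (tensor_map k M A (lact M h) id t) = lact M h (rmult M t)"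
        by (rule tensor_extI) (assumption | rule lin | simp add: h \<mu>_lact)+
      thus ?thesis using lact_trivial(2)[of M TA h t] h t by simp
    qed
    show "right_module k H TA M"
      unfolding right_module_def using 1 2 3 by (simp add: hmod_hom_def)
  qed
qed

lemma corepresentation_iff:
  fixes M :: "('k, 'h, 'm, 'a, ('a, 'c) tensor) corep"
  assumes "corep_setup k H A C M (rmult M) (coact M)"
  shows "corepresentation k H TA D M \<longleftrightarrow> right_module_setup.hopf_coaction k H A C M (rmult M) (\<lambda>m. theta M (rmult M) (coact M m))"
proof -
  interpret corep_setup k H A C M "rmult M" "coact M" by fact
  have "right_module k H TA M" using right_module_iff right_module_setup_axioms by blast
  moreover have "sigma = (\<lambda>m. theta M (rmult M) (coact M m))"
    by (simp add: fun_eq_iff sigma_def theta_eq[OF right_module_setup_axioms])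
  ultimately show ?thesis unfolding corepresentation_def Let_def using corep_iff by simp
qed

end

section \<open>The category of quasi-Hopf bimodules\<close>

lemma compose_hmod_hom:
  assumes f: "f \<in> hmod_hom k H L M" and g: "g \<in> hmod_hom k H M N" and L: "hmodule k H L"
  shows "compose (carrier L) g f \<in> hmod_hom k H L N"
proof -
  interpret L: module k L using L by (simp add: hmodule_def)
  have cl: "h \<in> carrier H \<Longrightarrow> x \<in> carrier L \<Longrightarrow> lact L h x \<in> carrier L" for h x
    using L by (auto simp: hmodule_def left_action_def intro: bilin_maps_closed)
  have l: "(\<lambda>x. g (f x)) \<in> lin_maps k L N" using f g by (auto simp: hmod_hom_def intro: lin_maps_comp)
  have "compose (carrier L) g f \<in> lin_maps k L N"
    by (rule lin_maps_cong[OF l L.module_axioms]) (simp add: compose_eq)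
  thus ?thesis using f g by (auto simp: hmod_hom_def compose_eq cl lin_maps_closed)
qed

context comodule_setup
begin

lemma hopf_bimoduleD:
  assumes "hopf_bimodule k H A C N"
  shows "hmodule k H N" "right_action k A N (bract N)"
    "\<And>h m a. h \<in> carrier H \<Longrightarrow> m \<in> carrier N \<Longrightarrow> a \<in> carrier A \<Longrightarrow> bract N (lact N h m) a = lact N h (bract N m a)"
    "bcoact N \<in> lin_maps k N (tensor k N C)"
    "module k N" "\<And>m a. m \<in> carrier N \<Longrightarrow> a \<in> carrier A \<Longrightarrow> bract N m a \<in> carrier N"
  using assms unfolding hopf_bimodule_def Let_def right_action_def hmodule_def by (auto intro: bilin_maps_closed)

text \<open>Arrows are undefined off the carrier, so the identity arrow is a restricted function;
  tensored with C it still is the identity, since only values on the carrier matter.\<close>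

lemma category_hopf_bimodule: "category (hopf_bimodule_category TYPE('m) k H A C)"
proof -
  let ?C = "hopf_bimodule_category TYPE('m) k H A C"
  have O: "hopf_bimodule k H A C X" if "X \<in> Obj ?C" for X
    using that by (simp add: hopf_bimodule_category_def)
  have A: "f \<in> Arr ?C X Y \<longleftrightarrow> f \<in> hmod_hom k H X Y \<and> f \<in> extensional (carrier X) \<and>
        (\<forall>m\<in>carrier X. \<forall>a\<in>carrier A. f (bract X m a) = bract Y (f m) a) \<and>
        (\<forall>m\<in>carrier X. bcoact Y (f m) = tensor_map k Y C f id (bcoact X m))" for f X Y
    by (simp add: hopf_bimodule_category_def)
  have I: "Idt ?C X = (\<lambda>x\<in>carrier X. x)" "Cmp ?C X Y Z g f = compose (carrier X) g f" for X Y Z f g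
    by (simp_all add: hopf_bimodule_category_def)
  show ?thesis
    unfolding category_def
  proof (intro conjI ballI)
    fix X assume X: "X \<in> Obj ?C"
    note x = hopf_bimoduleD[OF O[OF X]]
    interpret X: module k X by (rule x)
    have l: "(\<lambda>x\<in>carrier X. x) \<in> lin_maps k X X"
      by (rule lin_maps_cong[OF lin_maps_ident x(5)]) simp
    have "tensor_map k X C (\<lambda>x\<in>carrier X. x) id t = t" if t: "t \<in> carrier (tensor k X C)" for t
    proof -
      have "tensor_map k X C (\<lambda>x\<in>carrier X. x) id t = tensor_map k X C (\<lambda>x. x) (\<lambda>x. x) t"
        by (rule tensor_map_cong[OF l lin_maps_id x(5) mod_C x(5) mod_C t]) simp_all
      thus ?thesis using tensor_map_ident[OF x(5) mod_C t] by simp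
    qed
    thus "Idt ?C X \<in> Arr ?C X X"
      unfolding A I using l x(6) lin_maps_closed[OF x(4)] hmoduleD(5)[OF x(1)] by (simp add: hmod_hom_def)
  next
    fix X Y Z f g
    assume X: "X \<in> Obj ?C" and Y: "Y \<in> Obj ?C" and Z: "Z \<in> Obj ?C" and f: "f \<in> Arr ?C X Y" and g: "g \<in> Arr ?C Y Z"
    note x = hopf_bimoduleD[OF O[OF X]] and y = hopf_bimoduleD[OF O[OF Y]] and z = hopf_bimoduleD[OF O[OF Z]]
    have fl: "f \<in> lin_maps k X Y" and gl: "g \<in> lin_maps k Y Z" using f g unfolding A by (simp_all add: hmod_hom_def)
    note fc = lin_maps_closed[OF fl]
    have fh: "f \<in> hmod_hom k H X Y" and gh: "g \<in> hmod_hom k H Y Z" using f g unfolding A by simp_all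
    note gf = compose_hmod_hom[OF fh gh x(1)]
    have t: "tensor_map k Z C (compose (carrier X) g f) id t = tensor_map k Z C g id (tensor_map k Y C f id t)"
      if t: "t \<in> carrier (tensor k X C)" for t
    proof -
      have "tensor_map k Z C g id (tensor_map k Y C f id t) = tensor_map k Z C (\<lambda>x. g (f x)) (\<lambda>x. id (id x)) t"
        by (rule tensor_map_comp[OF fl lin_maps_id gl lin_maps_id x(5) mod_C y(5) mod_C z(5) mod_C t])
      also have "\<dots> = tensor_map k Z C (compose (carrier X) g f) id t"
        by (rule tensor_map_cong[OF lin_maps_comp[OF gl fl] _ x(5) mod_C z(5) mod_C t])
          (simp_all add: compose_eq lin_maps_ident)
      finally show ?thesis by simp
    qed
    have "compose (carrier X) g f (bract X m a) = bract Z (compose (carrier X) g f m) a" if "m \<in> carrier X" "a \<in> carrier A" for m a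
      using f g that fc x(6) unfolding A by (simp add: compose_eq)
    moreover have "bcoact Z (compose (carrier X) g f m) = tensor_map k Z C (compose (carrier X) g f) id (bcoact X m)" if m: "m \<in> carrier X" for m
      using f g m fc[OF m] t[OF lin_maps_closed[OF x(4) m]] unfolding A by (simp add: compose_eq)
    ultimately show "Cmp ?C X Y Z g f \<in> Arr ?C X Z"
      unfolding I A using gf compose_extensional by blast
  next
    fix X Y f assume X: "X \<in> Obj ?C" and Y: "Y \<in> Obj ?C" and f: "f \<in> Arr ?C X Y"
    have fl: "f \<in> lin_maps k X Y" and fe: "f \<in> extensional (carrier X)" using f unfolding A by (simp_all add: hmod_hom_def)
    show "Cmp ?C X X Y f (Idt ?C X) = f" "Cmp ?C X Y Y (Idt ?C Y) f = f"
      unfolding I using lin_maps_closed[OF fl] by (auto simp: compose_def intro!: extensionalityI[OF _ fe])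
  next
    fix W X Y Z f g h
    assume f: "f \<in> Arr ?C W X"
    have "f \<in> carrier W \<rightarrow> carrier X" using f unfolding A by (auto simp: hmod_hom_def lin_maps_closed)
    thus "Cmp ?C W X Z (Cmp ?C X Y Z h g) f = Cmp ?C W Y Z h (Cmp ?C W X Y g f)"
      unfolding I by (rule compose_assoc[symmetric])
  qed
qed

section \<open>The mutually inverse maps on objects\<close>

definition to_hopf :: "('k, 'h, 'm, 'a, ('a, 'c) tensor) corep \<Rightarrow> ('k, 'h, 'm, 'a, 'c) hopf_bimod" where
  "to_hopf M = \<lparr>carrier = carrier M, monoid.mult = monoid.mult M, one = \<one>\<^bsub>M\<^esub>, zero = \<zero>\<^bsub>M\<^esub>, add = add M,
     smult = smult M, lact = lact M, bract = (\<lambda>m\<in>carrier M. \<lambda>a\<in>carrier A. rmult M (pure k M A m a)),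
     bcoact = (\<lambda>m\<in>carrier M. theta M (rmult M) (coact M m))\<rparr>"

text \<open>The lift is restricted to the carrier because an isomorphism of categories requires
  equality of records after the round trip, hence equality of the action as a function.\<close>

definition hopf_mult :: "('k, 'h, 'm, 'a, 'c) hopf_bimod \<Rightarrow> ('m, 'a) tensor \<Rightarrow> 'm" where
  "hopf_mult N = (\<lambda>t\<in>carrier (tensor k N A). tensor_lift N (bract N) t)"

text \<open>The coaction is carried back into M \<otimes>_A D by the inverse of \<theta>, which is a
  bijection onto M \<otimes> C by \<open>theta_facts\<close>.\<close>

definition of_hopf :: "('k, 'h, 'm, 'a, 'c) hopf_bimod \<Rightarrow> ('k, 'h, 'm, 'a, ('a, 'c) tensor) corep" where
  "of_hopf N = \<lparr>carrier = carrier N, monoid.mult = monoid.mult N, one = \<one>\<^bsub>N\<^esub>, zero = \<zero>\<^bsub>N\<^esub>, add = add N,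
     smult = smult N, lact = lact N, rmult = hopf_mult N,
     coact = (\<lambda>m\<in>carrier N. inv_into (carrier (tensor_over k H TA N (hopf_mult N) D (dleft D)))
       (theta N (hopf_mult N)) (bcoact N m))\<rparr>"

lemma same_hopf: "same_module (to_hopf M) M" "same_module (of_hopf N) N" "lact (to_hopf M) = lact M" "lact (of_hopf N) = lact N"
  by (simp_all add: same_module_def to_hopf_def of_hopf_def)

lemma hopf_simps [simp]:
  "carrier (to_hopf M) = carrier M" "carrier (of_hopf N) = carrier N" "rmult (of_hopf N) = hopf_mult N"
  "bract (to_hopf M) = (\<lambda>m\<in>carrier M. \<lambda>a\<in>carrier A. rmult M (pure k M A m a))"
  "bcoact (to_hopf M) = (\<lambda>m\<in>carrier M. theta M (rmult M) (coact M m))"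
  "coact (of_hopf N) = (\<lambda>m\<in>carrier N. inv_into (carrier (tensor_over k H TA N (hopf_mult N) D (dleft D)))
       (theta N (hopf_mult N)) (bcoact N m))"
  by (simp_all add: to_hopf_def of_hopf_def)

lemma theta_facts:
  assumes "right_module_setup k H A C M \<mu>"
  shows "inj_on (theta M \<mu>) (carrier (tensor_over k H TA M \<mu> D (dleft D)))"
    "theta M \<mu> ` carrier (tensor_over k H TA M \<mu> D (dleft D)) = carrier (tensor k M C)"
proof -
  interpret right_module_setup k H A C M \<mu> by fact
  show "inj_on (theta M \<mu>) (carrier MD)" "theta M \<mu> ` carrier MD = carrier MC"
    unfolding theta_eq[OF assms, symmetric] by (rule inj_onI, rule thetaMD_eqI thetaMD_image; assumption) (rule thetaMD_image)
qed

context
  fixes M :: "('k, 'h, 'm, 'a, ('a, 'c) tensor) corep"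
  assumes M: "M \<in> Obj (corep_category TYPE('m) k H TA D)"
begin

lemma corep_object:
  shows "corepresentation k H TA D M" "extensional_hmod k H M" "rmult M \<in> extensional (carrier (tensor k M A))"
    "coact M \<in> extensional (carrier M)" "right_module_setup k H A C M (rmult M)" "corep_setup k H A C M (rmult M) (coact M)"
proof -
  show c: "corepresentation k H TA D M" "extensional_hmod k H M" "rmult M \<in> extensional (carrier (tensor k M A))"
    "coact M \<in> extensional (carrier M)" using M by (simp_all add: corep_category_def)
  show r: "right_module_setup k H A C M (rmult M)"
    using c(1) unfolding corepresentation_def Let_def right_module_iff by blast
  have "coact M \<in> lin_maps k M (tensor_over k H TA M (rmult M) D (dleft D))"
    using c(1) unfolding corepresentation_def Let_def hmod_hom_def by blast
  thus "corep_setup k H A C M (rmult M) (coact M)"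
    by (intro corep_setup.intro[OF r corep_setup_axioms.intro]) (rule lin_maps_closed)
qed

lemma to_hopf_object: "to_hopf M \<in> Obj (hopf_bimodule_category TYPE('m) k H A C)"
proof -
  interpret right_module_setup k H A C M "rmult M" by (rule corep_object)
  have "hopf_coaction (\<lambda>m. theta M (rmult M) (coact M m))"
    using corepresentation_iff[OF corep_object(6)] corep_object(1) by blast
  hence "hopf_coaction (bcoact (to_hopf M))"
    by (rule iffD1[OF hopf_coaction_cong, rotated]) simp
  hence "hopf_bimodule k H A C (to_hopf M)"
    by (rule iffD2[OF hopf_bimodule_iff[OF same_hopf(1) same_hopf(3)], rotated]) simp
  moreover have "extensional_hmod k H (to_hopf M)"
    using corep_object(2) by (simp add: extensional_hmod_def to_hopf_def)
  ultimately show ?thesis by (simp add: hopf_bimodule_category_def fun_eq_iff)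
qed

lemma hopf_mult_to_hopf: "hopf_mult (to_hopf M) = rmult M"
proof -
  interpret right_module_setup k H A C M "rmult M" by (rule corep_object)
  have T: "tensor k (to_hopf M) A = tensor k M A" by (rule tensor_same[OF same_module_refl same_hopf(1) same_module_refl])
  have b: "bract (to_hopf M) \<in> bilin_maps k M A M"
  proof (rule bilin_maps_cong)
    show "(\<lambda>m a. rmult M (pure k M A m a)) \<in> bilin_maps k M A M"
      by (rule bilin_mapsI; (assumption | rule lin | simp)+)
  qed simp_all
  have "\<forall>t\<in>carrier (tensor k M A). tensor_lift M (bract (to_hopf M)) t = rmult M t"
  proof (rule tensor_extI)
    show "(\<lambda>t. tensor_lift M (bract (to_hopf M)) t) \<in> lin_maps k (tensor k M A) M"
      by (rule tensor_lift_lin b mod_M mod_A)+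
    show "tensor_lift M (bract (to_hopf M)) (pure k M A m a) = rmult M (pure k M A m a)" if "m \<in> carrier M" "a \<in> carrier A" for m a
      by (subst tensor_lift_pure[OF mod_M mod_A b mod_M that]) (simp add: that)
  qed simp_all
  moreover have "tensor_lift (to_hopf M) (bract (to_hopf M)) = tensor_lift M (bract (to_hopf M))"
    by (rule tensor_lift_same[OF same_module_refl same_hopf(1) same_module_refl])
  ultimately have "\<And>t. t \<in> carrier (tensor k M A) \<Longrightarrow> hopf_mult (to_hopf M) t = rmult M t"
    unfolding hopf_mult_def T by simp
  moreover have "hopf_mult (to_hopf M) \<in> extensional (carrier (tensor k M A))"
    unfolding hopf_mult_def T by (rule restrict_extensional)
  ultimately show ?thesis using corep_object(3) by (metis extensionalityI)
qed

lemma of_to_hopf: "of_hopf (to_hopf M) = M"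
proof -
  have "coact (of_hopf (to_hopf M)) = coact M"
  proof (rule extensionalityI[OF _ corep_object(4)])
    show "coact (of_hopf (to_hopf M)) \<in> extensional (carrier M)" by simp
    fix m assume m: "m \<in> carrier M"
    have c: "coact M m \<in> carrier (tensor_over k H TA M (rmult M) D (dleft D))"
      using corep_object(6) m by (simp add: corep_setup_def corep_setup_axioms_def)
    have t: "tensor_over k H TA (to_hopf M) (rmult M) D (dleft D) = tensor_over k H TA M (rmult M) D (dleft D)"
      by (rule tensor_over_cong[OF same_hopf(1) same_module_refl same_hopf(3) HOL.refl])
    show "coact (of_hopf (to_hopf M)) m = coact M m"
      using m inv_into_f_f[OF theta_facts(1)[OF corep_object(5)] c]
      by (simp add: hopf_mult_to_hopf theta_same[OF same_hopf(1)] t)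
  qed
  thus ?thesis using hopf_mult_to_hopf by (simp add: to_hopf_def of_hopf_def)
qed

end

context
  fixes N :: "('k, 'h, 'm, 'a, 'c) hopf_bimod"
  assumes N: "N \<in> Obj (hopf_bimodule_category TYPE('m) k H A C)"
begin

lemma hopf_object:
  shows "hopf_bimodule k H A C N" "extensional_hmod k H N"
    "bract N = (\<lambda>m\<in>carrier N. \<lambda>a\<in>carrier A. bract N m a)" "bcoact N \<in> extensional (carrier N)"
  using N by (simp_all add: hopf_bimodule_category_def)

lemma hopf_mult_pure:
  assumes "m \<in> carrier N" "a \<in> carrier A"
  shows "hopf_mult N (pure k N A m a) = bract N m a"
  using hopf_bimoduleD[OF hopf_object(1)] assms
  by (simp add: hopf_mult_def right_action_def tensor_lift_pure[of k N A])

lemma right_module_hopf: "right_module_setup k H A C N (hopf_mult N)"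
proof -
  note n = hopf_bimoduleD[OF hopf_object(1)]
  have l: "hopf_mult N \<in> lin_maps k (tensor k N A) N"
  proof (rule lin_maps_cong)
    show "tensor_lift N (bract N) \<in> lin_maps k (tensor k N A) N"
      using n(2,5) by (simp add: right_action_def tensor_lift_lin)
  qed (simp_all add: hopf_mult_def n)
  show ?thesis
    by (intro right_module_setup.intro[OF comodule_setup_axioms right_module_setup_axioms.intro])
      (use n in \<open>simp_all add: l hopf_mult_pure right_action_def hmoduleD(5)\<close>)
qed

lemma coact_of_hopf:
  assumes m: "m \<in> carrier N"
  shows "coact (of_hopf N) m \<in> carrier (tensor_over k H TA N (hopf_mult N) D (dleft D))"
    "theta N (hopf_mult N) (coact (of_hopf N) m) = bcoact N m"
proof -
  have "bcoact N m \<in> theta N (hopf_mult N) ` carrier (tensor_over k H TA N (hopf_mult N) D (dleft D))"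
    using lin_maps_closed[OF hopf_bimoduleD(4)[OF hopf_object(1)] m] unfolding theta_facts(2)[OF right_module_hopf] .
  thus "coact (of_hopf N) m \<in> carrier (tensor_over k H TA N (hopf_mult N) D (dleft D))"
    "theta N (hopf_mult N) (coact (of_hopf N) m) = bcoact N m"
    using m by (simp_all add: inv_into_into f_inv_into_f)
qed

lemma of_hopf_object: "of_hopf N \<in> Obj (corep_category TYPE('m) k H TA D)"
proof -
  note s = same_module_sym[OF same_hopf(2)] and l = same_hopf(4)[symmetric]
  have r: "right_module_setup k H A C (of_hopf N) (hopf_mult N)"
    by (rule right_module_setup_same[OF s l right_module_hopf])
  interpret right_module_setup k H A C "of_hopf N" "hopf_mult N" by (rule r)
  have t: "tensor_over k H TA N (hopf_mult N) D (dleft D) = MD"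
    by (rule tensor_over_cong[OF s same_module_refl l HOL.refl])
  have cs: "corep_setup k H A C (of_hopf N) (rmult (of_hopf N)) (coact (of_hopf N))"
    unfolding hopf_simps(3)
    by (rule corep_setup.intro[OF r corep_setup_axioms.intro]) (use coact_of_hopf(1) t in simp)
  have "hopf_coaction (bcoact N)"
  proof (rule iffD1[OF hopf_bimodule_iff[OF s l]])
    show "bract N m a = hopf_mult N (pure k (of_hopf N) A m a)" if "m \<in> carrier (of_hopf N)" "a \<in> carrier A" for m a
      unfolding pure_same[OF same_module_refl same_hopf(2) same_module_refl]
      by (rule hopf_mult_pure[symmetric]) (use that in simp_all)
  qed (rule hopf_object)
  hence "hopf_coaction (\<lambda>m. theta (of_hopf N) (rmult (of_hopf N)) (coact (of_hopf N) m))"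
  proof (rule iffD1[OF hopf_coaction_cong, rotated])
    fix m assume "m \<in> carrier (of_hopf N)"
    hence "m \<in> carrier N" by (simp only: hopf_simps)
    thus "bcoact N m = theta (of_hopf N) (rmult (of_hopf N)) (coact (of_hopf N) m)"
      unfolding theta_same[OF same_hopf(2)] hopf_simps(3) by (rule coact_of_hopf(2)[symmetric])
  qed
  hence "corepresentation k H TA D (of_hopf N)"
    using corepresentation_iff[OF cs] by simp
  moreover have "extensional_hmod k H (of_hopf N)"
    using hopf_object(2) by (simp add: extensional_hmod_def of_hopf_def)
  moreover have "hopf_mult N \<in> extensional (carrier (tensor k (of_hopf N) A))"
    unfolding tensor_same[OF same_module_refl same_hopf(2) same_module_refl] hopf_mult_def by (rule restrict_extensional)
  ultimately show ?thesis by (simp add: corep_category_def)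
qed

lemma to_of_hopf: "to_hopf (of_hopf N) = N"
proof -
  have "bract (to_hopf (of_hopf N)) = bract N"
  proof (intro ext)
    fix m a
    have e: "bract N m a = (\<lambda>m\<in>carrier N. \<lambda>a\<in>carrier A. bract N m a) m a"
      using hopf_object(3) by metis
    show "bract (to_hopf (of_hopf N)) m a = bract N m a"
      unfolding e by (simp add: restrict_def hopf_mult_pure pure_same[OF same_module_refl same_hopf(2) same_module_refl])
  qed
  moreover have "bcoact (to_hopf (of_hopf N)) = bcoact N"
    by (rule extensionalityI[OF _ hopf_object(4)])
      (use coact_of_hopf(2) in \<open>simp_all add: theta_same[OF same_hopf(2)] del: hopf_simps(6)\<close>)
  ultimately show ?thesis by (simp add: to_hopf_def of_hopf_def)
qed

end

text \<open>The same functions are arrows on both sides. A-linearity is tested on pure tensors; for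
  A-linear maps \<theta> is natural, so the two forms of colinearity agree by injectivity of
  \<theta>.\<close>

lemma Arr_corep:
  fixes M N :: "('k, 'h, 'm, 'a, ('a, 'c) tensor) corep"
  assumes M: "M \<in> Obj (corep_category TYPE('m) k H TA D)" and N: "N \<in> Obj (corep_category TYPE('m) k H TA D)"
  shows "Arr (corep_category TYPE('m) k H TA D) M N = Arr (hopf_bimodule_category TYPE('m) k H A C) (to_hopf M) (to_hopf N)"
proof -
  interpret X: corep_setup k H A C M "rmult M" "coact M" by (rule corep_object[OF M])
  interpret Y: corep_setup k H A C N "rmult N" "coact N" by (rule corep_object[OF N])
  have hom: "hmod_hom k H (to_hopf M) (to_hopf N) = hmod_hom k H M N"
    unfolding hmod_hom_def same_hopf lin_maps_same[OF same_module_refl same_hopf(1) same_hopf(1)] by simp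
  have "(\<forall>t\<in>carrier (htensor k H M TA). g (rmult M t) = rmult N (tensor_map k N TA g id t)) \<and>
        (\<forall>x\<in>carrier M. coact N (g x) = map_over k H TA N (rmult N) D (dleft D) g id (coact M x))
    \<longleftrightarrow> (\<forall>m\<in>carrier M. \<forall>a\<in>carrier A. g (bract (to_hopf M) m a) = bract (to_hopf N) (g m) a) \<and>
        (\<forall>m\<in>carrier M. bcoact (to_hopf N) (g m) = tensor_map k (to_hopf N) C g id (bcoact (to_hopf M) m))"
    if g: "g \<in> hmod_hom k H M N" for g
  proof -
    have l [simp, lin]: "g \<in> lin_maps k M N" using g by (simp add: hmod_hom_def)
    note [lin] = lin_maps_comp[OF l]
    note [simp] = lin_maps_closed[OF l]
    have tm: "tensor_map k (to_hopf N) C = tensor_map k N C"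
      by (rule tensor_map_same[OF same_module_refl same_hopf(1) same_module_refl])
    have 1: "(\<forall>t\<in>carrier (htensor k H M TA). g (rmult M t) = rmult N (tensor_map k N TA g id t))
        \<longleftrightarrow> (\<forall>m\<in>carrier M. \<forall>a\<in>carrier A. g (rmult M (pure k M A m a)) = rmult N (pure k N A (g m) a))" (is "?l \<longleftrightarrow> ?r")
    proof
      assume h: ?l
      show ?r
      proof (intro ballI)
        fix m a assume ma: "m \<in> carrier M" "a \<in> carrier A"
        show "g (rmult M (pure k M A m a)) = rmult N (pure k N A (g m) a)"
          using bspec[OF h, of "pure k M A m a"] ma by simp
      qed
    next
      assume r: ?r
      show ?l unfolding htensor_simps T_same
        by (rule tensor_extI) (assumption | rule lin | simp add: r)+
    qed
    have 2: "coact N (g x) = map_over k H TA N (rmult N) D (dleft D) g id (coact M x)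
        \<longleftrightarrow> theta N (rmult N) (coact N (g x)) = tensor_map k N C g id (theta M (rmult M) (coact M x))"
      if r: "\<forall>m\<in>carrier M. \<forall>a\<in>carrier A. g (rmult M (pure k M A m a)) = rmult N (pure k N A (g m) a)" and x: "x \<in> carrier M" for x
    proof -
      let ?t = "rep (coact M x)"
      have t: "?t \<in> carrier (tensor k M AC)" using x by simp
      have tc: "tensor_map k N AC g id ?t \<in> carrier (tensor k N AC)"
        by (rule tensor_map_closed[OF t l lin_maps_id]) simp_all
      have P: "map_over k H TA N (rmult N) D (dleft D) g id (coact M x) = Y.prMD (tensor_map k N AC g id ?t)"
        by (simp add: map_over_def)
      \<comment> \<open>Naturality of \<theta> at g on representatives: g(m a) \<otimes> c = g(m)a
        \<otimes> c.\<close>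
      have "\<forall>t\<in>carrier (tensor k M AC). Y.mu_out C (tensor_map k N AC g id t) = tensor_map k N C g id (X.mu_out C t)"
        by (rule tensor_extI_right) (assumption | rule lin | simp add: r)+
      hence e: "Y.thetaMD (Y.prMD (tensor_map k N AC g id ?t)) = tensor_map k N C g id (X.thetaMD (coact M x))"
        unfolding Y.thetaMD_pr[OF tc] X.thetaMD_def using t by blast
      have c: "coact N (g x) \<in> carrier Y.MD" "Y.prMD (tensor_map k N AC g id ?t) \<in> carrier Y.MD"
        using tc x by simp_all
      show ?thesis
        unfolding P e[symmetric] theta_eq[OF corep_object(5)[OF M], symmetric] theta_eq[OF corep_object(5)[OF N], symmetric]
        by (rule iffI[OF arg_cong Y.thetaMD_eqI[OF c]])
    qed
    show ?thesis
      using 1 2 by (simp add: tm cong: conj_cong)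
  qed
  thus ?thesis
    unfolding corep_category_def hopf_bimodule_category_def cat.select_convs hopf_simps(1) hom
    by (intro Collect_cong conj_cong[OF HOL.refl]) blast
qed

lemma isomorphic_corep_hopf:
  "isomorphic_categories (corep_category TYPE('m) k H TA D) (hopf_bimodule_category TYPE('m) k H A C)"
proof (rule isomorphic_categoriesI[where ?F0.0 = to_hopf and ?G0.0 = of_hopf])
  fix X Y Z :: "('k, 'h, 'm, 'a, ('a, 'c) tensor) corep" and g f :: "'m \<Rightarrow> 'm"
  show "Idt (corep_category TYPE('m) k H TA D) X = Idt (hopf_bimodule_category TYPE('m) k H A C) (to_hopf X)"
    "Cmp (corep_category TYPE('m) k H TA D) X Y Z g f = Cmp (hopf_bimodule_category TYPE('m) k H A C) (to_hopf X) (to_hopf Y) (to_hopf Z) g f"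
    by (simp_all add: corep_category_def hopf_bimodule_category_def)
qed (rule category_hopf_bimodule to_hopf_object of_hopf_object of_to_hopf to_of_hopf Arr_corep; assumption)+

end

theorem proposition5p3:
  fixes k :: "'k ring"
    and H :: "('k, 'h) quasi_bialg"
    and A :: "('k, 'h, 'a) comod_alg"
    and C :: "('k, 'h, 'c) bimod_coalg"
  assumes "field k"
    and "quasi_bialgebra k H"
    and "comodule_algebra k H A"
    and "bimodule_coalgebra k H C"
  shows "cowreath k H (comodule_cowreath k H A C) \<and>
    isomorphic_categories
      (corep_category TYPE('m) k H (trivial_halg k H A) (induced_coring k H (comodule_cowreath k H A C)))
      (hopf_bimodule_category TYPE('m) k H A C)"
proof -
  have "cring k" using assms(1) by (simp add: field_def domain_def)
  then interpret comodule_setup k H A C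
    using assms(2-) by (simp add: comodule_setup_def comodule_setup_axioms_def quasi_bialgebra_over_def)
  show ?thesis using cowreath_comodule isomorphic_corep_hopf by blast
qed

end
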